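(* Let $V\hookrightarrow H\hookrightarrow V^*$ be a Gelfand triple of complex Hilbert spaces with norms $\|\cdot\|$, $|\cdot|$, $\|\cdot\|_*$, let $a(\cdot,\cdot)$ be a bounded $V$-elliptic sesquilinear form on $V$, and let $A$ be the Lax--Milgram operator defined from the triple $(H,V,a)$. Let $0<T<\infty$, and for $f\in L_2(0,T;V^* )$ put $y_f=\int_0^T e^{-(T-t)A}f(t)\,dt\in H$. For given data $f\in L_2(0,T;V^* )$ and $u_T\in H$, the final value problem $$\partial_t u+Au=f\ \text{ in } \mathcal D'(0,T;V^* ),\qquad u(T)=u_T\ \text{ in } H,$$ has a solution $u$ belonging to the space $$X=L_2(0,T;V)\cap C([0,T];H)\cap H^1(0,T;V^* )$$ if and only if $(f,u_T)$ belongs to the subspace $Y\subset L_2(0,T;V^* )\oplus H$ defined by the condition $$u_T-\int_0^T e^{-(T-t)A}f(t)\,dt\ \in\ D(e^{TA}).$$ In the affirmative case, the solution $u$ is uniquely determined in $X$, and there is a constant $c$ independent of $(f,u_T)\in Y$ such that $$\|u\|_X\le c\Big(|u_T|^2+\int_0^T\|f(t)\|_*^2\,dt+\Big|e^{TA}\Big(u_T-\int_0^Te^{-(T-t)A}f(t)\,dt\Big)\Big|^2\Big)^{1/2}=c\,\|(f,u_T)\|_Y ,$$ so that the solution operator $(f,u_T)\mapsto u$ is continuous $Y\to X$. Moreover, $$u(t)=e^{-tA}e^{TA}(u(T)-y_f)+\int_0^t e^{-(t-s)A}f(s)\,ds ,$$ where all terms belong to $X$ as functions of $t\in[0,T]$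.
   Context: Setting: $V\hookrightarrow H\hookrightarrow V^*$ is a Gelfand triple of complex Hilbert spaces ($V$ densely and continuously embedded in $H$, $V^*$ the space of bounded antilinear functionals on $V$, $H$ embedded in $V^*$ via its inner product $(\cdot\,|\,\cdot)$), and there are constants $C_j>0$ with $\|v\|_*\le C_1|v|\le C_2\|v\|$, $|a(u,v)|\le C_3\|u\|\,\|v\|$ and $\operatorname{Re}a(v,v)\ge C_4\|v\|^2$ ($V$-ellipticity) for all $u,v\in V$. The Lax--Milgram operator $A$ in $H$ has domain $D(A)$ consisting of those $u\in V$ for which there is $f\in H$ with $a(u,v)=(f\,|\,v)$ for all $v\in V$; then $Au=f$. The same letter denotes its bounded bijective extension $A\colon V\to V^*$ given by $\langle Au,v\rangle=a(u,v)$. $-A$ generates an analytic semigroup $e^{-tA}$ in $H$, and the extension $A\in\mathbb B(V,V^* )$, regarded as an unbounded operator in $V^*$ with domain $V$, is such that $-A$ generates an analytic semigroup on $V^*$, also denoted $e^{-tA}$, extending the one on $H$. For $t>0$ the operator $e^{-tA}$ on $H$ is injective, and $e^{tA}:=(e^{-tA})^{-1}$ denotes its (in general unbounded, closed) inverse in $H$, with domain $D(e^{tA})=R(e^{-tA})$, the range of $e^{-tA}$ on $H$. The integrals $\int_0^t e^{-(t-s)A}f(s)\,ds$ are Bochner integrals in $V^*$; it is known that their values (in particular $y_f$) lie in $H$. The norm on $X$ is $\|u\|_X=\big(\int_0^T\|u(t)\|^2dt+\sup_{0\le t\le T}|u(t)|^2+\int_0^T(\|u(t)\|_*^2+\|u'(t)\|_*^2)dt\big)^{1/2}$.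 The equation $\partial_tu+Au=f$ in $\mathcal D'(0,T;V^* )$ means that $\langle u,-\varphi'\rangle+\langle Au,\varphi\rangle=\langle f,\varphi\rangle$ holds in $V^*$ for every scalar test function $\varphi\in C_0^\infty(]0,T[)$. The space $Y$ is given the norm $\|(f,u_T)\|_Y=\big(|u_T|^2+\int_0^T\|f(t)\|_*^2dt+|e^{TA}(u_T-y_f)|^2\big)^{1/2}$. *)

theory Defs
  imports "HOL-Analysis.Analysis"
begin

section \<open>Complex Hilbert spaces\<close>

class scaleC =
  fixes scaleC :: "complex \<Rightarrow> 'a \<Rightarrow> 'a" (infixr \<open>*\<^sub>C\<close> 75)

class complex_vector = real_vector + scaleC +
  assumes scaleC_add_right: "c *\<^sub>C (x + y) = c *\<^sub>C x + c *\<^sub>C y"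
    and scaleC_add_left: "(c + d) *\<^sub>C x = c *\<^sub>C x + d *\<^sub>C x"
    and scaleC_scaleC: "c *\<^sub>C d *\<^sub>C x = (c * d) *\<^sub>C x"
    and scaleR_scaleC: "r *\<^sub>R x = complex_of_real r *\<^sub>C x"

text \<open>Inner products are linear in the first and antilinear in the second argument.\<close>

class complex_inner = complex_vector + real_normed_vector +
  fixes cinner :: "'a \<Rightarrow> 'a \<Rightarrow> complex"
  assumes cinner_commute: "cinner x y = cnj (cinner y x)"
    and cinner_add_left: "cinner (x + y) z = cinner x z + cinner y z"
    and cinner_scaleC_left: "cinner (c *\<^sub>C x) y = c * cinner x y"
    and norm_eq_sqrt_cinner: "norm x = sqrt (Re (cinner x x))"

class chilbert_space = complex_inner + complete_space

instantiation complex :: chilbert_space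
begin
definition "scaleC_complex (c :: complex) (x :: complex) = c * x"
definition "cinner_complex (x :: complex) (y :: complex) = x * cnj y"
instance
proof
  fix x :: complex
  show "norm x = sqrt (Re (cinner x x))"
    by (simp add: cinner_complex_def complex_norm_square[symmetric]
        flip: power2_eq_square)
qed (simp_all add: scaleC_complex_def cinner_complex_def algebra_simps scaleR_conv_of_real)
end

definition clinear :: "('a::complex_vector \<Rightarrow> 'b::complex_vector) \<Rightarrow> bool" where
  "clinear F \<longleftrightarrow> (\<forall>x y. F (x + y) = F x + F y) \<and> (\<forall>c x. F (c *\<^sub>C x) = c *\<^sub>C F x)"


section \<open>The space of bounded antilinear functionals\<close>

text \<open>
  Bounded antilinear functionals are in particular bounded real-linear maps into the complex
  numbers, so the antidual is a closed subspace of a type of bounded linear maps and inherits the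
  operator norm, which is the dual norm.
\<close>

typedef (overloaded) 'v antidual =
  "{g :: 'v::complex_inner \<Rightarrow>\<^sub>L complex. \<forall>c v. blinfun_apply g (c *\<^sub>C v) = cnj c * blinfun_apply g v}"
  by (rule exI[of _ 0]) simp

setup_lifting type_definition_antidual

instantiation antidual :: (complex_inner) real_normed_vector
begin
lift_definition zero_antidual :: "'a antidual" is 0 by simp
lift_definition plus_antidual :: "'a antidual \<Rightarrow> 'a antidual \<Rightarrow> 'a antidual" is "(+)"
  by (simp add: blinfun.add_left algebra_simps)
lift_definition minus_antidual :: "'a antidual \<Rightarrow> 'a antidual \<Rightarrow> 'a antidual" is "(-)"
  by (simp add: blinfun.diff_left algebra_simps)
lift_definition uminus_antidual :: "'a antidual \<Rightarrow> 'a antidual" is uminus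
  by (simp add: blinfun.minus_left)
lift_definition scaleR_antidual :: "real \<Rightarrow> 'a antidual \<Rightarrow> 'a antidual" is "(*\<^sub>R)"
  by (simp add: blinfun.scaleR_left)
lift_definition norm_antidual :: "'a antidual \<Rightarrow> real" is norm .
definition dist_antidual :: "'a antidual \<Rightarrow> 'a antidual \<Rightarrow> real"
  where "dist_antidual x y = norm (x - y)"
definition sgn_antidual :: "'a antidual \<Rightarrow> 'a antidual"
  where "sgn_antidual x = inverse (norm x) *\<^sub>R x"
definition uniformity_antidual :: "('a antidual \<times> 'a antidual) filter"
  where "uniformity_antidual = (INF e\<in>{0<..}. principal {(x, y). dist x y < e})"
definition open_antidual :: "'a antidual set \<Rightarrow> bool"
  where "open_antidual U \<longleftrightarrow> (\<forall>x\<in>U. \<forall>\<^sub>F (x', y) in uniformity. x' = x \<longrightarrow> y \<in> U)"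
instance
proof
  fix x y z :: "'a antidual" and r s :: real
  show "x + y + z = x + (y + z)" by transfer simp
  show "x + y = y + x" by transfer simp
  show "0 + x = x" by transfer simp
  show "- x + x = 0" by transfer simp
  show "x - y = x + - y" by transfer simp
  show "r *\<^sub>R (x + y) = r *\<^sub>R x + r *\<^sub>R y" by transfer (rule scaleR_right_distrib)
  show "(r + s) *\<^sub>R x = r *\<^sub>R x + s *\<^sub>R x" by transfer (rule scaleR_left_distrib)
  show "r *\<^sub>R s *\<^sub>R x = (r * s) *\<^sub>R x" by transfer simp
  show "1 *\<^sub>R x = x" by transfer simp
  show "norm x = 0 \<longleftrightarrow> x = 0" by transfer simp
  show "norm (x + y) \<le> norm x + norm y" by transfer (rule norm_triangle_ineq)
  show "norm (r *\<^sub>R x) = \<bar>r\<bar> * norm x" by transfer simp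
qed (simp_all add: dist_antidual_def sgn_antidual_def uniformity_antidual_def open_antidual_def)
end

instantiation antidual :: (complex_inner) complex_vector
begin
lift_definition scaleC_antidual :: "complex \<Rightarrow> 'a antidual \<Rightarrow> 'a antidual"
  is "\<lambda>c g. blinfun_mult_right c o\<^sub>L g"
  by (simp add: algebra_simps)
instance
proof
  fix x y :: "'a antidual" and c d :: complex and r :: real
  show "c *\<^sub>C (x + y) = c *\<^sub>C x + c *\<^sub>C y"
    by transfer (rule blinfun_eqI, simp add: blinfun.add_left algebra_simps)
  show "(c + d) *\<^sub>C x = c *\<^sub>C x + d *\<^sub>C x"
    by transfer (rule blinfun_eqI, simp add: blinfun.add_left algebra_simps)
  show "c *\<^sub>C d *\<^sub>C x = (c * d) *\<^sub>C x"
    by transfer (rule blinfun_eqI, simp)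
  show "r *\<^sub>R x = complex_of_real r *\<^sub>C x"
    by transfer (rule blinfun_eqI, simp add: blinfun.scaleR_left scaleR_conv_of_real)
qed
end

definition antidual_apply :: "'v::complex_inner antidual \<Rightarrow> 'v \<Rightarrow> complex" where
  "antidual_apply g = blinfun_apply (Rep_antidual g)"

text \<open>Only meaningful for bounded antilinear \<open>g\<close>.\<close>

definition antidual_of :: "('v::complex_inner \<Rightarrow> complex) \<Rightarrow> 'v antidual" where
  "antidual_of g = Abs_antidual (Blinfun g)"

lemma antidual_apply_antidual_of:
  assumes add: "\<And>x y. g (x + y) = g x + g y"
    and scale: "\<And>c x. g (c *\<^sub>C x) = cnj c * g x"
    and bound: "\<And>x. norm (g x) \<le> K * norm x"
  shows "antidual_apply (antidual_of g) = g"
proof -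
  have bl: "bounded_linear g"
    by (rule bounded_linear_intro[where K = K])
      (simp_all add: add scale scaleR_scaleC scaleC_complex_def bound mult.commute[of _ K])
  then show ?thesis
    unfolding antidual_apply_def antidual_of_def
    by (subst Abs_antidual_inverse) (simp_all add: bounded_linear_Blinfun_apply scale)
qed


section \<open>Bochner integrals and Lebesgue--Bochner spaces\<close>

text \<open>
  The Bochner integral of the library is restricted to second-countable (that is, separable)
  spaces. No separability is wanted here, so measurability is strong measurability. The simple
  functions and their integrals are those of the library.
\<close>

definition strongly_measurable :: "'a measure \<Rightarrow> ('a \<Rightarrow> 'b::real_normed_vector) \<Rightarrow> bool" where
  "strongly_measurable M f \<longleftrightarrow>
    (\<exists>s. (\<forall>i::nat. simple_function M (s i)) \<and> (AE x in M. (\<lambda>i. s i x) \<longlonglongrightarrow> f x))"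

definition has_strong_integral :: "'a measure \<Rightarrow> ('a \<Rightarrow> 'b::real_normed_vector) \<Rightarrow> 'b \<Rightarrow> bool" where
  "has_strong_integral M f y \<longleftrightarrow> strongly_measurable M f \<and>
    (\<exists>s. (\<forall>i::nat. Bochner_Integration.simple_bochner_integrable M (s i)) \<and>
      (\<lambda>i. \<integral>\<^sup>+x. norm (f x - s i x) \<partial>M) \<longlonglongrightarrow> 0 \<and>
      (\<lambda>i. Bochner_Integration.simple_bochner_integral M (s i)) \<longlonglongrightarrow> y)"

definition strong_integral :: "'a measure \<Rightarrow> ('a \<Rightarrow> 'b::real_normed_vector) \<Rightarrow> 'b" where
  "strong_integral M f = (THE y. has_strong_integral M f y)"

lemma has_strong_integral_if_has_bochner_integral:
  fixes f :: "'a \<Rightarrow> 'b::{real_normed_vector, second_countable_topology}"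
  assumes "has_bochner_integral M f y"
  shows "has_strong_integral M f y"
proof -
  from assms have f: "f \<in> borel_measurable M"
    by (rule borel_measurable_has_bochner_integral)
  obtain s where "\<forall>i. simple_function M (s i)" "\<forall>x\<in>space M. (\<lambda>i. s i x) \<longlonglongrightarrow> f x"
    using borel_measurable_implies_sequence_metric[OF f, of 0] by blast
  then have "strongly_measurable M f"
    unfolding strongly_measurable_def by (auto intro!: exI[of _ s] AE_I2)
  with assms show ?thesis
    unfolding has_strong_integral_def by (auto elim!: has_bochner_integral.cases)
qed

text \<open>
  Elements of the spaces \<open>L\<^sub>2(0,T;B)\<close> are represented by functions on the real line of which only
  the restriction to the interval \<open>[0,T]\<close> matters, up to null sets.
\<close>

definition L2 :: "real \<Rightarrow> (real \<Rightarrow> 'b::real_normed_vector) \<Rightarrow> bool" where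
  "L2 T f \<longleftrightarrow> strongly_measurable (lebesgue_on {0..T}) f \<and>
    integrable (lebesgue_on {0..T}) (\<lambda>t. (norm (f t))\<^sup>2)"

definition test_function :: "real \<Rightarrow> (real \<Rightarrow> complex) \<Rightarrow> bool" where
  "test_function T \<phi> \<longleftrightarrow>
    (\<exists>D. D 0 = \<phi> \<and> (\<forall>n::nat. \<forall>t. (D n has_vector_derivative D (Suc n) t) (at t))) \<and>
    (\<exists>\<alpha> \<beta>. 0 < \<alpha> \<and> \<beta> < T \<and> (\<forall>t. t \<notin> {\<alpha>..\<beta>} \<longrightarrow> \<phi> t = 0))"

text \<open>The pairing of the vector distribution \<open>g\<close> on \<open>]0,T[\<close> with the scalar function \<open>\<phi>\<close>.\<close>

definition pairing ::
    "real \<Rightarrow> (real \<Rightarrow> 'b::{complex_vector, real_normed_vector}) \<Rightarrow> (real \<Rightarrow> complex) \<Rightarrow> 'b" where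
  "pairing T g \<phi> = strong_integral (lebesgue_on {0..T}) (\<lambda>t. \<phi> t *\<^sub>C g t)"

definition has_weak_derivative ::
    "real \<Rightarrow> (real \<Rightarrow> 'b::{complex_vector, real_normed_vector}) \<Rightarrow> (real \<Rightarrow> 'b) \<Rightarrow> bool" where
  "has_weak_derivative T g g' \<longleftrightarrow>
    (\<forall>\<phi>. test_function T \<phi> \<longrightarrow>
      pairing T g' \<phi> = pairing T g (\<lambda>t. - vector_derivative \<phi> (at t)))"

definition H1 :: "real \<Rightarrow> (real \<Rightarrow> 'b::{complex_vector, real_normed_vector}) \<Rightarrow> bool" where
  "H1 T g \<longleftrightarrow> L2 T g \<and> (\<exists>g'. L2 T g' \<and> has_weak_derivative T g g')"

definition weak_derivative ::
    "real \<Rightarrow> (real \<Rightarrow> 'b::{complex_vector, real_normed_vector}) \<Rightarrow> real \<Rightarrow> 'b" where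
  "weak_derivative T g = (SOME g'. L2 T g' \<and> has_weak_derivative T g g')"


section \<open>Operator semigroups\<close>

text \<open>Unbounded operators are represented by their graphs.\<close>

definition c0_semigroup ::
    "(real \<Rightarrow> 'b \<Rightarrow> 'b::{complex_vector, real_normed_vector}) \<Rightarrow> bool" where
  "c0_semigroup S \<longleftrightarrow>
    (\<forall>t\<ge>0. clinear (S t) \<and> bounded_linear (S t)) \<and>
    (\<forall>x. S 0 x = x) \<and>
    (\<forall>s\<ge>0. \<forall>t\<ge>0. \<forall>x. S (s + t) x = S s (S t x)) \<and>
    (\<forall>x. ((\<lambda>t. S t x) \<longlongrightarrow> x) (at_right 0))"

definition generator ::
    "(real \<Rightarrow> 'b \<Rightarrow> 'b::{complex_vector, real_normed_vector}) \<Rightarrow> ('b \<times> 'b) set" where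
  "generator S = {(x, y). ((\<lambda>h. (S h x - x) /\<^sub>R h) \<longlongrightarrow> y) (at_right 0)}"

text \<open>
  The semigroup \<open>e\<^sup>-\<^sup>t\<^sup>A\<close> with generator \<open>-A\<close>. A strongly continuous semigroup on a Banach space is
  determined by its generator for \<open>t \<ge> 0\<close>; other values of \<open>t\<close> are irrelevant.
\<close>

definition exp_neg ::
    "('b \<times> 'b) set \<Rightarrow> real \<Rightarrow> 'b \<Rightarrow> 'b::{complex_vector, real_normed_vector}" where
  "exp_neg A = (SOME S. c0_semigroup S \<and> generator S = {(x, - y) | x y. (x, y) \<in> A})"


section \<open>Gelfand triples and Lax--Milgram operators\<close>

text \<open>The inclusion of \<open>V\<close> into \<open>H\<close> is an explicit map \<open>\<iota>\<close>.\<close>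

definition gelfand_triple :: "('v::chilbert_space \<Rightarrow> 'h::chilbert_space) \<Rightarrow> bool" where
  "gelfand_triple \<iota> \<longleftrightarrow> clinear \<iota> \<and> bounded_linear \<iota> \<and> inj \<iota> \<and> closure (range \<iota>) = UNIV"

definition bounded_sesquilinear :: "('v::complex_inner \<Rightarrow> 'v \<Rightarrow> complex) \<Rightarrow> bool" where
  "bounded_sesquilinear a \<longleftrightarrow>
    (\<forall>u u' v. a (u + u') v = a u v + a u' v) \<and>
    (\<forall>u v v'. a u (v + v') = a u v + a u v') \<and>
    (\<forall>c u v. a (c *\<^sub>C u) v = c * a u v) \<and>
    (\<forall>c u v. a u (c *\<^sub>C v) = cnj c * a u v) \<and>
    (\<exists>C. \<forall>u v. norm (a u v) \<le> C * norm u * norm v)"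

definition elliptic :: "('v::complex_inner \<Rightarrow> 'v \<Rightarrow> complex) \<Rightarrow> bool" where
  "elliptic a \<longleftrightarrow> (\<exists>C>0. \<forall>v. Re (a v v) \<ge> C * (norm v)\<^sup>2)"

definition H_to_antidual ::
    "('v::complex_inner \<Rightarrow> 'h::complex_inner) \<Rightarrow> 'h \<Rightarrow> 'v antidual" where
  "H_to_antidual \<iota> x = antidual_of (\<lambda>v. cinner x (\<iota> v))"

definition lax_milgram_H ::
    "('v \<Rightarrow> 'h::complex_inner) \<Rightarrow> ('v \<Rightarrow> 'v \<Rightarrow> complex) \<Rightarrow> ('h \<times> 'h) set" where
  "lax_milgram_H \<iota> a = {(\<iota> u, f) | u f. \<forall>v. a u v = cinner f (\<iota> v)}"

definition lax_milgram :: "('v::complex_inner \<Rightarrow> 'v \<Rightarrow> complex) \<Rightarrow> 'v \<Rightarrow> 'v antidual" where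
  "lax_milgram a u = antidual_of (a u)"

definition lax_milgram_antidual ::
    "('v::complex_inner \<Rightarrow> 'h::complex_inner) \<Rightarrow> ('v \<Rightarrow> 'v \<Rightarrow> complex) \<Rightarrow>
      ('v antidual \<times> 'v antidual) set" where
  "lax_milgram_antidual \<iota> a = {(H_to_antidual \<iota> (\<iota> u), lax_milgram a u) | u. True}"

definition semigroup_H ::
    "('v \<Rightarrow> 'h::complex_inner) \<Rightarrow> ('v \<Rightarrow> 'v \<Rightarrow> complex) \<Rightarrow> real \<Rightarrow> 'h \<Rightarrow> 'h" where
  "semigroup_H \<iota> a = exp_neg (lax_milgram_H \<iota> a)"

definition semigroup_antidual ::
    "('v::complex_inner \<Rightarrow> 'h::complex_inner) \<Rightarrow> ('v \<Rightarrow> 'v \<Rightarrow> complex) \<Rightarrow>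
      real \<Rightarrow> 'v antidual \<Rightarrow> 'v antidual" where
  "semigroup_antidual \<iota> a = exp_neg (lax_milgram_antidual \<iota> a)"

definition exp_pos_domain ::
    "('v \<Rightarrow> 'h::complex_inner) \<Rightarrow> ('v \<Rightarrow> 'v \<Rightarrow> complex) \<Rightarrow> real \<Rightarrow> 'h set" where
  "exp_pos_domain \<iota> a t = range (semigroup_H \<iota> a t)"

definition exp_pos ::
    "('v \<Rightarrow> 'h::complex_inner) \<Rightarrow> ('v \<Rightarrow> 'v \<Rightarrow> complex) \<Rightarrow> real \<Rightarrow> 'h \<Rightarrow> 'h" where
  "exp_pos \<iota> a t = inv (semigroup_H \<iota> a t)"


section \<open>The final value problem\<close>

definition duhamel ::
    "('v::complex_inner \<Rightarrow> 'h::complex_inner) \<Rightarrow> ('v \<Rightarrow> 'v \<Rightarrow> complex) \<Rightarrow>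
      (real \<Rightarrow> 'v antidual) \<Rightarrow> real \<Rightarrow> 'v antidual" where
  "duhamel \<iota> a f t =
    strong_integral (lebesgue_on {0..t}) (\<lambda>s. semigroup_antidual \<iota> a (t - s) (f s))"

text \<open>
  The same integral, regarded as an element of \<open>H\<close>. The embedding of \<open>H\<close> into the antidual is
  injective because \<open>V\<close> is dense in \<open>H\<close>.
\<close>

definition duhamel_H ::
    "('v::complex_inner \<Rightarrow> 'h::complex_inner) \<Rightarrow> ('v \<Rightarrow> 'v \<Rightarrow> complex) \<Rightarrow>
      (real \<Rightarrow> 'v antidual) \<Rightarrow> real \<Rightarrow> 'h" where
  "duhamel_H \<iota> a f t = inv (H_to_antidual \<iota>) (duhamel \<iota> a f t)"

text \<open>
  Elements of \<open>X\<close> are represented by their continuous \<open>H\<close>-valued version, of which only the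
  restriction to \<open>[0,T]\<close> matters; \<open>inv \<iota> (u t)\<close> is \<open>u t\<close> as an element of \<open>V\<close>.
\<close>

definition in_X ::
    "('v::complex_inner \<Rightarrow> 'h::complex_inner) \<Rightarrow> real \<Rightarrow> (real \<Rightarrow> 'h) \<Rightarrow> bool" where
  "in_X \<iota> T u \<longleftrightarrow>
    (AE t in lebesgue_on {0..T}. u t \<in> range \<iota>) \<and> L2 T (\<lambda>t. inv \<iota> (u t)) \<and>
    continuous_on {0..T} u \<and>
    H1 T (\<lambda>t. H_to_antidual \<iota> (u t))"

definition norm_X ::
    "('v::complex_inner \<Rightarrow> 'h::complex_inner) \<Rightarrow> real \<Rightarrow> (real \<Rightarrow> 'h) \<Rightarrow> real" where
  "norm_X \<iota> T u = sqrt (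
    (\<integral>t. (norm (inv \<iota> (u t)))\<^sup>2 \<partial>lebesgue_on {0..T}) +
    (SUP t\<in>{0..T}. (norm (u t))\<^sup>2) +
    (\<integral>t. (norm (H_to_antidual \<iota> (u t)))\<^sup>2 +
      (norm (weak_derivative T (\<lambda>t. H_to_antidual \<iota> (u t)) t))\<^sup>2 \<partial>lebesgue_on {0..T}))"

definition solves_fvp ::
    "('v::complex_inner \<Rightarrow> 'h::complex_inner) \<Rightarrow> ('v \<Rightarrow> 'v \<Rightarrow> complex) \<Rightarrow> real \<Rightarrow>
      (real \<Rightarrow> 'v antidual) \<Rightarrow> 'h \<Rightarrow> (real \<Rightarrow> 'h) \<Rightarrow> bool" where
  "solves_fvp \<iota> a T f u\<^sub>T u \<longleftrightarrow>
    (\<forall>\<phi>. test_function T \<phi> \<longrightarrow>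
      pairing T (\<lambda>t. H_to_antidual \<iota> (u t)) (\<lambda>t. - vector_derivative \<phi> (at t)) +
      pairing T (\<lambda>t. lax_milgram a (inv \<iota> (u t))) \<phi> = pairing T f \<phi>) \<and>
    u T = u\<^sub>T"

definition Y_space ::
    "('v::complex_inner \<Rightarrow> 'h::complex_inner) \<Rightarrow> ('v \<Rightarrow> 'v \<Rightarrow> complex) \<Rightarrow> real \<Rightarrow>
      ((real \<Rightarrow> 'v antidual) \<times> 'h) set" where
  "Y_space \<iota> a T = {(f, u\<^sub>T). L2 T f \<and> u\<^sub>T - duhamel_H \<iota> a f T \<in> exp_pos_domain \<iota> a T}"

definition norm_Y ::
    "('v::complex_inner \<Rightarrow> 'h::complex_inner) \<Rightarrow> ('v \<Rightarrow> 'v \<Rightarrow> complex) \<Rightarrow> real \<Rightarrow>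
      (real \<Rightarrow> 'v antidual) \<Rightarrow> 'h \<Rightarrow> real" where
  "norm_Y \<iota> a T f u\<^sub>T = sqrt (
    (norm u\<^sub>T)\<^sup>2 + (\<integral>t. (norm (f t))\<^sup>2 \<partial>lebesgue_on {0..T}) +
    (norm (exp_pos \<iota> a T (u\<^sub>T - duhamel_H \<iota> a f T)))\<^sup>2)"

end

theory Submission
  imports Defs "HOL-Computational_Algebra.Polynomial"
begin

text \<open>
  Let \<open>J h = (1 + h A)\<^sup>-\<^sup>1\<close>. An \<open>l\<^sub>2\<close> maximal regularity estimate for the implicit Euler scheme bounds the
  powers \<open>J h ^ n\<close> and the differences \<open>n (J h ^ n - J h ^ (n - 1))\<close> on \<open>V\<^sup>*\<close>, uniformly in \<open>n\<close> and \<open>h\<close>; on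
  \<open>H\<close>, \<open>J h\<close> is a contraction. The first bound yields the semigroup as the limit of the Euler scheme. The
  second one is the Ritt condition, which makes the semigroup on \<open>V\<^sup>*\<close> analytic, so that \<open>e\<^sup>-\<^sup>t\<^sup>A\<close> is
  injective there and hence on \<open>H\<close>.

  The initial value problem is solved in \<open>X\<close> by the semigroup for step functions \<open>f\<close> and \<open>u(0) \<in> V\<close>, and
  the energy estimate carries this over to all \<open>f \<in> L\<^sub>2(0,T;V\<^sup>*)\<close> and \<open>u(0) \<in> H\<close> by density. A weak solution
  of the homogeneous problem becomes a classical one after an application of \<open>A\<^sup>-\<^sup>1\<close> and the du
  Bois-Reymond lemma, hence is given by the semigroup. So every solution satisfies
  \<open>u(T) = e\<^sup>-\<^sup>T\<^sup>A u(0) + y\<^sub>f\<close>, and by injectivity the final value problem is the initial value problem with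
  \<open>u(0) = e\<^sup>T\<^sup>A (u(T) - y\<^sub>f)\<close>.
\<close>

section \<open>Antiduals, the Riesz theorem and the Lax--Milgram theorem\<close>

text \<open>The form need not be symmetric and the norm of V need not match it, so nothing makes
  \<open>J h\<close> a contraction for the dual norm; contractivity is available on H only. The
  estimates are therefore made in V and carried over by A^-1, an isomorphism of the antidual onto V
  that commutes with the resolvents. Testing the Euler scheme controls only sums of squares. To
  reach single indices, the differences are weighted by n; the weighted sequence solves the same
  scheme with a right-hand side that is already controlled, and doing this twice gives the Ritt
  condition, with constants that depend on the form through C/\<alpha> alone. Analyticity enters
  through real variables: the bound (n R/s)^n for A^n at time s makes the Taylor remainder vanish
  over any time \<tau> < s/(R e), so a zero moves backwards by a fixed proportion of the elapsed
  time until it reaches 0. As the spaces may be nonseparable, integrals and weak derivatives are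
  handled by pairing with fixed vectors of V, and countably many of these are selected by the values
  of simple functions.\<close>

instance chilbert_space \<subseteq> banach ..

section \<open>Complex scalars and inner products\<close>

lemma scaleC_zero_right [simp]: "c *\<^sub>C 0 = (0::'a::complex_vector)"
  using scaleC_add_right[of c 0 0] by simp

lemma scaleC_zero_left [simp]: "0 *\<^sub>C x = (0::'a::complex_vector)"
  using scaleC_add_left[of 0 0 x] by simp

lemma scaleC_minus_right [simp]: "c *\<^sub>C (- x) = - (c *\<^sub>C (x::'a::complex_vector))"
  using scaleC_add_right[of c x "- x"] by (simp add: eq_neg_iff_add_eq_0 add.commute)

lemma scaleC_minus_one: "(- 1) *\<^sub>C x = - (x::'a::complex_vector)"
  using scaleR_scaleC[of "-1" x] by simp

lemma scaleC_diff_right: "c *\<^sub>C (x - y) = c *\<^sub>C x - c *\<^sub>C (y::'a::complex_vector)"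
  using scaleC_add_right[of c x "- y"] by simp

lemma scaleC_scaleR_commute: "c *\<^sub>C (r *\<^sub>R x) = r *\<^sub>R (c *\<^sub>C (x::'a::complex_vector))"
  by (simp add: scaleR_scaleC scaleC_scaleC mult.commute)

lemma clinear_linear: "clinear F \<Longrightarrow> linear F"
  by (rule linearI) (simp_all add: clinear_def scaleR_scaleC)

lemma clinear_scaleC: "clinear F \<Longrightarrow> F (c *\<^sub>C x) = c *\<^sub>C F x"
  by (simp add: clinear_def)

lemma cinner_add_right: "cinner x (y + z) = cinner x y + cinner x (z::'a::complex_inner)"
  by (metis cinner_commute cinner_add_left complex_cnj_add)

lemma cinner_scaleC_right: "cinner x (c *\<^sub>C y) = cnj c * cinner x (y::'a::complex_inner)"
  by (metis cinner_commute cinner_scaleC_left complex_cnj_mult)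

lemma cinner_zero_left [simp]: "cinner 0 (y::'a::complex_inner) = 0"
  using cinner_add_left[of 0 0 y] by simp

lemma cinner_zero_right [simp]: "cinner (y::'a::complex_inner) 0 = 0"
  using cinner_add_right[of y 0 0] by simp

lemma cinner_minus_left [simp]: "cinner (- x) (y::'a::complex_inner) = - cinner x y"
  using cinner_add_left[of x "- x" y] by (simp add: eq_neg_iff_add_eq_0 add.commute)

lemma cinner_minus_right [simp]: "cinner x (- y::'a::complex_inner) = - cinner x y"
  using cinner_add_right[of x y "- y"] by (simp add: eq_neg_iff_add_eq_0 add.commute)

lemma cinner_diff_left: "cinner (x - y) (z::'a::complex_inner) = cinner x z - cinner y z"
  using cinner_add_left[of x "- y" z] by simp

lemma cinner_scaleR_left: "cinner (r *\<^sub>R x) (y::'a::complex_inner) = r * cinner x y"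
  by (simp add: scaleR_scaleC cinner_scaleC_left)

lemma cinner_scaleR_right: "cinner x (r *\<^sub>R y::'a::complex_inner) = r * cinner x y"
  by (simp add: scaleR_scaleC cinner_scaleC_right)

text \<open>\<open>sqrt\<close> is odd on the reals, so a nonnegative \<open>norm\<close> forces a
  nonnegative radicand; positivity is no separate axiom of the class.\<close>

lemma Re_cinner_self: "Re (cinner x x) = (norm (x::'a::complex_inner))\<^sup>2"
proof -
  have "0 \<le> Re (cinner x x)"
    using norm_eq_sqrt_cinner[of x] norm_ge_zero[of x] by (metis real_sqrt_ge_0_iff)
  then show ?thesis
    by (simp add: norm_eq_sqrt_cinner)
qed

lemma cinner_self: "cinner x x = of_real ((norm (x::'a::complex_inner))\<^sup>2)"
proof -
  have "Im (cinner x x) = 0"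
    using cinner_commute[of x x] by (metis Im_complex_of_real Reals_cnj_iff Reals_cases)
  then show ?thesis
    by (simp add: complex_eq_iff Re_cinner_self flip: of_real_power)
qed

lemma norm_plus_sq: "(norm (x + y))\<^sup>2 = (norm x)\<^sup>2 + 2 * Re (cinner x y) + (norm (y::'a::complex_inner))\<^sup>2"
proof -
  have "Re (cinner y x) = Re (cinner x y)"
    by (subst cinner_commute) simp
  then show ?thesis
    by (simp flip: Re_cinner_self add: cinner_add_left cinner_add_right)
qed

lemma norm_diff_sq: "(norm (x - y))\<^sup>2 = (norm x)\<^sup>2 - 2 * Re (cinner x y) + (norm (y::'a::complex_inner))\<^sup>2"
  using norm_plus_sq[of x "- y"] by simp

lemma norm_scaleC: "norm (c *\<^sub>C x) = cmod c * norm (x::'a::complex_inner)"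
proof -
  have "(norm (c *\<^sub>C x))\<^sup>2 = Re (c * cnj c * cinner x x)"
    by (simp add: cinner_scaleC_left cinner_scaleC_right mult_ac flip: Re_cinner_self)
  also have "\<dots> = (cmod c * norm x)\<^sup>2"
    by (simp add: cinner_self complex_norm_square[symmetric] power_mult_distrib flip: of_real_power of_real_mult)
  finally show ?thesis
    by (simp add: power2_eq_iff_nonneg)
qed

lemma cinner_Cauchy_Schwarz: "cmod (cinner x y) \<le> norm x * norm (y::'a::complex_inner)"
proof (cases "y = 0")
  case False
  define N where "N = (norm y)\<^sup>2"
  define c where "c = cinner x y"
  have N: "N > 0" using False by (simp add: N_def)
  \<comment> \<open>This vector is N times the component of x orthogonal to y; the scaling avoids a
    quotient.\<close>
  have "0 \<le> (norm (N *\<^sub>R x - c *\<^sub>C y))\<^sup>2" by simp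
  also have "\<dots> = N\<^sup>2 * (norm x)\<^sup>2 - 2 * N * (cmod c)\<^sup>2 + (cmod c)\<^sup>2 * N"
  proof -
    have "Re (cinner (N *\<^sub>R x) (c *\<^sub>C y)) = N * (cmod c)\<^sup>2"
      by (simp add: cinner_scaleR_left cinner_scaleC_right cmod_power2 flip: c_def)
        (simp add: power2_eq_square algebra_simps)
    then show ?thesis
      by (simp add: norm_diff_sq norm_scaleC power_mult_distrib N_def)
  qed
  finally have "N * (cmod c)\<^sup>2 \<le> N * (N * (norm x)\<^sup>2)"
    by (simp add: power2_eq_square algebra_simps)
  then have "(cmod c)\<^sup>2 \<le> (norm x * norm y)\<^sup>2"
    using N by (simp add: N_def power_mult_distrib mult.commute)
  then show ?thesis
    by (simp add: c_def abs_le_square_iff[symmetric])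
qed simp

lemma bounded_linear_scaleC: "bounded_linear (\<lambda>x::'a::complex_inner. c *\<^sub>C x)"
  by (rule bounded_linear_intro[where K = "cmod c"])
    (simp_all add: scaleC_add_right scaleC_scaleR_commute norm_scaleC)


section \<open>The antidual as a Banach space\<close>

lemma antidual_apply_add_left: "antidual_apply (f + g) v = antidual_apply f v + antidual_apply g v"
  by (simp add: antidual_apply_def plus_antidual.rep_eq blinfun.add_left)

lemma antidual_apply_diff_left: "antidual_apply (f - g) v = antidual_apply f v - antidual_apply g v"
  by (simp add: antidual_apply_def minus_antidual.rep_eq blinfun.diff_left)

lemma antidual_apply_zero_left [simp]: "antidual_apply 0 v = 0"
  by (simp add: antidual_apply_def zero_antidual.rep_eq)

lemma antidual_apply_scaleR_left: "antidual_apply (r *\<^sub>R f) v = r *\<^sub>R antidual_apply f v"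
  by (simp add: antidual_apply_def scaleR_antidual.rep_eq blinfun.scaleR_left)

lemma antidual_apply_scaleC_left: "antidual_apply (c *\<^sub>C f) v = c * antidual_apply f v"
  by (simp add: antidual_apply_def scaleC_antidual.rep_eq)

lemma antidual_apply_add_right: "antidual_apply f (v + w) = antidual_apply f v + antidual_apply f w"
  by (simp add: antidual_apply_def blinfun.add_right)

lemma antidual_apply_zero_right [simp]: "antidual_apply f 0 = 0"
  by (simp add: antidual_apply_def)

lemma antidual_apply_scaleC_right: "antidual_apply f (c *\<^sub>C v) = cnj c * antidual_apply f v"
  using Rep_antidual[of f] by (simp add: antidual_apply_def)

lemma antidual_apply_scaleR_right: "antidual_apply f (r *\<^sub>R v) = r *\<^sub>R antidual_apply f v"
  by (simp add: antidual_apply_def blinfun.scaleR_right)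

lemma norm_antidual_apply: "cmod (antidual_apply f v) \<le> norm f * norm v"
  by (simp add: antidual_apply_def norm_antidual.rep_eq norm_blinfun)

lemma antidual_eqI: "(\<And>v. antidual_apply f v = antidual_apply g v) \<Longrightarrow> f = g"
  by (simp add: antidual_apply_def Rep_antidual_inject[symmetric] blinfun_eqI)

lemma norm_antidual_le: "0 \<le> K \<Longrightarrow> (\<And>v. cmod (antidual_apply f v) \<le> K * norm v) \<Longrightarrow> norm f \<le> K"
  by (simp add: antidual_apply_def norm_antidual.rep_eq norm_blinfun_bound)

lemma norm_antidual_scaleC: "norm (c *\<^sub>C (f::'v::complex_inner antidual)) \<le> cmod c * norm f"
  by (rule norm_antidual_le)
    (auto simp: antidual_apply_scaleC_left norm_mult mult.assoc intro!: mult_left_mono norm_antidual_apply)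

lemma bounded_linear_scaleC_antidual: "bounded_linear (\<lambda>f::'v::complex_inner antidual. c *\<^sub>C f)"
  by (rule bounded_linear_intro[where K = "cmod c"])
    (simp_all add: scaleC_add_right scaleC_scaleR_commute mult.commute[of _ "cmod c"] norm_antidual_scaleC)

lemma bounded_linear_antidual_apply: "bounded_linear (\<lambda>f. antidual_apply f v)"
  by (rule bounded_linear_intro[where K = "norm v"])
    (simp_all add: antidual_apply_add_left antidual_apply_scaleR_left norm_antidual_apply)

lemma bounded_linear_antidual_apply_right: "bounded_linear (antidual_apply f)"
  by (rule bounded_linear_intro[where K = "norm f"])
    (simp_all add: antidual_apply_add_right antidual_apply_scaleR_right mult.commute[of _ "norm f"] norm_antidual_apply)

text \<open>Antilinearity passes to pointwise limits, so the antidual is closed in the Banach space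
  of bounded real-linear maps.\<close>

instance antidual :: (complex_inner) banach
proof
  fix X :: "nat \<Rightarrow> 'a antidual"
  assume X: "Cauchy X"
  have "Cauchy (\<lambda>n. Rep_antidual (X n))"
    using X by (simp add: Cauchy_def dist_norm norm_antidual.rep_eq minus_antidual.rep_eq)
  then obtain g where g: "(\<lambda>n. Rep_antidual (X n)) \<longlonglongrightarrow> g"
    using Cauchy_convergent_iff convergent_def by blast
  have lim: "(\<lambda>n. blinfun_apply (Rep_antidual (X n)) v) \<longlonglongrightarrow> blinfun_apply g v" for v
    using g by (intro tendsto_intros)
  have "blinfun_apply g (c *\<^sub>C v) = cnj c * blinfun_apply g v" for c v
  proof (rule LIMSEQ_unique[OF lim])
    have "(\<lambda>n. cnj c * blinfun_apply (Rep_antidual (X n)) v) \<longlonglongrightarrow> cnj c * blinfun_apply g v"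
      by (intro tendsto_intros lim)
    moreover have "(\<lambda>n. blinfun_apply (Rep_antidual (X n)) (c *\<^sub>C v)) =
        (\<lambda>n. cnj c * blinfun_apply (Rep_antidual (X n)) v)"
      using Rep_antidual by blast
    ultimately show "(\<lambda>n. blinfun_apply (Rep_antidual (X n)) (c *\<^sub>C v)) \<longlonglongrightarrow> cnj c * blinfun_apply g v"
      by metis
  qed
  then have r: "Rep_antidual (Abs_antidual g) = g"
    by (simp add: Abs_antidual_inverse)
  have "X \<longlonglongrightarrow> Abs_antidual g"
    using g by (simp add: tendsto_iff dist_norm norm_antidual.rep_eq minus_antidual.rep_eq r)
  then show "convergent X"
    by (auto simp: convergent_def)
qed

text \<open>For \<open>W = UNIV\<close> this is the Riesz representation theorem, and for \<open>g = cinner p\<close> it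
  is the orthogonal projection onto \<open>W\<close>.\<close>

lemma riesz_on_closed_subspace:
  fixes W :: "'v::chilbert_space set" and g :: "'v antidual"
  assumes W: "closed W" "0 \<in> W" "\<And>x y. x \<in> W \<Longrightarrow> y \<in> W \<Longrightarrow> x + y \<in> W"
    and sc: "\<And>c x. x \<in> W \<Longrightarrow> c *\<^sub>C x \<in> W"
  obtains u where "u \<in> W" "\<And>w. w \<in> W \<Longrightarrow> cinner u w = antidual_apply g w"
proof -
  \<comment> \<open>The quadratic functional whose minimizer over W is the representing
    vector.\<close>
  define F where "F v = (norm v)\<^sup>2 - 2 * Re (antidual_apply g v)" for v
  have scR: "r *\<^sub>R x \<in> W" if "x \<in> W" for r x
    using sc[OF that, of "of_real r"] by (simp add: scaleR_scaleC)
  have Fge: "F v \<ge> - (norm g)\<^sup>2" for v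
  proof -
    have "Re (antidual_apply g v) \<le> norm g * norm v"
      by (rule order_trans[OF complex_Re_le_cmod norm_antidual_apply])
    moreover have "0 \<le> (norm v - norm g)\<^sup>2" by simp
    ultimately show ?thesis
      by (simp add: F_def power2_eq_square algebra_simps)
  qed
  define m where "m = (INF v\<in>W. F v)"
  have bdd: "bdd_below (F ` W)"
    by (rule bdd_belowI[where m = "- (norm g)\<^sup>2"]) (auto intro: Fge)
  have m: "m \<le> F v" if "v \<in> W" for v
    unfolding m_def by (rule cINF_lower[OF bdd that])
  have "\<exists>v\<in>W. F v < m + 1 / Suc n" for n :: nat
    using cINF_less_iff[of W F "m + 1 / Suc n"] W(2) bdd by (auto simp: m_def)
  then obtain x where xW: "\<And>n. x n \<in> W" and xm: "\<And>n. F (x n) < m + 1 / Suc n"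
    by metis
  \<comment> \<open>Parallelogram law: the midpoint also has value at least m, which makes
    minimizing sequences Cauchy.\<close>
  have par: "(norm (p - q))\<^sup>2 \<le> 2 * (F p - m) + 2 * (F q - m)" if "p \<in> W" "q \<in> W" for p q
  proof -
    have "m \<le> F ((1/2) *\<^sub>R (p + q))"
      by (intro m scR W(3) that)
    also have "\<dots> = (norm (p + q))\<^sup>2 / 4 - Re (antidual_apply g (p + q))"
      by (simp add: F_def antidual_apply_scaleR_right power_divide)
    finally have "m \<le> ((norm p)\<^sup>2 + 2 * Re (cinner p q) + (norm q)\<^sup>2) / 4 -
        (Re (antidual_apply g p) + Re (antidual_apply g q))"
      by (simp only: norm_plus_sq antidual_apply_add_right plus_complex.simps)
    moreover have "m \<le> (P + 2 * R + Q) / 4 - (a + b) \<Longrightarrow>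
        P - 2 * R + Q \<le> 2 * (P - 2 * a - m) + 2 * (Q - 2 * b - m)" for P Q R a b :: real
      by argo
    ultimately show ?thesis
      unfolding F_def norm_diff_sq by blast
  qed
  have "Cauchy x"
  proof (rule CauchyI)
    fix e :: real assume e: "0 < e"
    obtain N :: nat where N: "4 / e\<^sup>2 < N" using reals_Archimedean2 by blast
    have "0 < 4 / e\<^sup>2" using e by simp
    with N have N0: "0 < real N" by linarith
    have N': "4 / real N < e\<^sup>2"
      using N N0 e by (simp add: pos_divide_less_eq mult.commute)
    have "norm (x i - x j) < e" if ij: "i \<ge> N" "j \<ge> N" for i j
    proof -
      have *: "1 / real (Suc k) \<le> 1 / real N" if "k \<ge> N" for k
        using that N0 by (simp add: frac_le)
      have "(norm (x i - x j))\<^sup>2 \<le> 2 * (F (x i) - m) + 2 * (F (x j) - m)"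
        by (rule par[OF xW xW])
      also have "\<dots> \<le> 4 / real N"
        using xm[of i] xm[of j] *[OF ij(1)] *[OF ij(2)] by argo
      also have "\<dots> < e\<^sup>2" by (rule N')
      finally show ?thesis
        using e by (simp add: power_less_imp_less_base)
    qed
    then show "\<exists>M. \<forall>i\<ge>M. \<forall>j\<ge>M. norm (x i - x j) < e" by blast
  qed
  then obtain u where u: "x \<longlonglongrightarrow> u"
    using Cauchy_convergent_iff convergent_def by blast
  have uW: "u \<in> W"
    by (rule closed_sequentially[OF W(1) _ u]) (rule xW)
  have "(\<lambda>n. F (x n)) \<longlonglongrightarrow> F u"
    unfolding F_def by (intro tendsto_intros u bounded_linear.tendsto[OF bounded_linear_antidual_apply_right])
  moreover have "(\<lambda>n. m + 1 / real (Suc n)) \<longlonglongrightarrow> m + 0"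
    by (intro tendsto_intros LIMSEQ_inverse_real_of_nat[unfolded inverse_eq_divide])
  ultimately have Fu: "F u \<le> m"
    using xm by (metis (no_types, lifting) add_0_right LIMSEQ_le less_imp_le)
  have re: "Re (cinner u w) = Re (antidual_apply g w)" if w: "w \<in> W" for w
  proof (rule ccontr)
    define d where "d = Re (cinner u w) - Re (antidual_apply g w)"
    assume "\<not> ?thesis"
    then have d: "d \<noteq> 0" by (simp add: d_def)
    \<comment> \<open>Minimizes 2 t d + t^2 X for X = \<open>(norm w)\<^sup>2 + 1\<close>; the added
      1 keeps the denominator positive when w is 0.\<close>
    define t where "t = - d / ((norm w)\<^sup>2 + 1)"
    have pos: "(norm w)\<^sup>2 + 1 > 0" by (simp add: add_nonneg_pos)
    have "F u \<le> F (u + t *\<^sub>R w)"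
      using Fu m[of "u + t *\<^sub>R w"] W(3) scR uW w by force
    then have "0 \<le> 2 * t * d + t\<^sup>2 * (norm w)\<^sup>2"
      by (simp add: F_def norm_plus_sq antidual_apply_add_right antidual_apply_scaleR_right
          cinner_scaleR_right d_def algebra_simps power_mult_distrib)
    also have "\<dots> \<le> 2 * t * d + t\<^sup>2 * ((norm w)\<^sup>2 + 1)"
      by (simp add: algebra_simps)
    also have "\<dots> = - (d\<^sup>2 / ((norm w)\<^sup>2 + 1))"
    proof -
      have "2 * (- d / X) * d + (- d / X)\<^sup>2 * X = - (d\<^sup>2 / X)" if "X > 0" for X :: real
        using that by (simp add: power2_eq_square field_simps)
      from this[OF pos] show ?thesis by (simp only: t_def)
    qed
    also have "\<dots> < 0" using d pos by simp
    finally show False by simp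
  qed
  have "cinner u w = antidual_apply g w" if w: "w \<in> W" for w
  proof -
    \<comment> \<open>Real parts suffice, because \<i> times w supplies the imaginary part.\<close>
    have "Re (cinner u (\<i> *\<^sub>C w)) = Re (antidual_apply g (\<i> *\<^sub>C w))"
      by (rule re[OF sc[OF w]])
    then show ?thesis
      using re[OF w] by (simp add: complex_eq_iff cinner_scaleC_right antidual_apply_scaleC_right)
  qed
  with uW show thesis by (rule that)
qed


text \<open>With the Riesz map R, the equation L u = g is the fixed point equation of the map u -
  \<rho> R (L u - g), which is a contraction for a suitable \<rho>.\<close>

lemma lax_milgram_solvable:
  fixes b :: "'v::chilbert_space \<Rightarrow> 'v \<Rightarrow> complex"
  assumes b: "bounded_sesquilinear b" and ell: "elliptic b"
  shows "\<exists>u. \<forall>v. b u v = antidual_apply g v"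
proof -
  from ell obtain \<alpha> where \<alpha>: "\<alpha> > 0" "\<And>v. Re (b v v) \<ge> \<alpha> * (norm v)\<^sup>2"
    unfolding elliptic_def by blast
  from b obtain C0 where C0: "\<And>u v. cmod (b u v) \<le> C0 * norm u * norm v"
    and add1: "\<And>u u' v. b (u + u') v = b u v + b u' v" and add2: "\<And>u v v'. b u (v + v') = b u v + b u v'"
    and sc1: "\<And>c u v. b (c *\<^sub>C u) v = c * b u v" and sc2: "\<And>c u v. b u (c *\<^sub>C v) = cnj c * b u v"
    unfolding bounded_sesquilinear_def by blast
  \<comment> \<open>Enlarged to at least \<alpha>, so that the radicand of the contraction constant
    c is nonnegative.\<close>
  define C where "C = max C0 \<alpha>"
  have C: "C > 0" "C \<ge> \<alpha>" using \<alpha> by (auto simp: C_def)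
  have bC: "cmod (b u v) \<le> C * norm u * norm v" for u v
    by (rule order_trans[OF C0]) (auto simp: C_def intro!: mult_right_mono)
  define L where "L = lax_milgram b"
  have L: "antidual_apply (L u) v = b u v" for u v
    unfolding L_def lax_milgram_def
    by (subst antidual_apply_antidual_of[where K = "C * norm u"]) (simp_all add: add2 sc2 bC)
  have nL: "norm (L u) \<le> C * norm u" for u
    by (rule norm_antidual_le) (use C bC in \<open>auto simp: L\<close>)
  have Ld: "L (u - v) = L u - L v" for u v
  proof (rule antidual_eqI)
    fix w
    have "b (u - v) w + b v w = b u w" by (simp flip: add1)
    then show "antidual_apply (L (u - v)) w = antidual_apply (L u - L v) w"
      by (simp add: L antidual_apply_diff_left algebra_simps)
  qed
  have "\<exists>u. \<forall>v. cinner u v = antidual_apply f v" for f :: "'v antidual"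
    by (rule riesz_on_closed_subspace[of UNIV f]) auto
  then obtain R where R: "\<And>f v. cinner (R f) v = antidual_apply (f :: 'v antidual) v"
    by metis
  have nR: "norm (R f) \<le> norm f" for f
  proof -
    have "(norm (R f))\<^sup>2 \<le> norm f * norm (R f)"
      unfolding Re_cinner_self[symmetric] R by (rule order_trans[OF complex_Re_le_cmod norm_antidual_apply])
    then show ?thesis
      by (cases "norm (R f) = 0") (auto simp: power2_eq_square)
  qed
  have Rd: "R (f - h) = R f - R h" for f h
  proof -
    have "cinner (R (f - h) - (R f - R h)) w = 0" for w
      by (simp add: cinner_diff_left R antidual_apply_diff_left)
    from this[of "R (f - h) - (R f - R h)"] show ?thesis by (simp add: cinner_self)
  qed
  \<comment> \<open>The minimizer of 1 - 2 \<rho> \<alpha> + \<rho>^2 C^2; the minimum is the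
    radicand of c.\<close>
  define \<rho> where "\<rho> = \<alpha> / C\<^sup>2"
  define c where "c = sqrt (1 - \<alpha>\<^sup>2 / C\<^sup>2)"
  have c: "0 \<le> 1 - \<alpha>\<^sup>2 / C\<^sup>2" "1 - \<alpha>\<^sup>2 / C\<^sup>2 < 1"
    using C \<alpha> by (auto simp: power_mono)
  define \<Phi> where "\<Phi> u = u - \<rho> *\<^sub>R R (L u - g)" for u
  have contr: "dist (\<Phi> u) (\<Phi> v) \<le> c * dist u v" for u v
  proof -
    define w where "w = u - v"
    have "\<Phi> u - \<Phi> v = w - \<rho> *\<^sub>R R (L w)"
    proof -
      have "L u - g - (L v - g) = L w" by (simp add: w_def Ld)
      then have "R (L w) = R (L u - g) - R (L v - g)" by (metis Rd)
      then show ?thesis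
        unfolding \<Phi>_def w_def by (simp only: scaleR_diff_right) simp
    qed
    moreover have "(norm (w - \<rho> *\<^sub>R R (L w)))\<^sup>2 \<le> (c * norm w)\<^sup>2"
    proof -
      have "Re (cinner w (R (L w))) = Re (b w w)"
        by (subst cinner_commute) (simp add: R L)
      then have "(norm (w - \<rho> *\<^sub>R R (L w)))\<^sup>2 = (norm w)\<^sup>2 - 2 * \<rho> * Re (b w w) + \<rho>\<^sup>2 * (norm (R (L w)))\<^sup>2"
        by (simp add: norm_diff_sq cinner_scaleR_right power_mult_distrib)
      also have "\<dots> \<le> (norm w)\<^sup>2 - 2 * \<rho> * (\<alpha> * (norm w)\<^sup>2) + \<rho>\<^sup>2 * (C * norm w)\<^sup>2"
      proof -
        have "(norm (R (L w)))\<^sup>2 \<le> (C * norm w)\<^sup>2"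
          by (intro power_mono order_trans[OF nR nL]) simp
        moreover have "\<rho> > 0" using \<alpha> C by (simp add: \<rho>_def)
        ultimately show ?thesis
          using \<alpha>(2)[of w] by (intro add_mono diff_mono mult_left_mono) auto
      qed
      also have "\<dots> = (1 - \<alpha>\<^sup>2 / C\<^sup>2) * (norm w)\<^sup>2"
        using C by (simp add: \<rho>_def field_simps power2_eq_square)
      also have "\<dots> = (c * norm w)\<^sup>2"
        using c by (simp add: c_def power_mult_distrib)
      finally show ?thesis .
    qed
    then have "norm (w - \<rho> *\<^sub>R R (L w)) \<le> c * norm w"
      by (rule power2_le_imp_le) (use c in \<open>simp add: c_def\<close>)
    ultimately show ?thesis by (simp add: dist_norm w_def)
  qed
  have "c < 1" "0 \<le> c"
    using c by (simp_all add: c_def)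
  then have "\<exists>!u. \<Phi> u = u"
    by (intro banach_fix_type[where c = c]) (auto simp: contr)
  then obtain u where "\<Phi> u = u" by blast
  then have "R (L u - g) = 0"
    using C \<alpha> by (simp add: \<Phi>_def \<rho>_def)
  then have "antidual_apply (L u - g) v = 0" for v
    using R[of "L u - g" v] by simp
  then show ?thesis by (auto simp: antidual_apply_diff_left L)
qed

lemma closed_under_closure:
  fixes Y :: "'a::real_normed_vector set"
  assumes add: "\<And>x y. x \<in> Y \<Longrightarrow> y \<in> Y \<Longrightarrow> x + y \<in> Y"
    and x: "x \<in> closure Y" and y: "y \<in> closure Y"
  shows "x + y \<in> closure Y"
proof -
  from x y obtain p q where "\<And>n. p n \<in> Y" "p \<longlonglongrightarrow> x" "\<And>n. q n \<in> Y" "q \<longlonglongrightarrow> y"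
    unfolding closure_sequential by blast
  then have "\<And>n. p n + q n \<in> Y" "(\<lambda>n. p n + q n) \<longlonglongrightarrow> x + y"
    by (auto intro: add tendsto_add)
  then show ?thesis unfolding closure_sequential by (intro exI[of _ "\<lambda>n. p n + q n"]) simp
qed

lemma bounded_linear_closure_mem:
  assumes F: "bounded_linear F" and Y: "\<And>y. y \<in> Y \<Longrightarrow> F y \<in> Z" and x: "x \<in> closure Y"
  shows "F x \<in> closure Z"
proof -
  from x obtain p where "\<And>n. p n \<in> Y" "p \<longlonglongrightarrow> x" unfolding closure_sequential by blast
  then have "\<And>n. F (p n) \<in> Z" "(\<lambda>n. F (p n)) \<longlonglongrightarrow> F x"
    by (auto intro: Y bounded_linear.tendsto[OF F])
  then show ?thesis unfolding closure_sequential by (intro exI[of _ "\<lambda>n. F (p n)"]) simp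
qed

text \<open>The constants are parameters and not existential witnesses, so that the bounds below can
  be written out and combined.\<close>

locale elliptic_form =
  fixes \<iota> :: "'v::chilbert_space \<Rightarrow> 'h::chilbert_space"
    and a :: "'v \<Rightarrow> 'v \<Rightarrow> complex" and C \<alpha> \<kappa> :: real
  assumes gelfand: "gelfand_triple \<iota>"
    and sesq: "bounded_sesquilinear a"
    and a_bound: "cmod (a u v) \<le> C * norm u * norm v"
    and a_elliptic: "\<alpha> * (norm v)\<^sup>2 \<le> Re (a v v)"
    and \<iota>_bound: "norm (\<iota> v) \<le> \<kappa> * norm v"
    and pos: "C > 0" "\<alpha> > 0" "\<kappa> > 0"
begin

section \<open>Embeddings, the operator of the form and its inverse\<close>

abbreviation "j \<equiv> H_to_antidual \<iota>"
abbreviation "L \<equiv> lax_milgram a"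

lemma \<iota>_clinear: "clinear \<iota>" and \<iota>_bl: "bounded_linear \<iota>" and \<iota>_inj: "inj \<iota>"
  and \<iota>_dense: "closure (range \<iota>) = UNIV"
  using gelfand by (auto simp: gelfand_triple_def)

lemma a_add_left: "a (u + u') v = a u v + a u' v" and a_add_right: "a u (v + v') = a u v + a u v'"
  and a_scaleC_left: "a (c *\<^sub>C u) v = c * a u v" and a_scaleC_right: "a u (c *\<^sub>C v) = cnj c * a u v"
  using sesq by (auto simp: bounded_sesquilinear_def)

lemma L_apply: "antidual_apply (L u) v = a u v"
  unfolding lax_milgram_def
  by (subst antidual_apply_antidual_of[where K = "C * norm u"])
    (simp_all add: a_add_right a_scaleC_right a_bound)

lemma j_apply: "antidual_apply (j x) v = cinner x (\<iota> v)"
proof -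
  have "cmod (cinner x (\<iota> v)) \<le> norm x * \<kappa> * norm v" for v
    using order_trans[OF cinner_Cauchy_Schwarz mult_left_mono[OF \<iota>_bound norm_ge_zero]]
    by (simp add: mult.assoc)
  then show ?thesis
    unfolding H_to_antidual_def
    by (subst antidual_apply_antidual_of[where K = "norm x * \<kappa>"])
      (simp_all add: cinner_add_right cinner_scaleC_right clinear_scaleC[OF \<iota>_clinear]
        linear_add[OF bounded_linear.linear[OF \<iota>_bl]])
qed

lemma L_norm: "norm (L u) \<le> C * norm u"
  by (rule norm_antidual_le) (use pos a_bound in \<open>auto simp: L_apply\<close>)

lemma j_norm: "norm (j x) \<le> \<kappa> * norm x"
proof (rule norm_antidual_le)
  show "cmod (antidual_apply (j x) v) \<le> \<kappa> * norm x * norm v" for v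
    using order_trans[OF cinner_Cauchy_Schwarz mult_left_mono[OF \<iota>_bound norm_ge_zero], of x v]
    by (simp add: j_apply mult_ac)
qed (use pos in auto)

lemma L_clinear: "clinear L"
  unfolding clinear_def by (auto intro!: antidual_eqI
      simp: L_apply antidual_apply_add_left antidual_apply_scaleC_left a_add_left a_scaleC_left)

lemma j_clinear: "clinear j"
  unfolding clinear_def by (auto intro!: antidual_eqI
      simp: j_apply antidual_apply_add_left antidual_apply_scaleC_left cinner_add_left cinner_scaleC_left)

lemma L_bl: "bounded_linear L"
  using clinear_linear[OF L_clinear] L_norm
  by (auto simp: linear_add linear_scale mult.commute[of _ C] intro!: bounded_linear_intro[where K = C])

lemma j_bl: "bounded_linear j"
  using clinear_linear[OF j_clinear] j_norm
  by (auto simp: linear_add linear_scale mult.commute[of _ \<kappa>] intro!: bounded_linear_intro[where K = \<kappa>])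

text \<open>Equality in the antidual says that x - y is orthogonal to the range of
  \<open>\<iota>\<close>; density makes it orthogonal to itself.\<close>

lemma j_inj: "inj j"
proof (rule injI)
  fix x y assume *: "j x = j y"
  have "cinner (x - y) z = 0" for z
  proof -
    have "z \<in> closure (range \<iota>)" by (simp add: \<iota>_dense)
    then obtain p where p: "\<And>n. p n \<in> range \<iota>" "p \<longlonglongrightarrow> z" unfolding closure_sequential by blast
    have "cinner (x - y) (p n) = 0" for n
      using p(1)[of n] arg_cong[OF *, of "\<lambda>f. antidual_apply f _"]
      by (auto simp: j_apply cinner_diff_left)
    moreover have "(\<lambda>n. cinner (x - y) (p n)) \<longlonglongrightarrow> cinner (x - y) z"
    proof -
      have "bounded_linear (cinner (x - y))"
        by (rule bounded_linear_intro[where K = "norm (x - y)"])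
         (auto simp: cinner_add_right cinner_scaleR_right scaleR_conv_of_real cinner_Cauchy_Schwarz mult.commute[of _ "norm (x - y)"])
      then show ?thesis by (rule bounded_linear.tendsto[OF _ p(2)])
    qed
    ultimately show ?thesis by (simp add: LIMSEQ_const_iff)
  qed
  from this[of "x - y"] show "x = y" by (simp add: cinner_self)
qed

lemma a_form_elliptic: "elliptic a"
  using a_elliptic pos by (auto simp: elliptic_def)

definition "Linv = inv L"

lemma norm_le_L: "\<alpha> * norm u \<le> norm (L u)"
proof -
  have "\<alpha> * (norm u)\<^sup>2 \<le> norm (L u) * norm u"
    using order_trans[OF a_elliptic order_trans[OF complex_Re_le_cmod]] norm_antidual_apply[of "L u" u]
    by (simp add: L_apply)
  then show ?thesis
    by (cases "norm u = 0") (auto simp: power2_eq_square)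
qed

lemma L_bij: "bij L"
proof (rule bijI)
  show "inj L"
  proof (rule injI)
    fix u v assume "L u = L v"
    then have "L (u - v) = 0" using linear_diff[OF clinear_linear[OF L_clinear]] by simp
    then show "u = v" using norm_le_L[of "u - v"] pos by (simp add: mult_le_0_iff)
  qed
  show "surj L"
    unfolding surj_def
  proof
    fix g :: "'v antidual"
    obtain u where "\<forall>v. a u v = antidual_apply g v"
      using lax_milgram_solvable[OF sesq a_form_elliptic] by blast
    then have "L u = g" by (auto intro!: antidual_eqI simp: L_apply)
    then show "\<exists>u. g = L u" by blast
  qed
qed

lemma L_Linv [simp]: "L (Linv g) = g" and Linv_L [simp]: "Linv (L u) = u"
  unfolding Linv_def using L_bij by (simp_all add: bij_is_surj surj_f_inv_f bij_is_inj)

lemma Linv_clinear: "clinear Linv"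
proof -
  have "L (Linv x + Linv y) = x + y" "L (c *\<^sub>C Linv x) = c *\<^sub>C x" for x y c
    using L_clinear by (simp_all add: clinear_def)
  then have "Linv (x + y) = Linv x + Linv y" "Linv (c *\<^sub>C x) = c *\<^sub>C Linv x" for x y c
    by (metis Linv_L)+
  then show ?thesis by (simp add: clinear_def)
qed

lemma Linv_norm: "norm (Linv g) \<le> (1 / \<alpha>) * norm g"
  using norm_le_L[of "Linv g"] pos by (simp add: pos_le_divide_eq mult.commute)

lemma Linv_bl: "bounded_linear Linv"
  using clinear_linear[OF Linv_clinear] Linv_norm
  by (auto simp: linear_add linear_scale mult.commute[of _ "1 / \<alpha>"] intro!: bounded_linear_intro[where K = "1 / \<alpha>"])

text \<open>Lax--Milgram for the form (u|v) + h a(u,v), which is elliptic on V with constant h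
  \<alpha>.\<close>

lemma resolvent_solvable:
  assumes h: "h > 0"
  shows "\<exists>!u. j (\<iota> u) + h *\<^sub>R L u = z"
proof -
  define b where "b u v = cinner (\<iota> u) (\<iota> v) + h * a u v" for u v
  have \<iota>: "\<iota> (u + v) = \<iota> u + \<iota> v" "\<iota> (c *\<^sub>C u) = c *\<^sub>C \<iota> u" for u v c
    using \<iota>_clinear by (auto simp: clinear_def)
  have bd: "cmod (b u v) \<le> (\<kappa> * \<kappa> + h * C) * norm u * norm v" for u v
  proof -
    have "cmod (b u v) \<le> cmod (cinner (\<iota> u) (\<iota> v)) + h * cmod (a u v)"
      unfolding b_def using h by (intro order_trans[OF norm_triangle_ineq]) (simp add: norm_mult)
    also have "\<dots> \<le> (\<kappa> * norm u) * (\<kappa> * norm v) + h * (C * norm u * norm v)"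
      using h pos by (intro add_mono mult_left_mono a_bound order_trans[OF cinner_Cauchy_Schwarz] mult_mono \<iota>_bound) auto
    finally show ?thesis by (simp add: algebra_simps)
  qed
  have eb: "h * \<alpha> * (norm v)\<^sup>2 \<le> Re (b v v)" for v
  proof -
    have "h * (\<alpha> * (norm v)\<^sup>2) \<le> h * Re (a v v)" using h a_elliptic by (intro mult_left_mono) auto
    then show ?thesis by (simp add: b_def Re_cinner_self mult.assoc add_increasing)
  qed
  have b: "bounded_sesquilinear b" "elliptic b"
    unfolding bounded_sesquilinear_def elliptic_def
  proof (intro conjI)
    show "\<exists>C. \<forall>u v. cmod (b u v) \<le> C * norm u * norm v" using bd by blast
    show "\<exists>C>0. \<forall>v. C * (norm v)\<^sup>2 \<le> Re (b v v)" using eb h pos by (intro exI[of _ "h * \<alpha>"]) auto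
  qed (simp_all add: b_def \<iota> a_add_left a_add_right a_scaleC_left a_scaleC_right cinner_add_left cinner_add_right
      cinner_scaleC_left cinner_scaleC_right algebra_simps)
  have eq: "(j (\<iota> u) + h *\<^sub>R L u = z) \<longleftrightarrow> (\<forall>v. b u v = antidual_apply z v)" for u
    by (auto simp: b_def antidual_apply_add_left antidual_apply_scaleR_left j_apply L_apply
        scaleR_conv_of_real intro!: antidual_eqI)
  show ?thesis
  proof (rule ex_ex1I)
    show "\<exists>u. j (\<iota> u) + h *\<^sub>R L u = z" unfolding eq by (rule lax_milgram_solvable[OF b])
    fix u w assume "j (\<iota> u) + h *\<^sub>R L u = z" "j (\<iota> w) + h *\<^sub>R L w = z"
    then have "b u v = b w v" for v unfolding eq by simp
    moreover have "b ((u - w) + w) v = b (u - w) v + b w v" for v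
      using b(1) unfolding bounded_sesquilinear_def by blast
    ultimately have "b (u - w) (u - w) = 0" by simp
    then have "(norm (u - w))\<^sup>2 \<le> 0" using eb[of "u - w"] h pos by (simp add: mult_le_0_iff)
    then show "u = w" by simp
  qed
qed

text \<open>Density of V in its antidual by orthogonality: the Riesz map R moves the range into V,
  where a vector orthogonal to the image is tested against its own image.\<close>

lemma j_\<iota>_dense: "closure (range (\<lambda>v. j (\<iota> v))) = UNIV"
proof -
  have "\<exists>u. \<forall>v. cinner u v = antidual_apply f v" for f :: "'v antidual"
    by (rule riesz_on_closed_subspace[of UNIV f]) auto
  then obtain R where R: "\<And>f v. cinner (R f) v = antidual_apply (f :: 'v antidual) v"
    by metis
  define Y where "Y = range (\<lambda>v. R (j (\<iota> v)))"
  have RL: "R f = u \<longleftrightarrow> (\<forall>v. cinner u v = antidual_apply f v)" for f u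
  proof -
    have "R f = u" if "\<forall>v. cinner u v = antidual_apply f v"
    proof -
      have "cinner (R f - u) (R f - u) = 0"
        using that R[of f "R f - u"] by (simp add: cinner_diff_left)
      then show ?thesis by (simp add: cinner_self)
    qed
    then show ?thesis using R by blast
  qed
  have \<iota>: "\<iota> (u + v) = \<iota> u + \<iota> v" "\<iota> (c *\<^sub>C u) = c *\<^sub>C \<iota> u" for u v c
    using \<iota>_clinear by (auto simp: clinear_def)
  have j': "j (u + v) = j u + j v" "j (c *\<^sub>C u) = c *\<^sub>C j u" for u v c
    using j_clinear by (auto simp: clinear_def)
  have Yadd: "x + y \<in> Y" if "x \<in> Y" "y \<in> Y" for x y
  proof -
    from that obtain u v where uv: "x = R (j (\<iota> u))" "y = R (j (\<iota> v))" unfolding Y_def by blast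
    have "R (j (\<iota> (u + v))) = x + y"
      unfolding uv RL by (simp add: \<iota> j' cinner_add_left R antidual_apply_add_left)
    then show ?thesis unfolding Y_def by (metis rangeI)
  qed
  have Ysc: "c *\<^sub>C x \<in> Y" if "x \<in> Y" for x c
  proof -
    from that obtain u where uv: "x = R (j (\<iota> u))" unfolding Y_def by blast
    have "R (j (\<iota> (c *\<^sub>C u))) = c *\<^sub>C x"
      unfolding uv RL by (simp add: \<iota> j' cinner_scaleC_left R antidual_apply_scaleC_left)
    then show ?thesis unfolding Y_def by (metis rangeI)
  qed
  have Y: "p \<in> closure Y" for p
  proof -
    define g where "g = antidual_of (\<lambda>v. cinner p v)"
    have g: "antidual_apply g = cinner p"
      unfolding g_def by (rule antidual_apply_antidual_of[where K = "norm p"])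
       (simp_all add: cinner_add_right cinner_scaleC_right cinner_Cauchy_Schwarz)
    have "closed (closure Y)" by simp
    moreover have "0 \<in> closure Y"
      using Ysc[of "R (j (\<iota> 0))" 0] closure_subset[of Y] by (auto simp: Y_def)
    ultimately obtain u where u: "u \<in> closure Y" "\<And>w. w \<in> closure Y \<Longrightarrow> cinner u w = antidual_apply g w"
      by (rule riesz_on_closed_subspace[of "closure Y" g])
       (auto intro: closed_under_closure Yadd bounded_linear_closure_mem[OF bounded_linear_scaleC Ysc])
    \<comment> \<open>The part of p orthogonal to \<open>closure Y\<close>, to be shown to
      vanish.\<close>
    define q where "q = p - u"
    have "cinner q (R (j (\<iota> v))) = 0" for v
    proof -
      have "R (j (\<iota> v)) \<in> closure Y" using closure_subset[of Y] by (auto simp: Y_def)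
      from u(2)[OF this] show ?thesis by (simp add: q_def cinner_diff_left g)
    qed
    \<comment> \<open>The case v = q: this pairing is
      \<open>antidual_apply (j (\<iota> q)) q\<close>, the squared norm of
      \<open>\<iota> q\<close>.\<close>
    then have "cinner (R (j (\<iota> q))) q = 0"
      by (subst cinner_commute) simp
    then have "\<iota> q = 0" by (simp add: R j_apply cinner_self)
    then have "q = 0" using \<iota>_inj linear_0[OF bounded_linear.linear[OF \<iota>_bl]] by (metis injD)
    then show ?thesis using u(1) by (simp add: q_def)
  qed
  have "g \<in> closure (range (\<lambda>v. j (\<iota> v)))" for g
  proof -
    from Y[of "R g"] obtain p where p: "\<And>n. p n \<in> Y" "p \<longlonglongrightarrow> R g" unfolding closure_sequential by blast
    then have "\<forall>n. \<exists>v. p n = R (j (\<iota> v))" by (auto simp: Y_def)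
    then obtain v where v: "\<And>n. p n = R (j (\<iota> (v n)))" by metis
    have "(\<lambda>n. j (\<iota> (v n))) \<longlonglongrightarrow> g"
    proof (rule LIM_zero_cancel, rule Lim_null_comparison)
      show "(\<lambda>n. norm (p n - R g)) \<longlonglongrightarrow> 0" using p(2) by (simp add: LIM_zero tendsto_norm_zero)
      have "norm (j (\<iota> (v n)) - g) \<le> norm (p n - R g)" for n
      proof (rule norm_antidual_le)
        fix w
        have "antidual_apply (j (\<iota> (v n)) - g) w = cinner (p n - R g) w"
          by (simp add: v antidual_apply_diff_left cinner_diff_left R)
        then show "cmod (antidual_apply (j (\<iota> (v n)) - g) w) \<le> norm (p n - R g) * norm w"
          by (simp add: cinner_Cauchy_Schwarz)
      qed simp
      then show "\<forall>\<^sub>F n in sequentially. norm (j (\<iota> (v n)) - g) \<le> norm (p n - R g)" by simp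
    qed
    then show ?thesis unfolding closure_sequential by (intro exI[of _ "\<lambda>n. j (\<iota> (v n))"]) simp
  qed
  then show ?thesis by blast
qed

end

section \<open>Strongly continuous semigroups\<close>

lemma bounded_linear_eq_on_dense:
  fixes F G :: "'a::real_normed_vector \<Rightarrow> 'b::real_normed_vector"
  assumes F: "bounded_linear F" and G: "bounded_linear G" and D: "closure D = UNIV"
    and eq: "\<And>x. x \<in> D \<Longrightarrow> F x = G x"
  shows "F x = G x"
proof -
  have "x \<in> closure D" by (simp add: D)
  then obtain p where p: "\<And>n. p n \<in> D" "p \<longlonglongrightarrow> x" unfolding closure_sequential by blast
  have "(\<lambda>n. F (p n)) \<longlonglongrightarrow> F x" "(\<lambda>n. G (p n)) \<longlonglongrightarrow> G x"
    using p(2) by (auto intro: bounded_linear.tendsto[OF F] bounded_linear.tendsto[OF G])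
  then show ?thesis using eq[OF p(1)] by (simp add: LIMSEQ_unique)
qed

text \<open>The uniform bound transfers the Cauchy property from a nearby point of D to x, by
  splitting the difference into three parts.\<close>

lemma convergent_on_dense:
  fixes E :: "nat \<Rightarrow> 'a::real_normed_vector \<Rightarrow> 'b::banach"
  assumes lin: "\<And>m. linear (E m)" and bd: "\<And>m x. norm (E m x) \<le> M * norm x"
    and D: "closure D = UNIV" and conv: "\<And>x. x \<in> D \<Longrightarrow> convergent (\<lambda>m. E m x)"
  shows "convergent (\<lambda>m. E m x)"
proof (rule Cauchy_convergent, rule CauchyI)
  fix e :: real assume e: "0 < e"
  define K where "K = max M 0 + 1"
  have K: "K > 0" "\<And>m x. norm (E m x) \<le> K * norm x"
    by (auto simp: K_def intro!: order_trans[OF bd] mult_right_mono)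
  have "x \<in> closure D" by (simp add: D)
  then obtain y where y: "y \<in> D" "norm (y - x) < e / (4 * K)"
    using e K(1) unfolding closure_approachable dist_norm by (metis divide_pos_pos mult_pos_pos zero_less_numeral)
  from conv[OF y(1)] have "Cauchy (\<lambda>m. E m y)" by (rule convergent_Cauchy)
  then obtain N where N: "\<And>m n. m \<ge> N \<Longrightarrow> n \<ge> N \<Longrightarrow> norm (E m y - E n y) < e / 2"
    using e by (meson CauchyD half_gt_zero)
  have d: "norm (E m y - E m x) \<le> e / 4" for m
  proof -
    have "norm (E m y - E m x) \<le> K * norm (y - x)"
      using K(2)[of m "y - x"] by (simp add: linear_diff[OF lin])
    also have "\<dots> \<le> K * (e / (4 * K))" using y(2) K(1) by (intro mult_left_mono) auto
    finally show ?thesis using K(1) by simp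
  qed
  have "norm (E m x - E n x) < e" if "m \<ge> N" "n \<ge> N" for m n
  proof -
    have "E m x - E n x = (E m y - E n y) - (E m y - E m x) + (E n y - E n x)" by simp
    also have "norm \<dots> \<le> norm (E m y - E n y) + norm (E m y - E m x) + norm (E n y - E n x)"
      by (meson add_mono norm_triangle_ineq norm_triangle_ineq4 order_refl order_trans)
    finally show ?thesis using N[OF that] d[of m] d[of n] by argo
  qed
  then show "\<exists>N. \<forall>m\<ge>N. \<forall>n\<ge>N. norm (E m x - E n x) < e" by blast
qed

lemma convergent_geometric:
  fixes X :: "nat \<Rightarrow> 'a::banach"
  assumes "\<And>n. norm (X (Suc n) - X n) \<le> K * (1/2) ^ n"
  shows "convergent X"
proof -
  have "summable (\<lambda>n. X (Suc n) - X n)"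
  proof (rule summable_comparison_test)
    show "summable (\<lambda>n. K * (1/2::real) ^ n)" by (intro summable_mult summable_geometric) simp
  qed (use assms in auto)
  then have "convergent (\<lambda>n. \<Sum>i<n. X (Suc i) - X i)" by (simp add: summable_iff_convergent)
  then have "convergent (\<lambda>n. X n - X 0)" by (simp add: sum_lessThan_telescope)
  then have "convergent (\<lambda>n. (X n - X 0) + X 0)" by (intro convergent_add convergent_const)
  then show ?thesis by simp
qed

text \<open>Generators are defined by difference quotients; this links them to the calculus of
  vector derivatives, one-sided ones included.\<close>

lemma has_vector_derivative_iff_quotient:
  "(f has_vector_derivative D) (at s within X) \<longleftrightarrow>
    ((\<lambda>r. (f r - f s) /\<^sub>R (r - s)) \<longlongrightarrow> D) (at s within X)"
proof -
  have "(f has_vector_derivative D) (at s within X) \<longleftrightarrow>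
      ((\<lambda>r. norm ((f r - f s - (r - s) *\<^sub>R D) /\<^sub>R norm (r - s))) \<longlongrightarrow> 0) (at s within X)"
    unfolding has_vector_derivative_def has_derivative_at_within tendsto_norm_zero_iff
    by (simp add: bounded_linear_scaleR_left)
  also have "\<dots> \<longleftrightarrow> ((\<lambda>r. norm ((f r - f s) /\<^sub>R (r - s) - D)) \<longlongrightarrow> 0) (at s within X)"
  proof (rule tendsto_cong)
    have "norm ((f r - f s - (r - s) *\<^sub>R D) /\<^sub>R norm (r - s)) = norm ((f r - f s) /\<^sub>R (r - s) - D)" if "r \<noteq> s" for r
    proof -
      have "(f r - f s) /\<^sub>R (r - s) - D = (f r - f s - (r - s) *\<^sub>R D) /\<^sub>R (r - s)"
        using that by (simp add: scaleR_diff_right)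
      then show ?thesis by simp
    qed
    then show "\<forall>\<^sub>F r in at s within X. norm ((f r - f s - (r - s) *\<^sub>R D) /\<^sub>R norm (r - s)) = norm ((f r - f s) /\<^sub>R (r - s) - D)"
      by (auto simp: eventually_at_filter)
  qed
  also have "\<dots> \<longleftrightarrow> ((\<lambda>r. (f r - f s) /\<^sub>R (r - s)) \<longlongrightarrow> D) (at s within X)"
    by (simp add: tendsto_norm_zero_iff LIM_zero_iff)
  finally show ?thesis .
qed

text \<open>Banach--Steinhaus by Baire: the open sets \<open>U k\<close> have empty intersection, so
  one of them is not dense, and the operators are uniformly bounded on a ball.\<close>

lemma uniform_boundedness:
  fixes F :: "nat \<Rightarrow> 'a::banach \<Rightarrow> 'b::real_normed_vector"
  assumes bl: "\<And>n. bounded_linear (F n)" and pt: "\<And>x. \<exists>K. \<forall>n. norm (F n x) \<le> K"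
  shows "\<exists>K. \<forall>n x. norm (F n x) \<le> K * norm x"
proof -
  define U where "U k = {x. \<exists>n. norm (F n x) > real k}" for k :: nat
  have cont: "continuous_on UNIV (F n)" for n
    using bl[of n] by (simp add: linear_continuous_on)
  have opn: "open (U k)" for k
  proof -
    have "U k = (\<Union>n. {x. real k < norm (F n x)})" by (auto simp: U_def)
    then show ?thesis
      by (auto intro!: open_Collect_less continuous_intros cont)
  qed
  have "(\<Inter>k. U k) = {}"
  proof -
    have False if "x \<in> (\<Inter>k. U k)" for x
    proof -
      obtain K where K: "\<forall>n. norm (F n x) \<le> K" using pt by blast
      obtain k :: nat where "K < k" using reals_Archimedean2 by blast
      with that K show False by (auto simp: U_def) (metis INT_iff UNIV_I less_le_not_le order_trans less_imp_le leD)
    qed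
    then show ?thesis by blast
  qed
  moreover have "closure (\<Inter>k. U k) = UNIV" if "\<And>k. closure (U k) = UNIV"
  proof -
    have "Met_TC.mtopology closure_of (\<Inter>(range U)) = UNIV"
    proof (rule Met_TC.metric_Baire_category)
      show "Met_TC.mcomplete TYPE('a)"
        by (simp add: complete_UNIV)
      show "openin Met_TC.mtopology T \<and> Met_TC.mtopology closure_of T = UNIV" if "T \<in> range U" for T
        using that opn \<open>\<And>k. closure (U k) = UNIV\<close> by auto
    qed auto
    then show ?thesis by simp
  qed
  ultimately have "\<exists>k. closure (U k) \<noteq> UNIV" by (metis closure_empty empty_not_UNIV)
  then obtain k z where z: "z \<notin> closure (U k)" by blast
  then have "z \<in> - closure (U k)" "open (- closure (U k))" by auto
  then obtain r where "r > 0" "ball z r \<subseteq> - closure (U k)"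
    using open_contains_ball by blast
  then have r: "r > 0" "ball z r \<inter> U k = {}"
    using closure_subset[of "U k"] by auto
  have "norm (F n x) \<le> (4 * k / r) * norm x" for n x
  proof (cases "x = 0")
    case False
    \<comment> \<open>Half the radius in the direction of x. \<open>F n y\<close> is a difference of
      two values of norm at most k, whence the factor 4 in the bound.\<close>
    define y where "y = (r / (2 * norm x)) *\<^sub>R x"
    have "z \<in> ball z r" "z + y \<in> ball z r"
      using r False by (auto simp: y_def dist_norm)
    then have "z \<notin> U k" "z + y \<notin> U k"
      using r(2) by blast+
    then have "norm (F n z) \<le> k" "norm (F n (z + y)) \<le> k"
      by (simp_all add: U_def not_less)
    moreover have "F n y = F n (z + y) - F n z"
      by (simp add: linear_add[OF bounded_linear.linear[OF bl]])
    ultimately have "norm (F n y) \<le> 2 * k"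
      using norm_triangle_ineq4[of "F n (z + y)" "F n z"] by simp
    then have "(r / (2 * norm x)) * norm (F n x) \<le> 2 * k"
      using r by (simp add: y_def linear_scale[OF bounded_linear.linear[OF bl]])
    then show ?thesis using r False by (simp add: field_simps)
  qed (simp add: linear_0[OF bounded_linear.linear[OF bl]])
  then show ?thesis by blast
qed

text \<open>If no bound held near 0, there would be times \<open>t n\<close> tending to 0 that
  violate uniform boundedness, although \<open>S (t n) z\<close> converges for every z. The
  semigroup law carries the local bound to longer times.\<close>

lemma c0_semigroup_locally_bounded:
  fixes S :: "real \<Rightarrow> 'b \<Rightarrow> 'b::{complex_vector, banach}"
  assumes S: "c0_semigroup S"
  obtains K where "K \<ge> 1" "\<And>t x. 0 \<le> t \<Longrightarrow> t \<le> \<tau> \<Longrightarrow> norm (S t x) \<le> K * norm x"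
proof -
  have bl: "\<And>t. t \<ge> 0 \<Longrightarrow> bounded_linear (S t)" and S0: "\<And>x. S 0 x = x"
    and law: "\<And>s t x. s \<ge> 0 \<Longrightarrow> t \<ge> 0 \<Longrightarrow> S (s + t) x = S s (S t x)"
    and lim: "\<And>x. ((\<lambda>t. S t x) \<longlongrightarrow> x) (at_right 0)"
    using S by (auto simp: c0_semigroup_def)
  have "\<exists>n::nat. \<forall>t x. 0 \<le> t \<longrightarrow> t \<le> 1 / Suc n \<longrightarrow> norm (S t x) \<le> n * norm x"
  proof (rule ccontr)
    assume "\<not> ?thesis"
    then have "\<forall>n::nat. \<exists>t x. 0 \<le> t \<and> t \<le> 1 / Suc n \<and> norm (S t x) > n * norm x"
      by (metis not_less)
    then obtain t x where t: "\<And>n. 0 \<le> t n" "\<And>n::nat. t n \<le> 1 / Suc n" and x: "\<And>n::nat. norm (S (t n) (x n)) > n * norm (x n)"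
      by metis
    have t0: "t \<longlonglongrightarrow> 0"
      by (rule tendsto_sandwich[OF _ _ tendsto_const LIMSEQ_inverse_real_of_nat[unfolded inverse_eq_divide]])
        (use t in auto)
    have "(\<lambda>n. S (t n) z) \<longlonglongrightarrow> z" for z
    proof -
      have "((\<lambda>t. S t z) \<longlongrightarrow> S 0 z) (at 0 within {0..})"
        using lim[of z] by (simp add: S0 at_within_Ici_at_right)
      then have "continuous (at 0 within {0..}) (\<lambda>t. S t z)" by (simp add: continuous_within)
      from this[unfolded continuous_within_sequentially, rule_format, of t] t0 t(1)
      show ?thesis by (simp add: S0 o_def)
    qed
    then have "\<exists>K. \<forall>n. norm (S (t n) z) \<le> K" for z
      by (metis convergentI convergent_imp_Bseq Bseq_def)
    from uniform_boundedness[OF bl[OF t(1)] this]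
    obtain K where K: "\<And>n x. norm (S (t n) x) \<le> K * norm x" by blast
    obtain n :: nat where n: "K < n" using reals_Archimedean2 by blast
    have "K * norm (x n) \<le> n * norm (x n)" using n by (intro mult_right_mono) auto
    with K[of n "x n"] x[of n] show False by linarith
  qed
  then obtain n :: nat where n: "\<And>t x. 0 \<le> t \<Longrightarrow> t \<le> 1 / Suc n \<Longrightarrow> norm (S t x) \<le> n * norm x" by blast
  define d where "d = 1 / real (Suc n)"
  \<comment> \<open>At least 1, so that the powers of \<open>Q\<close> increase with the number of
    steps.\<close>
  define Q where "Q = max 1 (real n)"
  have d: "d > 0" by (simp add: d_def)
  have Q: "norm (S t x) \<le> Q * norm x" if "0 \<le> t" "t \<le> d" for t x
    by (rule order_trans[OF n]) (use that in \<open>auto simp: d_def Q_def intro!: mult_right_mono\<close>)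
  have Q1: "Q \<ge> 1" by (simp add: Q_def)
  have pw: "norm (S t x) \<le> Q ^ k * norm x" if "0 \<le> t" "t \<le> k * d" for t x k
    using that
  proof (induction k arbitrary: t x)
    case (Suc k)
    show ?case
    proof (cases "t \<le> k * d")
      case True
      then have "norm (S t x) \<le> Q ^ k * norm x" using Suc by blast
      also have "\<dots> \<le> Q ^ Suc k * norm x" using Q1 by (intro mult_right_mono power_increasing) auto
      finally show ?thesis .
    next
      case False
      then have s: "0 \<le> t - k * d" "t - k * d \<le> d" using Suc.prems by (auto simp: algebra_simps)
      have "S t x = S (k * d) (S (t - k * d) x)"
        using law[of "k * d" "t - k * d" x] s d by simp
      also have "norm \<dots> \<le> Q ^ k * norm (S (t - k * d) x)" using Suc.IH[of "k * d"] d by simp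
      also have "\<dots> \<le> Q ^ k * (Q * norm x)" using Q[OF s] Q1 by (intro mult_left_mono) auto
      finally show ?thesis by (simp add: mult_ac)
    qed
  qed (simp add: S0)
  obtain k :: nat where k: "\<tau> / d < k" using reals_Archimedean2 by blast
  then have "\<tau> \<le> k * d" using d by (simp add: pos_divide_less_eq)
  with pw Q1 show thesis by (intro that[of "Q ^ k"]) auto
qed

text \<open>A uniform bound lets the vector vary together with the time: the error
  \<open>S (\<sigma> r) (g r - x)\<close> has norm at most
  \<open>K * norm (g r - x)\<close>.\<close>

lemma c0_semigroup_jointly_continuous:
  assumes bl: "\<And>t. t \<in> X \<Longrightarrow> linear (S t)" and K: "\<And>t x. t \<in> X \<Longrightarrow> norm (S t x) \<le> K * norm x"
    and \<sigma>: "\<forall>\<^sub>F r in F. \<sigma> r \<in> X" and S: "((\<lambda>r. S (\<sigma> r) x) \<longlongrightarrow> y) F" and g: "(g \<longlongrightarrow> x) F"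
  shows "((\<lambda>r. S (\<sigma> r) (g r)) \<longlongrightarrow> y) F"
proof -
  have "((\<lambda>r. S (\<sigma> r) (g r - x)) \<longlongrightarrow> 0) F"
  proof (rule Lim_null_comparison)
    show "\<forall>\<^sub>F r in F. norm (S (\<sigma> r) (g r - x)) \<le> K * norm (g r - x)"
      using \<sigma> by eventually_elim (rule K)
    have "((\<lambda>r. K * norm (g r - x)) \<longlongrightarrow> K * norm (x - x)) F" by (intro tendsto_intros g)
    then show "((\<lambda>r. K * norm (g r - x)) \<longlongrightarrow> 0) F" by simp
  qed
  from tendsto_add[OF this S] have "((\<lambda>r. S (\<sigma> r) (g r - x) + S (\<sigma> r) x) \<longlongrightarrow> y) F" by simp
  then show ?thesis
  proof (rule Lim_transform_eventually)
    show "\<forall>\<^sub>F r in F. S (\<sigma> r) (g r - x) + S (\<sigma> r) x = S (\<sigma> r) (g r)"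
      using \<sigma> by eventually_elim (simp add: linear_diff[OF bl])
  qed
qed

text \<open>Factoring out the earlier of two times leaves \<open>S (q - p) x - x\<close>, so right
  continuity at 0 and a local bound give continuity from both sides.\<close>

lemma c0_semigroup_continuous_on:
  fixes S :: "real \<Rightarrow> 'b \<Rightarrow> 'b::{complex_vector, banach}"
  assumes S: "c0_semigroup S"
  shows "continuous_on {0..} (\<lambda>t. S t x)"
proof -
  have bl: "\<And>t. t \<ge> 0 \<Longrightarrow> bounded_linear (S t)" and S0: "\<And>x. S 0 x = x"
    and law: "\<And>s t x. s \<ge> 0 \<Longrightarrow> t \<ge> 0 \<Longrightarrow> S (s + t) x = S s (S t x)"
    and lim: "\<And>x. ((\<lambda>t. S t x) \<longlongrightarrow> x) (at_right 0)"
    using S by (auto simp: c0_semigroup_def)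
  show ?thesis
    unfolding continuous_on_iff
  proof (intro ballI allI impI)
    fix s e :: real assume s: "s \<in> {0..}" and e: "e > 0"
    obtain K where K: "K \<ge> 1" "\<And>t x. 0 \<le> t \<Longrightarrow> t \<le> s + 1 \<Longrightarrow> norm (S t x) \<le> K * norm x"
      using c0_semigroup_locally_bounded[OF S] by blast
    have "\<forall>\<^sub>F h in at_right 0. norm (S h x - x) < e / K"
      using lim[of x] K(1) e by (auto simp: tendsto_iff dist_norm)
    then obtain d where d: "d > 0" "\<And>h. 0 < h \<Longrightarrow> h < d \<Longrightarrow> norm (S h x - x) < e / K"
      by (auto simp: eventually_at_right_field)
    have d': "norm (S h x - x) < e / K" if "0 \<le> h" "h < d" for h
      using d that K(1) e by (cases "h = 0") (auto simp: S0)
    have *: "norm (S q x - S p x) < e" if pq: "0 \<le> p" "p \<le> q" "q - p < d" "p \<le> s + 1" for p q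
    proof -
      have "S q x - S p x = S p (S (q - p) x - x)"
        using law[of p "q - p" x] pq by (simp add: linear_diff[OF bounded_linear.linear[OF bl]])
      also have "norm \<dots> \<le> K * norm (S (q - p) x - x)" using K pq by auto
      also have "\<dots> < K * (e / K)" using K(1) d'[of "q - p"] pq by (intro mult_strict_left_mono) auto
      finally show ?thesis using K(1) by simp
    qed
    show "\<exists>d>0. \<forall>r\<in>{0..}. dist r s < d \<longrightarrow> dist (S r x) (S s x) < e"
    proof (intro exI[of _ d] conjI ballI impI d)
      fix r :: real assume r: "r \<in> {0..}" "dist r s < d"
      show "dist (S r x) (S s x) < e"
      proof (cases "r \<le> s")
        case True
        with *[of r s] r show ?thesis by (simp add: dist_norm norm_minus_commute)
      next
        case False
        with *[of s r] r s show ?thesis by (simp add: dist_norm)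
      qed
    qed
  qed
qed

text \<open>For r on either side of s, the difference quotient is \<open>S (min r s)\<close> applied
  to the quotient at 0 over the length \<open>\<bar>r - s\<bar>\<close>; joint continuity then
  treats both one-sided derivatives at once.\<close>

lemma c0_semigroup_generator_derivative:
  fixes S :: "real \<Rightarrow> 'b \<Rightarrow> 'b::{complex_vector, banach}"
  assumes S: "c0_semigroup S" and gen: "(x, z) \<in> generator S" and s: "s \<ge> 0"
  shows "((\<lambda>t. S t x) has_vector_derivative S s z) (at s within {0..})"
    and "(S s x, S s z) \<in> generator S"
proof -
  have bl: "\<And>t. t \<ge> 0 \<Longrightarrow> bounded_linear (S t)" and S0: "\<And>x. S 0 x = x"
    and law: "\<And>s t x. s \<ge> 0 \<Longrightarrow> t \<ge> 0 \<Longrightarrow> S (s + t) x = S s (S t x)"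
    using S by (auto simp: c0_semigroup_def)
  have ln: "linear (S t)" if "t \<ge> 0" for t using bl[OF that] by (simp add: bounded_linear.linear)
  have g: "((\<lambda>h. (S h x - x) /\<^sub>R h) \<longlongrightarrow> z) (at_right 0)"
    using gen by (simp add: generator_def)
  have "((\<lambda>h. (S h (S s x) - S s x) /\<^sub>R h) \<longlongrightarrow> S s z) (at_right 0)"
  proof -
    have "((\<lambda>h. S s ((S h x - x) /\<^sub>R h)) \<longlongrightarrow> S s z) (at_right 0)"
      by (rule bounded_linear.tendsto[OF bl[OF s] g])
    moreover have "\<forall>\<^sub>F h in at_right 0. S s ((S h x - x) /\<^sub>R h) = (S h (S s x) - S s x) /\<^sub>R h"
      unfolding eventually_at_filter
    proof (intro always_eventually allI impI)
      fix h :: real assume "h \<noteq> 0" "h \<in> {0<..}"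
      then have "S s (S h x) = S h (S s x)"
        using law[of s h x] law[of h s x] s by (simp add: add.commute)
      then show "S s ((S h x - x) /\<^sub>R h) = (S h (S s x) - S s x) /\<^sub>R h"
        by (simp add: linear_scale[OF ln[OF s]] linear_diff[OF ln[OF s]])
    qed
    ultimately show ?thesis
      by (rule Lim_transform_eventually)
  qed
  then show "(S s x, S s z) \<in> generator S"
    by (simp add: generator_def)
  obtain K where K: "K \<ge> 1" "\<And>t x. 0 \<le> t \<Longrightarrow> t \<le> s + 1 \<Longrightarrow> norm (S t x) \<le> K * norm x"
    using c0_semigroup_locally_bounded[OF S] by blast
  define q where "q h = (if h = 0 then z else (S h x - x) /\<^sub>R h)" for h
  have q: "(q \<longlongrightarrow> z) (at 0 within {0..})"
    unfolding at_within_Ici_at_right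
    using g by (rule Lim_transform_eventually) (auto simp: q_def eventually_at_filter)
  show "((\<lambda>t. S t x) has_vector_derivative S s z) (at s within {0..})"
    unfolding has_vector_derivative_iff_quotient
  proof (rule Lim_transform_eventually)
    show "((\<lambda>r. S (min r s) (q \<bar>r - s\<bar>)) \<longlongrightarrow> S s z) (at s within {0..})"
    proof (rule c0_semigroup_jointly_continuous[where X = "{0..s+1}" and K = K and S = S
          and \<sigma> = "\<lambda>r. min r s" and x = z and g = "\<lambda>r. q \<bar>r - s\<bar>"])
      show "linear (S t)" if "t \<in> {0..s+1}" for t using that ln by auto
      show "\<forall>\<^sub>F r in at s within {0..}. min r s \<in> {0..s+1}"
        unfolding eventually_at_filter by (rule always_eventually) (use s in auto)
      have c: "continuous_on {0..} (\<lambda>r. S (min r s) z)"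
        by (rule continuous_on_compose2[OF c0_semigroup_continuous_on[OF S, of z]]) (use s in \<open>auto intro!: continuous_intros\<close>)
      from this[unfolded continuous_on, rule_format, of s] s
      show "((\<lambda>r. S (min r s) z) \<longlongrightarrow> S s z) (at s within {0..})" by simp
      show "((\<lambda>r. q \<bar>r - s\<bar>) \<longlongrightarrow> z) (at s within {0..})"
      proof (rule filterlim_compose[OF q])
        show "filterlim (\<lambda>r. \<bar>r - s\<bar>) (at 0 within {0..}) (at s within {0..})"
          unfolding filterlim_at
        proof (intro conjI)
          show "((\<lambda>r. \<bar>r - s\<bar>) \<longlongrightarrow> 0) (at s within {0..})"
            by (rule tendsto_eq_intros refl)+ simp
        qed (use always_eventually in \<open>auto simp: eventually_at_filter\<close>)
      qed
    qed (use K in auto)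
    show "\<forall>\<^sub>F r in at s within {0..}. S (min r s) (q \<bar>r - s\<bar>) = (S r x - S s x) /\<^sub>R (r - s)"
      unfolding eventually_at_filter
    proof (intro always_eventually allI impI)
      fix r :: real assume r: "r \<noteq> s" "r \<in> {0..}"
      show "S (min r s) (q \<bar>r - s\<bar>) = (S r x - S s x) /\<^sub>R (r - s)"
      proof (cases "r < s")
        case True
        have "S r (q (s - r)) = (S s x - S r x) /\<^sub>R (s - r)"
          using law[of r "s - r" x] r True
          by (simp add: q_def linear_scale[OF ln] linear_diff[OF ln])
        also have "\<dots> = (S r x - S s x) /\<^sub>R (r - s)"
        proof -
          have "inverse (s - r) = - inverse (r - s)" by (metis inverse_minus_eq minus_diff_eq)
          then show ?thesis by (metis minus_diff_eq scaleR_minus_left scaleR_minus_right)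
        qed
        finally show ?thesis using True by simp
      next
        case False
        then show ?thesis
          using law[of s "r - s" x] r s
          by (simp add: q_def linear_scale[OF ln] linear_diff[OF ln])
      qed
    qed
  qed
qed

section \<open>The Hille--Yosida theorem and analyticity\<close>

text \<open>Generators with bounded inverse: the operator is \<open>A = B\<^sup>-\<^sup>1\<close> and \<open>J h\<close> is its resolvent
  \<open>(1 + h A)\<^sup>-\<^sup>1\<close>.\<close>

locale hille_yosida =
  fixes B :: "'b::{complex_vector, banach} \<Rightarrow> 'b" and J :: "real \<Rightarrow> 'b \<Rightarrow> 'b" and M :: real
  assumes B_clinear: "clinear B" and B_bl: "bounded_linear B" and B_inj: "inj B"
    and B_dense: "closure (range B) = UNIV"
    and scaleC_bl: "\<And>c. bounded_linear (\<lambda>x::'b. c *\<^sub>C x)"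
    and J_clinear: "h > 0 \<Longrightarrow> clinear (J h)"
    and J_resolvent: "h > 0 \<Longrightarrow> J h (B x + h *\<^sub>R x) = B x"
    and resolvent_surj: "h > 0 \<Longrightarrow> \<exists>x. z = B x + h *\<^sub>R x"
    and power_bound: "h > 0 \<Longrightarrow> norm ((J h ^^ n) x) \<le> M * norm x"
    and M_ge_1: "M \<ge> 1"
begin

section \<open>Algebra and uniform estimates of the resolvent\<close>

lemma B_linear: "linear B"
  by (rule clinear_linear[OF B_clinear])

lemma J_linear: "h > 0 \<Longrightarrow> linear (J h)"
  by (rule clinear_linear[OF J_clinear])

lemma J_bound: "h > 0 \<Longrightarrow> norm (J h x) \<le> M * norm x"
  using power_bound[of h 1 x] by simp

lemma J_bl: "h > 0 \<Longrightarrow> bounded_linear (J h)"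
  by (rule bounded_linear_intro[where K = M])
    (simp_all add: linear_add[OF J_linear] linear_scale[OF J_linear] J_bound mult.commute[of _ M])

text \<open>The identity 1 - J h = h J h A on the domain of A, expressed through the inverse
  \<open>B\<close>: on the range of \<open>B\<close> the resolvent differs from the identity by a
  term of order h.\<close>

lemma J_B: "h > 0 \<Longrightarrow> J h (B x) = B x - h *\<^sub>R J h x"
  using J_resolvent[of h x] by (simp add: linear_add[OF J_linear] linear_scale[OF J_linear] algebra_simps)

lemma B_J: assumes h: "h > 0" shows "B (J h y) = J h (B y)"
proof -
  obtain x where x: "y = B x + h *\<^sub>R x" using resolvent_surj[OF h] by blast
  have "J h (B y) = J h (B (B x) + h *\<^sub>R B x)"
    by (simp add: x linear_add[OF B_linear] linear_scale[OF B_linear])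
  also have "\<dots> = B (J h y)" using h by (simp add: J_resolvent x)
  finally show ?thesis by simp
qed

text \<open>Writing y as (B + k)(B + h) w reduces both orders of composition to
  \<open>B (B w)\<close>.\<close>

lemma J_commute: assumes h: "h > 0" and k: "k > 0" shows "J h (J k y) = J k (J h y)"
proof -
  obtain x where x: "y = B x + h *\<^sub>R x" using resolvent_surj[OF h] by blast
  obtain w where w: "x = B w + k *\<^sub>R w" using resolvent_surj[OF k] by blast
  have y: "y = B (B w + h *\<^sub>R w) + k *\<^sub>R (B w + h *\<^sub>R w)"
    by (simp add: x w linear_add[OF B_linear] linear_scale[OF B_linear] algebra_simps)
  have "J h y = B (B w + k *\<^sub>R w)" unfolding x J_resolvent[OF h] by (simp add: w)
  moreover have "J k y = B (B w + h *\<^sub>R w)" unfolding y J_resolvent[OF k] ..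
  ultimately have "J h y = B (B w) + k *\<^sub>R B w" "J k y = B (B w) + h *\<^sub>R B w"
    by (simp_all add: linear_add[OF B_linear] linear_scale[OF B_linear])
  then show ?thesis by (simp add: J_resolvent h k)
qed

lemma J_pow_clinear: "h > 0 \<Longrightarrow> clinear (J h ^^ n)"
  by (induction n) (use J_clinear in \<open>auto simp: clinear_def\<close>)

lemma J_pow_linear: "h > 0 \<Longrightarrow> linear (J h ^^ n)"
  by (rule clinear_linear[OF J_pow_clinear])

lemma B_J_pow: "h > 0 \<Longrightarrow> B ((J h ^^ n) x) = (J h ^^ n) (B x)"
  by (induction n) (simp_all add: B_J)

lemma J_pow_commute: "h > 0 \<Longrightarrow> k > 0 \<Longrightarrow> J k ((J h ^^ n) x) = (J h ^^ n) (J k x)"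
  by (induction n) (simp_all add: J_commute)

lemma J_pow_B_Suc: "h > 0 \<Longrightarrow> (J h ^^ Suc n) (B w) = (J h ^^ n) (B w) - h *\<^sub>R (J h ^^ Suc n) w"
  by (simp add: funpow_swap1 J_B linear_diff[OF J_pow_linear] linear_scale[OF J_pow_linear])

lemma J_pow_B_diff: "h > 0 \<Longrightarrow> norm ((J h ^^ n) (B w) - B w) \<le> n * h * (M * norm w)"
proof (induction n)
  case (Suc n)
  have "(J h ^^ Suc n) (B w) - B w = ((J h ^^ n) (B w) - B w) - h *\<^sub>R (J h ^^ Suc n) w"
    by (simp add: J_pow_B_Suc[OF Suc.prems] del: funpow.simps)
  also have "norm \<dots> \<le> norm ((J h ^^ n) (B w) - B w) + h * norm ((J h ^^ Suc n) w)"
    using Suc.prems by (metis abs_of_pos norm_scaleR norm_triangle_ineq4)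
  also have "\<dots> \<le> n * h * (M * norm w) + h * (M * norm w)"
    using Suc.prems by (intro add_mono Suc.IH mult_left_mono power_bound) auto
  finally show ?case by (simp add: algebra_simps)
qed simp

text \<open>On the range of \<open>B\<close> the deviation is at most linear in n h; density and the
  power bound extend this smallness to every x, uniformly over all n and h with n h small.\<close>

lemma J_pow_equicontinuous:
  assumes e: "\<epsilon> > 0"
  obtains \<delta> where "\<delta> > 0" "\<And>h n. h > 0 \<Longrightarrow> real n * h \<le> \<delta> \<Longrightarrow> norm ((J h ^^ n) x - x) \<le> \<epsilon>"
proof -
  have "x \<in> closure (range B)" by (simp add: B_dense)
  moreover have "\<epsilon> / (3 * M) > 0" using e M_ge_1 by simp
  ultimately obtain w where w: "norm (B w - x) < \<epsilon> / (3 * M)"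
    unfolding closure_approachable dist_norm by blast
  then have "M * norm (B w - x) < M * (\<epsilon> / (3 * M))" using M_ge_1 by (intro mult_strict_left_mono) auto
  then have w1: "M * norm (B w - x) < \<epsilon> / 3" using M_ge_1 by simp
  have "1 * norm (B w - x) \<le> M * norm (B w - x)" using M_ge_1 by (intro mult_right_mono) auto
  then have w2: "norm (B w - x) < \<epsilon> / 3" using w1 by linarith
  define \<delta> where "\<delta> = \<epsilon> / (3 * (M * norm w + 1))"
  have p: "M * norm w + 1 > 0" using M_ge_1 by (simp add: add_nonneg_pos)
  have d: "\<delta> > 0" using e p by (simp add: \<delta>_def)
  have "norm ((J h ^^ n) x - x) \<le> \<epsilon>" if h: "h > 0" "real n * h \<le> \<delta>" for h n
  proof -
    have "(J h ^^ n) x - x = ((J h ^^ n) (B w) - B w) - (J h ^^ n) (B w - x) + (B w - x)"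
      by (simp add: linear_diff[OF J_pow_linear[OF h(1)]])
    also have "norm \<dots> \<le> norm ((J h ^^ n) (B w) - B w) + norm ((J h ^^ n) (B w - x)) + norm (B w - x)"
      by (meson add_mono norm_triangle_ineq norm_triangle_ineq4 order_refl order_trans)
    also have "\<dots> \<le> \<epsilon> / 3 + \<epsilon> / 3 + \<epsilon> / 3"
    proof (intro add_mono)
      have "norm ((J h ^^ n) (B w) - B w) \<le> n * h * (M * norm w)" by (rule J_pow_B_diff[OF h(1)])
      also have "\<dots> \<le> \<delta> * (M * norm w + 1)"
        using h M_ge_1 d by (intro mult_mono) auto
      also have "\<dots> = \<epsilon> / 3" using p by (simp add: \<delta>_def field_simps)
      finally show "norm ((J h ^^ n) (B w) - B w) \<le> \<epsilon> / 3" .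
      show "norm ((J h ^^ n) (B w - x)) \<le> \<epsilon> / 3"
        using power_bound[OF h(1), of n "B w - x"] w1 by linarith
    qed (use w2 in simp)
    finally show ?thesis by simp
  qed
  with d show thesis using that by blast
qed

text \<open>Telescoping writes the increment as -h times a sum of powers applied to w, each within
  \<epsilon> of w. The estimate precedes any limit, so it survives the limit and there identifies
  the generator.\<close>

lemma J_pow_derivative:
  assumes h: "h > 0" and w: "\<And>k. k \<le> n \<Longrightarrow> norm ((J h ^^ k) w - w) \<le> \<epsilon>"
  shows "norm ((J h ^^ n) (B w) - B w + (n * h) *\<^sub>R w) \<le> n * h * \<epsilon>"
  using w
proof (induction n)
  case (Suc n)
  have "(J h ^^ Suc n) (B w) - B w + (Suc n * h) *\<^sub>R w =
      ((J h ^^ n) (B w) - B w + (n * h) *\<^sub>R w) - h *\<^sub>R ((J h ^^ Suc n) w - w)"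
    by (simp add: J_pow_B_Suc[OF h] algebra_simps del: funpow.simps)
  also have "norm \<dots> \<le> norm ((J h ^^ n) (B w) - B w + (n * h) *\<^sub>R w) + h * norm ((J h ^^ Suc n) w - w)"
    using h by (metis abs_of_pos norm_scaleR norm_triangle_ineq4)
  also have "\<dots> \<le> n * h * \<epsilon> + h * \<epsilon>"
    using h by (intro add_mono Suc.IH mult_left_mono Suc.prems) auto
  finally show ?case by (simp add: algebra_simps)
qed simp

section \<open>The semigroup as the limit of dyadic Euler schemes\<close>

definition steps :: "nat \<Rightarrow> real \<Rightarrow> nat" where "steps m t = nat \<lfloor>t * 2 ^ m\<rfloor>"
text \<open>With step size \<open>1 / 2 ^ m\<close> every level halves the steps of the previous
  one, so that consecutive approximations can be compared; the last incomplete step is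
  dropped.\<close>

definition E :: "nat \<Rightarrow> real \<Rightarrow> 'b \<Rightarrow> 'b" where "E m t = J (1 / 2 ^ m) ^^ steps m t"
definition S :: "real \<Rightarrow> 'b \<Rightarrow> 'b" where "S t x = lim (\<lambda>m. E m t x)"

lemma steps_le: "t \<ge> 0 \<Longrightarrow> steps m t / 2 ^ m \<le> t"
  by (simp add: steps_def pos_divide_le_eq)

lemma steps_ge: "t \<ge> 0 \<Longrightarrow> t - 1 / 2 ^ m \<le> steps m t / 2 ^ m"
proof -
  assume "t \<ge> 0"
  then have "t * 2 ^ m - 1 \<le> steps m t" unfolding steps_def by (simp add: algebra_simps) linarith
  then have "(t * 2 ^ m - 1) / 2 ^ m \<le> steps m t / 2 ^ m" by (rule divide_right_mono) simp
  then show ?thesis by (simp add: diff_divide_distrib)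
qed

lemma steps_tendsto: assumes t: "t \<ge> 0" shows "(\<lambda>m. steps m t / 2 ^ m) \<longlonglongrightarrow> t"
proof (rule tendsto_sandwich[of "\<lambda>m. t - (1/2) ^ m" _ _ "\<lambda>_. t"])
  have "(\<lambda>m. t - (1/2) ^ m) \<longlonglongrightarrow> t - 0" by (intro tendsto_intros LIMSEQ_realpow_zero) auto
  then show "(\<lambda>m. t - (1/2) ^ m) \<longlonglongrightarrow> t" by simp
qed (use steps_le[OF t] steps_ge[OF t] in \<open>auto simp: power_one_over intro!: always_eventually\<close>)

lemma E_linear: "linear (E m t)"
  unfolding E_def by (rule J_pow_linear) simp

lemma E_bound: "norm (E m t x) \<le> M * norm x"
  unfolding E_def by (rule power_bound) simp

text \<open>One step of size h against two of half the size: on vectors \<open>B (B w)\<close> the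
  expansions agree to first order, and the second-order remainders add up with the weights 2 + 1 + 4
  = 7.\<close>

lemma J_twice_minus_J:
  assumes h: "h > 0"
  shows "norm (J (h/2) (J (h/2) (B (B w))) - J h (B (B w))) \<le> 7 * M ^ 2 * (h/2)\<^sup>2 * norm w"
proof -
  define k where "k = h / 2"
  have k: "k > 0" using h by (simp add: k_def)
  have JB2: "J k (B (B w)) = B (B w) - k *\<^sub>R B w + (k * k) *\<^sub>R J k w" if "k > 0" for k
    using that by (simp add: J_B algebra_simps)
  have "J k (J k (B (B w))) = J k (B (B w)) - k *\<^sub>R J k (B w) + (k * k) *\<^sub>R J k (J k w)"
    by (simp add: JB2 k linear_add[OF J_linear] linear_diff[OF J_linear] linear_scale[OF J_linear])
  also have "\<dots> = B (B w) - (k *\<^sub>R B w + k *\<^sub>R B w) + ((k * k) *\<^sub>R J k w + (k * k) *\<^sub>R J k w) + (k * k) *\<^sub>R J k (J k w)"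
    by (simp add: JB2 k J_B scaleR_diff_right)
  finally have "J k (J k (B (B w))) = \<dots>" .
  moreover have "h *\<^sub>R B w = k *\<^sub>R B w + k *\<^sub>R B w" "(h * h) *\<^sub>R J h w = (k * k) *\<^sub>R (4 *\<^sub>R J h w)"
    by (simp_all add: k_def flip: scaleR_add_left)
  ultimately have "J k (J k (B (B w))) - J h (B (B w)) = (k * k) *\<^sub>R (2 *\<^sub>R J k w + J k (J k w) - 4 *\<^sub>R J h w)"
    by (simp add: JB2 h scaleR_add_right scaleR_diff_right scaleR_2 del: scaleR_scaleR)
  also have "norm \<dots> = k\<^sup>2 * norm (2 *\<^sub>R J k w + J k (J k w) - 4 *\<^sub>R J h w)"
    by (simp add: power2_eq_square)
  also have "\<dots> \<le> k\<^sup>2 * (7 * M ^ 2 * norm w)"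
  proof (rule mult_left_mono)
    have "norm (2 *\<^sub>R J k w + J k (J k w) - 4 *\<^sub>R J h w) \<le> 2 * norm (J k w) + norm (J k (J k w)) + 4 * norm (J h w)"
      by (rule order_trans[OF norm_triangle_ineq4] add_mono order_trans[OF norm_triangle_ineq])+ auto
    also have "\<dots> \<le> 2 * (M * norm w) + M * norm w + 4 * (M * norm w)"
      using k h J_bound[OF k] J_bound[OF h] power_bound[OF k, of 2 w] by (intro add_mono) (auto simp: numeral_2_eq_2)
    also have "\<dots> = 7 * M * norm w" by simp
    also have "\<dots> \<le> 7 * M ^ 2 * norm w"
      using M_ge_1 self_le_power[of M 2] by (intro mult_right_mono mult_left_mono) auto
    finally show "norm (2 *\<^sub>R J k w + J k (J k w) - 4 *\<^sub>R J h w) \<le> 7 * M ^ 2 * norm w" .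
  qed simp
  finally show ?thesis by (simp add: k_def mult_ac)
qed

text \<open>The local errors of n steps telescope. The prefix \<open>J h ^^ l\<close> collects all
  later full steps into one power, so that each error costs the factor M twice and not a power of M
  that grows with n.\<close>

lemma J_pow_refine:
  assumes h: "h > 0"
  shows "norm ((J h ^^ l) ((J (h/2) ^^ (2 * n)) x - (J h ^^ n) x)) \<le>
    n * (M\<^sup>2 * norm (J (h/2) (J (h/2) x) - J h x))"
proof (induction n arbitrary: l)
  case (Suc n)
  define d where "d = J (h/2) (J (h/2) x) - J h x"
  have k: "h/2 > 0" using h by simp
  have "(J (h/2) ^^ (2 * Suc n)) x = (J (h/2) ^^ (2 * n)) (J (h/2) (J (h/2) x))"
    by (simp add: funpow_swap1)
  then have "(J (h/2) ^^ (2 * Suc n)) x - (J h ^^ Suc n) x =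
      (J (h/2) ^^ (2 * n)) d + J h ((J (h/2) ^^ (2 * n)) x - (J h ^^ n) x)"
    by (simp add: d_def linear_diff[OF J_pow_linear[OF k]] linear_diff[OF J_linear[OF h]] J_pow_commute[OF k h])
  then have "(J h ^^ l) ((J (h/2) ^^ (2 * Suc n)) x - (J h ^^ Suc n) x) =
      (J h ^^ l) ((J (h/2) ^^ (2 * n)) d) + (J h ^^ Suc l) ((J (h/2) ^^ (2 * n)) x - (J h ^^ n) x)"
    by (simp add: linear_add[OF J_pow_linear[OF h]] funpow_swap1)
  also have "norm \<dots> \<le> M * (M * norm d) + n * (M\<^sup>2 * norm d)"
  proof (rule order_trans[OF norm_triangle_ineq], rule add_mono)
    show "norm ((J h ^^ l) ((J (h/2) ^^ (2 * n)) d)) \<le> M * (M * norm d)"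
      using M_ge_1 by (intro order_trans[OF power_bound[OF h]] mult_left_mono power_bound[OF k]) auto
    show "norm ((J h ^^ Suc l) ((J (h/2) ^^ (2 * n)) x - (J h ^^ n) x)) \<le> n * (M\<^sup>2 * norm d)"
      unfolding d_def by (rule Suc.IH)
  qed
  finally show ?case unfolding d_def by (simp add: power2_eq_square algebra_simps)
qed (use linear_0[OF J_pow_linear[OF h]] in simp)

text \<open>The n local errors of order h^2 add up to order t h, and rounding at the finer level
  contributes at most one step of size h/2.\<close>

lemma E_refine:
  assumes t: "t \<ge> 0"
  shows "norm (E (Suc m) t (B (B w)) - E m t (B (B w))) \<le> (7 * M ^ 4 * t * norm w + M\<^sup>2 * norm (B w)) * (1/2) ^ m"
proof -
  define h :: real where "h = 1 / 2 ^ m"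
  define n where "n = steps m t"
  define x where "x = B (B w)"
  have h: "h > 0" and k: "h / 2 > 0" by (simp_all add: h_def)
  have hn: "n * h \<le> t" using steps_le[OF t, of m] by (simp add: n_def h_def)
  \<comment> \<open>Refinement doubles the number of steps, with one more when the fractional part
    is at least one half.\<close>
  have "\<lfloor>2 * (t * 2 ^ m)\<rfloor> = 2 * \<lfloor>t * 2 ^ m\<rfloor> \<or> \<lfloor>2 * (t * 2 ^ m)\<rfloor> = 2 * \<lfloor>t * 2 ^ m\<rfloor> + 1" by linarith
  then have "steps (Suc m) t = 2 * n \<or> steps (Suc m) t = 2 * n + 1"
    using t unfolding n_def steps_def by (auto simp: mult_ac nat_add_distrib nat_mult_distrib)
  moreover have "norm ((J (h/2) ^^ (2 * n + 1)) x - (J (h/2) ^^ (2 * n)) x) \<le> M\<^sup>2 * norm (B w) * h"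
  proof -
    have "(J (h/2) ^^ (2 * n + 1)) x - (J (h/2) ^^ (2 * n)) x = - (h/2) *\<^sub>R (J (h/2) ^^ (Suc (2 * n))) (B w)"
      using J_pow_B_Suc[OF k, of "2 * n" "B w"] by (simp add: x_def)
    also have "norm \<dots> \<le> (h/2) * (M * norm (B w))"
      using k power_bound[OF k, of "Suc (2*n)" "B w"] h by (simp del: funpow.simps)
    also have "\<dots> \<le> h * (M\<^sup>2 * norm (B w))"
      using h M_ge_1 self_le_power[of M 2] by (intro mult_mono) auto
    finally show ?thesis by (simp add: mult_ac)
  qed
  moreover have "M\<^sup>2 * norm (B w) * h \<ge> 0" using h by simp
  ultimately have "norm ((J (h/2) ^^ steps (Suc m) t) x - (J (h/2) ^^ (2 * n)) x) \<le> M\<^sup>2 * norm (B w) * h"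
    by (metis cancel_comm_monoid_add_class.diff_cancel norm_zero)
  moreover have "norm ((J (h/2) ^^ (2 * n)) x - (J h ^^ n) x) \<le> 7 * M ^ 4 * t * norm w * h"
  proof -
    have "norm ((J (h/2) ^^ (2 * n)) x - (J h ^^ n) x) \<le> n * (M\<^sup>2 * norm (J (h/2) (J (h/2) x) - J h x))"
      using J_pow_refine[OF h, of 0] by simp
    also have "\<dots> \<le> n * (M\<^sup>2 * (7 * M\<^sup>2 * (h/2)\<^sup>2 * norm w))"
      unfolding x_def by (intro mult_left_mono J_twice_minus_J[OF h]) auto
    also have "\<dots> = (n * h) * (7 * M ^ 4 * norm w * h / 4)"
      by (simp add: power2_eq_square power4_eq_xxxx)
    also have "\<dots> \<le> t * (7 * M ^ 4 * norm w * h)"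
      using t h M_ge_1 by (intro mult_mono hn) auto
    finally show ?thesis by (simp add: mult_ac)
  qed
  moreover have "E (Suc m) t (B (B w)) - E m t (B (B w)) =
      ((J (h/2) ^^ steps (Suc m) t) x - (J (h/2) ^^ (2 * n)) x) + ((J (h/2) ^^ (2 * n)) x - (J h ^^ n) x)"
    by (simp add: E_def h_def n_def x_def mult.commute)
  ultimately have "norm (E (Suc m) t (B (B w)) - E m t (B (B w))) \<le> M\<^sup>2 * norm (B w) * h + 7 * M ^ 4 * t * norm w * h"
    by (metis add_mono norm_triangle_mono)
  then show ?thesis by (simp add: h_def power_one_over algebra_simps)
qed

lemma B_B_dense: "closure (range (\<lambda>w. B (B w))) = UNIV"
proof -
  have "B x \<in> closure (range (\<lambda>w. B (B w)))" for x
    by (rule bounded_linear_closure_mem[OF B_bl, of "range B"]) (auto simp: B_dense)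
  then have "range B \<subseteq> closure (range (\<lambda>w. B (B w)))" by blast
  then have "closure (range B) \<subseteq> closure (range (\<lambda>w. B (B w)))" by (simp add: closure_minimal)
  then show ?thesis by (auto simp: B_dense)
qed

text \<open>The second-order error bound holds on vectors \<open>B (B w)\<close>; these are dense,
  and the approximations are uniformly bounded.\<close>

lemma S_lim: assumes t: "t \<ge> 0" shows "(\<lambda>m. E m t x) \<longlonglongrightarrow> S t x"
proof -
  have "convergent (\<lambda>m. E m t x)"
    by (rule convergent_on_dense[OF E_linear E_bound B_B_dense])
      (auto intro: convergent_geometric E_refine[OF t])
  then show ?thesis unfolding S_def by (simp add: convergent_LIMSEQ_iff)
qed

lemma S_bound: assumes t: "t \<ge> 0" shows "norm (S t x) \<le> M * norm x"
  by (rule LIMSEQ_le_const2[OF tendsto_norm[OF S_lim[OF t]]]) (use E_bound in auto)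

lemma S_clinear: assumes t: "t \<ge> 0" shows "clinear (S t)"
  unfolding clinear_def
proof safe
  fix x y c
  have "(\<lambda>m. E m t (x + y)) \<longlonglongrightarrow> S t x + S t y"
    using tendsto_add[OF S_lim[OF t, of x] S_lim[OF t, of y]] by (simp add: linear_add[OF E_linear])
  then show "S t (x + y) = S t x + S t y" by (rule LIMSEQ_unique[OF S_lim[OF t]])
  have "(\<lambda>m. c *\<^sub>C E m t x) \<longlonglongrightarrow> c *\<^sub>C S t x"
    by (rule bounded_linear.tendsto[OF scaleC_bl S_lim[OF t]])
  moreover have "c *\<^sub>C E m t x = E m t (c *\<^sub>C x)" for m
    unfolding E_def by (rule clinear_scaleC[OF J_pow_clinear, symmetric]) simp
  ultimately show "S t (c *\<^sub>C x) = c *\<^sub>C S t x" using LIMSEQ_unique[OF S_lim[OF t]] by simp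
qed

lemma S_linear: "t \<ge> 0 \<Longrightarrow> linear (S t)"
  by (rule clinear_linear[OF S_clinear])

lemma S_bl: "t \<ge> 0 \<Longrightarrow> bounded_linear (S t)"
  by (rule bounded_linear_intro[where K = M])
    (simp_all add: linear_add[OF S_linear] linear_scale[OF S_linear] S_bound mult.commute[of _ M])

lemma S_zero: "S 0 x = x"
  using S_lim[of 0 x] by (simp add: E_def steps_def LIMSEQ_const_iff)

lemma S_commute:
  assumes t: "t \<ge> 0" and F: "bounded_linear F" and c: "\<And>m n x. F ((J (1 / 2 ^ m) ^^ n) x) = (J (1 / 2 ^ m) ^^ n) (F x)"
  shows "F (S t x) = S t (F x)"
proof (rule LIMSEQ_unique)
  show "(\<lambda>m. F (E m t x)) \<longlonglongrightarrow> F (S t x)" by (rule bounded_linear.tendsto[OF F S_lim[OF t]])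
  show "(\<lambda>m. F (E m t x)) \<longlonglongrightarrow> S t (F x)" using S_lim[OF t, of "F x"] by (simp add: E_def c)
qed

lemma B_S: "t \<ge> 0 \<Longrightarrow> B (S t x) = S t (B x)"
  by (rule S_commute[OF _ B_bl]) (simp_all add: B_J_pow)

lemma J_S: "t \<ge> 0 \<Longrightarrow> h > 0 \<Longrightarrow> J h (S t x) = S t (J h x)"
  by (rule S_commute[OF _ J_bl]) (simp_all add: J_pow_commute)

text \<open>Rounding s and t separately loses at most one step against rounding s + t, and on the
  range of \<open>B\<close> one step is of order 2^-m; density gives all vectors.\<close>

lemma S_add:
  assumes s: "s \<ge> 0" and t: "t \<ge> 0"
  shows "S (s + t) x = S s (S t x)"
proof -
  have "S (s + t) (B w) = S s (S t (B w))" for w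
  proof -
    have "(\<lambda>m. E m s (E m t (B w))) \<longlonglongrightarrow> S s (S t (B w))"
    proof -
      have "(\<lambda>m. E m s (E m t (B w) - S t (B w))) \<longlonglongrightarrow> 0"
      proof (rule Lim_null_comparison)
        show "\<forall>\<^sub>F m in sequentially. norm (E m s (E m t (B w) - S t (B w))) \<le> M * norm (E m t (B w) - S t (B w))"
          by (simp add: E_bound)
        have "(\<lambda>m. M * norm (E m t (B w) - S t (B w))) \<longlonglongrightarrow> M * norm (S t (B w) - S t (B w))"
          by (intro tendsto_intros S_lim[OF t])
        then show "(\<lambda>m. M * norm (E m t (B w) - S t (B w))) \<longlonglongrightarrow> 0" by simp
      qed
      from tendsto_add[OF this S_lim[OF s, of "S t (B w)"]] show ?thesis
        by (simp add: linear_diff[OF E_linear])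
    qed
    moreover have "(\<lambda>m. E m (s + t) (B w) - E m s (E m t (B w))) \<longlonglongrightarrow> 0"
    proof (rule Lim_null_comparison)
      have "norm (E m (s + t) (B w) - E m s (E m t (B w))) \<le> M * norm w * (1/2) ^ m" for m
      proof -
        define n where "n = steps m s + steps m t"
        define h :: real where "h = 1 / 2 ^ m"
        have h: "h > 0" by (simp add: h_def)
        have "\<lfloor>(s + t) * 2 ^ m\<rfloor> = \<lfloor>s * 2 ^ m\<rfloor> + \<lfloor>t * 2 ^ m\<rfloor> \<or> \<lfloor>(s + t) * 2 ^ m\<rfloor> = \<lfloor>s * 2 ^ m\<rfloor> + \<lfloor>t * 2 ^ m\<rfloor> + 1"
          by (simp add: distrib_right) linarith
        then have "steps m (s + t) = n \<or> steps m (s + t) = Suc n"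
          using s t unfolding n_def steps_def by (auto simp: nat_add_distrib)
        moreover have "E m s (E m t (B w)) = (J h ^^ n) (B w)"
          by (simp add: E_def n_def h_def funpow_add)
        ultimately have "E m (s + t) (B w) - E m s (E m t (B w)) = 0 \<or>
            E m (s + t) (B w) - E m s (E m t (B w)) = - h *\<^sub>R (J h ^^ Suc n) w"
          using J_pow_B_Suc[OF h, of n w] by (auto simp: E_def h_def[symmetric] simp del: funpow.simps)
        moreover have "norm (- h *\<^sub>R (J h ^^ Suc n) w) \<le> h * (M * norm w)"
          using h power_bound[OF h, of "Suc n" w] by (simp del: funpow.simps)
        moreover have "h * (M * norm w) \<ge> 0" using h M_ge_1 by simp
        ultimately have "norm (E m (s + t) (B w) - E m s (E m t (B w))) \<le> h * (M * norm w)"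
          by (metis norm_zero)
        then show ?thesis by (simp add: h_def power_one_over)
      qed
      then show "\<forall>\<^sub>F m in sequentially. norm (E m (s + t) (B w) - E m s (E m t (B w))) \<le> M * norm w * (1/2) ^ m"
        by simp
      have "(\<lambda>m. M * norm w * (1/2) ^ m) \<longlonglongrightarrow> M * norm w * 0"
        by (intro tendsto_intros LIMSEQ_realpow_zero) auto
      then show "(\<lambda>m. M * norm w * (1/2) ^ m) \<longlonglongrightarrow> 0" by simp
    qed
    ultimately have "(\<lambda>m. E m (s + t) (B w)) \<longlonglongrightarrow> S s (S t (B w))"
      by (rule Lim_transform)
    then show ?thesis using S_lim[of "s + t" "B w"] s t by (simp add: LIMSEQ_unique)
  qed
  then show ?thesis
    using bounded_linear_eq_on_dense[OF S_bl bounded_linear_compose[OF S_bl S_bl] B_dense, of "s + t" s t x] s t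
    by auto
qed

text \<open>Both bounds are discrete estimates that hold uniformly in the step size, so they pass to
  the limit with the same \<delta>.\<close>

lemma S_continuous_at_0:
  assumes e: "\<epsilon> > 0"
  obtains \<delta> where "\<delta> > 0" "\<And>t. 0 \<le> t \<Longrightarrow> t \<le> \<delta> \<Longrightarrow> norm (S t x - x) \<le> \<epsilon>"
    "\<And>t. 0 \<le> t \<Longrightarrow> t \<le> \<delta> \<Longrightarrow> norm (S t (B x) - B x + t *\<^sub>R x) \<le> t * \<epsilon>"
proof -
  obtain \<delta> where d: "\<delta> > 0" and b: "\<And>h n. h > 0 \<Longrightarrow> real n * h \<le> \<delta> \<Longrightarrow> norm ((J h ^^ n) x - x) \<le> \<epsilon>"
    using J_pow_equicontinuous[OF e] by blast
  show thesis
  proof (rule that[OF d])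
    fix t :: real assume t: "0 \<le> t" "t \<le> \<delta>"
    have st: "real k * (1 / 2 ^ m) \<le> \<delta>" if "k \<le> steps m t" for k m
    proof -
      have "real k * (1 / 2 ^ m) \<le> steps m t / 2 ^ m" using that by (simp add: divide_right_mono)
      then show ?thesis using steps_le[OF t(1), of m] t(2) by linarith
    qed
    have "norm (E m t x - x) \<le> \<epsilon>" for m
      unfolding E_def by (rule b) (use st in auto)
    then show "norm (S t x - x) \<le> \<epsilon>"
      by (intro LIMSEQ_le_const2[OF tendsto_norm[OF tendsto_diff[OF S_lim[OF t(1)] tendsto_const]]]) auto
    have "norm (E m t (B x) - B x + (steps m t / 2 ^ m) *\<^sub>R x) \<le> steps m t / 2 ^ m * \<epsilon>" for m
      using J_pow_derivative[of "1 / 2 ^ m" "steps m t" x \<epsilon>] b st unfolding E_def by simp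
    then show "norm (S t (B x) - B x + t *\<^sub>R x) \<le> t * \<epsilon>"
      by (intro LIMSEQ_le[OF tendsto_norm[OF tendsto_add[OF tendsto_diff[OF S_lim[OF t(1)] tendsto_const]
              tendsto_scaleR[OF steps_tendsto[OF t(1)] tendsto_const]]]
            tendsto_mult[OF steps_tendsto[OF t(1)] tendsto_const]]) auto
  qed
qed

lemma c0_semigroup_S: "c0_semigroup S"
  unfolding c0_semigroup_def
proof (intro conjI allI impI)
  fix x
  show "((\<lambda>t. S t x) \<longlongrightarrow> x) (at_right 0)"
    unfolding tendsto_iff eventually_at_right_field
  proof (intro allI impI)
    fix e :: real assume "e > 0"
    then have "e / 2 > 0" by simp
    then obtain \<delta> where "\<delta> > 0" "\<And>t. 0 \<le> t \<Longrightarrow> t \<le> \<delta> \<Longrightarrow> norm (S t x - x) \<le> e / 2"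
      using S_continuous_at_0 by metis
    moreover have "e / 2 < e" using \<open>e > 0\<close> by simp
    ultimately show "\<exists>b>0. \<forall>y>0. y < b \<longrightarrow> dist (S y x) x < e"
      unfolding dist_norm by (meson less_imp_le order_le_less_trans)
  qed
qed (simp_all add: S_clinear S_bl S_zero S_add)

lemma generator_S: "generator S = {(B z, - z) | z. True}"
proof -
  have 1: "((\<lambda>h. (S h (B z) - B z) /\<^sub>R h) \<longlongrightarrow> - z) (at_right 0)" for z
    unfolding tendsto_iff eventually_at_right_field
  proof (intro allI impI)
    fix e :: real assume e: "e > 0"
    then have "e / 2 > 0" by simp
    then obtain \<delta> where d: "\<delta> > 0" "\<And>t. 0 \<le> t \<Longrightarrow> t \<le> \<delta> \<Longrightarrow> norm (S t (B z) - B z + t *\<^sub>R z) \<le> t * (e / 2)"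
      using S_continuous_at_0 by metis
    have "dist ((S h (B z) - B z) /\<^sub>R h) (- z) < e" if "h > 0" "h < \<delta>" for h
    proof -
      have "(S h (B z) - B z) /\<^sub>R h + z = (S h (B z) - B z + h *\<^sub>R z) /\<^sub>R h"
        using that by (simp add: scaleR_add_right)
      then have "norm ((S h (B z) - B z) /\<^sub>R h + z) \<le> inverse h * (h * (e / 2))"
        using that d(2)[of h] by simp
      also have "\<dots> = e / 2" using that by simp
      also have "\<dots> < e" using e by simp
      finally show ?thesis by (simp add: dist_norm)
    qed
    then show "\<exists>b>0. \<forall>h>0. h < b \<longrightarrow> dist ((S h (B z) - B z) /\<^sub>R h) (- z) < e"
      using d(1) by blast
  qed
  \<comment> \<open>Nothing else belongs to the generator: \<open>J 1\<close> commutes with the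
    semigroup and maps x into the range of \<open>B\<close>, where the derivative is known. The
    resolvent identity then recovers x as \<open>B (- y)\<close>.\<close>
  have 2: "\<exists>z. x = B z \<and> y = - z" if y: "((\<lambda>h. (S h x - x) /\<^sub>R h) \<longlongrightarrow> y) (at_right 0)" for x y
  proof -
    have p: "(1::real) > 0" by simp
    obtain u where u: "x = B u + 1 *\<^sub>R u" using resolvent_surj[OF p] by blast
    have "((\<lambda>h. J 1 ((S h x - x) /\<^sub>R h)) \<longlongrightarrow> J 1 y) (at_right 0)"
      by (rule bounded_linear.tendsto[OF J_bl[OF p] y])
    moreover have "\<forall>\<^sub>F h in at_right 0. J 1 ((S h x - x) /\<^sub>R h) = (S h (B u) - B u) /\<^sub>R h"
      unfolding eventually_at_filter
    proof (intro always_eventually allI impI)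
      fix h :: real assume "h \<noteq> 0" "h \<in> {0<..}"
      then have "J 1 (S h x) = S h (B u)" "J 1 x = B u"
        using J_resolvent[OF p, of u] by (simp_all add: J_S u)
      then show "J 1 ((S h x - x) /\<^sub>R h) = (S h (B u) - B u) /\<^sub>R h"
        by (simp add: linear_scale[OF J_linear] linear_diff[OF J_linear])
    qed
    ultimately have "((\<lambda>h. (S h (B u) - B u) /\<^sub>R h) \<longlongrightarrow> J 1 y) (at_right 0)"
      by (rule Lim_transform_eventually)
    then have "J 1 y = - u"
      by (rule tendsto_unique[OF _ _ 1, rotated]) simp
    then have u': "u = J 1 (- y)" using linear_neg[OF J_linear[OF p]] by simp
    obtain v where v: "- y = B v + 1 *\<^sub>R v" using resolvent_surj[OF p] by blast
    have "u = B v" using u' J_resolvent[OF p, of v] v by simp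
    then have "x = B (- y)" using u v by (simp add: linear_add[OF B_linear])
    then show ?thesis by (intro exI[of _ "- y"]) simp
  qed
  show ?thesis
    unfolding generator_def using 1 2 by auto
qed

section \<open>Product rule, classical solutions and uniqueness\<close>

lemma S_continuous_on: "continuous_on {0..} (\<lambda>t. S t x)"
  by (rule c0_semigroup_continuous_on[OF c0_semigroup_S])

lemma S_tendsto:
  assumes "\<forall>\<^sub>F r in F. \<sigma> r \<ge> 0" "(\<sigma> \<longlongrightarrow> t) F" "t \<ge> 0" "(g \<longlongrightarrow> x) F"
  shows "((\<lambda>r. S (\<sigma> r) (g r)) \<longlongrightarrow> S t x) F"
proof (rule c0_semigroup_jointly_continuous[where X = "{0..}" and K = M and S = S and \<sigma> = \<sigma> and g = g, OF _ _ _ _ assms(4)])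
  show "((\<lambda>r. S (\<sigma> r) x) \<longlongrightarrow> S t x) F"
    by (rule continuous_on_tendsto_compose[OF S_continuous_on assms(2)]) (use assms in auto)
qed (use assms S_bound S_linear in auto)

lemma S_B_derivative:
  assumes "s \<ge> 0"
  shows "((\<lambda>t. S t (B z)) has_vector_derivative - S s z) (at s within {0..})"
proof -
  have "(B z, - z) \<in> generator S" by (auto simp: generator_S)
  from c0_semigroup_generator_derivative(1)[OF c0_semigroup_S this assms] show ?thesis
    using assms by (simp add: linear_neg[OF S_linear])
qed

text \<open>With q in the role of A y(s), this is the product rule. The quotient splits into
  \<open>S (t - r)\<close> acting on the quotient of y and the quotient of the orbit of the fixed
  vector \<open>B q\<close>.\<close>

lemma S_product_rule:
  assumes y: "(y has_vector_derivative y') (at s within X)" and q: "y s = B q"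
    and s: "s \<le> t" and X: "X \<subseteq> {..t}"
  shows "((\<lambda>r. S (t - r) (y r)) has_vector_derivative S (t - s) (y' + q)) (at s within X)"
proof -
  have y0: "((\<lambda>r. (y r - y s) /\<^sub>R (r - s)) \<longlongrightarrow> y') (at s within X)"
    using y by (simp add: has_vector_derivative_iff_quotient)
  have ev: "\<forall>\<^sub>F r in at s within X. t - r \<ge> 0"
    using X by (auto simp: eventually_at_filter intro!: always_eventually)
  have lim: "((\<lambda>r. t - r) \<longlongrightarrow> t - s) (at s within X)"
    by (intro tendsto_intros)
  have 1: "((\<lambda>r. S (t - r) ((y r - y s) /\<^sub>R (r - s))) \<longlongrightarrow> S (t - s) y') (at s within X)"
    by (rule S_tendsto[OF ev lim _ y0]) (use s in simp)
  have "((\<lambda>\<sigma>. (S \<sigma> (B q) - S (t - s) (B q)) /\<^sub>R (\<sigma> - (t - s))) \<longlongrightarrow> - S (t - s) q) (at (t - s) within {0..})"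
    using S_B_derivative[of "t - s" q] s by (simp add: has_vector_derivative_iff_quotient)
  moreover have "filterlim (\<lambda>r. t - r) (at (t - s) within {0..}) (at s within X)"
    unfolding filterlim_at using lim X by (auto simp: eventually_at_filter intro!: always_eventually)
  ultimately have "((\<lambda>r. (S (t - r) (B q) - S (t - s) (B q)) /\<^sub>R (t - r - (t - s))) \<longlongrightarrow> - S (t - s) q) (at s within X)"
    by (rule filterlim_compose)
  from tendsto_diff[OF 1 this] have
    "((\<lambda>r. S (t - r) ((y r - y s) /\<^sub>R (r - s)) - (S (t - r) (B q) - S (t - s) (B q)) /\<^sub>R (t - r - (t - s)))
      \<longlongrightarrow> S (t - s) (y' + q)) (at s within X)"
    using s by (simp add: linear_add[OF S_linear])
  then show ?thesis
    unfolding has_vector_derivative_iff_quotient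
  proof (rule Lim_transform_eventually)
    show "\<forall>\<^sub>F r in at s within X. S (t - r) ((y r - y s) /\<^sub>R (r - s)) - (S (t - r) (B q) - S (t - s) (B q)) /\<^sub>R (t - r - (t - s))
        = (S (t - r) (y r) - S (t - s) (y s)) /\<^sub>R (r - s)"
      unfolding eventually_at_filter
    proof (intro always_eventually allI impI)
      fix r assume r: "r \<noteq> s" "r \<in> X"
      then have ln: "linear (S (t - r))" using X by (intro S_linear) auto
      have "inverse (t - r - (t - s)) = - inverse (r - s)"
        by (metis diff_diff_eq2 add.commute add_diff_cancel_left inverse_minus_eq minus_diff_eq diff_add_cancel)
      then show "S (t - r) ((y r - y s) /\<^sub>R (r - s)) - (S (t - r) (B q) - S (t - s) (B q)) /\<^sub>R (t - r - (t - s))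
        = (S (t - r) (y r) - S (t - s) (y s)) /\<^sub>R (r - s)"
        by (simp add: linear_scale[OF ln] linear_diff[OF ln] q scaleR_diff_right)
    qed
  qed
qed

text \<open>The function \<open>S (t - r) (y r)\<close> of r has derivative 0, and its values at t
  and 0 are the two sides.\<close>

lemma classical_solution_eq:
  assumes t: "t \<ge> 0"
    and y: "\<And>s. s \<in> {0..t} \<Longrightarrow> (y has_vector_derivative - q s) (at s within {0..t})"
    and q: "\<And>s. s \<in> {0..t} \<Longrightarrow> y s = B (q s)"
  shows "y t = S t (y 0)"
proof -
  have "((\<lambda>r. S (t - r) (y r)) has_vector_derivative 0) (at s within {0..t})" if "s \<in> {0..t}" for s
    using S_product_rule[OF y[OF that] q[OF that], of t] that by (simp add: linear_0[OF S_linear])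
  then obtain c where "\<And>s. s \<in> {0..t} \<Longrightarrow> S (t - s) (y s) = c"
    using has_vector_derivative_zero_constant[of "{0..t}" "\<lambda>r. S (t - r) (y r)"] by auto
  from this[of 0] this[of t] t show ?thesis by (simp add: S_zero)
qed

text \<open>\<open>exp_neg\<close> is a choice. Any semigroup with this generator solves the Cauchy
  problem classically for initial values in the range of \<open>B\<close>, hence agrees with
  \<open>S\<close> there and, by density, everywhere.\<close>

lemma exp_neg_eq:
  assumes t: "t \<ge> 0"
  shows "exp_neg {(B z, z) | z. True} t x = S t x"
proof -
  define S' where "S' = exp_neg {(B z, z) | z. True}"
  have "\<exists>S. c0_semigroup S \<and> generator S = {(x, - y) | x y. (x, y) \<in> {(B z, z) | z. True}}"
    by (rule exI[of _ S]) (auto simp: c0_semigroup_S generator_S)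
  from someI_ex[OF this] have S': "c0_semigroup S'" and g: "generator S' = {(B z, - z) | z. True}"
    unfolding S'_def exp_neg_def by auto
  have "S' t (B w) = S t (B w)" for w
  proof -
    have gw: "(B w, - w) \<in> generator S'" by (auto simp: g)
    have l: "linear (S' s)" if "s \<ge> 0" for s using S' that by (auto simp: c0_semigroup_def bounded_linear.linear)
    have "S' t (B w) = S t (S' 0 (B w))"
    proof (rule classical_solution_eq[OF t, where q = "\<lambda>s. S' s w"])
      fix s assume s: "s \<in> {0..t}"
      show "((\<lambda>a. S' a (B w)) has_vector_derivative - S' s w) (at s within {0..t})"
        using c0_semigroup_generator_derivative(1)[OF S' gw, of s] s linear_neg[OF l, of s w]
        by (auto intro: has_vector_derivative_within_subset)
      have "(S' s (B w), - S' s w) \<in> generator S'"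
        using c0_semigroup_generator_derivative(2)[OF S' gw, of s] s linear_neg[OF l, of s w] by simp
      then show "S' s (B w) = B (S' s w)" by (auto simp: g)
    qed
    then show ?thesis using S' by (simp add: c0_semigroup_def)
  qed
  moreover have "bounded_linear (S' t)" using S' t unfolding c0_semigroup_def by blast
  ultimately have "S' t x = S t x"
    using bounded_linear_eq_on_dense[OF _ S_bl B_dense, of "S' t" t x] t by auto
  then show ?thesis by (simp add: S'_def)
qed

end

section \<open>Smoothing, analyticity and injectivity\<close>

lemma power_over_fact_le_exp: "x ^ n / fact n \<le> exp x" if "x \<ge> 0" for x :: real
proof -
  have "(\<lambda>n. x ^ n /\<^sub>R fact n) sums exp x" by (rule exp_converges)
  moreover have "\<And>n. x ^ n /\<^sub>R fact n \<ge> 0" using that by simp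
  ultimately have "(\<Sum>k\<in>{n}. x ^ k /\<^sub>R fact k) \<le> exp x"
    using sum_le_suminf[of "\<lambda>n. x ^ n /\<^sub>R fact n" "{n}"] by (simp add: sums_iff)
  then show ?thesis by (simp add: field_simps)
qed

text \<open>The Ritt condition on the resolvent makes the semigroup analytic.\<close>

locale hille_yosida_ritt = hille_yosida +
  fixes R :: real
  assumes ritt: "h > 0 \<Longrightarrow> Suc n * norm ((J h ^^ Suc n) x - (J h ^^ n) x) \<le> R * norm x"
    and R_ge_1: "R \<ge> 1"
begin

text \<open>The Ritt condition for \<open>B w\<close>: the difference of consecutive powers is -h
  times a power applied to w, and the number of steps times h tends to t.\<close>

lemma S_analytic_bound_range:
  assumes t: "t > 0"
  shows "t * norm (S t w) \<le> R * norm (B w)"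
proof -
  have "steps m t / 2 ^ m * norm (E m t w) \<le> R * norm (B w)" for m
  proof (cases "steps m t")
    case 0
    then show ?thesis using R_ge_1 by simp
  next
    case (Suc n)
    have h: "1 / 2 ^ m > (0::real)" by simp
    have "(J (1 / 2 ^ m) ^^ Suc n) (B w) - (J (1 / 2 ^ m) ^^ n) (B w) = - (1 / 2 ^ m) *\<^sub>R E m t w"
      using J_pow_B_Suc[OF h, of n w] by (simp add: E_def Suc del: funpow.simps)
    then show ?thesis using ritt[OF h, of n "B w"] by (simp add: Suc del: funpow.simps)
  qed
  then show ?thesis
    using t by (intro LIMSEQ_le_const2[OF tendsto_mult[OF steps_tendsto tendsto_norm[OF S_lim]]]) auto
qed

text \<open>In terms of A: S t x lies in the domain, and A S t is bounded by R/t. The bound on the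
  range of \<open>B\<close> extends by density because \<open>B\<close> is continuous, that is, A is
  closed.\<close>

lemma S_smoothing:
  assumes t: "t > 0"
  obtains z where "S t x = B z" "norm z \<le> (R / t) * norm x"
proof -
  have "x \<in> closure (range B)" by (simp add: B_dense)
  then obtain p where p: "\<And>n. p n \<in> range B" "p \<longlonglongrightarrow> x" unfolding closure_sequential by blast
  then have "\<forall>n. \<exists>w. p n = B w" by auto
  then obtain w where w: "\<And>n. p n = B (w n)" by metis
  have d: "norm (S t (w m) - S t (w n)) \<le> (R / t) * norm (p m - p n)" for m n
    using S_analytic_bound_range[OF t, of "w m - w n"] t
    by (simp add: w linear_diff[OF S_linear] linear_diff[OF B_linear] field_simps)
  have "Cauchy (\<lambda>n. S t (w n))"
  proof (rule CauchyI)
    fix e :: real assume e: "e > 0"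
    have "Cauchy p" using p(2) by (rule LIMSEQ_imp_Cauchy)
    moreover have "e / (R / t) > 0" using e t R_ge_1 by simp
    ultimately obtain N where N: "\<And>m n. m \<ge> N \<Longrightarrow> n \<ge> N \<Longrightarrow> norm (p m - p n) < e / (R / t)"
      by (meson CauchyD)
    have "norm (S t (w m) - S t (w n)) < e" if "m \<ge> N" "n \<ge> N" for m n
    proof -
      have "(R / t) * norm (p m - p n) < (R / t) * (e / (R / t))"
        using N[OF that] t R_ge_1 by (intro mult_strict_left_mono) auto
      then show ?thesis using d[of m n] t R_ge_1 by simp
    qed
    then show "\<exists>N. \<forall>m\<ge>N. \<forall>n\<ge>N. norm (S t (w m) - S t (w n)) < e" by blast
  qed
  then obtain z where z: "(\<lambda>n. S t (w n)) \<longlonglongrightarrow> z" using Cauchy_convergent_iff convergent_def by blast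
  have "(\<lambda>n. B (S t (w n))) \<longlonglongrightarrow> B z" by (rule bounded_linear.tendsto[OF B_bl z])
  moreover have "(\<lambda>n. B (S t (w n))) \<longlonglongrightarrow> S t x"
    using bounded_linear.tendsto[OF S_bl p(2), of t] t by (simp add: B_S w)
  ultimately have "S t x = B z" by (rule LIMSEQ_unique[symmetric])
  moreover have "norm z \<le> (R / t) * norm x"
  proof (rule LIMSEQ_le[OF tendsto_norm[OF z]])
    show "(\<lambda>n. (R / t) * norm (p n)) \<longlonglongrightarrow> (R / t) * norm x" by (intro tendsto_intros p(2))
    have "norm (S t (w n)) \<le> (R / t) * norm (p n)" for n
      using S_analytic_bound_range[OF t, of "w n"] t by (simp add: w field_simps)
    then show "\<exists>N. \<forall>n\<ge>N. norm (S t (w n)) \<le> (R / t) * norm (p n)" by blast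
  qed
  ultimately show thesis by (rule that)
qed

text \<open>Smoothing over k equal pieces of time bounds A^k S (k s) by (R/s)^k.\<close>

lemma S_smoothing_pow:
  assumes s: "s > 0"
  shows "\<exists>y. S (k * s) x = (B ^^ k) y \<and> norm y \<le> (R / s) ^ k * norm x"
proof (induction k)
  case (Suc k)
  then obtain y where y: "S (k * s) x = (B ^^ k) y" "norm y \<le> (R / s) ^ k * norm x" by blast
  obtain z where z: "S s y = B z" "norm z \<le> (R / s) * norm y" using S_smoothing[OF s] by blast
  have BS: "(B ^^ k) (S s y) = S s ((B ^^ k) y)" for k y
    using s by (induction k) (simp_all add: B_S)
  have "S (Suc k * s) x = S s (S (k * s) x)"
    using S_add[of s "k * s" x] s by (simp add: algebra_simps)
  also have "\<dots> = (B ^^ k) (B z)" by (simp add: y BS[symmetric] z)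
  also have "\<dots> = (B ^^ Suc k) z" by (simp add: funpow_swap1)
  finally have "S (Suc k * s) x = (B ^^ Suc k) z" .
  moreover have "norm z \<le> (R / s) ^ Suc k * norm x"
  proof -
    have "norm z \<le> (R / s) * ((R / s) ^ k * norm x)"
      using z(2) y(2) s R_ge_1 by (intro order_trans[OF z(2)] mult_left_mono) auto
    then show ?thesis by (simp add: mult.assoc)
  qed
  ultimately show ?case by blast
qed (simp add: S_zero)

text \<open>Taylor expansion of the analytic function \<open>t \<mapsto> S t x\<close> at the zero \<open>t0\<close>.\<close>

lemma S_eq_0_backwards:
  assumes s: "s > 0" and \<tau>: "\<tau> > 0" "\<tau> * R * exp 1 < s" and 0: "S (s + \<tau>) x = 0"
  shows "S s x = 0"
proof -
  \<comment> \<open>The Taylor remainder of order n. Its ratio is below 1 by the hypothesis on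
    \<tau>, so the left side is 0 in the limit.\<close>
  have bound: "norm (S s x) \<le> M * norm x * (\<tau> * R * exp 1 / s) ^ n" if n: "n > 0" for n :: nat
  proof -
    obtain y where y: "S s x = (B ^^ n) y" "norm y \<le> (R / (s / n)) ^ n * norm x"
    proof -
      have "s / n > 0" "n * (s / n) = s" using s n by simp_all
      then show thesis using S_smoothing_pow[of "s / n" n x] that by metis
    qed
    \<comment> \<open>\<open>Y k\<close> is A^k applied to S s x; in particular \<open>Y 0\<close>
      is S s x and \<open>Y n\<close> is y.\<close>
    define Y where "Y k = (B ^^ (n - k)) y" for k
    have BY: "B (Y (Suc k)) = Y k" if "k < n" for k
      using that unfolding Y_def by (metis Suc_diff_Suc comp_apply funpow.simps(2))
    have Yz: "S \<tau> (Y k) = 0" if "k \<le> n" for k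
    proof -
      have "S \<tau> (S s x) = 0" using 0 S_add[of \<tau> s x] s \<tau> by (simp add: add.commute)
      moreover have "S s x = (B ^^ k) (Y k)"
        using that by (simp add: Y_def y funpow_add[symmetric, THEN fun_cong, unfolded o_apply])
      moreover have "S \<tau> ((B ^^ k) v) = (B ^^ k) (S \<tau> v)" for k v
        using less_imp_le[OF \<tau>(1)] by (induction k) (simp_all add: B_S[symmetric])
      moreover have "v = 0" if "(B ^^ k) v = 0" for k v
        using that
      proof (induction k)
        case (Suc k)
        then have "B ((B ^^ k) v) = B 0" by (simp add: linear_0[OF B_linear])
        then have "(B ^^ k) v = 0" using B_inj by (simp add: inj_eq)
        then show ?case by (rule Suc.IH)
      qed simp
      ultimately show ?thesis by metis
    qed
    \<comment> \<open>The Taylor polynomial about the time s + r, evaluated at the time s.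
      Differentiation in the centre r leaves a single term; for m = n the value at r = 0 is S s x,
      and at r = \<tau> all coefficients vanish.\<close>
    define P where "P m = (\<lambda>r. \<Sum>k<m. (r ^ k / fact k) *\<^sub>R S r (Y k))" for m
    have der: "(P m has_vector_derivative (if m = 0 then 0 else - (r ^ (m - 1) / fact (m - 1)) *\<^sub>R S r (Y m))) (at r within {0..})"
      if "m \<le> n" "r \<ge> 0" for m r
      using that
    proof (induction m)
      case (Suc m)
      have 1: "((\<lambda>r. r ^ m / fact m) has_vector_derivative (if m = 0 then 0 else r ^ (m - 1) / fact (m - 1))) (at r within {0..})"
      proof (cases m)
        case (Suc l)
        have "((\<lambda>r. r ^ m / fact m) has_real_derivative real m * r ^ (m - 1) / fact m) (at r within {0..})"
          by (auto intro!: derivative_eq_intros)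
        moreover have "real m * r ^ (m - 1) / fact m = r ^ (m - 1) / fact (m - 1)"
          by (simp add: Suc del: of_nat_Suc)
        ultimately show ?thesis using Suc by (simp add: has_real_derivative_iff_has_vector_derivative)
      qed simp
      have 2: "((\<lambda>r. S r (Y m)) has_vector_derivative - S r (Y (Suc m))) (at r within {0..})"
        using S_B_derivative[OF Suc.prems(2), of "Y (Suc m)"] BY[of m] Suc.prems by simp
      have "(P (Suc m)) = (\<lambda>r. P m r + (r ^ m / fact m) *\<^sub>R S r (Y m))"
        by (auto simp: P_def)
      moreover have "((\<lambda>r. P m r + (r ^ m / fact m) *\<^sub>R S r (Y m)) has_vector_derivative
          (if m = 0 then 0 else - (r ^ (m - 1) / fact (m - 1)) *\<^sub>R S r (Y m)) +
          ((r ^ m / fact m) *\<^sub>R (- S r (Y (Suc m))) + (if m = 0 then 0 else r ^ (m - 1) / fact (m - 1)) *\<^sub>R S r (Y m)))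
          (at r within {0..})"
        by (intro has_vector_derivative_add Suc.IH has_vector_derivative_scaleR 1[folded has_real_derivative_iff_has_vector_derivative] 2) (use Suc.prems in auto)
      ultimately show ?case by (cases "m = 0") simp_all
    qed (simp add: P_def)
    define c where "c = M * norm y"
    have "norm (P n \<tau> - P n 0) \<le> c * \<tau> ^ n / fact n - c * 0 ^ n / fact n"
    proof (rule differentiable_bound_general[OF \<tau>(1)])
      have "(P n has_vector_derivative (if n = 0 then 0 else - (r ^ (n - 1) / fact (n - 1)) *\<^sub>R S r (Y n))) (at r within {0..\<tau>})"
        if "r \<in> {0..\<tau>}" for r
        by (rule has_vector_derivative_within_subset[OF der]) (use that in auto)
      then show "continuous_on {0..\<tau>} (P n)"
        unfolding continuous_on_eq_continuous_within by (blast intro: has_vector_derivative_continuous)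
      show "continuous_on {0..\<tau>} (\<lambda>r. c * r ^ n / fact n)" by (intro continuous_intros) auto
      fix r assume r: "0 < r" "r < \<tau>"
      have "at r within {0..} = at r" using r by (intro at_within_interior) simp
      then show "(P n has_vector_derivative - (r ^ (n - 1) / fact (n - 1)) *\<^sub>R S r y) (at r)"
        using der[of n r] r n by (simp add: Y_def)
      have "((\<lambda>r. c * r ^ n / fact n) has_real_derivative c * (real n * r ^ (n - 1)) / fact n) (at r)"
        by (auto intro!: derivative_eq_intros)
      moreover have "c * (real n * r ^ (n - 1)) / fact n = c * r ^ (n - 1) / fact (n - 1)"
        using n by (cases n) (simp_all del: of_nat_Suc)
      ultimately show "((\<lambda>r. c * r ^ n / fact n) has_vector_derivative c * r ^ (n - 1) / fact (n - 1)) (at r)"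
        by (simp add: has_real_derivative_iff_has_vector_derivative)
      have "norm (- (r ^ (n - 1) / fact (n - 1)) *\<^sub>R S r y) \<le> (r ^ (n - 1) / fact (n - 1)) * (M * norm y)"
        using r S_bound[of r y] by (simp add: mult_left_mono divide_right_mono)
      then show "norm (- (r ^ (n - 1) / fact (n - 1)) *\<^sub>R S r y) \<le> c * r ^ (n - 1) / fact (n - 1)"
        by (simp add: c_def mult_ac)
    qed
    moreover have "P n \<tau> = 0" using Yz by (auto simp: P_def intro!: sum.neutral)
    moreover have "P n 0 = S s x"
    proof -
      have "P n 0 = (\<Sum>k\<in>{0}. ((0::real) ^ k / fact k) *\<^sub>R S 0 (Y k))"
        unfolding P_def by (rule sum.mono_neutral_right) (use n in auto)
      then show ?thesis by (simp add: S_zero Y_def y)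
    qed
    ultimately have "norm (S s x) \<le> c * \<tau> ^ n / fact n" using n by (simp add: power_0_left)
    also have "\<dots> \<le> M * ((R / (s / n)) ^ n * norm x) * \<tau> ^ n / fact n"
      unfolding c_def using y(2) \<tau> M_ge_1 by (intro divide_right_mono mult_right_mono mult_left_mono) auto
    also have "\<dots> = M * norm x * (R * \<tau> / s) ^ n * (real n ^ n / fact n)"
      by (simp add: power_divide power_mult_distrib)
    \<comment> \<open>The n pieces of length s/n produce n^n, which the factorial of the remainder
      absorbs up to e^n.\<close>
    also have "\<dots> \<le> M * norm x * (R * \<tau> / s) ^ n * exp n"
      using s \<tau> M_ge_1 R_ge_1 by (intro mult_left_mono power_over_fact_le_exp) auto
    also have "\<dots> = M * norm x * (\<tau> * R * exp 1 / s) ^ n"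
    proof -
      have "exp (real n) = exp 1 ^ n" by (simp flip: exp_of_nat_mult)
      then show ?thesis by (simp add: power_divide power_mult_distrib mult_ac)
    qed
    finally show ?thesis .
  qed
  have "(\<lambda>n. M * norm x * (\<tau> * R * exp 1 / s) ^ n) \<longlonglongrightarrow> M * norm x * 0"
    using s \<tau> R_ge_1 by (intro tendsto_intros LIMSEQ_realpow_zero) auto
  then have "norm (S s x) \<le> M * norm x * 0"
    by (rule LIMSEQ_le_const) (use bound in \<open>auto intro!: exI[of _ 1]\<close>)
  then show ?thesis by simp
qed

text \<open>A zero at some time moves to q times that time with a fixed q < 1, hence to times
  tending to 0, where strong continuity gives x = 0.\<close>

lemma S_inj: assumes t: "t \<ge> 0" shows "inj (S t)"
proof -
  have "x = 0" if 0: "S t x = 0" for x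
  proof (cases "t = 0")
    case False
    then have tp: "t > 0" using t by simp
    \<comment> \<open>Small enough that p R e < 1/2 < 1 - p, which is the condition for a backward
      step by the proportion p.\<close>
    define p where "p = 1 / (2 * R * exp 1 + 2)"
    define q where "q = 1 - p"
    have D: "2 * R * exp 1 + 2 > 2" using R_ge_1 by simp
    have p: "p > 0" "p < 1/2" using D by (simp_all add: p_def)
    have "p * (2 * R * exp 1 + 2) = 1" using D by (simp add: p_def)
    then have p3: "p * R * exp 1 < 1 / 2" using p(1) by (simp add: algebra_simps)
    have "S (q ^ n * t) x = 0" for n
    proof (induction n)
      case (Suc n)
      have q: "q > 1 / 2" using p by (simp add: q_def)
      have c: "q ^ n * t > 0" using q tp by simp
      have "(p * (q ^ n * t)) * R * exp 1 < q ^ Suc n * t"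
      proof -
        have "(p * R * exp 1) * (q ^ n * t) < q * (q ^ n * t)"
          using c p3 q by (intro mult_strict_right_mono) auto
        then show ?thesis by (simp add: mult_ac)
      qed
      moreover have "q ^ Suc n * t + p * (q ^ n * t) = q ^ n * t"
        by (simp add: q_def algebra_simps)
      ultimately show ?case
        using S_eq_0_backwards[of "q ^ Suc n * t" "p * (q ^ n * t)" x] Suc c p q tp by simp
    qed (simp add: 0)
    moreover have "(\<lambda>n. S (q ^ n * t) x) \<longlonglongrightarrow> S 0 x"
    proof (rule S_tendsto)
      have "(\<lambda>n. q ^ n * t) \<longlonglongrightarrow> 0 * t" using p by (intro tendsto_intros LIMSEQ_realpow_zero) (auto simp: q_def)
      then show "(\<lambda>n. q ^ n * t) \<longlonglongrightarrow> 0" by simp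
    qed (use p tp in \<open>auto simp: q_def\<close>)
    ultimately show ?thesis by (simp add: S_zero LIMSEQ_const_iff)
  qed (use that S_zero in simp)
  then show ?thesis
    by (metis injI linear_diff[OF S_linear[OF t]] right_minus_eq)
qed

end

section \<open>Resolvent powers of an elliptic form\<close>

text \<open>A crude shift of the index: \<open>f 0\<close> is counted N times so that the correction
  is proportional to N like the other bounds.\<close>

lemma sum_le_shift:
  fixes f :: "nat \<Rightarrow> real"
  assumes "\<And>n. f n \<ge> 0"
  shows "(\<Sum>n<N. f n) \<le> N * f 0 + (\<Sum>n<N. f (Suc n))"
proof (cases N)
  case (Suc M)
  have "(\<Sum>n<N. f n) = f 0 + (\<Sum>n<M. f (Suc n))" unfolding Suc by (rule sum.lessThan_Suc_shift)
  moreover have "f 0 \<le> N * f 0" using assms[of 0] Suc by (simp add: algebra_simps)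
  moreover have "(\<Sum>n<M. f (Suc n)) \<le> (\<Sum>n<N. f (Suc n))" using assms Suc by simp
  ultimately show ?thesis by linarith
qed simp

text \<open>Discrete counterpart of integrating the derivative of t |x|^2. It turns bounds on sums
  of squares, of x and of its weighted differences, into a bound at the single index N.\<close>

lemma weighted_norm_le:
  fixes x :: "nat \<Rightarrow> 'a::real_normed_vector"
  shows "N * (norm (x N))\<^sup>2 \<le>
    (\<Sum>n<N. (norm (real (Suc n) *\<^sub>R (x (Suc n) - x n)))\<^sup>2 + 2 * (norm (x n))\<^sup>2 + (norm (x (Suc n)))\<^sup>2)"
proof (induction N)
  case (Suc N)
  define A where "A = norm (x N)"
  define B where "B = norm (x (Suc N))"
  define q where "q = norm (real (Suc N) *\<^sub>R (x (Suc N) - x N))"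
  have "real (Suc N) * (B - A) \<le> q"
    unfolding q_def B_def A_def norm_scaleR
    by (auto intro!: mult_left_mono norm_triangle_ineq2 simp del: of_nat_Suc)
  then have "(real (Suc N) * (B - A)) * (B + A) \<le> q * (B + A)"
    by (rule mult_right_mono) (simp add: A_def B_def)
  moreover have "0 \<le> (q - A)\<^sup>2 + (q - B)\<^sup>2" by simp
  ultimately have "real (Suc N) * B\<^sup>2 \<le> N * A\<^sup>2 + (q\<^sup>2 + 2 * A\<^sup>2 + B\<^sup>2)"
  proof -
    assume a: "(real (Suc N) * (B - A)) * (B + A) \<le> q * (B + A)" and b: "0 \<le> (q - A)\<^sup>2 + (q - B)\<^sup>2"
    have "q * (B + A) \<le> q\<^sup>2 + (A\<^sup>2 + B\<^sup>2) / 2" using b unfolding power2_diff distrib_left by argo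
    moreover have "(real (Suc N) * (B - A)) * (B + A) = real (Suc N) * B\<^sup>2 - N * A\<^sup>2 - A\<^sup>2"
      by (simp add: power2_eq_square algebra_simps)
    moreover have "A\<^sup>2 \<ge> 0" "B\<^sup>2 \<ge> 0" by simp_all
    ultimately show ?thesis using a by argo
  qed
  with Suc.IH show ?case by (simp add: A_def B_def q_def)
qed simp

context elliptic_form
begin

section \<open>Energy estimates for the Euler scheme\<close>

lemma \<iota>_linear: "linear \<iota>" and j_linear: "linear j" and L_linear: "linear L" and Linv_linear: "linear Linv"
  using \<iota>_clinear j_clinear L_clinear Linv_clinear by (simp_all add: clinear_linear)

text \<open>The condition number of the form: the bound C for \<open>L\<close> times the bound
  1/\<alpha> for its inverse.\<close>

definition "K = C / \<alpha>"

text \<open>The equation is tested with the new value z', and Young's inequality absorbs half of the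
  elliptic term. Writing the right-hand side as \<open>L g\<close> allows g to be measured in
  V.\<close>

lemma energy_inequality:
  assumes h: "h > 0" and eq: "j (\<iota> z') - j (\<iota> z) + h *\<^sub>R L z' = h *\<^sub>R L g"
  shows "(norm (\<iota> z'))\<^sup>2 + h * \<alpha> * (norm z')\<^sup>2 \<le> (norm (\<iota> z))\<^sup>2 + h * \<alpha> * (K\<^sup>2 * (norm g)\<^sup>2)"
proof -
  have "Re (antidual_apply (j (\<iota> z') - j (\<iota> z) + h *\<^sub>R L z') z') = Re (antidual_apply (h *\<^sub>R L g) z')"
    by (simp only: eq)
  then have "(norm (\<iota> z'))\<^sup>2 - Re (cinner (\<iota> z) (\<iota> z')) + h * Re (a z' z') = h * Re (a g z')"
    by (simp add: antidual_apply_add_left antidual_apply_diff_left antidual_apply_scaleR_left j_apply L_apply Re_cinner_self)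
  moreover have "2 * Re (cinner (\<iota> z) (\<iota> z')) \<le> (norm (\<iota> z))\<^sup>2 + (norm (\<iota> z'))\<^sup>2"
    using norm_diff_sq[of "\<iota> z" "\<iota> z'"] zero_le_power2[of "norm (\<iota> z - \<iota> z')"] by linarith
  moreover have "h * (\<alpha> * (norm z')\<^sup>2) \<le> h * Re (a z' z')"
    using h by (intro mult_left_mono a_elliptic) auto
  moreover have "h * Re (a g z') \<le> h * (\<alpha> * (norm z')\<^sup>2 / 2 + \<alpha> * (K\<^sup>2 * (norm g)\<^sup>2) / 2)"
  proof (rule mult_left_mono)
    have "0 \<le> \<alpha> * (norm z' - K * norm g)\<^sup>2" using pos by simp
    also have "\<dots> = \<alpha> * (norm z')\<^sup>2 - 2 * C * norm g * norm z' + \<alpha> * (K\<^sup>2 * (norm g)\<^sup>2)"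
      using pos by (simp add: K_def power2_diff power_mult_distrib power_divide algebra_simps)
    finally show "Re (a g z') \<le> \<alpha> * (norm z')\<^sup>2 / 2 + \<alpha> * (K\<^sup>2 * (norm g)\<^sup>2) / 2"
      using order_trans[OF complex_Re_le_cmod a_bound, of g z'] by argo
  qed (use h in simp)
  ultimately show ?thesis by (simp add: algebra_simps)
qed

text \<open>Summation telescopes the H-norms. As the start is 0, both sides carry the factor h
  \<alpha>, which cancels and leaves a bound independent of the step size.\<close>

lemma discrete_maximal_regularity:
  assumes h: "h > 0" and 0: "z 0 = 0"
    and eq: "\<And>n. j (\<iota> (z (Suc n))) - j (\<iota> (z n)) + h *\<^sub>R L (z (Suc n)) = h *\<^sub>R L (g n)"
  shows "(\<Sum>n<N. (norm (z (Suc n)))\<^sup>2) \<le> K\<^sup>2 * (\<Sum>n<N. (norm (g n))\<^sup>2)"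
proof -
  have "(norm (\<iota> (z N)))\<^sup>2 + h * \<alpha> * (\<Sum>n<N. (norm (z (Suc n)))\<^sup>2) \<le> h * \<alpha> * (K\<^sup>2 * (\<Sum>n<N. (norm (g n))\<^sup>2))"
  proof (induction N)
    case (Suc N)
    then show ?case using energy_inequality[OF h eq[of N]] by (simp add: algebra_simps)
  qed (simp add: 0 linear_0[OF \<iota>_linear])
  then have "(h * \<alpha>) * (\<Sum>n<N. (norm (z (Suc n)))\<^sup>2) \<le> (h * \<alpha>) * (K\<^sup>2 * (\<Sum>n<N. (norm (g n))\<^sup>2))"
    using zero_le_power2[of "norm (\<iota> (z N))"] by linarith
  then show ?thesis using h pos by simp
qed

text \<open>\<open>c0\<close> bounds the mean square of the scheme, \<open>c2\<close> its single
  terms and \<open>c3\<close> the weighted differences, all relative to the squared norm of u 0;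
  \<open>c0 - 1\<close> is the mean-square bound for the shifted sequence.\<close>

definition "c0 = 2 * K\<^sup>2 + 3"
definition "c2 = (K\<^sup>2 + 3) * c0"
definition "c3 = K\<^sup>2 * c0 * (8 * K\<^sup>2 + 5)"

context
  fixes h :: real and u :: "nat \<Rightarrow> 'v"
  assumes h: "h > 0" and euler: "\<And>n. j (\<iota> (u (Suc n))) + h *\<^sub>R L (u (Suc n)) = j (\<iota> (u n))"
begin

text \<open>The discrete analogues of \<open>t u'\<close> and \<open>t (t u')'\<close> solve the same Euler scheme, with right-hand sides
  \<open>- L u\<close> and \<open>- L (2 du + u)\<close>.\<close>

definition "du n = real n *\<^sub>R (u n - u (n - 1))"
definition "ddu n = real n *\<^sub>R (du n - du (n - 1))"

lemma j_u: "j (\<iota> (u (Suc n))) = j (\<iota> (u n)) - h *\<^sub>R L (u (Suc n))"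
  using euler[of n] by (simp add: algebra_simps)

lemma j_du: "j (\<iota> (du n)) = - (real n * h) *\<^sub>R L (u n)"
proof (cases n)
  case (Suc m)
  then show ?thesis
    by (simp add: du_def linear_scale[OF j_linear] linear_scale[OF \<iota>_linear] linear_diff[OF j_linear]
        linear_diff[OF \<iota>_linear] j_u del: of_nat_Suc)
qed (simp add: du_def linear_0[OF j_linear] linear_0[OF \<iota>_linear])

lemma L_du: "L (du n) = real n *\<^sub>R (L (u n) - L (u (n - 1)))"
  by (simp add: du_def linear_scale[OF L_linear] linear_diff[OF L_linear])

lemma du_eq: "j (\<iota> (du (Suc n))) - j (\<iota> (du n)) + h *\<^sub>R L (du (Suc n)) = h *\<^sub>R L (- u n)"
  by (simp add: j_du L_du linear_neg[OF L_linear] algebra_simps)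

lemma j_ddu: "j (\<iota> (ddu n)) = - (real n * h) *\<^sub>R (L (u (n - 1)) + L (du n))"
proof (cases n)
  case (Suc m)
  have "j (\<iota> (du (Suc m))) - j (\<iota> (du m)) = - h *\<^sub>R (L (u m) + L (du (Suc m)))"
    using du_eq[of m] by (simp add: linear_neg[OF L_linear] algebra_simps)
  then have "real (Suc m) *\<^sub>R (j (\<iota> (du (Suc m))) - j (\<iota> (du m))) = real (Suc m) *\<^sub>R - h *\<^sub>R (L (u m) + L (du (Suc m)))"
    by (simp only:)
  then show ?thesis
    by (simp add: Suc ddu_def linear_scale[OF j_linear] linear_scale[OF \<iota>_linear] linear_diff[OF j_linear]
        linear_diff[OF \<iota>_linear] del: of_nat_Suc)
qed (simp add: ddu_def linear_0[OF j_linear] linear_0[OF \<iota>_linear])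

lemma L_ddu: "L (ddu n) = real n *\<^sub>R (L (du n) - L (du (n - 1)))"
  by (simp add: ddu_def linear_scale[OF L_linear] linear_diff[OF L_linear])

lemma ddu_eq: "j (\<iota> (ddu (Suc n))) - j (\<iota> (ddu n)) + h *\<^sub>R L (ddu (Suc n)) = h *\<^sub>R L (- 2 *\<^sub>R du n - u n)"
proof -
  have "real n *\<^sub>R L (u (n - 1)) = real n *\<^sub>R L (u n) - L (du n)"
    by (simp add: L_du scaleR_diff_right)
  \<comment> \<open>Replaces u (n - 1) by u n at the cost of one \<open>du n\<close>, which accounts
    for the coefficient 2.\<close>
  then have *: "(real n * h) *\<^sub>R L (u (n - 1)) = (real n * h) *\<^sub>R L (u n) - h *\<^sub>R L (du n)"
    by (metis mult.commute scaleR_diff_right scaleR_scaleR)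
  have "j (\<iota> (ddu (Suc n))) - j (\<iota> (ddu n)) + h *\<^sub>R L (ddu (Suc n)) =
      (real n * h) *\<^sub>R L (u (n - 1)) - (real n * h) *\<^sub>R L (u n) - h *\<^sub>R L (u n) - h *\<^sub>R L (du n)"
    by (simp add: j_ddu L_ddu algebra_simps)
  also have "\<dots> = h *\<^sub>R (- 2 *\<^sub>R L (du n) - L (u n))"
    unfolding * by (simp add: algebra_simps flip: scaleR_2)
  also have "\<dots> = h *\<^sub>R L (- 2 *\<^sub>R du n - u n)"
    by (simp only: linear_diff[OF L_linear] linear_scale[OF L_linear])
  finally show ?thesis .
qed

text \<open>The scheme starts at u 0 and not at 0, so maximal regularity is applied to u n - u 0,
  whose right-hand side is the constant - u 0.\<close>

lemma sum_u_Suc: "(\<Sum>n<N. (norm (u (Suc n)))\<^sup>2) \<le> N * ((c0 - 1) * (norm (u 0))\<^sup>2)"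
proof -
  have "(\<Sum>n<N. (norm (u (Suc n) - u 0))\<^sup>2) \<le> K\<^sup>2 * (\<Sum>n<N. (norm (- u 0))\<^sup>2)"
  proof (rule discrete_maximal_regularity[OF h, where z = "\<lambda>n. u n - u 0"])
    show "j (\<iota> (u (Suc n) - u 0)) - j (\<iota> (u n - u 0)) + h *\<^sub>R L (u (Suc n) - u 0) = h *\<^sub>R L (- u 0)" for n
      using euler[of n]
      by (simp add: linear_diff[OF j_linear] linear_diff[OF \<iota>_linear] linear_diff[OF L_linear] linear_neg[OF L_linear] algebra_simps)
  qed simp
  also have "\<dots> = N * (K\<^sup>2 * (norm (u 0))\<^sup>2)" by simp
  finally have "(\<Sum>n<N. (norm (u (Suc n) - u 0))\<^sup>2) \<le> N * (K\<^sup>2 * (norm (u 0))\<^sup>2)" .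
  moreover have "(\<Sum>n<N. (norm (u (Suc n)))\<^sup>2) \<le> (\<Sum>n<N. 2 * (norm (u (Suc n) - u 0))\<^sup>2 + 2 * (norm (u 0))\<^sup>2)"
  proof (rule sum_mono)
    fix n
    have "(norm (u (Suc n)))\<^sup>2 \<le> (norm (u (Suc n) - u 0) + norm (u 0))\<^sup>2"
      using norm_triangle_sub[of "u (Suc n)" "u 0"] by (intro power_mono) (simp_all add: add.commute)
    moreover have "0 \<le> (norm (u (Suc n) - u 0) - norm (u 0))\<^sup>2" by simp
    ultimately show "(norm (u (Suc n)))\<^sup>2 \<le> 2 * (norm (u (Suc n) - u 0))\<^sup>2 + 2 * (norm (u 0))\<^sup>2"
      unfolding power2_sum power2_diff by argo
  qed
  ultimately show ?thesis
    by (simp add: sum.distrib sum_distrib_left[symmetric] c0_def algebra_simps)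
qed

lemma sum_u: "(\<Sum>n<N. (norm (u n))\<^sup>2) \<le> N * (c0 * (norm (u 0))\<^sup>2)"
  using sum_u_Suc[of N] sum_le_shift[of "\<lambda>n. (norm (u n))\<^sup>2" N] by (simp add: algebra_simps)

lemma sum_du_Suc: "(\<Sum>n<N. (norm (du (Suc n)))\<^sup>2) \<le> N * (K\<^sup>2 * c0 * (norm (u 0))\<^sup>2)"
proof -
  have "(\<Sum>n<N. (norm (du (Suc n)))\<^sup>2) \<le> K\<^sup>2 * (\<Sum>n<N. (norm (- u n))\<^sup>2)"
    by (rule discrete_maximal_regularity[where z = du and g = "\<lambda>n. - u n", OF h _ du_eq]) (simp add: du_def)
  also have "\<dots> \<le> K\<^sup>2 * (N * (c0 * (norm (u 0))\<^sup>2))"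
    using sum_u[of N] by (intro mult_left_mono) auto
  finally show ?thesis by (simp add: mult_ac)
qed

lemma sum_du: "(\<Sum>n<N. (norm (du n))\<^sup>2) \<le> N * (K\<^sup>2 * c0 * (norm (u 0))\<^sup>2)"
  using sum_du_Suc[of N] sum_le_shift[of "\<lambda>n. (norm (du n))\<^sup>2" N] by (simp add: du_def)

lemma sum_ddu_Suc: "(\<Sum>n<N. (norm (ddu (Suc n)))\<^sup>2) \<le> N * (K\<^sup>2 * c0 * (8 * K\<^sup>2 + 2) * (norm (u 0))\<^sup>2)"
proof -
  have "(\<Sum>n<N. (norm (ddu (Suc n)))\<^sup>2) \<le> K\<^sup>2 * (\<Sum>n<N. (norm (- 2 *\<^sub>R du n - u n))\<^sup>2)"
    by (rule discrete_maximal_regularity[where z = ddu and g = "\<lambda>n. - 2 *\<^sub>R du n - u n", OF h _ ddu_eq]) (simp add: ddu_def)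
  also have "\<dots> \<le> K\<^sup>2 * (\<Sum>n<N. 8 * (norm (du n))\<^sup>2 + 2 * (norm (u n))\<^sup>2)"
  proof (intro mult_left_mono sum_mono)
    fix n
    have "(norm (- 2 *\<^sub>R du n - u n))\<^sup>2 \<le> (2 * norm (du n) + norm (u n))\<^sup>2"
      using norm_triangle_ineq4[of "- 2 *\<^sub>R du n" "u n"] by (intro power_mono) auto
    moreover have "0 \<le> (2 * norm (du n) - norm (u n))\<^sup>2" by simp
    ultimately show "(norm (- 2 *\<^sub>R du n - u n))\<^sup>2 \<le> 8 * (norm (du n))\<^sup>2 + 2 * (norm (u n))\<^sup>2"
      unfolding power2_sum power2_diff power_mult_distrib by simp
  qed simp
  also have "\<dots> \<le> K\<^sup>2 * (8 * (N * (K\<^sup>2 * c0 * (norm (u 0))\<^sup>2)) + 2 * (N * (c0 * (norm (u 0))\<^sup>2)))"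
    unfolding sum.distrib sum_distrib_left[symmetric]
    using sum_u[of N] sum_du[of N] by (intro mult_left_mono add_mono) auto
  finally show ?thesis by (simp add: algebra_simps)
qed

text \<open>The weighted differences of u are \<open>du\<close>, so the three sums in
  \<open>weighted_norm_le\<close> grow at most linearly in n; division by n leaves the bound, and
  index 0 is treated apart.\<close>

lemma euler_bound: "(norm (u n))\<^sup>2 \<le> c2 * (norm (u 0))\<^sup>2"
proof (cases "n = 0")
  case True
  have "1 \<le> c2" unfolding c2_def c0_def using mult_mono[of 1 "K\<^sup>2 + 3" 1 "2 * K\<^sup>2 + 3"] by simp
  then show ?thesis using True mult_right_mono[of 1 c2 "(norm (u 0))\<^sup>2"] by simp
next
  case False
  have "n * (norm (u n))\<^sup>2 \<le> (\<Sum>k<n. (norm (du (Suc k)))\<^sup>2) + 2 * (\<Sum>k<n. (norm (u k))\<^sup>2) + (\<Sum>k<n. (norm (u (Suc k)))\<^sup>2)"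
    using weighted_norm_le[of n u] by (simp add: du_def sum.distrib sum_distrib_left)
  also have "\<dots> \<le> n * (K\<^sup>2 * c0 * (norm (u 0))\<^sup>2) + 2 * (n * (c0 * (norm (u 0))\<^sup>2)) + n * ((c0 - 1) * (norm (u 0))\<^sup>2)"
    using sum_du_Suc[of n] sum_u[of n] sum_u_Suc[of n] by linarith
  also have "\<dots> \<le> n * (c2 * (norm (u 0))\<^sup>2)"
    by (simp add: c2_def algebra_simps)
  finally show ?thesis using False by simp
qed

text \<open>The same argument one order higher: \<open>ddu\<close> consists of the weighted
  differences of \<open>du\<close>.\<close>

lemma euler_difference_bound: "(norm (real (Suc n) *\<^sub>R (u (Suc n) - u n)))\<^sup>2 \<le> c3 * (norm (u 0))\<^sup>2"
proof -
  define N where "N = Suc n"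
  have "N * (norm (du N))\<^sup>2 \<le> (\<Sum>k<N. (norm (ddu (Suc k)))\<^sup>2) + 2 * (\<Sum>k<N. (norm (du k))\<^sup>2) + (\<Sum>k<N. (norm (du (Suc k)))\<^sup>2)"
    using weighted_norm_le[of N du] by (simp add: ddu_def sum.distrib sum_distrib_left)
  also have "\<dots> \<le> N * (K\<^sup>2 * c0 * (8 * K\<^sup>2 + 2) * (norm (u 0))\<^sup>2) + 2 * (N * (K\<^sup>2 * c0 * (norm (u 0))\<^sup>2)) + N * (K\<^sup>2 * c0 * (norm (u 0))\<^sup>2)"
    using sum_ddu_Suc[of N] sum_du[of N] sum_du_Suc[of N] by linarith
  also have "\<dots> = N * (c3 * (norm (u 0))\<^sup>2)"
    by (simp add: c3_def algebra_simps)
  finally show ?thesis by (simp add: N_def du_def)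
qed

end

section \<open>Resolvents and inverses on the antidual and on H\<close>

definition "res h f = (THE u. j (\<iota> u) + h *\<^sub>R L u = f)"

lemma res: "h > 0 \<Longrightarrow> j (\<iota> (res h f)) + h *\<^sub>R L (res h f) = f"
  unfolding res_def by (rule theI') (rule resolvent_solvable)

lemma res_eqI: "h > 0 \<Longrightarrow> j (\<iota> u) + h *\<^sub>R L u = f \<Longrightarrow> res h f = u"
  unfolding res_def by (rule the1_equality) (rule resolvent_solvable)

lemma res_clinear: assumes h: "h > 0" shows "clinear (res h)"
  unfolding clinear_def
proof safe
  fix x y c
  have *: "j (\<iota> (u + v)) = j (\<iota> u) + j (\<iota> v)" "j (\<iota> (c *\<^sub>C u)) = c *\<^sub>C j (\<iota> u)" "L (u + v) = L u + L v" "L (c *\<^sub>C u) = c *\<^sub>C L u" for u v c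
    using j_clinear \<iota>_clinear L_clinear by (simp_all add: clinear_def)
  show "res h (x + y) = res h x + res h y"
    using res[OF h, of x] res[OF h, of y] by (intro res_eqI[OF h]) (simp add: * algebra_simps)
  have "c *\<^sub>C (j (\<iota> (res h x)) + h *\<^sub>R L (res h x)) = c *\<^sub>C x" by (simp only: res[OF h])
  then show "res h (c *\<^sub>C x) = c *\<^sub>C res h x"
    by (intro res_eqI[OF h]) (simp add: * scaleC_add_right scaleC_scaleR_commute)
qed

text \<open>The inverse of A and its resolvents on the antidual and on H. All four factor through V,
  into which \<open>Linv\<close> and \<open>res\<close> map.\<close>

definition "Bs f = j (\<iota> (Linv f))"
definition "Js h f = j (\<iota> (res h f))"
definition "BH x = \<iota> (Linv (j x))"
definition "JH h x = \<iota> (res h (j x))"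

lemma \<iota>_j_injD: "j (\<iota> u) = j (\<iota> v) \<Longrightarrow> u = v"
  using j_inj \<iota>_inj by (meson injD)

text \<open>\<open>Linv\<close> carries the iterates into V, where they satisfy the Euler scheme of
  the preceding estimates.\<close>

lemma Linv_Js_pow:
  assumes h: "h > 0"
  shows "j (\<iota> (Linv ((Js h ^^ Suc n) f))) + h *\<^sub>R L (Linv ((Js h ^^ Suc n) f)) = j (\<iota> (Linv ((Js h ^^ n) f)))"
proof -
  define y where "y = (Js h ^^ n) f"
  define v where "v = res h y"
  define p where "p = Linv (j (\<iota> v))"
  have "L (p + h *\<^sub>R v) = y"
    using res[OF h, of y] by (simp add: p_def v_def linear_add[OF L_linear] linear_scale[OF L_linear])
  then have "Linv y = p + h *\<^sub>R v" by (metis Linv_L)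
  then have "j (\<iota> (Linv y)) = j (\<iota> p) + h *\<^sub>R L p"
    by (simp add: p_def linear_add[OF \<iota>_linear] linear_scale[OF \<iota>_linear] linear_add[OF j_linear] linear_scale[OF j_linear])
  then show ?thesis by (simp add: y_def[symmetric] Js_def v_def[symmetric] p_def)
qed

text \<open>Passing to V by \<open>Linv\<close> costs 1/\<alpha> and returning by \<open>L\<close>
  costs C, together the factor \<open>K\<close>.\<close>

lemma Js_pow_bound:
  assumes h: "h > 0"
  shows "norm ((Js h ^^ n) f) \<le> K * sqrt c2 * norm f"
proof -
  have "norm (Linv ((Js h ^^ n) f)) \<le> sqrt c2 * norm (Linv f)"
    using real_sqrt_le_mono[OF euler_bound[where u = "\<lambda>n. Linv ((Js h ^^ n) f)", OF h Linv_Js_pow[OF h], of n]]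
    by (simp add: real_sqrt_mult)
  also have "\<dots> \<le> sqrt c2 * ((1 / \<alpha>) * norm f)"
    by (intro mult_left_mono Linv_norm) (simp add: c2_def c0_def)
  finally have "C * norm (Linv ((Js h ^^ n) f)) \<le> C * (sqrt c2 * ((1 / \<alpha>) * norm f))"
    using pos by (intro mult_left_mono) auto
  then show ?thesis
    using L_norm[of "Linv ((Js h ^^ n) f)"] by (simp add: K_def mult_ac)
qed

lemma Js_ritt:
  assumes h: "h > 0"
  shows "Suc n * norm ((Js h ^^ Suc n) f - (Js h ^^ n) f) \<le> K * sqrt c3 * norm f"
proof -
  define p where "p n = Linv ((Js h ^^ n) f)" for n
  have "norm (real (Suc n) *\<^sub>R (p (Suc n) - p n)) \<le> sqrt c3 * norm (p 0)"
    using real_sqrt_le_mono[OF euler_difference_bound[where u = "\<lambda>n. Linv ((Js h ^^ n) f)", OF h Linv_Js_pow[OF h], of n]]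
    by (simp add: real_sqrt_mult p_def del: of_nat_Suc)
  also have "\<dots> \<le> sqrt c3 * ((1 / \<alpha>) * norm f)"
    using Linv_norm[of f] by (intro mult_left_mono) (simp_all add: c3_def c0_def p_def)
  finally have "C * norm (real (Suc n) *\<^sub>R (p (Suc n) - p n)) \<le> C * (sqrt c3 * ((1 / \<alpha>) * norm f))"
    using pos by (intro mult_left_mono) auto
  moreover have *: "L (real (Suc n) *\<^sub>R (p (Suc n) - p n)) = real (Suc n) *\<^sub>R ((Js h ^^ Suc n) f - (Js h ^^ n) f)"
    by (simp add: p_def linear_scale[OF L_linear] linear_diff[OF L_linear] del: of_nat_Suc funpow.simps)
  ultimately have "norm (real (Suc n) *\<^sub>R ((Js h ^^ Suc n) f - (Js h ^^ n) f)) \<le> C * (sqrt c3 * ((1 / \<alpha>) * norm f))"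
    using L_norm[of "real (Suc n) *\<^sub>R (p (Suc n) - p n)"] unfolding * by linarith
  also have "\<dots> = K * sqrt c3 * norm f" by (simp add: K_def)
  finally show ?thesis by (simp only: norm_scaleR abs_of_nat)
qed

definition "Ms = max 1 (K * sqrt c2)"
definition "Rs = max 1 (K * sqrt c3)"

sublocale star: hille_yosida_ritt Bs Js Ms Rs
proof (intro hille_yosida_ritt.intro hille_yosida.intro hille_yosida_ritt_axioms.intro)
  show "clinear Bs"
    using j_clinear \<iota>_clinear Linv_clinear by (simp add: Bs_def clinear_def)
  show "bounded_linear Bs"
    unfolding Bs_def by (rule bounded_linear_compose[OF j_bl bounded_linear_compose[OF \<iota>_bl Linv_bl]])
  show "inj Bs"
    by (rule injI) (metis Bs_def \<iota>_j_injD L_Linv)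
  have "range Bs = range (\<lambda>v. j (\<iota> v))"
    by (auto simp: Bs_def image_iff) (metis Linv_L)
  then show "closure (range Bs) = UNIV" by (simp add: j_\<iota>_dense)
  show "bounded_linear (\<lambda>x::'v antidual. c *\<^sub>C x)" for c by (rule bounded_linear_scaleC_antidual)
  fix h :: real assume h: "h > 0"
  show "clinear (Js h)"
    using j_clinear \<iota>_clinear res_clinear[OF h] by (simp add: Js_def clinear_def)
  show "Js h (Bs x + h *\<^sub>R x) = Bs x" for x
    by (simp add: Js_def Bs_def res_eqI[OF h, of "Linv x"])
  show "\<exists>x. z = Bs x + h *\<^sub>R x" for z
    using res[OF h, of z] by (intro exI[of _ "L (res h z)"]) (simp add: Bs_def)
  show "norm ((Js h ^^ n) x) \<le> Ms * norm x" for n x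
    by (rule order_trans[OF Js_pow_bound[OF h]]) (auto simp: Ms_def intro!: mult_right_mono)
  show "Suc n * norm ((Js h ^^ Suc n) x - (Js h ^^ n) x) \<le> Rs * norm x" for n x
    by (rule order_trans[OF Js_ritt[OF h]]) (auto simp: Rs_def intro!: mult_right_mono)
qed (simp_all add: Ms_def Rs_def)

text \<open>The resolvent equation is tested with its own solution: the form contributes a
  nonnegative real part, and Cauchy--Schwarz bounds the rest.\<close>

lemma JH_bound: assumes h: "h > 0" shows "norm (JH h x) \<le> norm x"
proof -
  define u where "u = res h (j x)"
  have "Re (antidual_apply (j (\<iota> u) + h *\<^sub>R L u) u) = Re (antidual_apply (j x) u)"
    by (simp add: u_def res[OF h])
  then have "(norm (\<iota> u))\<^sup>2 + h * Re (a u u) = Re (cinner x (\<iota> u))"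
    by (simp add: antidual_apply_add_left antidual_apply_scaleR_left j_apply L_apply Re_cinner_self)
  moreover have "Re (a u u) \<ge> 0" by (rule order_trans[OF _ a_elliptic]) (use pos in simp)
  ultimately have "(norm (\<iota> u))\<^sup>2 \<le> Re (cinner x (\<iota> u))"
    using h by (metis le_add_same_cancel1 mult_nonneg_nonneg less_imp_le)
  also have "\<dots> \<le> norm x * norm (\<iota> u)"
    by (rule order_trans[OF complex_Re_le_cmod cinner_Cauchy_Schwarz])
  finally have "norm (\<iota> u) \<le> norm x"
    by (cases "norm (\<iota> u) = 0") (auto simp: power2_eq_square)
  then show ?thesis by (simp add: JH_def u_def)
qed

sublocale H: hille_yosida BH JH 1
proof (intro hille_yosida.intro)
  show "clinear BH"
    using j_clinear \<iota>_clinear Linv_clinear by (simp add: BH_def clinear_def)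
  show "bounded_linear BH"
    unfolding BH_def by (rule bounded_linear_compose[OF \<iota>_bl bounded_linear_compose[OF Linv_bl j_bl]])
  show "inj BH"
    by (rule injI) (metis BH_def \<iota>_inj j_inj injD L_Linv)
  \<comment> \<open>Density in two stages: \<open>Linv\<close> carries the dense range of
    \<open>j\<close> to a dense subset of V, and \<open>\<iota>\<close> carries that to a dense
    subset of H.\<close>
  have "closure (range j) = UNIV"
    using j_\<iota>_dense closure_mono[of "range (\<lambda>v. j (\<iota> v))" "range j"] by auto
  then have "Linv (L v) \<in> closure (range (\<lambda>x. Linv (j x)))" for v
    by (intro bounded_linear_closure_mem[OF Linv_bl, of "range j"]) auto
  then have "\<iota> v \<in> closure (range BH)" for v
    by (intro bounded_linear_closure_mem[OF \<iota>_bl, of "range (\<lambda>x. Linv (j x))"]) (auto simp: BH_def)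
  then have "closure (range \<iota>) \<subseteq> closure (range BH)" by (intro closure_minimal) auto
  then show "closure (range BH) = UNIV" by (auto simp: \<iota>_dense)
  show "bounded_linear (\<lambda>x::'h. c *\<^sub>C x)" for c by (rule bounded_linear_scaleC)
  fix h :: real assume h: "h > 0"
  show "clinear (JH h)"
    using j_clinear \<iota>_clinear res_clinear[OF h] by (simp add: JH_def clinear_def)
  show "JH h (BH x + h *\<^sub>R x) = BH x" for x
    by (simp add: JH_def BH_def res_eqI[OF h, of "Linv (j x)"] linear_add[OF j_linear] linear_scale[OF j_linear])
  show "\<exists>x. z = BH x + h *\<^sub>R x" for z
  proof -
    define u where "u = res h (j z)"
    \<comment> \<open>Defined so that z = \<open>\<iota> u + h *\<^sub>R x\<close>; the resolvent
      equation then says \<open>j x = L u\<close>, that is \<open>BH x = \<iota> u\<close>.\<close>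
    define x where "x = (z - \<iota> u) /\<^sub>R h"
    have "j z - j (\<iota> u) = h *\<^sub>R L u" using res[OF h, of "j z"] by (simp add: u_def algebra_simps)
    then have "j x = L u"
      using h by (simp add: x_def linear_scale[OF j_linear] linear_diff[OF j_linear])
    then have "BH x = \<iota> u" by (simp add: BH_def)
    then show ?thesis using h by (intro exI[of _ x]) (simp add: x_def)
  qed
  show "norm ((JH h ^^ n) x) \<le> 1 * norm x" for n x
    by (induction n) (auto intro: order_trans[OF JH_bound[OF h]])
qed simp

section \<open>Identification of the two semigroups\<close>

lemma lax_milgram_H_eq: "lax_milgram_H \<iota> a = {(BH z, z) | z. True}"
proof -
  have "(\<forall>v. a u v = cinner f (\<iota> v)) \<longleftrightarrow> L u = j f" for u f
    by (metis L_apply j_apply antidual_eqI)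
  then have "(\<forall>v. a u v = cinner f (\<iota> v)) \<longleftrightarrow> u = Linv (j f)" for u f
    by (metis L_Linv Linv_L)
  then show ?thesis by (auto simp: lax_milgram_H_def BH_def)
qed

lemma lax_milgram_antidual_eq: "lax_milgram_antidual \<iota> a = {(Bs z, z) | z. True}"
proof -
  have "(j (\<iota> u), L u) = (Bs (L u), L u)" "(Bs z, z) = (j (\<iota> (Linv z)), L (Linv z))" for u z
    by (simp_all add: Bs_def)
  then show ?thesis unfolding lax_milgram_antidual_def by blast
qed

lemma semigroup_H_eq: "t \<ge> 0 \<Longrightarrow> semigroup_H \<iota> a t = H.S t"
  unfolding semigroup_H_def lax_milgram_H_eq by (rule ext) (rule H.exp_neg_eq)

lemma semigroup_antidual_eq: "t \<ge> 0 \<Longrightarrow> semigroup_antidual \<iota> a t = star.S t"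
  unfolding semigroup_antidual_def lax_milgram_antidual_eq by (rule ext) (rule star.exp_neg_eq)

text \<open>\<open>j\<close> intertwines the resolvents, hence the Euler iterates, hence their
  limits.\<close>

lemma j_HS: assumes t: "t \<ge> 0" shows "j (H.S t x) = star.S t (j x)"
proof (rule LIMSEQ_unique)
  have "j ((JH h ^^ n) x) = (Js h ^^ n) (j x)" for h n
    by (induction n) (simp_all add: JH_def Js_def)
  then have "j (H.E m t x) = star.E m t (j x)" for m
    by (simp add: H.E_def star.E_def H.steps_def star.steps_def)
  then show "(\<lambda>m. j (H.E m t x)) \<longlonglongrightarrow> star.S t (j x)" using star.S_lim[OF t, of "j x"] by simp
  show "(\<lambda>m. j (H.E m t x)) \<longlonglongrightarrow> j (H.S t x)"
    by (rule bounded_linear.tendsto[OF j_bl H.S_lim[OF t]])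
qed

lemma HS_inj: "t \<ge> 0 \<Longrightarrow> inj (H.S t)"
  by (rule injI) (metis j_HS star.S_inj j_inj injD)

end

section \<open>Strong integrals and square integrable functions\<close>

abbreviation "leb T \<equiv> lebesgue_on {0..T::real}"

lemma finite_measure_leb: "finite_measure (leb T)"
  by (rule finite_measure_lebesgue_on) simp

text \<open>Lebesgue measure is complete, so every part of an exceptional null set is measurable;
  the theorem on everywhere limits is applied to a modification that is constant on this
  set.\<close>

lemma borel_measurable_leb_AE_limit:
  fixes f :: "real \<Rightarrow> 'b::metric_space"
  assumes s: "\<And>i::nat. s i \<in> borel_measurable (leb T)" and lim: "AE t in leb T. (\<lambda>i. s i t) \<longlonglongrightarrow> f t"
  shows "f \<in> borel_measurable (leb T)"
proof -
  obtain N where N: "N \<in> null_sets (leb T)" "{t \<in> space (leb T). \<not> (\<lambda>i. s i t) \<longlonglongrightarrow> f t} \<subseteq> N"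
    using lim by (auto simp: eventually_ae_filter)
  define c where "c = (SOME c::'b. True)"
  define g where "g t = (if t \<in> N then c else f t)" for t
  have Nm: "N \<in> sets (leb T)" using N by auto
  have "(\<lambda>t. if t \<in> N then c else s i t) \<in> borel_measurable (leb T)" for i
    by (rule measurable_If_set) (use s Nm in auto)
  then have g: "g \<in> borel_measurable (leb T)"
    by (rule borel_measurable_LIMSEQ_metric) (use N(2) in \<open>auto simp: g_def\<close>)
  have sub: "A \<in> sets (leb T)" if "A \<subseteq> N" for A
  proof -
    have "N \<in> null_sets lebesgue" "N \<subseteq> {0..T}" using N(1) by (simp_all add: null_sets_restrict_space)
    then have "A \<in> sets lebesgue" using that by (meson null_sets_completion_subset null_setsD2)
    then show ?thesis using that \<open>N \<subseteq> {0..T}\<close> by (auto simp: sets_restrict_space_iff)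
  qed
  show ?thesis
  proof (rule measurableI)
    fix A :: "'b set" assume A: "A \<in> sets borel"
    have "f -` A \<inter> space (leb T) = (g -` A \<inter> space (leb T) - N) \<union> (f -` A \<inter> space (leb T) \<inter> N)"
      by (auto simp: g_def)
    also have "\<dots> \<in> sets (leb T)"
      by (rule sets.Un[OF sets.Diff[OF measurable_sets[OF g A] Nm] sub]) auto
    finally show "f -` A \<inter> space (leb T) \<in> sets (leb T)" .
  qed simp
qed

lemma strongly_measurable_imp_measurable:
  assumes "strongly_measurable (leb T) f"
  shows "f \<in> borel_measurable (leb T)"
  using assms unfolding strongly_measurable_def
  by (auto intro: borel_measurable_leb_AE_limit borel_measurable_simple_function)

text \<open>Dyadic rounding downwards. It maps [0,T] into itself with finitely many values and so
  turns a continuous dependence on t into simple functions.\<close>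

definition grid :: "nat \<Rightarrow> real \<Rightarrow> real" where "grid i t = of_int \<lfloor>t * 2 ^ i\<rfloor> / 2 ^ i"

lemma grid_le: "grid i t \<le> t" and grid_ge: "t - 1 / 2 ^ i \<le> grid i t"
proof -
  have "of_int \<lfloor>t * 2 ^ i\<rfloor> \<le> t * 2 ^ i" "t * 2 ^ i - 1 \<le> of_int \<lfloor>t * 2 ^ i\<rfloor>" by linarith+
  then have "of_int \<lfloor>t * 2 ^ i\<rfloor> / 2 ^ i \<le> t * 2 ^ i / 2 ^ i" "(t * 2 ^ i - 1) / 2 ^ i \<le> of_int \<lfloor>t * 2 ^ i\<rfloor> / 2 ^ i"
    by (intro divide_right_mono; simp)+
  then show "grid i t \<le> t" "t - 1 / 2 ^ i \<le> grid i t" by (simp_all add: grid_def diff_divide_distrib)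
qed

lemma grid_mem: "t \<in> {0..T} \<Longrightarrow> grid i t \<in> {0..T}"
  using grid_le[of i t] by (auto simp: grid_def intro: order_trans)

lemma grid_tendsto: "(\<lambda>i. grid i t) \<longlonglongrightarrow> t"
proof (rule tendsto_sandwich[of "\<lambda>i. t - (1/2) ^ i" _ _ "\<lambda>_. t"])
  have "(\<lambda>m. t - (1/2) ^ m) \<longlonglongrightarrow> t - 0" by (intro tendsto_intros LIMSEQ_realpow_zero) auto
  then show "(\<lambda>m. t - (1/2) ^ m) \<longlonglongrightarrow> t" by simp
qed (use grid_le[of _ t] grid_ge[of t] in \<open>auto simp: power_one_over intro!: always_eventually\<close>)

lemma simple_function_grid: "simple_function (leb T) (grid i)"
proof (rule simple_function_borel_measurable)
  have "grid i \<in> borel_measurable borel" unfolding grid_def by measurable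
  then show "grid i \<in> borel_measurable (leb T)"
    by (simp add: measurable_completion measurable_restrict_space1)
  have "grid i ` {0..T} \<subseteq> (\<lambda>k. of_int k / 2 ^ i) ` {0..\<lfloor>T * 2 ^ i\<rfloor>}"
    by (auto simp: grid_def intro!: imageI floor_mono mult_right_mono)
  then have "finite (grid i ` {0..T})" by (rule finite_subset) simp
  then show "finite (grid i ` space (leb T))" by simp
qed

text \<open>Simple approximants are inserted for f and g and dyadic rounding for t; the composition
  is again simple and converges by continuity.\<close>

lemma strongly_measurable_compose:
  assumes f: "strongly_measurable (leb T) f" and g: "strongly_measurable (leb T) g"
    and G: "continuous_on ({0..T} \<times> UNIV \<times> UNIV) (\<lambda>(t, x, y). G t x y)"
  shows "strongly_measurable (leb T) (\<lambda>t. G t (f t) (g t))"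
proof -
  from f obtain s where s: "\<And>i::nat. simple_function (leb T) (s i)" "AE t in leb T. (\<lambda>i. s i t) \<longlonglongrightarrow> f t"
    unfolding strongly_measurable_def by blast
  from g obtain r where r: "\<And>i::nat. simple_function (leb T) (r i)" "AE t in leb T. (\<lambda>i. r i t) \<longlonglongrightarrow> g t"
    unfolding strongly_measurable_def by blast
  show ?thesis
    unfolding strongly_measurable_def
  proof (intro exI[of _ "\<lambda>i t. (\<lambda>t' (x, y). G t' x y) (grid i t) (s i t, r i t)"] conjI allI)
    show "simple_function (leb T) (\<lambda>t. (\<lambda>t' (x, y). G t' x y) (grid i t) (s i t, r i t))" for i
      by (rule simple_function_compose2[OF simple_function_grid simple_function_Pair[OF s(1) r(1)]])
    show "AE t in leb T. (\<lambda>i. (\<lambda>t' (x, y). G t' x y) (grid i t) (s i t, r i t)) \<longlonglongrightarrow> G t (f t) (g t)"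
      using s(2) r(2) AE_space
    proof eventually_elim
      fix t assume t: "(\<lambda>i. s i t) \<longlonglongrightarrow> f t" "(\<lambda>i. r i t) \<longlonglongrightarrow> g t" "t \<in> space (leb T)"
      have "(\<lambda>i. (\<lambda>(t, x, y). G t x y) (grid i t, s i t, r i t)) \<longlonglongrightarrow> (\<lambda>(t, x, y). G t x y) (t, f t, g t)"
        by (rule continuous_on_tendsto_compose[OF G])
          (use t grid_mem[of t T] in \<open>auto intro!: tendsto_intros grid_tendsto always_eventually\<close>)
      then show "(\<lambda>i. (\<lambda>t' (x, y). G t' x y) (grid i t) (s i t, r i t)) \<longlonglongrightarrow> G t (f t) (g t)" by simp
    qed
  qed
qed

lemma strongly_measurable_const: "strongly_measurable M (\<lambda>_. c)"
  unfolding strongly_measurable_def by (intro exI[of _ "\<lambda>_ _. c"]) simp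

lemma strongly_measurable_simple: "simple_function M f \<Longrightarrow> strongly_measurable M f"
  unfolding strongly_measurable_def by (intro exI[of _ "\<lambda>_. f"]) simp

lemma strongly_measurable_cong_AE:
  assumes "strongly_measurable M f" "AE t in M. f t = g t"
  shows "strongly_measurable M g"
proof -
  obtain s where s: "\<And>i::nat. simple_function M (s i)" "AE t in M. (\<lambda>i. s i t) \<longlonglongrightarrow> f t"
    using assms(1) unfolding strongly_measurable_def by blast
  have "AE t in M. (\<lambda>i. s i t) \<longlonglongrightarrow> g t"
    using s(2) assms(2) by eventually_elim simp
  then show ?thesis using s(1) unfolding strongly_measurable_def by blast
qed

lemma strongly_measurable_continuous:
  fixes g :: "real \<Rightarrow> 'c::real_normed_vector"
  assumes "continuous_on {0..T} g"
  shows "strongly_measurable (leb T) g"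
proof -
  have "continuous_on ({0..T} \<times> UNIV \<times> UNIV) (\<lambda>(t, x::real, y::real). g t)"
    unfolding case_prod_unfold by (rule continuous_on_compose2[OF assms]) (auto intro: continuous_intros)
  from strongly_measurable_compose[OF strongly_measurable_const[of _ 0] strongly_measurable_const[of _ 0] this]
  show ?thesis .
qed

lemma strongly_measurable_compose1:
  assumes f: "strongly_measurable (leb T) f"
    and G: "continuous_on ({0..T} \<times> UNIV) (\<lambda>(t, x). G t x)"
  shows "strongly_measurable (leb T) (\<lambda>t. G t (f t))"
proof -
  have "continuous_on ({0..T} \<times> UNIV \<times> UNIV) (\<lambda>p. (\<lambda>(t, x). G t x) ((\<lambda>(t, x, y::real). (t, x)) p))"
    by (rule continuous_on_compose2[OF G]) (auto simp: case_prod_unfold intro!: continuous_intros)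
  then have "continuous_on ({0..T} \<times> UNIV \<times> UNIV) (\<lambda>(t, x, y::real). G t x)"
    by (simp add: case_prod_unfold)
  from strongly_measurable_compose[OF f strongly_measurable_const[of _ 0] this]
  show ?thesis .
qed

lemma strongly_measurable_bounded_linear:
  assumes f: "strongly_measurable (leb T) f" and F: "bounded_linear F"
  shows "strongly_measurable (leb T) (\<lambda>t. F (f t))"
proof (rule strongly_measurable_compose1[OF f])
  show "continuous_on ({0..T} \<times> UNIV) (\<lambda>(t, x). F x)"
    unfolding case_prod_unfold by (intro bounded_linear.continuous_on[OF F] continuous_intros)
qed

lemma strongly_measurable_add:
  assumes f: "strongly_measurable (leb T) f" and g: "strongly_measurable (leb T) g"
  shows "strongly_measurable (leb T) (\<lambda>t. f t + g t)"
  by (rule strongly_measurable_compose[OF f g]) (auto simp: case_prod_unfold intro!: continuous_intros)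

lemma strongly_measurable_diff:
  assumes f: "strongly_measurable (leb T) f" and g: "strongly_measurable (leb T) g"
  shows "strongly_measurable (leb T) (\<lambda>t. f t - g t)"
  by (rule strongly_measurable_compose[OF f g]) (auto simp: case_prod_unfold intro!: continuous_intros)

text \<open>By uniform continuity each \<open>u n\<close> is within 1/(n+1) of its own composition
  with a sufficiently fine rounding, and these simple functions have the same limit.\<close>

lemma strongly_measurable_limit_continuous:
  assumes u: "\<And>n::nat. continuous_on {0..T} (u n)" and lim: "AE t in leb T. (\<lambda>n. u n t) \<longlonglongrightarrow> f t"
  shows "strongly_measurable (leb T) f"
proof -
  have "\<exists>i. \<forall>t\<in>{0..T}. dist (u n (grid i t)) (u n t) < 1 / Suc n" for n
  proof -
    have "uniformly_continuous_on {0..T} (u n)"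
      by (rule compact_uniformly_continuous[OF u]) simp
    then obtain d where d: "d > 0" "\<And>x y. x \<in> {0..T} \<Longrightarrow> y \<in> {0..T} \<Longrightarrow> dist x y < d \<Longrightarrow> dist (u n x) (u n y) < 1 / Suc n"
      unfolding uniformly_continuous_on_def by (metis divide_pos_pos of_nat_0_less_iff zero_less_Suc zero_less_one)
    obtain i where i: "(1/2) ^ i < d" using d(1) real_arch_pow_inv[of d "1/2"] by auto
    have "dist (grid i t) t < d" for t
      using grid_le[of i t] grid_ge[of t i] i by (simp add: dist_real_def power_one_over)
    then show ?thesis using d(2) grid_mem[of _ T] by blast
  qed
  then obtain i where i: "\<And>n t. t \<in> {0..T} \<Longrightarrow> dist (u n (grid (i n) t)) (u n t) < 1 / Suc n" by metis
  show ?thesis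
    unfolding strongly_measurable_def
  proof (intro exI[of _ "\<lambda>n t. u n (grid (i n) t)"] conjI allI)
    show "simple_function (leb T) (\<lambda>t. u n (grid (i n) t))" for n
      by (rule simple_function_compose1[OF simple_function_grid])
    show "AE t in leb T. (\<lambda>n. u n (grid (i n) t)) \<longlonglongrightarrow> f t"
      using lim AE_space
    proof eventually_elim
      fix t assume t: "(\<lambda>n. u n t) \<longlonglongrightarrow> f t" "t \<in> space (leb T)"
      have "(\<lambda>n. dist (u n (grid (i n) t)) (u n t)) \<longlonglongrightarrow> 0"
        by (rule tendsto_sandwich[OF _ _ tendsto_const LIMSEQ_inverse_real_of_nat[unfolded inverse_eq_divide]])
          (use i t in \<open>auto intro!: always_eventually less_imp_le\<close>)
      then have "(\<lambda>n. u n (grid (i n) t) - u n t) \<longlonglongrightarrow> 0"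
        by (simp add: dist_norm tendsto_norm_zero_iff)
      from tendsto_add[OF this t(1)] show "(\<lambda>n. u n (grid (i n) t)) \<longlonglongrightarrow> f t" by simp
    qed
  qed
qed

text \<open>Values larger than twice the norm of f are replaced by 0. Where f is not 0 the factor 2
  makes the truncation inactive in the end; where f is 0 the approximants vanish.\<close>

lemma strongly_measurable_dominated_approx:
  assumes f: "strongly_measurable (leb T) f"
  obtains s where "\<And>i::nat. simple_function (leb T) (s i)" "\<And>i t. norm (s i t) \<le> 2 * norm (f t)"
    "AE t in leb T. (\<lambda>i. s i t) \<longlonglongrightarrow> f t"
proof -
  from f obtain s where s: "\<And>i::nat. simple_function (leb T) (s i)" "AE t in leb T. (\<lambda>i. s i t) \<longlonglongrightarrow> f t"
    unfolding strongly_measurable_def by blast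
  define r where "r i t = (if norm (s i t) \<le> 2 * norm (f t) then s i t else 0)" for i t
  have [measurable]: "f \<in> borel_measurable (leb T)" "\<And>i. s i \<in> borel_measurable (leb T)"
    using strongly_measurable_imp_measurable[OF f] s(1) by (auto intro: borel_measurable_simple_function)
  have P: "{t \<in> space (leb T). norm (s i t) \<le> 2 * norm (f t)} \<in> sets (leb T)" for i
    by measurable
  show thesis
  proof (rule that)
    show "simple_function (leb T) (r i)" for i
      unfolding r_def by (rule simple_function_If[OF s(1) _ P]) simp
    show "norm (r i t) \<le> 2 * norm (f t)" for i t by (simp add: r_def)
    show "AE t in leb T. (\<lambda>i. r i t) \<longlonglongrightarrow> f t"
      using s(2)
    proof eventually_elim
      fix t assume t: "(\<lambda>i. s i t) \<longlonglongrightarrow> f t"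
      show "(\<lambda>i. r i t) \<longlonglongrightarrow> f t"
      proof (cases "f t = 0")
        case True
        then have "r i t = 0" for i by (simp add: r_def)
        then show ?thesis using True by simp
      next
        case False
        have "\<forall>\<^sub>F i in sequentially. norm (s i t) < 2 * norm (f t)"
          by (rule order_tendstoD(2)[OF tendsto_norm[OF t]]) (use False in simp)
        then have "\<forall>\<^sub>F i in sequentially. s i t = r i t" by eventually_elim (simp add: r_def)
        then show ?thesis by (rule Lim_transform_eventually[OF t])
      qed
    qed
  qed
qed

section \<open>Square integrable functions\<close>

lemma integrable_leb_continuous:
  fixes g :: "real \<Rightarrow> 'b::euclidean_space"
  shows "continuous_on {0..T} g \<Longrightarrow> integrable (leb T) g"
  by (rule continuous_imp_integrable_real)

lemma L2_strongly_measurable: "L2 T f \<Longrightarrow> strongly_measurable (leb T) f"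
  and L2_integrable_sq: "L2 T f \<Longrightarrow> integrable (leb T) (\<lambda>t. (norm (f t))\<^sup>2)"
  by (simp_all add: L2_def)

lemma L2_measurable: "L2 T f \<Longrightarrow> f \<in> borel_measurable (leb T)"
  by (rule strongly_measurable_imp_measurable[OF L2_strongly_measurable])

lemma L2_integrable_norm:
  assumes f: "L2 T f" shows "integrable (leb T) (\<lambda>t. norm (f t))"
proof (rule Bochner_Integration.integrable_bound)
  show "integrable (leb T) (\<lambda>t. 1 + (norm (f t))\<^sup>2)"
    using L2_integrable_sq[OF f] by (intro Bochner_Integration.integrable_add) (simp_all add: integrable_leb_continuous)
  show "(\<lambda>t. norm (f t)) \<in> borel_measurable (leb T)" using L2_measurable[OF f] by measurable
  have "norm (f t) \<le> 1 + (norm (f t))\<^sup>2" for t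
  proof -
    have "2 * norm (f t) \<le> 1 + (norm (f t))\<^sup>2"
      using zero_le_power2[of "norm (f t) - 1"] by (simp add: power2_diff)
    then show ?thesis using norm_ge_zero[of "f t"] by linarith
  qed
  then show "AE t in leb T. norm (norm (f t)) \<le> norm (1 + (norm (f t))\<^sup>2)" by simp
qed

lemma L2_bound:
  assumes "strongly_measurable (leb T) g" and h: "integrable (leb T) h" and b: "AE t in leb T. (norm (g t))\<^sup>2 \<le> h t"
  shows "L2 T g"
  unfolding L2_def
proof (intro conjI assms(1) Bochner_Integration.integrable_bound[OF h])
  show "(\<lambda>t. (norm (g t))\<^sup>2) \<in> borel_measurable (leb T)"
    using strongly_measurable_imp_measurable[OF assms(1)] by measurable
  show "AE t in leb T. norm ((norm (g t))\<^sup>2) \<le> norm (h t)" using b by eventually_elim auto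
qed

lemma L2_bounded_linear:
  assumes f: "L2 T f" and F: "bounded_linear F"
  shows "L2 T (\<lambda>t. F (f t))"
proof -
  obtain K where K: "\<And>x. norm (F x) \<le> norm x * K" using bounded_linear.bounded[OF F] by blast
  show ?thesis
  proof (rule L2_bound[OF strongly_measurable_bounded_linear[OF L2_strongly_measurable[OF f] F]])
    show "integrable (leb T) (\<lambda>t. (norm (f t))\<^sup>2 * K\<^sup>2)" using L2_integrable_sq[OF f] by simp
    have "(norm (F (f t)))\<^sup>2 \<le> (norm (f t))\<^sup>2 * K\<^sup>2" for t
      using power_mono[OF K[of "f t"] norm_ge_zero, of 2] by (simp add: power_mult_distrib)
    then show "AE t in leb T. (norm (F (f t)))\<^sup>2 \<le> (norm (f t))\<^sup>2 * K\<^sup>2" by simp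
  qed
qed

lemma norm_add_sq_le: "(norm (x + y))\<^sup>2 \<le> 2 * (norm x)\<^sup>2 + 2 * (norm (y::'a::real_normed_vector))\<^sup>2"
proof -
  have "(norm (x + y))\<^sup>2 \<le> (norm x + norm y)\<^sup>2" by (intro power_mono norm_triangle_ineq) simp
  moreover have "0 \<le> (norm x - norm y)\<^sup>2" by simp
  ultimately show ?thesis unfolding power2_sum power2_diff by argo
qed

lemma L2_add:
  assumes f: "L2 T f" and g: "L2 T g"
  shows "L2 T (\<lambda>t. f t + g t)"
proof (rule L2_bound[OF strongly_measurable_add[OF L2_strongly_measurable[OF f] L2_strongly_measurable[OF g]]])
  show "integrable (leb T) (\<lambda>t. 2 * (norm (f t))\<^sup>2 + 2 * (norm (g t))\<^sup>2)"
    using L2_integrable_sq[OF f] L2_integrable_sq[OF g] by simp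
qed (simp add: norm_add_sq_le)

lemma L2_uminus: "L2 T f \<Longrightarrow> L2 T (\<lambda>t. - f t)"
  by (rule L2_bounded_linear[of T f uminus]) (auto intro: bounded_linear_minus bounded_linear_ident)

lemma L2_diff: "L2 T f \<Longrightarrow> L2 T g \<Longrightarrow> L2 T (\<lambda>t. f t - g t)"
  using L2_add[OF _ L2_uminus, of T f g] by simp

lemma L2_continuous:
  assumes "continuous_on {0..T} f"
  shows "L2 T f"
  unfolding L2_def using assms
  by (auto intro!: strongly_measurable_continuous integrable_leb_continuous continuous_intros)

lemma L2_cong_AE: "L2 T f \<Longrightarrow> AE t in leb T. f t = g t \<Longrightarrow> L2 T g"
proof (rule L2_bound[where h = "\<lambda>t. (norm (f t))\<^sup>2"])
  assume "L2 T f" "AE t in leb T. f t = g t"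
  then show "strongly_measurable (leb T) g" "integrable (leb T) (\<lambda>t. (norm (f t))\<^sup>2)"
    by (auto intro: strongly_measurable_cong_AE L2_strongly_measurable L2_integrable_sq)
qed auto

lemma bounded_bilinear_scaleC_antidual: "bounded_bilinear (\<lambda>c (x::'v::complex_inner antidual). c *\<^sub>C x)"
proof (rule bounded_bilinear.intro)
  fix a b :: complex and x y :: "'v antidual" and r :: real
  show "(a + b) *\<^sub>C x = a *\<^sub>C x + b *\<^sub>C x" by (rule scaleC_add_left)
  show "a *\<^sub>C (x + y) = a *\<^sub>C x + a *\<^sub>C y" by (rule scaleC_add_right)
  show "(r *\<^sub>R a) *\<^sub>C x = r *\<^sub>R a *\<^sub>C x"
    by (simp add: scaleR_scaleC[of r "a *\<^sub>C x"] scaleC_scaleC scaleR_conv_of_real)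
  show "a *\<^sub>C r *\<^sub>R x = r *\<^sub>R a *\<^sub>C x" by (rule scaleC_scaleR_commute)
  show "\<exists>K. \<forall>(a::complex) (b::'v antidual). norm (a *\<^sub>C b) \<le> norm a * norm b * K"
    by (rule exI[of _ 1]) (simp add: norm_antidual_scaleC)
qed

lemma L2_mult_continuous:
  fixes f :: "real \<Rightarrow> 'v::complex_inner antidual"
  assumes f: "L2 T f" and p: "continuous_on {0..T} \<phi>"
  shows "L2 T (\<lambda>t. \<phi> t *\<^sub>C f t)"
proof -
  have "bounded (\<phi> ` {0..T})" by (rule compact_imp_bounded[OF compact_continuous_image[OF p]]) simp
  then obtain K where K: "\<And>t. t \<in> {0..T} \<Longrightarrow> cmod (\<phi> t) \<le> K"
    unfolding bounded_iff by (metis imageI)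
  show ?thesis
  proof (rule L2_bound)
    have "continuous_on ({0..T} \<times> UNIV) (\<lambda>x. \<phi> (fst x) *\<^sub>C (snd x :: 'v antidual))"
      by (rule bounded_bilinear.continuous_on[OF bounded_bilinear_scaleC_antidual
            continuous_on_compose2[OF p continuous_on_fst[OF continuous_on_id]] continuous_on_snd[OF continuous_on_id]]) auto
    then have "continuous_on ({0..T} \<times> UNIV) (\<lambda>(t, x::'v antidual). \<phi> t *\<^sub>C x)"
      by (simp add: case_prod_unfold)
    then show "strongly_measurable (leb T) (\<lambda>t. \<phi> t *\<^sub>C f t)"
      by (rule strongly_measurable_compose1[OF L2_strongly_measurable[OF f]])
    show "integrable (leb T) (\<lambda>t. K\<^sup>2 * (norm (f t))\<^sup>2)" using L2_integrable_sq[OF f] by simp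
    have "(norm (\<phi> t *\<^sub>C f t))\<^sup>2 \<le> K\<^sup>2 * (norm (f t))\<^sup>2" if "t \<in> {0..T}" for t
    proof -
      have "norm (\<phi> t *\<^sub>C f t) \<le> K * norm (f t)"
        by (rule order_trans[OF norm_antidual_scaleC]) (use K[OF that] in \<open>auto intro: mult_right_mono\<close>)
      from power_mono[OF this norm_ge_zero, of 2] show ?thesis by (simp add: power_mult_distrib)
    qed
    then show "AE t in leb T. (norm (\<phi> t *\<^sub>C f t))\<^sup>2 \<le> K\<^sup>2 * (norm (f t))\<^sup>2" by (auto intro!: AE_I2)
  qed
qed

text \<open>Pairing with v commutes with integrals of simple functions and multiplies errors by at
  most \<open>norm v\<close>, so strong integrals reduce to scalar Bochner integrals.\<close>

lemma has_strong_integral_apply: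
  fixes f :: "real \<Rightarrow> 'v::complex_inner antidual"
  assumes "has_strong_integral (leb T) f y"
  shows "has_bochner_integral (leb T) (\<lambda>t. antidual_apply (f t) v) (antidual_apply y v)"
proof -
  from assms obtain s where f: "strongly_measurable (leb T) f"
    and s: "\<And>i::nat. Bochner_Integration.simple_bochner_integrable (leb T) (s i)"
      "(\<lambda>i. \<integral>\<^sup>+t. norm (f t - s i t) \<partial>leb T) \<longlonglongrightarrow> 0"
      "(\<lambda>i. Bochner_Integration.simple_bochner_integral (leb T) (s i)) \<longlonglongrightarrow> y"
    unfolding has_strong_integral_def by blast
  note bl = bounded_linear_antidual_apply[of v]
  show ?thesis
  proof (rule has_bochner_integral.intros)
    show "(\<lambda>t. antidual_apply (f t) v) \<in> borel_measurable (leb T)"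
      by (rule measurable_compose[OF strongly_measurable_imp_measurable[OF f]])
        (auto intro!: borel_measurable_continuous_onI bounded_linear.continuous_on[OF bl] continuous_intros)
    show "Bochner_Integration.simple_bochner_integrable (leb T) (\<lambda>t. antidual_apply (s i t) v)" for i
      by (rule simple_bochner_integrable_compose2[where p = "\<lambda>x y. antidual_apply x v", OF _ s(1) s(1)]) simp
    show "(\<lambda>i. \<integral>\<^sup>+t. norm (antidual_apply (f t) v - antidual_apply (s i t) v) \<partial>leb T) \<longlonglongrightarrow> 0"
    proof (rule tendsto_sandwich[where f = "\<lambda>_. 0"])
      show "\<forall>\<^sub>F i in sequentially. (\<integral>\<^sup>+t. norm (antidual_apply (f t) v - antidual_apply (s i t) v) \<partial>leb T) \<le>
          norm v * (\<integral>\<^sup>+t. norm (f t - s i t) \<partial>leb T)"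
      proof (intro always_eventually allI)
        fix i
        have m: "(\<lambda>t. f t - s i t) \<in> borel_measurable (leb T)"
          using s(1)[of i] by (intro strongly_measurable_imp_measurable strongly_measurable_diff f strongly_measurable_simple)
            (auto elim: simple_bochner_integrable.cases)
        have "(\<integral>\<^sup>+t. norm (antidual_apply (f t) v - antidual_apply (s i t) v) \<partial>leb T) \<le> (\<integral>\<^sup>+t. ennreal (norm v) * norm (f t - s i t) \<partial>leb T)"
        proof (rule nn_integral_mono)
          fix t
          show "ennreal (norm (antidual_apply (f t) v - antidual_apply (s i t) v)) \<le> ennreal (norm v) * ennreal (norm (f t - s i t))"
            using norm_antidual_apply[of "f t - s i t" v]
            by (simp add: antidual_apply_diff_left ennreal_mult[symmetric] mult.commute ennreal_leI)
        qed
        also have "\<dots> = norm v * (\<integral>\<^sup>+t. norm (f t - s i t) \<partial>leb T)"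
          using m by (intro nn_integral_cmult) measurable
        finally show "(\<integral>\<^sup>+t. norm (antidual_apply (f t) v - antidual_apply (s i t) v) \<partial>leb T) \<le>
          norm v * (\<integral>\<^sup>+t. norm (f t - s i t) \<partial>leb T)" .
      qed
      show "(\<lambda>i. norm v * (\<integral>\<^sup>+t. norm (f t - s i t) \<partial>leb T)) \<longlonglongrightarrow> 0"
        using ennreal_tendsto_cmult[OF _ s(2), of "ennreal (norm v)"] by simp
    qed auto
    show "(\<lambda>i. Bochner_Integration.simple_bochner_integral (leb T) (\<lambda>t. antidual_apply (s i t) v)) \<longlonglongrightarrow> antidual_apply y v"
      using bounded_linear.tendsto[OF bl s(3)]
      by (simp add: simple_bochner_integral_linear[OF bounded_linear.linear[OF bl] s(1)])
  qed
qed

lemma strong_integral_eqI: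
  fixes f :: "real \<Rightarrow> 'v::complex_inner antidual"
  assumes "has_strong_integral (leb T) f y"
  shows "strong_integral (leb T) f = y"
  unfolding strong_integral_def
proof (rule the_equality)
  show "has_strong_integral (leb T) f y" by (rule assms)
  fix z assume "has_strong_integral (leb T) f z"
  then show "z = y"
    using assms has_strong_integral_apply has_bochner_integral_eq by (blast intro: antidual_eqI)
qed

text \<open>The value is first defined weakly, as the functional that integrates the pairing with v;
  the integral of \<open>norm (f t)\<close> bounds it. Convergence of the simple integrals is then
  an estimate of functionals.\<close>

lemma has_strong_integral_exists:
  fixes f :: "real \<Rightarrow> 'v::complex_inner antidual"
  assumes f: "strongly_measurable (leb T) f" and int: "integrable (leb T) (\<lambda>t. norm (f t))"
  shows "\<exists>y. has_strong_integral (leb T) f y"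
proof -
  interpret finite_measure "leb T" by (rule finite_measure_leb)
  note bl = bounded_linear_antidual_apply
  have m: "(\<lambda>t. antidual_apply (f t) v) \<in> borel_measurable (leb T)" for v
      by (rule measurable_compose[OF strongly_measurable_imp_measurable[OF f]])
        (auto intro!: borel_measurable_continuous_onI bounded_linear.continuous_on[OF bl] continuous_intros)
  have intf: "integrable (leb T) (\<lambda>t. antidual_apply (f t) v)" for v
  proof (rule Bochner_Integration.integrable_bound[OF _ m])
    show "integrable (leb T) (\<lambda>t. norm (f t) * norm v)" using int by simp
  qed (simp add: norm_antidual_apply)
  define g where "g v = (\<integral>t. antidual_apply (f t) v \<partial>leb T)" for v
  define y where "y = antidual_of g"
  have y: "antidual_apply y = g"
    unfolding y_def
  proof (rule antidual_apply_antidual_of)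
    show "g (v + w) = g v + g w" for v w
      unfolding g_def antidual_apply_add_right by (rule Bochner_Integration.integral_add[OF intf intf])
    show "g (c *\<^sub>C v) = cnj c * g v" for c v
      unfolding g_def antidual_apply_scaleC_right by simp
    show "norm (g v) \<le> (\<integral>t. norm (f t) \<partial>leb T) * norm v" for v
    proof -
      have "norm (g v) \<le> (\<integral>t. norm (f t) * norm v \<partial>leb T)"
        unfolding g_def by (rule Bochner_Integration.integral_norm_bound_integral[OF intf]) (use int in \<open>auto simp: norm_antidual_apply\<close>)
      then show ?thesis by simp
    qed
  qed
  obtain s where s: "\<And>i::nat. simple_function (leb T) (s i)" "\<And>i t. norm (s i t) \<le> 2 * norm (f t)"
    "AE t in leb T. (\<lambda>i. s i t) \<longlonglongrightarrow> f t"
    using strongly_measurable_dominated_approx[OF f] by blast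
  have sb: "Bochner_Integration.simple_bochner_integrable (leb T) (s i)" for i
    by (rule simple_bochner_integrable.intros) (use s(1) in auto)
  have dm: "(\<lambda>t. f t - s i t) \<in> borel_measurable (leb T)" for i
    using s(1)[of i] by (intro strongly_measurable_imp_measurable strongly_measurable_diff f strongly_measurable_simple)
  have di: "integrable (leb T) (\<lambda>t. norm (f t - s i t))" for i
  proof (rule Bochner_Integration.integrable_bound)
    show "integrable (leb T) (\<lambda>t. 3 * norm (f t))" using int by simp
    show "(\<lambda>t. norm (f t - s i t)) \<in> borel_measurable (leb T)" using dm[of i] by measurable
    have "norm (f t - s i t) \<le> 3 * norm (f t)" for t
      using norm_triangle_ineq4[of "f t" "s i t"] s(2)[of i t] by linarith
    then show "AE t in leb T. norm (norm (f t - s i t)) \<le> norm (3 * norm (f t))" by simp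
  qed
  have lim: "(\<lambda>i. \<integral>t. norm (f t - s i t) \<partial>leb T) \<longlonglongrightarrow> (\<integral>t. 0 \<partial>leb T)"
  proof (rule integral_dominated_convergence)
    show "integrable (leb T) (\<lambda>t. 3 * norm (f t))" using int by simp
    show "(\<lambda>t. norm (f t - s i t)) \<in> borel_measurable (leb T)" for i using dm[of i] by measurable
    show "AE t in leb T. (\<lambda>i. norm (f t - s i t)) \<longlonglongrightarrow> 0"
      using s(3)
    proof eventually_elim
      fix t assume "(\<lambda>i. s i t) \<longlonglongrightarrow> f t"
      from tendsto_norm[OF tendsto_diff[OF tendsto_const[of "f t"] this]]
      show "(\<lambda>i. norm (f t - s i t)) \<longlonglongrightarrow> 0" by simp
    qed
    have "norm (f t - s i t) \<le> 3 * norm (f t)" for t i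
      using norm_triangle_ineq4[of "f t" "s i t"] s(2)[of i t] by linarith
    then show "AE t in leb T. norm (norm (f t - s i t)) \<le> 3 * norm (f t)" for i by simp
  qed simp
  have "(\<lambda>i. Bochner_Integration.simple_bochner_integral (leb T) (s i)) \<longlonglongrightarrow> y"
  proof (rule LIM_zero_cancel, rule Lim_null_comparison)
    show "(\<lambda>i. \<integral>t. norm (f t - s i t) \<partial>leb T) \<longlonglongrightarrow> 0" using lim by simp
    have "norm (Bochner_Integration.simple_bochner_integral (leb T) (s i) - y) \<le> (\<integral>t. norm (f t - s i t) \<partial>leb T)" for i
    proof (rule norm_antidual_le)
      fix v
      have sbv: "Bochner_Integration.simple_bochner_integrable (leb T) (\<lambda>t. antidual_apply (s i t) v)"
        by (rule simple_bochner_integrable_compose2[where p = "\<lambda>x y. antidual_apply x v", OF _ sb sb]) simp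
      have "antidual_apply (Bochner_Integration.simple_bochner_integral (leb T) (s i)) v =
          (\<integral>t. antidual_apply (s i t) v \<partial>leb T)"
        unfolding simple_bochner_integral_linear[OF bounded_linear.linear[OF bl] sb, symmetric]
        by (rule simple_bochner_integrable_eq_integral[OF sbv])
      then have "antidual_apply (Bochner_Integration.simple_bochner_integral (leb T) (s i) - y) v =
          (\<integral>t. antidual_apply (s i t) v - antidual_apply (f t) v \<partial>leb T)"
        using intf[of v] has_bochner_integral_simple_bochner_integrable[OF sbv]
        by (simp add: antidual_apply_diff_left y g_def has_bochner_integral_iff)
      also have "norm \<dots> \<le> (\<integral>t. norm (f t - s i t) * norm v \<partial>leb T)"
      proof (rule Bochner_Integration.integral_norm_bound_integral)
        show "integrable (leb T) (\<lambda>t. antidual_apply (s i t) v - antidual_apply (f t) v)"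
          using intf[of v] has_bochner_integral_simple_bochner_integrable[OF sbv] by (simp add: has_bochner_integral_iff)
        show "norm (antidual_apply (s i t) v - antidual_apply (f t) v) \<le> norm (f t - s i t) * norm v" for t
          using norm_antidual_apply[of "f t - s i t" v]
          by (simp add: antidual_apply_diff_left norm_minus_commute)
      qed (use di in simp)
      finally show "cmod (antidual_apply (Bochner_Integration.simple_bochner_integral (leb T) (s i) - y) v) \<le> (\<integral>t. norm (f t - s i t) \<partial>leb T) * norm v"
        by simp
    qed simp
    then show "\<forall>\<^sub>F i in sequentially. norm (Bochner_Integration.simple_bochner_integral (leb T) (s i) - y) \<le> (\<integral>t. norm (f t - s i t) \<partial>leb T)"
      by simp
  qed
  moreover have "(\<lambda>i. \<integral>\<^sup>+t. norm (f t - s i t) \<partial>leb T) \<longlonglongrightarrow> 0"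
  proof -
    have "(\<integral>\<^sup>+t. norm (f t - s i t) \<partial>leb T) = ennreal (\<integral>t. norm (f t - s i t) \<partial>leb T)" for i
      by (rule nn_integral_eq_integral[OF di]) simp
    then show ?thesis using tendsto_ennrealI[OF lim] by simp
  qed
  ultimately show ?thesis
    unfolding has_strong_integral_def using f sb by blast
qed

lemma strong_integral_apply:
  fixes f :: "real \<Rightarrow> 'v::complex_inner antidual"
  assumes f: "strongly_measurable (leb T) f" "integrable (leb T) (\<lambda>t. norm (f t))"
  shows "antidual_apply (strong_integral (leb T) f) v = (\<integral>t. antidual_apply (f t) v \<partial>leb T)"
    and "integrable (leb T) (\<lambda>t. antidual_apply (f t) v)"
proof -
  obtain y where y: "has_strong_integral (leb T) f y" using has_strong_integral_exists[OF f] by blast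
  have "strong_integral (leb T) f = y" by (rule strong_integral_eqI[OF y])
  then show "antidual_apply (strong_integral (leb T) f) v = (\<integral>t. antidual_apply (f t) v \<partial>leb T)"
    and "integrable (leb T) (\<lambda>t. antidual_apply (f t) v)"
    using has_strong_integral_apply[OF y, of v] by (auto simp: has_bochner_integral_iff)
qed

lemma L2_integrable_apply:
  fixes f :: "real \<Rightarrow> 'v::complex_inner antidual"
  shows "L2 T f \<Longrightarrow> integrable (leb T) (\<lambda>t. antidual_apply (f t) v)"
  by (rule strong_integral_apply(2)[OF L2_strongly_measurable L2_integrable_norm])

lemma L2_integrable_mult_apply:
  fixes f :: "real \<Rightarrow> 'v::complex_inner antidual"
  assumes "L2 T f" "continuous_on {0..T} \<phi>"
  shows "integrable (leb T) (\<lambda>t. \<phi> t * antidual_apply (f t) v)"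
  using L2_integrable_apply[OF L2_mult_continuous[OF assms], of v] by (simp add: antidual_apply_scaleC_left)

lemma pairing_apply:
  fixes f :: "real \<Rightarrow> 'v::complex_inner antidual"
  assumes "L2 T f" "continuous_on {0..T} \<phi>"
  shows "antidual_apply (pairing T f \<phi>) v = (\<integral>t. \<phi> t * antidual_apply (f t) v \<partial>leb T)"
  unfolding pairing_def
  using strong_integral_apply(1)[OF L2_strongly_measurable L2_integrable_norm, OF L2_mult_continuous L2_mult_continuous, OF assms assms]
  by (simp add: antidual_apply_scaleC_left)

lemma test_function_props:
  assumes "test_function T \<phi>"
  shows "(\<phi> has_vector_derivative vector_derivative \<phi> (at t)) (at t)"
    and "continuous_on S \<phi>" and "continuous_on S (\<lambda>t. vector_derivative \<phi> (at t))"
    and "\<phi> 0 = 0" and "\<phi> T = 0"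
proof -
  from assms obtain D \<alpha> \<beta> where D: "D 0 = \<phi>" "\<And>n t. (D n has_vector_derivative D (Suc n) t) (at t)"
    and ab: "0 < \<alpha>" "\<beta> < T" "\<And>t. t \<notin> {\<alpha>..\<beta>} \<Longrightarrow> \<phi> t = 0"
    unfolding test_function_def by blast
  have d: "vector_derivative \<phi> (at t) = D 1 t" for t
    using D(2)[of 0 t] by (simp add: D(1) vector_derivative_at)
  show "(\<phi> has_vector_derivative vector_derivative \<phi> (at t)) (at t)"
    using D(2)[of 0 t] by (simp add: d D(1))
  have c: "continuous_on S (D n)" for n
    unfolding continuous_on_eq_continuous_within
    by (meson D(2) has_vector_derivative_continuous continuous_at_imp_continuous_at_within)
  show "continuous_on S \<phi>" "continuous_on S (\<lambda>t. vector_derivative \<phi> (at t))"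
    using c[of 0] c[of 1] by (simp_all add: D(1) d)
  show "\<phi> 0 = 0" "\<phi> T = 0" using ab by simp_all
qed

section \<open>Test functions and the du Bois-Reymond lemma\<close>

text \<open>The functions p(1/t) e^(-1/t), extended by 0 to t \<le> 0, form a class closed under
  differentiation, which makes them smooth.\<close>

definition flat :: "real poly \<Rightarrow> real \<Rightarrow> real" where
  "flat p t = (if t > 0 then poly p (1 / t) * exp (- (1 / t)) else 0)"

text \<open>The chain rule with x = 1/t, whose derivative is -x^2, applied to p(x) e^(-x).\<close>

definition flat_deriv :: "real poly \<Rightarrow> real poly" where
  "flat_deriv p = [:0, 0, 1:] * (p - pderiv p)"

lemma poly_times_exp_minus_tendsto_0: "((\<lambda>x. poly p x * exp (- x)) \<longlongrightarrow> (0::real)) at_top"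
proof -
  have "((\<lambda>x. \<Sum>i\<le>degree p. coeff p i * (x ^ i / exp x)) \<longlongrightarrow> (\<Sum>i\<le>degree p. coeff p i * 0)) at_top"
    by (intro tendsto_sum tendsto_mult tendsto_const tendsto_power_div_exp_0)
  moreover have "(\<Sum>i\<le>degree p. coeff p i * (x ^ i / exp x)) = poly p x * exp (- x)" for x
    by (simp add: poly_altdef sum_distrib_right exp_minus divide_inverse mult.assoc)
  ultimately show ?thesis by simp
qed

lemma flat_has_derivative: "(flat p has_real_derivative flat (flat_deriv p) t) (at t)"
proof -
  consider "t > 0" | "t < 0" | "t = 0" by linarith
  then show ?thesis
  proof cases
    case 1
    have "((\<lambda>t. poly p (1 / t) * exp (- (1 / t))) has_real_derivative flat (flat_deriv p) t) (at t)"
      using 1 by (auto intro!: derivative_eq_intros poly_DERIV[THEN DERIV_chain2]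
          simp: flat_def flat_deriv_def field_simps power2_eq_square)
    then show ?thesis
      by (rule has_field_derivative_transform_within_open[of _ _ _ "{0<..}"]) (use 1 in \<open>auto simp: flat_def\<close>)
  next
    case 2
    have "((\<lambda>t. 0) has_real_derivative flat (flat_deriv p) t) (at t)"
      using 2 by (simp add: flat_def)
    then show ?thesis
      by (rule has_field_derivative_transform_within_open[of _ _ _ "{..<0}"]) (use 2 in \<open>auto simp: flat_def\<close>)
  next
    case 3
    \<comment> \<open>With x = 1/h the difference quotient at 0 is x p(x) e^(-x), which tends to 0
      at infinity.\<close>
    have "((\<lambda>h. poly ([:0, 1:] * p) (inverse h) * exp (- inverse h)) \<longlongrightarrow> 0) (at_right 0)"
      by (rule filterlim_compose[OF poly_times_exp_minus_tendsto_0 filterlim_inverse_at_top_right])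
    then have r: "((\<lambda>h. flat p h / h) \<longlongrightarrow> 0) (at_right 0)"
      by (rule Lim_transform_eventually)
        (auto simp: eventually_at_filter flat_def field_simps intro!: always_eventually)
    have l: "((\<lambda>h. flat p h / h) \<longlongrightarrow> 0) (at_left 0)"
      by (rule Lim_transform_eventually[OF tendsto_const[of 0]])
        (auto simp: eventually_at_filter flat_def intro!: always_eventually)
    have "((\<lambda>h. flat p h / h) \<longlongrightarrow> 0) (at 0)"
      using l r by (rule filterlim_split_at)
    then show ?thesis
      using 3 by (simp add: DERIV_def flat_def)
  qed
qed

text \<open>The span of products that vanish outside the unit interval. It is closed under
  differentiation, so that all derivatives can be chosen one after the other.\<close>

inductive bump_class :: "(real \<Rightarrow> real) \<Rightarrow> bool" where
  bump_base: "bump_class (\<lambda>t. flat p t * flat q (1 - t))"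
| bump_add: "bump_class f \<Longrightarrow> bump_class g \<Longrightarrow> bump_class (\<lambda>t. f t + g t)"
| bump_scale: "bump_class f \<Longrightarrow> bump_class (\<lambda>t. c * f t)"

lemma bump_class_derivative:
  "bump_class f \<Longrightarrow> \<exists>f'. bump_class f' \<and> (\<forall>t. (f has_real_derivative f' t) (at t))"
proof (induction rule: bump_class.induct)
  case (bump_base p q)
  have "bump_class (\<lambda>t. flat (flat_deriv p) t * flat q (1 - t) + (-1) * (flat p t * flat (flat_deriv q) (1 - t)))"
    by (intro bump_class.intros)
  moreover have "((\<lambda>t. flat p t * flat q (1 - t)) has_real_derivative
      flat (flat_deriv p) t * flat q (1 - t) + (-1) * (flat p t * flat (flat_deriv q) (1 - t))) (at t)" for t
  proof -
    have "((\<lambda>t. flat q (1 - t)) has_real_derivative flat (flat_deriv q) (1 - t) * (-1)) (at t)"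
      by (rule DERIV_chain2[OF flat_has_derivative]) (auto intro!: derivative_eq_intros)
    from DERIV_mult[OF flat_has_derivative this] show ?thesis by (simp add: algebra_simps)
  qed
  ultimately show ?case by (intro exI conjI allI)
next
  case (bump_add f g)
  then obtain f' g' where "bump_class f'" "\<And>t. (f has_real_derivative f' t) (at t)"
    "bump_class g'" "\<And>t. (g has_real_derivative g' t) (at t)" by blast
  then show ?case by (intro exI[of _ "\<lambda>t. f' t + g' t"] conjI allI bump_class.bump_add DERIV_add)
next
  case (bump_scale f c)
  then obtain f' where "bump_class f'" "\<And>t. (f has_real_derivative f' t) (at t)" by blast
  then show ?case by (intro exI[of _ "\<lambda>t. c * f' t"] conjI allI bump_class.bump_scale DERIV_cmult)
qed

text \<open>The normalized primitive of a bump function. \<open>D\<close> lists it with all its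
  derivatives, the first of which serves as a mollifier kernel.\<close>

lemma smooth_step_exists:
  obtains D :: "nat \<Rightarrow> real \<Rightarrow> real" where
    "\<And>n t. (D n has_real_derivative D (Suc n) t) (at t)"
    "\<And>t. t \<le> 0 \<Longrightarrow> D 0 t = 0" "\<And>t. t \<ge> 1 \<Longrightarrow> D 0 t = 1"
    "\<And>t. D 1 t \<ge> 0" "\<And>t. t \<notin> {0..1} \<Longrightarrow> D 1 t = 0"
proof -
  define \<rho>0 where "\<rho>0 t = flat 1 t * flat 1 (1 - t)" for t
  have cl: "bump_class \<rho>0" unfolding \<rho>0_def by (rule bump_base)
  have nn: "\<rho>0 t \<ge> 0" "t \<notin> {0<..<1} \<Longrightarrow> \<rho>0 t = 0" "t \<in> {0<..<1} \<Longrightarrow> \<rho>0 t > 0" for t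
    by (auto simp: \<rho>0_def flat_def)
  have "isCont \<rho>0 t" for t
    using bump_class_derivative[OF cl] DERIV_isCont by blast
  then obtain F where F: "\<And>x. (F has_vector_derivative \<rho>0 x) (at x)"
    using einterval_antiderivative[of "-\<infinity>" "\<infinity>" \<rho>0] by auto
  have F': "(F has_real_derivative \<rho>0 x) (at x)" for x
    using F by (simp add: has_real_derivative_iff_has_vector_derivative)
  have F0: "F t = F 0" if "t \<le> 0" for t
  proof (cases "t = 0")
    case False
    with that have "t < 0" by simp
    from MVT2[OF this F'] obtain z where "z > t" "z < 0" "F 0 - F t = (0 - t) * \<rho>0 z"
      by blast
    then show ?thesis using nn(2)[of z] by simp
  qed simp
  have F1: "F t = F 1" if "t \<ge> 1" for t
  proof (cases "t = 1")
    case False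
    with that have "1 < t" by simp
    from MVT2[OF this F'] obtain z where "z > 1" "z < t" "F t - F 1 = (t - 1) * \<rho>0 z"
      by blast
    then show ?thesis using nn(2)[of z] by simp
  qed simp
  define c where "c = F 1 - F 0"
  obtain z where "z > 0" "z < 1" "F 1 - F 0 = (1 - 0) * \<rho>0 z"
    using MVT2[OF zero_less_one F'] by blast
  then have c: "c > 0" using nn(3)[of z] by (simp add: c_def)
  define \<rho> where "\<rho> t = (1 / c) * \<rho>0 t" for t
  define \<sigma> where "\<sigma> t = (F t - F 0) / c" for t
  have cl': "bump_class \<rho>" unfolding \<rho>_def by (rule bump_scale[OF cl])
  have "\<exists>E. \<forall>n. bump_class (E n) \<and> (n = 0 \<longrightarrow> E n = \<rho>) \<and> (\<forall>t. (E n has_real_derivative E (Suc n) t) (at t))"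
  proof -
    have "\<exists>E. \<forall>n. (bump_class (E n) \<and> (n = 0 \<longrightarrow> E n = \<rho>)) \<and> (\<forall>t. (E n has_real_derivative E (Suc n) t) (at t))"
      by (rule dependent_nat_choice) (use cl' bump_class_derivative in auto)
    then show ?thesis by simp
  qed
  then obtain E where E: "E 0 = \<rho>" "\<And>n t. (E n has_real_derivative E (Suc n) t) (at t)" by metis
  \<comment> \<open>\<open>E\<close> starts with the density \<rho>, so the list is shifted by one
    to start with its primitive.\<close>
  define D where "D n = (case n of 0 \<Rightarrow> \<sigma> | Suc m \<Rightarrow> E m)" for n
  show thesis
  proof (rule that)
    show "(D n has_real_derivative D (Suc n) t) (at t)" for n t
    proof (cases n)
      case 0
      have "((\<lambda>t. (F t - F 0) / c) has_real_derivative \<rho> t) (at t)"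
        using F'[of t] c by (auto intro!: derivative_eq_intros simp: \<rho>_def)
      then show ?thesis by (simp add: 0 D_def E(1) \<sigma>_def[abs_def])
    qed (simp add: D_def E(2))
    show "D 0 t = 0" if "t \<le> 0" for t using F0[OF that] by (simp add: D_def \<sigma>_def)
    show "D 0 t = 1" if "t \<ge> 1" for t using F1[OF that] c by (simp add: D_def \<sigma>_def c_def)
    show "D 1 t \<ge> 0" for t using nn(1) c by (simp add: D_def E(1) \<rho>_def)
    show "D 1 t = 0" if "t \<notin> {0..1}" for t using nn(2)[of t] that by (auto simp: D_def E(1) \<rho>_def)
  qed
qed

text \<open>Testing with smoothed indicator functions of \<open>]a, b]\<close> gives the du Bois-Reymond lemma.\<close>

context
  fixes D :: "nat \<Rightarrow> real \<Rightarrow> real" and T :: real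
  assumes D: "\<And>n t. (D n has_real_derivative D (Suc n) t) (at t)"
    and D0: "\<And>t. t \<le> 0 \<Longrightarrow> D 0 t = 0" and D1: "\<And>t. t \<ge> 1 \<Longrightarrow> D 0 t = 1"
    and Dp: "\<And>t. D 1 t \<ge> 0" and Ds: "\<And>t. t \<notin> {0..1} \<Longrightarrow> D 1 t = 0"
begin

lemma step_bounds: "0 \<le> D 0 t" "D 0 t \<le> 1"
proof -
  have mono: "D 0 x \<le> D 0 y" if "x \<le> y" for x y
    by (rule DERIV_nonneg_imp_nondecreasing[OF that]) (use D[of 0] Dp in auto)
  show "0 \<le> D 0 t" using mono[of "min 0 t" t] D0[of "min 0 t"] by simp
  show "D 0 t \<le> 1" using mono[of t "max 1 t"] D1[of "max 1 t"] by simp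
qed

text \<open>Rises to the right of a and falls to the right of b, each over the length \<epsilon>;
  for 0 < a and b + \<epsilon> < T the support stays inside ]0,T[.\<close>

definition "plateau a b \<epsilon> t = complex_of_real (D 0 ((t - a) / \<epsilon>) - D 0 ((t - b) / \<epsilon>))"

lemma scaled_derivative:
  assumes "\<epsilon> > 0"
  shows "((\<lambda>t. D n ((t - a) / \<epsilon>) / \<epsilon> ^ n) has_real_derivative D (Suc n) ((t - a) / \<epsilon>) / \<epsilon> ^ Suc n) (at t)"
proof -
  have "((\<lambda>t. D n ((t - a) / \<epsilon>)) has_real_derivative D (Suc n) ((t - a) / \<epsilon>) * (1 / \<epsilon>)) (at t)"
    by (rule DERIV_chain2[OF D]) (use assms in \<open>auto intro!: derivative_eq_intros\<close>)
  from DERIV_cdivide[OF this, of "\<epsilon> ^ n"] show ?thesis by (simp add: field_simps)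
qed

lemma kernel_continuous: "\<epsilon> > 0 \<Longrightarrow> continuous_on X (\<lambda>t. D 1 ((t - a) / \<epsilon>) / \<epsilon>)"
  using DERIV_continuous_on[OF has_field_derivative_at_within[OF scaled_derivative[of \<epsilon> 1 a]]] by simp

lemma plateau_derivative:
  assumes "\<epsilon> > 0"
  shows "vector_derivative (plateau a b \<epsilon>) (at t) =
    complex_of_real (D 1 ((t - a) / \<epsilon>) / \<epsilon>) - complex_of_real (D 1 ((t - b) / \<epsilon>) / \<epsilon>)"
proof (rule vector_derivative_at)
  have "((\<lambda>t. D 0 ((t - a) / \<epsilon>) - D 0 ((t - b) / \<epsilon>)) has_real_derivative
      D 1 ((t - a) / \<epsilon>) / \<epsilon> - D 1 ((t - b) / \<epsilon>) / \<epsilon>) (at t)"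
    using DERIV_diff[OF scaled_derivative[OF assms, of 0 a] scaled_derivative[OF assms, of 0 b]] by simp
  from has_vector_derivative_of_real[OF this, where 'a = complex]
  show "(plateau a b \<epsilon> has_vector_derivative
      complex_of_real (D 1 ((t - a) / \<epsilon>) / \<epsilon>) - complex_of_real (D 1 ((t - b) / \<epsilon>) / \<epsilon>)) (at t)"
    by (simp add: plateau_def[abs_def])
qed

lemma test_function_plateau:
  assumes "0 < a" "a \<le> b" "\<epsilon> > 0" "b + \<epsilon> < T"
  shows "test_function T (plateau a b \<epsilon>)"
  unfolding test_function_def
proof (intro conjI)
  define P where "P n t = complex_of_real (D n ((t - a) / \<epsilon>) / \<epsilon> ^ n - D n ((t - b) / \<epsilon>) / \<epsilon> ^ n)" for n t
  show "\<exists>P. P 0 = plateau a b \<epsilon> \<and> (\<forall>n::nat. \<forall>t. (P n has_vector_derivative P (Suc n) t) (at t))"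
  proof (intro exI[of _ P] conjI allI)
    show "P 0 = plateau a b \<epsilon>" by (simp add: P_def[abs_def] plateau_def[abs_def])
    fix n t
    have "((\<lambda>t. D n ((t - a) / \<epsilon>) / \<epsilon> ^ n - D n ((t - b) / \<epsilon>) / \<epsilon> ^ n) has_real_derivative
        D (Suc n) ((t - a) / \<epsilon>) / \<epsilon> ^ Suc n - D (Suc n) ((t - b) / \<epsilon>) / \<epsilon> ^ Suc n) (at t)"
      by (intro DERIV_diff scaled_derivative assms)
    from has_vector_derivative_of_real[OF this, where 'a = complex]
    show "(P n has_vector_derivative P (Suc n) t) (at t)"
      unfolding P_def[abs_def] .
  qed
  show "\<exists>\<alpha> \<beta>. 0 < \<alpha> \<and> \<beta> < T \<and> (\<forall>t. t \<notin> {\<alpha>..\<beta>} \<longrightarrow> plateau a b \<epsilon> t = 0)"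
  proof (rule exI[of _ a], rule exI[of _ "b + \<epsilon>"], intro conjI allI impI)
    fix t assume "t \<notin> {a..b + \<epsilon>}"
    then consider "t < a" | "t > b + \<epsilon>" by force
    then show "plateau a b \<epsilon> t = 0"
    proof cases
      case 1
      then have "(t - a) / \<epsilon> \<le> 0" "(t - b) / \<epsilon> \<le> 0" using assms by (auto simp: divide_le_0_iff)
      then show ?thesis by (simp add: plateau_def D0)
    next
      case 2
      then have "(t - a) / \<epsilon> \<ge> 1" "(t - b) / \<epsilon> \<ge> 1" using assms by auto
      then show ?thesis by (simp add: plateau_def D1)
    qed
  qed (use assms in auto)
qed

text \<open>The kernel is nonnegative, has integral 1 and lives on [a, a + \<epsilon> n], so the
  integral averages w just to the right of a.\<close>

lemma mollifier_tendsto: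
  fixes w :: "real \<Rightarrow> complex" and \<epsilon> :: "nat \<Rightarrow> real"
  assumes w: "continuous_on {0..T} w" and a: "0 \<le> a" and \<epsilon>: "\<And>n. \<epsilon> n > 0" "\<And>n. a + \<epsilon> n \<le> T" "\<epsilon> \<longlonglongrightarrow> 0"
  shows "(\<lambda>n. \<integral>t. complex_of_real (D 1 ((t - a) / \<epsilon> n) / \<epsilon> n) * w t \<partial>leb T) \<longlonglongrightarrow> w a"
proof (rule tendstoI)
  fix e :: real assume e: "e > 0"
  have aT: "a \<in> {0..T}" using a \<epsilon>(1,2)[of 0] by auto
  then obtain d where d: "d > 0" "\<And>t. t \<in> {0..T} \<Longrightarrow> dist t a < d \<Longrightarrow> dist (w t) (w a) < e / 2"
    using w e unfolding continuous_on_iff by (meson half_gt_zero)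
  have "\<forall>\<^sub>F n in sequentially. \<epsilon> n < d" using \<epsilon>(3) d(1) by (rule order_tendstoD)
  then show "\<forall>\<^sub>F n in sequentially. dist (\<integral>t. complex_of_real (D 1 ((t - a) / \<epsilon> n) / \<epsilon> n) * w t \<partial>leb T) (w a) < e"
  proof eventually_elim
    fix n assume n: "\<epsilon> n < d"
    define k where "k t = D 1 ((t - a) / \<epsilon> n) / \<epsilon> n" for t
    have kc: "continuous_on {0..T} k"
      unfolding k_def by (rule kernel_continuous[OF \<epsilon>(1)])
    have "(k has_integral D 0 ((T - a) / \<epsilon> n) - D 0 ((0 - a) / \<epsilon> n)) {0..T}"
    proof (rule fundamental_theorem_of_calculus)
      show "0 \<le> T" using aT by simp
      show "((\<lambda>t. D 0 ((t - a) / \<epsilon> n)) has_vector_derivative k x) (at x within {0..T})" for x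
        using scaled_derivative[OF \<epsilon>(1)[of n], of 0 a x]
        by (auto simp: has_real_derivative_iff_has_vector_derivative k_def intro: has_vector_derivative_at_within)
    qed
    moreover have "(T - a) / \<epsilon> n \<ge> 1" "(0 - a) / \<epsilon> n \<le> 0"
      using \<epsilon>(1,2)[of n] a by (auto simp: divide_le_0_iff)
    ultimately have "integral {0..T} k = 1" by (simp add: D0 D1 integral_unique)
    then have k1: "(\<integral>t. k t \<partial>leb T) = 1"
      using lebesgue_integral_eq_integral[OF integrable_leb_continuous[OF kc]] by simp
    have kw: "continuous_on {0..T} (\<lambda>t. complex_of_real (k t) * (w t - w a))"
      "continuous_on {0..T} (\<lambda>t. complex_of_real (k t) * w t)" "continuous_on {0..T} (\<lambda>t. complex_of_real (k t) * w a)"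
      by (intro continuous_intros kc w)+
    have "(\<integral>t. complex_of_real (k t) * w t \<partial>leb T) - w a = (\<integral>t. complex_of_real (k t) * w t \<partial>leb T) - (\<integral>t. complex_of_real (k t) * w a \<partial>leb T)"
      using k1 by simp
    also have "\<dots> = (\<integral>t. complex_of_real (k t) * (w t - w a) \<partial>leb T)"
      by (subst Bochner_Integration.integral_diff[symmetric])
        (auto intro!: integrable_leb_continuous kw simp: right_diff_distrib)
    also have "norm \<dots> \<le> (\<integral>t. k t * (e / 2) \<partial>leb T)"
    proof (rule Bochner_Integration.integral_norm_bound_integral[OF integrable_leb_continuous[OF kw(1)]])
      show "integrable (leb T) (\<lambda>t. k t * (e / 2))"
        by (intro integrable_leb_continuous continuous_intros kc)
      fix t assume t: "t \<in> space (leb T)"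
      have kp: "k t \<ge> 0" using Dp \<epsilon>(1)[of n] by (simp add: k_def)
      show "norm (complex_of_real (k t) * (w t - w a)) \<le> k t * (e / 2)"
      proof (cases "k t = 0")
        case False
        then have "(t - a) / \<epsilon> n \<in> {0..1}" using Ds by (auto simp: k_def)
        then have "dist t a < d" using \<epsilon>(1)[of n] n by (auto simp: dist_real_def zero_le_divide_iff)
        then have "norm (w t - w a) \<le> e / 2" using d(2)[of t] t by (simp add: dist_norm less_imp_le)
        then show ?thesis using mult_left_mono[OF _ kp] kp by (simp only: norm_mult norm_of_real abs_of_nonneg)
      qed simp
    qed
    also have "\<dots> = e / 2" using k1 by simp
    also have "\<dots> < e" using e by simp
    finally show "dist (\<integral>t. complex_of_real (D 1 ((t - a) / \<epsilon> n) / \<epsilon> n) * w t \<partial>leb T) (w a) < e"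
      by (simp add: dist_norm k_def)
  qed
qed

text \<open>The step vanishes at 0, so for a < b the limit is 0 at a and 1 at b; this fixes the
  half-open interval.\<close>

lemma plateau_tendsto:
  assumes \<epsilon>: "\<And>n. \<epsilon> n > 0" "\<epsilon> \<longlonglongrightarrow> 0" and ab: "a \<le> b"
  shows "(\<lambda>n. plateau a b (\<epsilon> n) t) \<longlonglongrightarrow> indicator {a<..b} t"
proof -
  have *: "(\<lambda>n. D 0 ((t - a) / \<epsilon> n)) \<longlonglongrightarrow> indicator {a<..} t" for a
  proof (cases "t > a")
    case True
    have "\<forall>\<^sub>F n in sequentially. \<epsilon> n < t - a" using True by (intro order_tendstoD[OF \<epsilon>(2)]) simp
    then have "\<forall>\<^sub>F n in sequentially. 1 = D 0 ((t - a) / \<epsilon> n)"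
      by eventually_elim (use \<epsilon>(1) in \<open>simp add: D1 less_imp_le\<close>)
    then have "(\<lambda>n. D 0 ((t - a) / \<epsilon> n)) \<longlonglongrightarrow> 1"
      by (rule Lim_transform_eventually[OF tendsto_const])
    then show ?thesis using True by simp
  next
    case False
    then have "(t - a) / \<epsilon> n \<le> 0" for n using \<epsilon>(1)[of n] by (simp add: divide_le_0_iff)
    then show ?thesis using False by (simp add: D0)
  qed
  have "(\<lambda>n. plateau a b (\<epsilon> n) t) \<longlonglongrightarrow> complex_of_real (indicator {a<..} t - indicator {b<..} t)"
    unfolding plateau_def by (intro tendsto_of_real tendsto_diff *)
  moreover have "complex_of_real (indicator {a<..} t - indicator {b<..} t) = indicator {a<..b} t"
    using ab by (auto simp: indicator_def)
  ultimately show ?thesis by simp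
qed

lemma du_Bois_Reymond_aux:
  fixes w g :: "real \<Rightarrow> complex"
  assumes w: "continuous_on {0..T} w" and g: "integrable (leb T) g"
    and eq: "\<And>\<phi>. test_function T \<phi> \<Longrightarrow>
      (\<integral>t. \<phi> t * g t \<partial>leb T) = (\<integral>t. - vector_derivative \<phi> (at t) * w t \<partial>leb T)"
    and ab: "0 < a" "a \<le> b" "b < T"
  shows "(\<integral>t. indicator {a<..b} t * g t \<partial>leb T) = w b - w a"
proof -
  \<comment> \<open>Division by n + 2 and not by n + 1 keeps b + \<epsilon> n strictly below T
    already for n = 0.\<close>
  define \<epsilon> where "\<epsilon> n = (T - b) / real (n + 2)" for n :: nat
  have \<epsilon>0: "\<epsilon> n > 0" for n using ab by (simp add: \<epsilon>_def)
  have \<epsilon>1: "b + \<epsilon> n < T" for n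
  proof -
    have "(T - b) / real (n + 2) < (T - b) / 1" using ab by (intro divide_strict_left_mono) auto
    then show ?thesis by (simp add: \<epsilon>_def)
  qed
  have "(\<lambda>n. (T - b) / real (n + 2)) \<longlonglongrightarrow> 0"
    by (intro tendsto_divide_0[OF tendsto_const] filterlim_compose[OF filterlim_real_sequentially] filterlim_add_const_nat_at_top
        filterlim_at_top_imp_at_infinity)
  then have \<epsilon>2: "\<epsilon> \<longlonglongrightarrow> 0" by (simp add: \<epsilon>_def[abs_def])
  have gm: "g \<in> borel_measurable (leb T)" using g by simp
  have pc: "continuous_on {0..T} (plateau a b (\<epsilon> n))" for n
    by (rule test_function_props(2)[OF test_function_plateau[OF ab(1,2) \<epsilon>0 \<epsilon>1]])
  have pm: "plateau a b (\<epsilon> n) \<in> borel_measurable (leb T)" for n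
    by (rule strongly_measurable_imp_measurable[OF strongly_measurable_continuous[OF pc]])
  have "(\<lambda>n. \<integral>t. plateau a b (\<epsilon> n) t * g t \<partial>leb T) \<longlonglongrightarrow> (\<integral>t. indicator {a<..b} t * g t \<partial>leb T)"
  proof (rule integral_dominated_convergence)
    show "integrable (leb T) (\<lambda>t. norm (g t))" using g by simp
    show "(\<lambda>t. plateau a b (\<epsilon> n) t * g t) \<in> borel_measurable (leb T)" for n using gm pm by measurable
    have "(indicator {a<..b} :: real \<Rightarrow> complex) \<in> borel_measurable (leb T)"
      by (intro borel_measurable_indicator) (use ab in \<open>auto simp: sets_restrict_space intro!: image_eqI[of _ _ "{a<..b}"]\<close>)
    then show "(\<lambda>t. indicator {a<..b} t * g t) \<in> borel_measurable (leb T)" using gm by measurable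
    show "AE t in leb T. (\<lambda>n. plateau a b (\<epsilon> n) t * g t) \<longlonglongrightarrow> indicator {a<..b} t * g t"
      by (intro AE_I2 tendsto_mult tendsto_const plateau_tendsto \<epsilon>0 \<epsilon>2 ab)
    have "norm (plateau a b (\<epsilon> n) t) \<le> 1" for n t
      unfolding plateau_def norm_of_real using step_bounds[of "(t - a) / \<epsilon> n"] step_bounds[of "(t - b) / \<epsilon> n"] by linarith
    then show "AE t in leb T. norm (plateau a b (\<epsilon> n) t * g t) \<le> norm (g t)" for n
      by (simp add: norm_mult mult_left_le_one_le)
  qed
  moreover have "(\<integral>t. plateau a b (\<epsilon> n) t * g t \<partial>leb T) =
      (\<integral>t. complex_of_real (D 1 ((t - b) / \<epsilon> n) / \<epsilon> n) * w t \<partial>leb T) - (\<integral>t. complex_of_real (D 1 ((t - a) / \<epsilon> n) / \<epsilon> n) * w t \<partial>leb T)" for n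
  proof -
    have "continuous_on {0..T} (\<lambda>t. complex_of_real (D 1 ((t - c) / \<epsilon> n) / \<epsilon> n) * w t)" for c
      by (intro continuous_on_mult continuous_on_of_real kernel_continuous w \<epsilon>0)
    then have "integrable (leb T) (\<lambda>t. complex_of_real (D 1 ((t - c) / \<epsilon> n) / \<epsilon> n) * w t)" for c
      by (rule integrable_leb_continuous)
    then have "(\<integral>t. complex_of_real (D 1 ((t - b) / \<epsilon> n) / \<epsilon> n) * w t \<partial>leb T) - (\<integral>t. complex_of_real (D 1 ((t - a) / \<epsilon> n) / \<epsilon> n) * w t \<partial>leb T) =
      (\<integral>t. complex_of_real (D 1 ((t - b) / \<epsilon> n) / \<epsilon> n) * w t - complex_of_real (D 1 ((t - a) / \<epsilon> n) / \<epsilon> n) * w t \<partial>leb T)"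
      by (simp only: Bochner_Integration.integral_diff)
    also have "\<dots> = (\<integral>t. - vector_derivative (plateau a b (\<epsilon> n)) (at t) * w t \<partial>leb T)"
      unfolding plateau_derivative[OF \<epsilon>0] by (rule Bochner_Integration.integral_cong) (simp_all add: left_diff_distrib)
    also have "\<dots> = (\<integral>t. plateau a b (\<epsilon> n) t * g t \<partial>leb T)"
      by (rule eq[symmetric]) (intro test_function_plateau ab \<epsilon>0 \<epsilon>1)
    finally show ?thesis ..
  qed
  moreover have "(\<lambda>n. (\<integral>t. complex_of_real (D 1 ((t - b) / \<epsilon> n) / \<epsilon> n) * w t \<partial>leb T) -
      (\<integral>t. complex_of_real (D 1 ((t - a) / \<epsilon> n) / \<epsilon> n) * w t \<partial>leb T)) \<longlonglongrightarrow> w b - w a"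
  proof (intro tendsto_diff mollifier_tendsto w \<epsilon>0 \<epsilon>2)
    show "a + \<epsilon> n \<le> T" "b + \<epsilon> n \<le> T" for n using \<epsilon>1[of n] ab by auto
  qed (use ab in auto)
  ultimately show ?thesis by (simp add: LIMSEQ_unique)
qed

end

lemma du_Bois_Reymond:
  fixes w g :: "real \<Rightarrow> complex"
  assumes "continuous_on {0..T} w" "integrable (leb T) g"
    and "\<And>\<phi>. test_function T \<phi> \<Longrightarrow>
      (\<integral>t. \<phi> t * g t \<partial>leb T) = (\<integral>t. - vector_derivative \<phi> (at t) * w t \<partial>leb T)"
    and "0 < a" "a \<le> b" "b < T"
  shows "(\<integral>t. indicator {a<..b} t * g t \<partial>leb T) = w b - w a"
proof (rule smooth_step_exists)
  fix D :: "nat \<Rightarrow> real \<Rightarrow> real"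
  assume "\<And>n t. (D n has_real_derivative D (Suc n) t) (at t)"
    "\<And>t. t \<le> 0 \<Longrightarrow> D 0 t = 0" "\<And>t. t \<ge> 1 \<Longrightarrow> D 0 t = 1"
    "\<And>t. D 1 t \<ge> 0" "\<And>t. t \<notin> {0..1} \<Longrightarrow> D 1 t = 0"
  then show ?thesis
    by (rule du_Bois_Reymond_aux) (use assms in auto)
qed

section \<open>Strong solutions and the energy estimate\<close>

lemma sets_leb_subset:
  assumes "A \<in> sets (leb T)" "t \<le> T"
  shows "A \<inter> {0..t} \<in> sets (leb t)"
proof -
  have "A \<in> sets lebesgue" using assms(1) by (simp add: sets_restrict_space_iff)
  then have "A \<inter> {0..t} \<in> sets lebesgue" by (rule sets.Int) simp
  then show ?thesis by (simp add: sets_restrict_space_iff)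
qed

lemma strongly_measurable_subinterval:
  assumes f: "strongly_measurable (leb T) f" and t: "t \<le> T"
  shows "strongly_measurable (leb t) f"
proof -
  obtain s where s: "\<And>i::nat. simple_function (leb T) (s i)" "AE t in leb T. (\<lambda>i. s i t) \<longlonglongrightarrow> f t"
    using f unfolding strongly_measurable_def by blast
  have "simple_function (leb t) (s i)" for i
    unfolding simple_function_def
  proof (intro conjI ballI)
    have "finite (s i ` {0..T})" using s(1)[of i] by (simp add: simple_function_def)
    then show "finite (s i ` space (leb t))" using t by (auto elim!: finite_subset[rotated])
    fix x assume x: "x \<in> s i ` space (leb t)"
    then have "s i -` {x} \<inter> space (leb T) \<in> sets (leb T)" using s(1)[of i] t by (auto simp: simple_function_def)
    from sets_leb_subset[OF this t] show "s i -` {x} \<inter> space (leb t) \<in> sets (leb t)"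
      using t by (simp add: Int_assoc)
  qed
  moreover have "AE x in leb t. (\<lambda>i. s i x) \<longlonglongrightarrow> f x"
  proof -
    have "AE x in lebesgue. x \<in> {0..T} \<longrightarrow> (\<lambda>i. s i x) \<longlonglongrightarrow> f x"
      using s(2) by (subst (asm) AE_restrict_space_iff) auto
    then have "AE x in lebesgue. x \<in> {0..t} \<longrightarrow> (\<lambda>i. s i x) \<longlonglongrightarrow> f x"
      by eventually_elim (use t in auto)
    then show ?thesis by (subst AE_restrict_space_iff) auto
  qed
  ultimately show ?thesis unfolding strongly_measurable_def by blast
qed

lemma integrable_leb_subinterval:
  fixes h :: "real \<Rightarrow> real"
  assumes h: "integrable (leb T) h" and t: "t \<le> T"
  shows "integrable (leb t) h"
proof -
  have "set_integrable lebesgue {0..T} h" using h by (simp add: set_integrable_def integrable_restrict_space)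
  then have "set_integrable lebesgue {0..t} h" by (rule set_integrable_subset) (use t in auto)
  then show ?thesis by (simp add: set_integrable_def integrable_restrict_space)
qed

lemma L2_subinterval: "L2 T f \<Longrightarrow> t \<le> T \<Longrightarrow> L2 t f"
  unfolding L2_def by (blast intro: strongly_measurable_subinterval integrable_leb_subinterval)

lemma has_integral_leb:
  fixes h :: "real \<Rightarrow> 'b::euclidean_space"
  shows "integrable (leb T) h \<Longrightarrow> (h has_integral (\<integral>t. h t \<partial>leb T)) {0..T}"
  by (rule has_integral_integral_lebesgue_on) auto

lemma integral_leb_eqI:
  fixes h :: "real \<Rightarrow> 'b::euclidean_space"
  shows "integrable (leb T) h \<Longrightarrow> (h has_integral I) {0..T} \<Longrightarrow> (\<integral>t. h t \<partial>leb T) = I"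
  using has_integral_leb has_integral_unique by blast

lemma integral_leb_mono_interval:
  fixes h :: "real \<Rightarrow> real"
  assumes "integrable (leb T) h" "t \<le> T" "\<And>s. h s \<ge> 0"
  shows "(\<integral>s. h s \<partial>leb t) \<le> (\<integral>s. h s \<partial>leb T)"
  by (rule has_integral_subset_le[OF _ has_integral_leb[OF integrable_leb_subinterval[OF assms(1,2)]] has_integral_leb[OF assms(1)]])
    (use assms in auto)

text \<open>The square of the L2 norm. Working with squares gives the triangle inequality in a form
  with factors 2.\<close>

definition sqint :: "real \<Rightarrow> (real \<Rightarrow> 'b::real_normed_vector) \<Rightarrow> real" where
  "sqint T f = (\<integral>t. (norm (f t))\<^sup>2 \<partial>leb T)"

lemma sqint_nonneg: "sqint T f \<ge> 0"
  by (simp add: sqint_def)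

lemma sqint_add_le:
  assumes "L2 T f" "L2 T g"
  shows "sqint T (\<lambda>t. f t + g t) \<le> 2 * sqint T f + 2 * sqint T g"
proof -
  have "sqint T (\<lambda>t. f t + g t) \<le> (\<integral>t. 2 * (norm (f t))\<^sup>2 + 2 * (norm (g t))\<^sup>2 \<partial>leb T)"
    unfolding sqint_def
    by (intro integral_mono L2_integrable_sq L2_add Bochner_Integration.integrable_add integrable_mult_right assms norm_add_sq_le)
  also have "\<dots> = 2 * sqint T f + 2 * sqint T g"
    using L2_integrable_sq[OF assms(1)] L2_integrable_sq[OF assms(2)] by (simp add: sqint_def)
  finally show ?thesis .
qed

lemma sqint_minus_commute: "sqint T (\<lambda>t. f t - g t) = sqint T (\<lambda>t. g t - f t)"
  by (simp add: sqint_def norm_minus_commute)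

lemma sqint_diff_triangle:
  assumes "L2 T f" "L2 T g" "L2 T h"
  shows "sqint T (\<lambda>t. f t - h t) \<le> 2 * sqint T (\<lambda>t. f t - g t) + 2 * sqint T (\<lambda>t. g t - h t)"
  using sqint_add_le[OF L2_diff[OF assms(1,2)] L2_diff[OF assms(2,3)]] by simp

lemma sqint_le:
  assumes f: "L2 T f" and g: "L2 T g" and "\<And>t. t \<in> {0..T} \<Longrightarrow> norm (f t) \<le> K * norm (g t)"
  shows "sqint T f \<le> K\<^sup>2 * sqint T g"
proof -
  have "sqint T f \<le> (\<integral>t. K\<^sup>2 * (norm (g t))\<^sup>2 \<partial>leb T)"
    unfolding sqint_def
  proof (rule integral_mono[OF L2_integrable_sq[OF f]])
    show "integrable (leb T) (\<lambda>t. K\<^sup>2 * (norm (g t))\<^sup>2)" using L2_integrable_sq[OF g] by simp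
    fix t assume "t \<in> space (leb T)"
    then show "(norm (f t))\<^sup>2 \<le> K\<^sup>2 * (norm (g t))\<^sup>2"
      using power_mono[OF assms(3)[of t] norm_ge_zero, of 2] by (simp add: power_mult_distrib)
  qed
  then show ?thesis by (simp add: sqint_def)
qed

text \<open>Young's inequality with a free parameter in the role of Cauchy--Schwarz; the later
  choice 4^-n for \<delta> balances a squared error of order 16^-n.\<close>

lemma L1_le_sqint:
  assumes f: "L2 T f" and T: "T \<ge> 0" and d: "\<delta> > 0"
  shows "(\<integral>t. norm (f t) \<partial>leb T) \<le> \<delta> * T + sqint T f / \<delta>"
proof -
  have "(\<integral>t. norm (f t) \<partial>leb T) \<le> (\<integral>t. \<delta> + (norm (f t))\<^sup>2 / \<delta> \<partial>leb T)"
  proof (rule integral_mono[OF L2_integrable_norm[OF f]])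
    show "integrable (leb T) (\<lambda>t. \<delta> + (norm (f t))\<^sup>2 / \<delta>)"
      using L2_integrable_sq[OF f] by (intro Bochner_Integration.integrable_add) (simp_all add: integrable_leb_continuous)
    fix t
    have "0 \<le> (\<delta> - norm (f t))\<^sup>2 + \<delta> * norm (f t)" using d by simp
    then have "norm (f t) * \<delta> \<le> \<delta> * \<delta> + (norm (f t))\<^sup>2" by (simp add: power2_eq_square algebra_simps)
    then have "norm (f t) \<le> (\<delta> * \<delta> + (norm (f t))\<^sup>2) / \<delta>" using d by (simp add: pos_le_divide_eq)
    then show "norm (f t) \<le> \<delta> + (norm (f t))\<^sup>2 / \<delta>" using d by (simp add: add_divide_distrib)
  qed
  also have "\<dots> = (\<integral>t. \<delta> \<partial>leb T) + (\<integral>t. (norm (f t))\<^sup>2 / \<delta> \<partial>leb T)"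
    using L2_integrable_sq[OF f] by (intro Bochner_Integration.integral_add) (simp_all add: integrable_leb_continuous)
  also have "(\<integral>t. \<delta> \<partial>leb T) = \<delta> * T"
    using T by (simp add: measure_restrict_space)
  finally show ?thesis by (simp add: sqint_def)
qed

lemma L2_apply_tendsto:
  fixes G :: "nat \<Rightarrow> real \<Rightarrow> 'v::complex_inner antidual"
  assumes G: "\<And>n. L2 T (G n)" "L2 T g" and T: "T \<ge> 0" and e: "\<And>n. sqint T (\<lambda>t. G n t - g t) \<le> K * (1/16) ^ n"
  shows "(\<lambda>n. \<integral>t. antidual_apply (G n t) v \<partial>leb T) \<longlonglongrightarrow> (\<integral>t. antidual_apply (g t) v \<partial>leb T)"
proof (rule LIM_zero_cancel, rule Lim_null_comparison)
  have "norm ((\<integral>t. antidual_apply (G n t) v \<partial>leb T) - (\<integral>t. antidual_apply (g t) v \<partial>leb T)) \<le> (T + K) * norm v * (1/4) ^ n" for n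
  proof -
    have "(\<integral>t. antidual_apply (G n t) v \<partial>leb T) - (\<integral>t. antidual_apply (g t) v \<partial>leb T) = (\<integral>t. antidual_apply (G n t - g t) v \<partial>leb T)"
      using L2_integrable_apply[OF G(1)] L2_integrable_apply[OF G(2)] by (simp add: antidual_apply_diff_left)
    also have "norm \<dots> \<le> (\<integral>t. norm (G n t - g t) * norm v \<partial>leb T)"
      by (rule Bochner_Integration.integral_norm_bound_integral)
        (auto intro!: L2_integrable_apply L2_diff G L2_integrable_norm norm_antidual_apply)
    also have "\<dots> = (\<integral>t. norm (G n t - g t) \<partial>leb T) * norm v" by simp
    also have "\<dots> \<le> ((1/4) ^ n * T + sqint T (\<lambda>t. G n t - g t) / (1/4) ^ n) * norm v"
      by (intro mult_right_mono L1_le_sqint L2_diff G T) auto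
    also have "\<dots> \<le> ((1/4) ^ n * T + (K * (1/16) ^ n) / (1/4) ^ n) * norm v"
      by (intro mult_right_mono add_left_mono divide_right_mono e) auto
    also have "(K * (1/16) ^ n) / (1/4) ^ n = K * (1/4::real) ^ n"
      by (simp add: power_divide[symmetric] flip: times_divide_eq_right)
    finally show ?thesis by (simp add: algebra_simps)
  qed
  then show "\<forall>\<^sub>F n in sequentially. norm ((\<integral>t. antidual_apply (G n t) v \<partial>leb T) - (\<integral>t. antidual_apply (g t) v \<partial>leb T)) \<le> (T + K) * norm v * (1/4) ^ n"
    by simp
  have "(\<lambda>n. (T + K) * norm v * (1/4) ^ n) \<longlonglongrightarrow> (T + K) * norm v * 0"
    by (intro tendsto_intros LIMSEQ_realpow_zero) auto
  then show "(\<lambda>n. (T + K) * norm v * (1/4) ^ n) \<longlonglongrightarrow> 0" by simp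
qed

lemma L2_indicator:
  fixes g :: "'b::real_normed_vector"
  assumes "E \<inter> {0..T} \<in> sets (leb T)"
  shows "L2 T (\<lambda>t. if t \<in> E then g else 0)"
proof (rule L2_bound)
  show "strongly_measurable (leb T) (\<lambda>t. if t \<in> E then g else 0)"
    by (intro strongly_measurable_simple simple_function_If_set) (use assms in auto)
  show "integrable (leb T) (\<lambda>_. (norm g)\<^sup>2)" by (intro integrable_leb_continuous continuous_on_const)
qed auto

lemma borel_in_leb: "E \<in> sets borel \<Longrightarrow> E \<inter> {0..T} \<in> sets (leb T)"
  by (simp add: sets_restrict_space_iff sets.Int)

section \<open>Strong solutions\<close>

context elliptic_form
begin

abbreviation "S \<equiv> star.S"

text \<open>\<open>S (t - s) x\<close> is jointly continuous in s and x, which is what the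
  composition rule for strong measurability asks for.\<close>

lemma L2_convolution:
  assumes f: "L2 t f"
  shows "L2 t (\<lambda>s. S (t - s) (f s))"
proof (rule L2_bound)
  have "continuous_on ({0..t} \<times> UNIV) (\<lambda>(s, x). S (t - s) x)"
    unfolding continuous_on_def
  proof (clarify)
    fix s and x :: "'v antidual" assume s: "s \<in> {0..t}"
    show "((\<lambda>(s, x). S (t - s) x) \<longlongrightarrow> S (t - s) x) (at (s, x) within {0..t} \<times> UNIV)"
      unfolding case_prod_unfold
    proof (rule star.S_tendsto)
      show "\<forall>\<^sub>F p in at (s, x) within {0..t} \<times> UNIV. 0 \<le> t - fst p"
        unfolding eventually_at_filter by (rule always_eventually) auto
      show "((\<lambda>p. t - fst p) \<longlongrightarrow> t - s) (at (s, x) within {0..t} \<times> UNIV)"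
        by (rule tendsto_eq_intros refl)+ simp
      show "(snd \<longlongrightarrow> x) (at (s, x) within {0..t} \<times> UNIV)"
        by (rule tendsto_eq_intros refl)+ simp
    qed (use s in auto)
  qed
  then show "strongly_measurable (leb t) (\<lambda>s. S (t - s) (f s))"
    by (rule strongly_measurable_compose1[OF L2_strongly_measurable[OF f]])
  show "integrable (leb t) (\<lambda>s. Ms\<^sup>2 * (norm (f s))\<^sup>2)" using L2_integrable_sq[OF f] by simp
  show "AE s in leb t. (norm (S (t - s) (f s)))\<^sup>2 \<le> Ms\<^sup>2 * (norm (f s))\<^sup>2"
  proof (rule AE_I2)
    fix s assume "s \<in> space (leb t)"
    then show "(norm (S (t - s) (f s)))\<^sup>2 \<le> Ms\<^sup>2 * (norm (f s))\<^sup>2"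
      using power_mono[OF star.S_bound[of "t - s" "f s"] norm_ge_zero, of 2] by (simp add: power_mult_distrib)
  qed
qed

lemma duhamel_apply:
  assumes f: "L2 T f" and t: "t \<in> {0..T}"
  shows "antidual_apply (duhamel \<iota> a f t) v = (\<integral>s. antidual_apply (S (t - s) (f s)) v \<partial>leb t)"
proof -
  have ft: "L2 t f" using L2_subinterval[OF f] t by simp
  have eq: "AE s in leb t. S (t - s) (f s) = semigroup_antidual \<iota> a (t - s) (f s)"
    by (rule AE_I2) (simp add: semigroup_antidual_eq)
  have l: "L2 t (\<lambda>s. semigroup_antidual \<iota> a (t - s) (f s))"
    by (rule L2_cong_AE[OF L2_convolution[OF ft] eq])
  have "antidual_apply (duhamel \<iota> a f t) v = (\<integral>s. antidual_apply (semigroup_antidual \<iota> a (t - s) (f s)) v \<partial>leb t)"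
    unfolding duhamel_def by (rule strong_integral_apply(1)[OF L2_strongly_measurable[OF l] L2_integrable_norm[OF l]])
  also have "\<dots> = (\<integral>s. antidual_apply (S (t - s) (f s)) v \<partial>leb t)"
    by (rule Bochner_Integration.integral_cong) (simp_all add: semigroup_antidual_eq)
  finally show ?thesis .
qed

text \<open>Continuous into V, with the equation valid classically off a finite set; this set
  accommodates the jumps of step functions f.\<close>

definition strong_solution :: "real \<Rightarrow> (real \<Rightarrow> 'v antidual) \<Rightarrow> 'v \<Rightarrow> (real \<Rightarrow> 'v) \<Rightarrow> bool" where
  "strong_solution T f x u \<longleftrightarrow> continuous_on {0..T} u \<and> u 0 = x \<and> L2 T f \<and>
    (\<exists>F. finite F \<and> (\<forall>t\<in>{0<..<T} - F. ((\<lambda>s. j (\<iota> (u s))) has_vector_derivative f t - L (u t)) (at t)))"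

lemma strong_solution_add:
  assumes "strong_solution T f x u" "strong_solution T g y w"
  shows "strong_solution T (\<lambda>t. f t + g t) (x + y) (\<lambda>t. u t + w t)"
proof -
  obtain F where F: "finite F" "\<And>t. t \<in> {0<..<T} - F \<Longrightarrow> ((\<lambda>s. j (\<iota> (u s))) has_vector_derivative f t - L (u t)) (at t)"
    using assms(1) unfolding strong_solution_def by blast
  obtain G where G: "finite G" "\<And>t. t \<in> {0<..<T} - G \<Longrightarrow> ((\<lambda>s. j (\<iota> (w s))) has_vector_derivative g t - L (w t)) (at t)"
    using assms(2) unfolding strong_solution_def by blast
  have "((\<lambda>s. j (\<iota> (u s + w s))) has_vector_derivative (f t + g t) - L (u t + w t)) (at t)" if "t \<in> {0<..<T} - (F \<union> G)" for t
    using has_vector_derivative_add[OF F(2)[of t] G(2)[of t]] that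
    by (simp add: linear_add[OF j_linear] linear_add[OF \<iota>_linear] linear_add[OF L_linear] algebra_simps)
  then have "\<exists>F. finite F \<and> (\<forall>t\<in>{0<..<T} - F. ((\<lambda>s. j (\<iota> (u s + w s))) has_vector_derivative (f t + g t) - L (u t + w t)) (at t))"
    using F(1) G(1) by (intro exI[of _ "F \<union> G"]) auto
  then show ?thesis using assms unfolding strong_solution_def by (auto intro: continuous_on_add L2_add)
qed

lemma strong_solution_uminus:
  assumes "strong_solution T f x u"
  shows "strong_solution T (\<lambda>t. - f t) (- x) (\<lambda>t. - u t)"
proof -
  obtain F where F: "finite F" "\<And>t. t \<in> {0<..<T} - F \<Longrightarrow> ((\<lambda>s. j (\<iota> (u s))) has_vector_derivative f t - L (u t)) (at t)"
    using assms(1) unfolding strong_solution_def by blast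
  have "((\<lambda>s. j (\<iota> (- u s))) has_vector_derivative - f t - L (- u t)) (at t)" if "t \<in> {0<..<T} - F" for t
    using has_vector_derivative_minus[OF F(2)[OF that]]
    by (simp add: linear_neg[OF j_linear] linear_neg[OF \<iota>_linear] linear_neg[OF L_linear] algebra_simps)
  then show ?thesis using assms F(1) unfolding strong_solution_def by (auto intro: continuous_on_minus L2_uminus)
qed

lemma strong_solution_diff:
  "strong_solution T f x u \<Longrightarrow> strong_solution T g y w \<Longrightarrow> strong_solution T (\<lambda>t. f t - g t) (x - y) (\<lambda>t. u t - w t)"
  using strong_solution_add[OF _ strong_solution_uminus, of T f x u g y w] by simp

lemma j_\<iota>_Linv: "j (\<iota> (Linv g)) = Bs g"
  by (simp add: Bs_def)

lemma S_derivative_at: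
  assumes "t > c"
  shows "((\<lambda>s. S (s - c) (Bs g)) has_vector_derivative - S (t - c) g) (at t)"
proof -
  have "((\<lambda>s. S s (Bs g)) has_vector_derivative - S (t - c) g) (at (t - c))"
    using star.S_B_derivative[of "t - c" g] assms at_within_interior[of "t - c" "{0..}"] by simp
  moreover have "((\<lambda>s. s - c) has_vector_derivative 1) (at t)"
    by (auto intro!: derivative_eq_intros)
  ultimately show ?thesis
    using vector_diff_chain_at[of "\<lambda>s. s - c" 1 t "\<lambda>s. S s (Bs g)"] by (simp add: o_def)
qed

text \<open>For x in V the orbit is written as A^-1 S t A x, which is continuous into V.\<close>

lemma strong_solution_homogeneous: "strong_solution T (\<lambda>_. 0) x (\<lambda>t. Linv (S t (L x)))"
  unfolding strong_solution_def
proof (intro conjI exI[of _ "{}"] ballI)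
  show "continuous_on {0..T} (\<lambda>t. Linv (S t (L x)))"
    by (intro bounded_linear.continuous_on[OF Linv_bl] continuous_on_subset[OF star.S_continuous_on]) auto
  show "L2 T (\<lambda>_. 0 :: 'v antidual)" by (intro L2_continuous) simp
  fix t assume "t \<in> {0<..<T} - {}"
  then show "((\<lambda>s. j (\<iota> (Linv (S s (L x))))) has_vector_derivative 0 - L (Linv (S t (L x)))) (at t)"
  proof (rule_tac has_vector_derivative_transform_within_open[of "\<lambda>s. S (s - 0) (Bs (L x))" _ t "{0<..}"])
    show "((\<lambda>s. S (s - 0) (Bs (L x))) has_vector_derivative 0 - L (Linv (S t (L x)))) (at t)" if "t \<in> {0<..<T} - {}"
      using S_derivative_at[of 0 t "L x"] that by simp
  qed (auto simp: j_\<iota>_Linv star.B_S)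
qed (simp_all add: star.S_zero)

text \<open>The integral of S (t - s) g over s from c to t is A^-1 (g - S (t - c) g); this is the
  response to a constant right-hand side switched on at time c.\<close>

lemma strong_solution_step:
  assumes c: "c \<ge> 0"
  shows "strong_solution T (\<lambda>t. if t \<in> {c<..} then g else 0) 0 (\<lambda>t. if t \<le> c then 0 else Linv (g - S (t - c) g))"
  unfolding strong_solution_def
proof (intro conjI exI[of _ "{c}"] ballI)
  have 0: "Linv 0 = 0" using linear_0[OF Linv_linear] .
  have "continuous_on ({..c} \<union> {c..}) (\<lambda>t. if t \<le> c then 0 else Linv (g - S (t - c) g))"
  proof (rule continuous_on_cases)
    have "continuous_on {c..} (\<lambda>t. S (t - c) g)"
      by (rule continuous_on_compose2[OF star.S_continuous_on]) (auto intro!: continuous_intros)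
    then show "continuous_on {c..} (\<lambda>t. Linv (g - S (t - c) g))"
      by (intro bounded_linear.continuous_on[OF Linv_bl] continuous_on_diff continuous_on_const)
  qed (auto simp: star.S_zero 0)
  then show "continuous_on {0..T} (\<lambda>t. if t \<le> c then 0 else Linv (g - S (t - c) g))"
    by (rule continuous_on_subset) auto
  show "L2 T (\<lambda>t. if t \<in> {c<..} then g else 0)"
    by (rule L2_indicator[OF borel_in_leb]) simp
  fix t assume t: "t \<in> {0<..<T} - {c}"
  show "((\<lambda>s. j (\<iota> (if s \<le> c then 0 else Linv (g - S (s - c) g)))) has_vector_derivative
      (if t \<in> {c<..} then g else 0) - L (if t \<le> c then 0 else Linv (g - S (t - c) g))) (at t)"
  proof (cases "t < c")
    case True
    have "((\<lambda>s. 0 :: 'v antidual) has_vector_derivative (if t \<in> {c<..} then g else 0) - L (if t \<le> c then 0 else Linv (g - S (t - c) g))) (at t)"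
      using True by (simp add: linear_0[OF L_linear])
    then show ?thesis
      by (rule has_vector_derivative_transform_within_open[of _ _ _ "{..<c}"])
        (use True in \<open>auto simp: linear_0[OF \<iota>_linear] linear_0[OF j_linear]\<close>)
  next
    case False
    with t have tc: "t > c" by auto
    have "((\<lambda>s. Bs g - S (s - c) (Bs g)) has_vector_derivative 0 - - S (t - c) g) (at t)"
      by (intro has_vector_derivative_diff has_vector_derivative_const S_derivative_at tc)
    then have "((\<lambda>s. Bs g - S (s - c) (Bs g)) has_vector_derivative (if t \<in> {c<..} then g else 0) - L (if t \<le> c then 0 else Linv (g - S (t - c) g))) (at t)"
      using tc by simp
    then show ?thesis
      by (rule has_vector_derivative_transform_within_open[of _ _ _ "{c<..}"])
        (use tc in \<open>auto simp: j_\<iota>_Linv linear_diff[OF star.B_linear] star.B_S\<close>)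
  qed
qed (use c in auto)

lemma strong_solution_energy:
  assumes u: "strong_solution T f x u" and T: "0 < T"
  shows "t \<in> {0..T} \<Longrightarrow> (norm (\<iota> (u t)))\<^sup>2 \<le> (norm (\<iota> x))\<^sup>2 + (1 / \<alpha>) * sqint T f"
    and "\<alpha> * sqint T u \<le> (norm (\<iota> x))\<^sup>2 + (1 / \<alpha>) * sqint T f"
proof -
  obtain F where F: "finite F" "\<And>t. t \<in> {0<..<T} - F \<Longrightarrow> ((\<lambda>s. j (\<iota> (u s))) has_vector_derivative f t - L (u t)) (at t)"
    using u unfolding strong_solution_def by blast
  have uc: "continuous_on {0..T} u" and u0: "u 0 = x" and f: "L2 T f" using u by (auto simp: strong_solution_def)
  have uL: "L2 T u" by (rule L2_continuous[OF uc])
  define E where "E s = (norm (\<iota> (u s)))\<^sup>2" for s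
  define E' where "E' s = 2 * Re (antidual_apply (f s - L (u s)) (u s))" for s
  have Ec: "continuous_on {0..T} E"
    unfolding E_def by (intro continuous_intros bounded_linear.continuous_on[OF \<iota>_bl] uc)
  have Ed: "(E has_vector_derivative E' t) (at t)" if t: "t \<in> {0<..<T} - F" for t
    unfolding has_vector_derivative_iff_quotient
  proof (rule Lim_transform_eventually)
    have "isCont u t" using uc t by (auto simp: continuous_on_eq_continuous_at[of "{0<..<T}"] intro: continuous_on_subset continuous_on_interior)
    then have ut: "(u \<longlongrightarrow> u t) (at t)" by (simp add: isCont_def)
    have q: "((\<lambda>r. (j (\<iota> (u r)) - j (\<iota> (u t))) /\<^sub>R (r - t)) \<longlongrightarrow> f t - L (u t)) (at t)"
      using F(2)[OF t] by (simp add: has_vector_derivative_iff_quotient)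
    have bb: "bounded_bilinear (\<lambda>g v. antidual_apply (g :: 'v antidual) v)"
      by (rule bounded_bilinear.intro)
        (auto simp: antidual_apply_add_left antidual_apply_add_right antidual_apply_scaleR_left antidual_apply_scaleR_right
          intro!: exI[of _ 1] norm_antidual_apply)
    \<comment> \<open>The increment of \<open>E\<close> is the real part of the increment of
      \<open>j (\<iota> (u r))\<close> paired with \<open>u r + u t\<close>, so only the derivative
      in the antidual enters.\<close>
    have "((\<lambda>r. Re (antidual_apply ((j (\<iota> (u r)) - j (\<iota> (u t))) /\<^sub>R (r - t)) (u r + u t))) \<longlongrightarrow> Re (antidual_apply (f t - L (u t)) (u t + u t))) (at t)"
      by (intro tendsto_Re bounded_bilinear.tendsto[OF bb] q tendsto_add ut tendsto_const)
    then show "((\<lambda>r. Re (antidual_apply ((j (\<iota> (u r)) - j (\<iota> (u t))) /\<^sub>R (r - t)) (u r + u t))) \<longlongrightarrow> E' t) (at t)"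
      by (simp add: E'_def antidual_apply_add_right)
    have "Re (antidual_apply ((j (\<iota> (u r)) - j (\<iota> (u t))) /\<^sub>R (r - t)) (u r + u t)) = (E r - E t) /\<^sub>R (r - t)" for r
    proof -
      have "Re (cinner (\<iota> (u t)) (\<iota> (u r))) = Re (cinner (\<iota> (u r)) (\<iota> (u t)))"
        by (subst cinner_commute) simp
      then show ?thesis
        by (simp add: E_def antidual_apply_scaleR_left antidual_apply_diff_left j_apply linear_add[OF \<iota>_linear]
            cinner_add_right Re_cinner_self)
    qed
    then show "\<forall>\<^sub>F r in at t. Re (antidual_apply ((j (\<iota> (u r)) - j (\<iota> (u t))) /\<^sub>R (r - t)) (u r + u t)) = (E r - E t) /\<^sub>R (r - t)"
      by simp
  qed
  have E'le: "E' s \<le> (1 / \<alpha>) * (norm (f s))\<^sup>2 - \<alpha> * (norm (u s))\<^sup>2" for s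
  proof -
    have "Re (antidual_apply (f s) (u s)) \<le> norm (f s) * norm (u s)"
      by (rule order_trans[OF complex_Re_le_cmod norm_antidual_apply])
    moreover have "0 \<le> (1 / \<alpha>) * (norm (f s) - \<alpha> * norm (u s))\<^sup>2" using pos by simp
    moreover have "(1 / \<alpha>) * (norm (f s) - \<alpha> * norm (u s))\<^sup>2 = (1 / \<alpha>) * (norm (f s))\<^sup>2 - 2 * (norm (f s) * norm (u s)) + \<alpha> * (norm (u s))\<^sup>2"
      using pos by (simp add: power2_eq_square field_simps)
    ultimately show ?thesis
      using a_elliptic[of "u s"] by (simp add: E'_def antidual_apply_diff_left L_apply)
  qed
  have main: "E t + \<alpha> * sqint t u \<le> (norm (\<iota> x))\<^sup>2 + (1 / \<alpha>) * sqint t f" if t: "t \<in> {0..T}" for t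
  proof -
    \<comment> \<open>This version of the fundamental theorem tolerates the finite exceptional
      set.\<close>
    have "(E' has_integral E t - E 0) {0..t}"
    proof (rule fundamental_theorem_of_calculus_interior_strong[OF F(1)])
      show "(E has_vector_derivative E' x) (at x)" if "x \<in> {0<..<t} - F" for x using Ed[of x] that t by auto
      show "continuous_on {0..t} E" by (rule continuous_on_subset[OF Ec]) (use t in auto)
    qed (use t in auto)
    moreover have "((\<lambda>s. (1 / \<alpha>) * (norm (f s))\<^sup>2 - \<alpha> * (norm (u s))\<^sup>2) has_integral (1 / \<alpha>) * sqint t f - \<alpha> * sqint t u) {0..t}"
      unfolding sqint_def
      by (intro has_integral_diff has_integral_mult_right has_integral_leb L2_integrable_sq L2_subinterval[OF f] L2_subinterval[OF uL])
        (use t in auto)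
    ultimately have "E t - E 0 \<le> (1 / \<alpha>) * sqint t f - \<alpha> * sqint t u"
      by (rule has_integral_le) (rule E'le)
    then show ?thesis by (simp add: E_def u0)
  qed
  have mono: "sqint t f \<le> sqint T f" if "t \<in> {0..T}" for t
    unfolding sqint_def by (rule integral_leb_mono_interval[OF L2_integrable_sq[OF f]]) (use that in auto)
  show "(norm (\<iota> (u t)))\<^sup>2 \<le> (norm (\<iota> x))\<^sup>2 + (1 / \<alpha>) * sqint T f" if t: "t \<in> {0..T}"
  proof -
    have "(1 / \<alpha>) * sqint t f \<le> (1 / \<alpha>) * sqint T f" using mono[OF t] pos by (intro mult_left_mono) auto
    moreover have "0 \<le> \<alpha> * sqint t u" using pos by (simp add: sqint_nonneg)
    ultimately show ?thesis using main[OF t] by (simp add: E_def)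
  qed
  show "\<alpha> * sqint T u \<le> (norm (\<iota> x))\<^sup>2 + (1 / \<alpha>) * sqint T f"
  proof -
    have "E T + \<alpha> * sqint T u \<le> (norm (\<iota> x))\<^sup>2 + (1 / \<alpha>) * sqint T f" using main[of T] T by simp
    moreover have "E T \<ge> 0" by (simp add: E_def)
    ultimately show ?thesis by linarith
  qed
qed

text \<open>Differentiating \<open>S (t - s) (j (\<iota> (u s)))\<close> in s cancels the terms with
  A and leaves \<open>S (t - s) (f s)\<close>; pairing with v makes the integral scalar.\<close>

lemma strong_solution_formula:
  assumes u: "strong_solution T f x u" and t: "t \<in> {0..T}"
  shows "antidual_apply (j (\<iota> (u t))) v = antidual_apply (S t (j (\<iota> x))) v + (\<integral>s. antidual_apply (S (t - s) (f s)) v \<partial>leb t)"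
proof -
  obtain F where F: "finite F" "\<And>t. t \<in> {0<..<T} - F \<Longrightarrow> ((\<lambda>s. j (\<iota> (u s))) has_vector_derivative f t - L (u t)) (at t)"
    using u unfolding strong_solution_def by blast
  have uc: "continuous_on {0..T} u" and u0: "u 0 = x" and f: "L2 T f" using u by (auto simp: strong_solution_def)
  have ft: "L2 t f" using L2_subinterval[OF f] t by simp
  define \<psi> where "\<psi> s = antidual_apply (S (t - s) (j (\<iota> (u s)))) v" for s
  have "((\<lambda>s. antidual_apply (S (t - s) (f s)) v) has_integral \<psi> t - \<psi> 0) {0..t}"
  proof (rule fundamental_theorem_of_calculus_interior_strong[OF F(1)])
    fix s assume s: "s \<in> {0<..<t} - F"
    have "((\<lambda>r. S (t - r) (j (\<iota> (u r)))) has_vector_derivative S (t - s) (f s - L (u s) + L (u s))) (at s within {..<t})"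
      by (rule star.S_product_rule)
        (use s t F(2)[of s] in \<open>auto simp: Bs_def intro: has_vector_derivative_at_within\<close>)
    then have "((\<lambda>r. S (t - r) (j (\<iota> (u r)))) has_vector_derivative S (t - s) (f s)) (at s)"
      using s at_within_open[of s "{..<t}"] by simp
    from bounded_linear.has_vector_derivative[OF bounded_linear_antidual_apply this]
    show "(\<psi> has_vector_derivative antidual_apply (S (t - s) (f s)) v) (at s)" by (simp add: \<psi>_def[abs_def])
  next
    have "continuous_on {0..t} (\<lambda>s. S (t - s) (j (\<iota> (u s))))"
      unfolding continuous_on_def
    proof (intro ballI, rule star.S_tendsto)
      fix s assume s: "s \<in> {0..t}"
      show "\<forall>\<^sub>F r in at s within {0..t}. 0 \<le> t - r"
        unfolding eventually_at_filter by (rule always_eventually) auto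
      show "((\<lambda>r. t - r) \<longlongrightarrow> t - s) (at s within {0..t})" by (intro tendsto_intros)
      have "continuous_on {0..t} u" by (rule continuous_on_subset[OF uc]) (use t in auto)
      then show "((\<lambda>s. j (\<iota> (u s))) \<longlongrightarrow> j (\<iota> (u s))) (at s within {0..t})"
        using s by (intro bounded_linear.tendsto[OF j_bl] bounded_linear.tendsto[OF \<iota>_bl]) (simp add: continuous_on_def)
    qed auto
    then show "continuous_on {0..t} \<psi>"
      unfolding \<psi>_def by (rule bounded_linear.continuous_on[OF bounded_linear_antidual_apply])
  qed (use t in auto)
  from integral_leb_eqI[OF L2_integrable_apply[OF L2_convolution[OF ft]] this]
  show ?thesis by (simp add: \<psi>_def star.S_zero u0)
qed

text \<open>Integration by parts without boundary terms, since \<phi> vanishes at 0 and T.\<close>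

lemma strong_solution_weak:
  assumes u: "strong_solution T f x u" and T: "0 < T" and \<phi>: "test_function T \<phi>"
  shows "(\<integral>t. - vector_derivative \<phi> (at t) * antidual_apply (j (\<iota> (u t))) v \<partial>leb T) +
      (\<integral>t. \<phi> t * antidual_apply (L (u t)) v \<partial>leb T) = (\<integral>t. \<phi> t * antidual_apply (f t) v \<partial>leb T)"
proof -
  obtain F where F: "finite F" "\<And>t. t \<in> {0<..<T} - F \<Longrightarrow> ((\<lambda>s. j (\<iota> (u s))) has_vector_derivative f t - L (u t)) (at t)"
    using u unfolding strong_solution_def by blast
  have uc: "continuous_on {0..T} u" and f: "L2 T f" using u by (auto simp: strong_solution_def)
  note p = test_function_props[OF \<phi>]
  define w where "w t = antidual_apply (j (\<iota> (u t))) v" for t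
  define \<phi>' where "\<phi>' t = vector_derivative \<phi> (at t)" for t
  have wc: "continuous_on {0..T} w"
    unfolding w_def by (intro bounded_linear.continuous_on[OF bounded_linear_antidual_apply] bounded_linear.continuous_on[OF j_bl] bounded_linear.continuous_on[OF \<iota>_bl] uc)
  have "((\<lambda>t. \<phi> t * antidual_apply (f t - L (u t)) v + \<phi>' t * w t) has_integral \<phi> T * w T - \<phi> 0 * w 0) {0..T}"
  proof (rule fundamental_theorem_of_calculus_interior_strong[OF F(1)])
    fix t assume "t \<in> {0<..<T} - F"
    from bounded_linear.has_vector_derivative[OF bounded_linear_antidual_apply F(2)[OF this]]
    have "(w has_vector_derivative antidual_apply (f t - L (u t)) v) (at t)" by (simp add: w_def[abs_def])
    from has_vector_derivative_mult[OF p(1) this]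
    show "((\<lambda>t. \<phi> t * w t) has_vector_derivative \<phi> t * antidual_apply (f t - L (u t)) v + \<phi>' t * w t) (at t)"
      by (simp add: \<phi>'_def)
  qed (use T in \<open>auto intro!: continuous_intros p wc\<close>)
  then have 0: "((\<lambda>t. \<phi> t * antidual_apply (f t - L (u t)) v + \<phi>' t * w t) has_integral 0) {0..T}"
    by (simp add: p)
  have Lu: "L2 T (\<lambda>t. L (u t))" by (intro L2_continuous bounded_linear.continuous_on[OF L_bl] uc)
  have i: "integrable (leb T) (\<lambda>t. \<phi> t * antidual_apply (f t) v)" "integrable (leb T) (\<lambda>t. \<phi> t * antidual_apply (L (u t)) v)"
    "integrable (leb T) (\<lambda>t. \<phi>' t * w t)"
    using L2_integrable_mult_apply[OF f p(2)] L2_integrable_mult_apply[OF Lu p(2)]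
      integrable_leb_continuous[OF continuous_on_mult[OF p(3) wc]] by (simp_all add: \<phi>'_def)
  have "(\<integral>t. \<phi> t * antidual_apply (f t) v - \<phi> t * antidual_apply (L (u t)) v + \<phi>' t * w t \<partial>leb T) = 0"
    by (rule integral_leb_eqI) (use i 0 in \<open>auto simp: antidual_apply_diff_left right_diff_distrib\<close>)
  then have "(\<integral>t. \<phi> t * antidual_apply (f t) v \<partial>leb T) - (\<integral>t. \<phi> t * antidual_apply (L (u t)) v \<partial>leb T) + (\<integral>t. \<phi>' t * w t \<partial>leb T) = 0"
    using i by simp
  then show ?thesis
    by (simp add: \<phi>'_def w_def algebra_simps)
qed

end

section \<open>The initial value problem\<close>

lemma L2_apply_tendsto_mult:
  fixes G :: "nat \<Rightarrow> real \<Rightarrow> 'v::complex_inner antidual"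
  assumes G: "\<And>n. L2 T (G n)" "L2 T g" and T: "T \<ge> 0" and e: "\<And>n. sqint T (\<lambda>t. G n t - g t) \<le> K * (1/16) ^ n"
    and \<phi>: "continuous_on {0..T} \<phi>"
  shows "(\<lambda>n. \<integral>t. \<phi> t * antidual_apply (G n t) v \<partial>leb T) \<longlonglongrightarrow> (\<integral>t. \<phi> t * antidual_apply (g t) v \<partial>leb T)"
proof -
  have "bounded (\<phi> ` {0..T})" by (rule compact_imp_bounded[OF compact_continuous_image[OF \<phi>]]) simp
  then obtain C where C: "\<And>t. t \<in> {0..T} \<Longrightarrow> cmod (\<phi> t) \<le> C"
    unfolding bounded_iff by (metis imageI)
  have "(\<lambda>n. \<integral>t. antidual_apply (\<phi> t *\<^sub>C G n t) v \<partial>leb T) \<longlonglongrightarrow> (\<integral>t. antidual_apply (\<phi> t *\<^sub>C g t) v \<partial>leb T)"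
  proof (rule L2_apply_tendsto[OF L2_mult_continuous[OF G(1) \<phi>] L2_mult_continuous[OF G(2) \<phi>] T])
    fix n
    have "sqint T (\<lambda>t. \<phi> t *\<^sub>C G n t - \<phi> t *\<^sub>C g t) \<le> C\<^sup>2 * sqint T (\<lambda>t. G n t - g t)"
    proof (rule sqint_le[OF L2_diff[OF L2_mult_continuous[OF G(1) \<phi>] L2_mult_continuous[OF G(2) \<phi>]] L2_diff[OF G]])
      fix t assume t: "t \<in> {0..T}"
      show "norm (\<phi> t *\<^sub>C G n t - \<phi> t *\<^sub>C g t) \<le> C * norm (G n t - g t)"
        unfolding scaleC_diff_right[symmetric]
        by (rule order_trans[OF norm_antidual_scaleC]) (use C[OF t] in \<open>auto intro: mult_right_mono\<close>)
    qed
    also have "\<dots> \<le> C\<^sup>2 * (K * (1/16) ^ n)" by (intro mult_left_mono e) simp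
    finally show "sqint T (\<lambda>t. \<phi> t *\<^sub>C G n t - \<phi> t *\<^sub>C g t) \<le> (C\<^sup>2 * K) * (1/16) ^ n" by (simp add: mult.assoc)
  qed
  then show ?thesis by (simp add: antidual_apply_scaleC_left)
qed

lemma sqint_eq_0_AE: "AE t in leb T. f t = g t \<Longrightarrow> sqint T (\<lambda>t. f t - g t) = 0"
  unfolding sqint_def by (rule integral_eq_zero_AE) (auto elim: eventually_mono)

lemma sqint_tendsto_0:
  fixes f :: "nat \<Rightarrow> real \<Rightarrow> 'b::real_normed_vector"
  assumes f: "\<And>n. L2 T (f n)" and h: "integrable (leb T) h" and b: "\<And>n t. (norm (f n t))\<^sup>2 \<le> h t"
    and lim: "AE t in leb T. (\<lambda>n. f n t) \<longlonglongrightarrow> 0"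
  shows "(\<lambda>n. sqint T (f n)) \<longlonglongrightarrow> 0"
proof -
  have "(\<lambda>n. sqint T (f n)) \<longlonglongrightarrow> (\<integral>t. 0 \<partial>leb T)"
    unfolding sqint_def
  proof (rule integral_dominated_convergence[OF _ _ h])
    show "(\<lambda>t. (norm (f n t))\<^sup>2) \<in> borel_measurable (leb T)" for n
      using L2_integrable_sq[OF f] by (rule borel_measurable_integrable)
    show "AE t in leb T. (\<lambda>n. (norm (f n t))\<^sup>2) \<longlonglongrightarrow> 0"
      using lim
    proof eventually_elim
      fix t assume "(\<lambda>n. f n t) \<longlonglongrightarrow> 0"
      from tendsto_power[OF tendsto_norm[OF this], of 2] show "(\<lambda>n. (norm (f n t))\<^sup>2) \<longlonglongrightarrow> 0" by simp
    qed
  qed (simp_all add: b)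
  then show ?thesis by simp
qed

lemma AE_leb_I:
  assumes "AE t in lborel. P t" shows "AE t in leb T. P t"
proof -
  have "AE t in lebesgue. t \<in> {0..T} \<longrightarrow> P t" using AE_completion[OF assms] by (auto elim: eventually_mono)
  then show ?thesis by (subst AE_restrict_space_iff) auto
qed

lemma quarter_power_sq: "((1/4::real) ^ n)\<^sup>2 = (1/16) ^ n"
  by (simp add: power2_eq_square flip: power_mult_distrib)

lemma geometric_tendsto: "(\<lambda>n. a + b * (1/16::real) ^ n) \<longlonglongrightarrow> a"
proof -
  have "(\<lambda>n. a + b * (1/16::real) ^ n) \<longlonglongrightarrow> a + b * 0" by (intro tendsto_intros LIMSEQ_realpow_zero) auto
  then show ?thesis by simp
qed

section \<open>Density of the right-hand sides with strong solutions\<close>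

context elliptic_form
begin

text \<open>The L2 closure of the right-hand sides that have a strong solution from 0; a nonzero
  initial value is added later by superposition.\<close>

definition "approximable T f \<longleftrightarrow> L2 T f \<and>
  (\<forall>e>0. \<exists>g u. strong_solution T g 0 u \<and> sqint T (\<lambda>t. f t - g t) \<le> e)"

lemma strong_solution_L2: "strong_solution T g x u \<Longrightarrow> L2 T g"
  by (simp add: strong_solution_def)

lemma approximable_strong_solution: "strong_solution T g 0 u \<Longrightarrow> approximable T g"
  unfolding approximable_def
  by (intro conjI allI impI exI[of _ g] exI[of _ u]) (auto simp: strong_solution_L2 sqint_def)

lemma approximable_limit:
  assumes f: "L2 T f" and h: "\<And>e. e > 0 \<Longrightarrow> \<exists>h. approximable T h \<and> sqint T (\<lambda>t. f t - h t) \<le> e"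
  shows "approximable T f"
  unfolding approximable_def
proof (intro conjI allI impI f)
  fix e :: real assume e: "e > 0"
  \<comment> \<open>A quarter, because the triangle inequality for squares doubles each of the two
    errors.\<close>
  then obtain h where h: "approximable T h" "sqint T (\<lambda>t. f t - h t) \<le> e / 4" using h[of "e / 4"] by auto
  then obtain g u where g: "strong_solution T g 0 u" "sqint T (\<lambda>t. h t - g t) \<le> e / 4"
    unfolding approximable_def using e by (meson zero_less_divide_iff zero_less_numeral)
  have "sqint T (\<lambda>t. f t - g t) \<le> 2 * sqint T (\<lambda>t. f t - h t) + 2 * sqint T (\<lambda>t. h t - g t)"
    by (rule sqint_diff_triangle[OF f _ strong_solution_L2[OF g(1)]]) (use h in \<open>simp add: approximable_def\<close>)
  then have "sqint T (\<lambda>t. f t - g t) \<le> e" using h g by linarith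
  with g show "\<exists>g u. strong_solution T g 0 u \<and> sqint T (\<lambda>t. f t - g t) \<le> e" by blast
qed

lemma approximable_cong_AE:
  assumes h: "approximable T h" and eq: "AE t in leb T. h t = f t"
  shows "approximable T f"
proof (rule approximable_limit)
  show "L2 T f" using h eq L2_cong_AE unfolding approximable_def by blast
  have "sqint T (\<lambda>t. f t - h t) = 0"
    by (rule sqint_eq_0_AE) (use eq in \<open>auto elim: eventually_mono\<close>)
  then show "\<exists>h. approximable T h \<and> sqint T (\<lambda>t. f t - h t) \<le> e" if "e > 0" for e
    using h that by (intro exI[of _ h]) auto
qed

lemma approximable_uminus: "approximable T f \<Longrightarrow> approximable T (\<lambda>t. - f t)"
  unfolding approximable_def
proof (intro conjI allI impI)
  assume f: "L2 T f \<and> (\<forall>e>0. \<exists>g u. strong_solution T g 0 u \<and> sqint T (\<lambda>t. f t - g t) \<le> e)"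
  then show "L2 T (\<lambda>t. - f t)" by (simp add: L2_uminus)
  fix e :: real assume "e > 0"
  then obtain g u where g: "strong_solution T g 0 u" "sqint T (\<lambda>t. f t - g t) \<le> e" using f by blast
  from strong_solution_uminus[OF g(1)] have "strong_solution T (\<lambda>t. - g t) 0 (\<lambda>t. - u t)" by simp
  moreover have "sqint T (\<lambda>t. - f t - - g t) = sqint T (\<lambda>t. f t - g t)"
    by (simp add: sqint_def norm_minus_commute)
  ultimately show "\<exists>g u. strong_solution T g 0 u \<and> sqint T (\<lambda>t. - f t - g t) \<le> e"
    using g by (intro exI[of _ "\<lambda>t. - g t"] exI[of _ "\<lambda>t. - u t"]) simp
qed

lemma approximable_add:
  assumes f: "approximable T f" and h: "approximable T h"
  shows "approximable T (\<lambda>t. f t + h t)"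
  unfolding approximable_def
proof (intro conjI allI impI)
  show "L2 T (\<lambda>t. f t + h t)" using f h by (simp add: approximable_def L2_add)
  fix e :: real assume e: "e > 0"
  then have e4: "e / 4 > 0" by simp
  obtain g u where g: "strong_solution T g 0 u" "sqint T (\<lambda>t. f t - g t) \<le> e / 4" using f e4 unfolding approximable_def by blast
  obtain k w where k: "strong_solution T k 0 w" "sqint T (\<lambda>t. h t - k t) \<le> e / 4" using h e4 unfolding approximable_def by blast
  have "sqint T (\<lambda>t. (f t - g t) + (h t - k t)) \<le> 2 * sqint T (\<lambda>t. f t - g t) + 2 * sqint T (\<lambda>t. h t - k t)"
    by (intro sqint_add_le L2_diff) (use f g h k in \<open>auto simp: approximable_def strong_solution_L2\<close>)
  then have "sqint T (\<lambda>t. f t + h t - (g t + k t)) \<le> e" using g k by (simp add: algebra_simps)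
  moreover have "strong_solution T (\<lambda>t. g t + k t) 0 (\<lambda>t. u t + w t)" using strong_solution_add[OF g(1) k(1)] by simp
  ultimately show "\<exists>g u. strong_solution T g 0 u \<and> sqint T (\<lambda>t. f t + h t - g t) \<le> e" by blast
qed

lemma approximable_zero: "approximable T (\<lambda>_. 0)"
  using approximable_strong_solution[OF strong_solution_homogeneous[of T 0]] .

lemma approximable_sum:
  "finite I \<Longrightarrow> (\<And>i. i \<in> I \<Longrightarrow> approximable T (f i)) \<Longrightarrow> approximable T (\<lambda>t. \<Sum>i\<in>I. f i t)"
  by (induction I rule: finite_induct) (simp_all add: approximable_zero approximable_add)

lemma approximable_ray: "approximable T (\<lambda>t. if t \<in> {c<..} then g else 0)"
proof (cases "c \<ge> 0")
  case True
  then show ?thesis by (rule approximable_strong_solution[OF strong_solution_step])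
next
  case False
  \<comment> \<open>On [0,T] this function differs from the required one only at the point
    0.\<close>
  have "approximable T (\<lambda>t. if t \<in> {0<..} then g else 0)"
    by (rule approximable_strong_solution[OF strong_solution_step]) simp
  then show ?thesis
  proof (rule approximable_cong_AE)
    have "AE t in leb T. t \<noteq> 0" by (rule AE_leb_I) (rule AE_lborel_singleton)
    then show "AE t in leb T. (if t \<in> {0<..} then g else 0) = (if t \<in> {c<..} then g else 0)"
      using AE_space by eventually_elim (use False in auto)
  qed
qed

text \<open>Rays are stable under intersection and generate the Borel sets; complements follow by
  linearity and disjoint unions by dominated convergence.\<close>

lemma approximable_borel:
  assumes "E \<in> sets borel"
  shows "approximable T (\<lambda>t. if t \<in> E then g else 0)"
proof -
  have "sets borel = sigma_sets UNIV (range (\<lambda>c::real. {c<..}))"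
    unfolding borel_Ioi by (subst sets_measure_of) auto
  with assms have E: "E \<in> sigma_sets UNIV (range (\<lambda>c::real. {c<..}))" by simp
  have stab: "Int_stable (range (\<lambda>c::real. {c<..}))"
  proof (rule Int_stableI)
    fix A B assume "A \<in> range (\<lambda>c::real. {c<..})" "B \<in> range (\<lambda>c::real. {c<..})"
    then obtain c d where "A = {c<..}" "B = {d<..}" by blast
    then have "A \<inter> B = {max c d<..}" by auto
    then show "A \<inter> B \<in> range (\<lambda>c::real. {c<..})" by blast
  qed
  have sb: "A \<in> sets borel" if "A \<in> sigma_sets UNIV (range (\<lambda>c::real. {c<..}))" for A
    using that \<open>sets borel = _\<close> by simp
  show ?thesis
  proof (rule sigma_sets_induct_disjoint[OF stab _ E, where P = "\<lambda>E. approximable T (\<lambda>t. if t \<in> E then g else 0)"])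
    fix A :: "real set" assume "A \<in> range (\<lambda>c. {c<..})"
    then show "approximable T (\<lambda>t. if t \<in> A then g else 0)" using approximable_ray by auto
  next
    show "approximable T (\<lambda>t. if t \<in> {} then g else 0)" by (simp add: approximable_zero)
  next
    fix A :: "real set" assume A: "approximable T (\<lambda>t. if t \<in> A then g else 0)"
    from approximable_add[OF approximable_ray[of T "-1" g] approximable_uminus[OF A]]
    show "approximable T (\<lambda>t. if t \<in> UNIV - A then g else 0)"
      by (rule approximable_cong_AE) (auto intro!: AE_I2)
  next
    fix A :: "nat \<Rightarrow> real set"
    assume dis: "disjoint_family A" and A: "range A \<subseteq> sigma_sets UNIV (range (\<lambda>c. {c<..}))"
      and ap: "\<And>i. approximable T (\<lambda>t. if t \<in> A i then g else 0)"
    have Ab: "A i \<in> sets borel" for i using A sb by blast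
    define h where "h n t = (if t \<in> (\<Union>i<n. A i) then g else 0)" for n t
    have hs: "h n t = (\<Sum>i<n. if t \<in> A i then g else 0)" for n t
    proof (induction n)
      case (Suc n)
      have "h (Suc n) t = h n t + (if t \<in> A n then g else 0)"
      proof (cases "t \<in> A n")
        case True
        then have "t \<notin> (\<Union>i<n. A i)" using dis unfolding disjoint_family_on_def by (metis IntI UN_iff UNIV_I empty_iff lessThan_iff less_irrefl)
        then show ?thesis using True by (simp add: h_def lessThan_Suc)
      qed (simp add: h_def lessThan_Suc)
      then show ?case using Suc by simp
    qed (simp add: h_def)
    have hap: "approximable T (h n)" for n
      unfolding hs[abs_def] by (intro approximable_sum ap) simp
    define f where "f t = (if t \<in> (\<Union>i. A i) then g else 0)" for t
    have f: "L2 T f" unfolding f_def by (rule L2_indicator[OF borel_in_leb]) (use Ab in auto)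
    have "(\<lambda>n. sqint T (\<lambda>t. f t - h n t)) \<longlonglongrightarrow> 0"
    proof (rule sqint_tendsto_0)
      show "L2 T (\<lambda>t. f t - h n t)" for n using f hap by (intro L2_diff) (auto simp: approximable_def)
      show "integrable (leb T) (\<lambda>_. (norm g)\<^sup>2)" by (intro integrable_leb_continuous continuous_on_const)
      show "(norm (f t - h n t))\<^sup>2 \<le> (norm g)\<^sup>2" for n t by (auto simp: f_def h_def)
      show "AE t in leb T. (\<lambda>n. f t - h n t) \<longlonglongrightarrow> 0"
      proof (rule AE_I2)
        fix t
        show "(\<lambda>n. f t - h n t) \<longlonglongrightarrow> 0"
        proof (cases "t \<in> (\<Union>i. A i)")
          case True
          then obtain i where i: "t \<in> A i" by blast
          have "\<forall>\<^sub>F n in sequentially. f t - h n t = 0"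
            using eventually_gt_at_top[of i] by eventually_elim (use i in \<open>auto simp: f_def h_def\<close>)
          then show ?thesis by (rule tendsto_eventually)
        qed (simp add: f_def h_def)
      qed
    qed
    then have "\<exists>n. sqint T (\<lambda>t. f t - h n t) \<le> e" if "e > 0" for e
      using that order_tendstoD(2)[of _ 0 sequentially e] by (meson eventually_sequentially less_imp_le order_refl)
    with f hap have "approximable T f" by (intro approximable_limit) blast+
    then show "approximable T (\<lambda>t. if t \<in> (\<Union>i. A i) then g else 0)" by (simp add: f_def[abs_def])
  qed simp
qed

text \<open>A Lebesgue set agrees almost everywhere with its Borel \<open>main_part\<close>.\<close>

lemma approximable_indicator:
  assumes E: "E \<in> sets (leb T)"
  shows "approximable T (\<lambda>t. if t \<in> E then g else 0)"
proof -
  have E': "E \<in> sets lebesgue" using E by (simp add: sets_restrict_space_iff)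
  have "approximable T (\<lambda>t. if t \<in> main_part lborel E then g else 0)"
    using main_part_sets[OF E'] by (intro approximable_borel) simp
  then show ?thesis
  proof (rule approximable_cong_AE)
    have "AE t in leb T. t \<in> main_part lborel E \<longleftrightarrow> t \<in> E"
      by (rule AE_leb_I) (rule AE_in_main_part[OF E'])
    then show "AE t in leb T. (if t \<in> main_part lborel E then g else 0) = (if t \<in> E then g else 0)"
      by eventually_elim simp
  qed
qed

lemma approximable_simple:
  assumes s: "simple_function (leb T) s"
  shows "approximable T s"
proof -
  have fin: "finite (s ` {0..T})" and m: "\<And>y. y \<in> s ` {0..T} \<Longrightarrow> s -` {y} \<inter> {0..T} \<in> sets (leb T)"
    using s by (auto simp: simple_function_def)
  have "approximable T (\<lambda>t. \<Sum>y\<in>s ` {0..T}. if t \<in> s -` {y} \<inter> {0..T} then y else 0)"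
    by (intro approximable_sum fin approximable_indicator m)
  then show ?thesis
  proof (rule approximable_cong_AE)
    have "(\<Sum>y\<in>s ` {0..T}. if t \<in> s -` {y} \<inter> {0..T} then y else 0) = s t" if "t \<in> {0..T}" for t
    proof -
      have "(\<Sum>y\<in>s ` {0..T}. if t \<in> s -` {y} \<inter> {0..T} then y else 0) = (\<Sum>y\<in>s ` {0..T}. if s t = y then y else 0)"
        using that by (intro sum.cong) auto
      also have "\<dots> = s t" using fin that by (simp add: sum.delta)
      finally show ?thesis .
    qed
    then show "AE t in leb T. (\<Sum>y\<in>s ` {0..T}. if t \<in> s -` {y} \<inter> {0..T} then y else 0) = s t"
      by (intro AE_I2) simp
  qed
qed

lemma approximable_L2:
  assumes f: "L2 T f"
  shows "approximable T f"
proof -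
  obtain s where s: "\<And>i::nat. simple_function (leb T) (s i)" "\<And>i t. norm (s i t) \<le> 2 * norm (f t)"
    "AE t in leb T. (\<lambda>i. s i t) \<longlonglongrightarrow> f t"
    using strongly_measurable_dominated_approx[OF L2_strongly_measurable[OF f]] by blast
  have sa: "approximable T (s i)" for i by (rule approximable_simple[OF s(1)])
  have "(\<lambda>n. sqint T (\<lambda>t. f t - s n t)) \<longlonglongrightarrow> 0"
  proof (rule sqint_tendsto_0)
    show "L2 T (\<lambda>t. f t - s n t)" for n using f sa by (intro L2_diff) (auto simp: approximable_def)
    show "integrable (leb T) (\<lambda>t. 9 * (norm (f t))\<^sup>2)" using L2_integrable_sq[OF f] by simp
    show "(norm (f t - s n t))\<^sup>2 \<le> 9 * (norm (f t))\<^sup>2" for n t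
    proof -
      have "norm (f t - s n t) \<le> 3 * norm (f t)"
        using norm_triangle_ineq4[of "f t" "s n t"] s(2)[of n t] by linarith
      from power_mono[OF this norm_ge_zero, of 2] show ?thesis by (simp add: power_mult_distrib)
    qed
    show "AE t in leb T. (\<lambda>n. f t - s n t) \<longlonglongrightarrow> 0"
      using s(3)
    proof eventually_elim
      fix t assume "(\<lambda>i. s i t) \<longlonglongrightarrow> f t"
      from tendsto_diff[OF tendsto_const[of "f t"] this] show "(\<lambda>n. f t - s n t) \<longlonglongrightarrow> 0" by simp
    qed
  qed
  then have "\<exists>n. sqint T (\<lambda>t. f t - s n t) \<le> e" if "e > 0" for e
    using that order_tendstoD(2)[of _ 0 sequentially e] by (meson eventually_sequentially less_imp_le order_refl)
  with sa show ?thesis by (intro approximable_limit[OF f]) blast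
qed

text \<open>Superposition of a strong solution from 0 with a nearby right-hand side and a
  homogeneous one whose initial value lies in V and is close to x in H.\<close>

lemma strong_solution_approx:
  assumes f: "L2 T f" and e: "e > 0"
  obtains g y u where "strong_solution T g y u" "sqint T (\<lambda>t. g t - f t) \<le> e" "(norm (\<iota> y - x))\<^sup>2 \<le> e"
proof -
  obtain g u where g: "strong_solution T g 0 u" "sqint T (\<lambda>t. f t - g t) \<le> e"
    using approximable_L2[OF f] e unfolding approximable_def by blast
  have "x \<in> closure (range \<iota>)" by (simp add: \<iota>_dense)
  moreover have "sqrt e > 0" using e by simp
  ultimately obtain y where y: "norm (\<iota> y - x) < sqrt e"
    unfolding closure_approachable dist_norm by blast
  have "(norm (\<iota> y - x))\<^sup>2 \<le> (sqrt e)\<^sup>2" using y by (intro power_mono) auto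
  then have y2: "(norm (\<iota> y - x))\<^sup>2 \<le> e" using e by simp
  from strong_solution_add[OF g(1) strong_solution_homogeneous[of T y]]
  have "strong_solution T g y (\<lambda>t. u t + Linv (S t (L y)))" by simp
  moreover have "sqint T (\<lambda>t. g t - f t) \<le> e" using g(2) by (subst sqint_minus_commute)
  ultimately show thesis using y2 by (rule that)
qed

section \<open>Passage to the limit in the strong solutions\<close>

context
  fixes T :: real and f :: "real \<Rightarrow> 'v antidual" and x :: 'h
    and fn :: "nat \<Rightarrow> real \<Rightarrow> 'v antidual" and xn :: "nat \<Rightarrow> 'v" and un :: "nat \<Rightarrow> real \<Rightarrow> 'v"
  assumes T: "T > 0" and f: "L2 T f"
    and sol: "\<And>n. strong_solution T (fn n) (xn n) (un n)"
    and fn: "\<And>n. sqint T (\<lambda>t. fn n t - f t) \<le> (1/16) ^ n"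
    and xn: "\<And>n. (norm (\<iota> (xn n) - x))\<^sup>2 \<le> (1/16) ^ n"
begin

text \<open>\<open>E2\<close> is the energy bound for the limit, with its factors 2 from the squared
  triangle inequality; \<open>k1\<close> measures the excess for the n-th data and \<open>k2\<close>
  the distance between two members of the sequence.\<close>

definition "k1 = 2 + 2 / \<alpha>"
definition "k2 = 4 * (1 + 1 / \<alpha>)"
definition "E2 = 2 * (norm x)\<^sup>2 + (2 / \<alpha>) * sqint T f"
text \<open>Two limits of one sequence: in H it converges uniformly in t, which yields the
  continuous version, and in V for almost every t.\<close>

definition "uH t = lim (\<lambda>n. \<iota> (un n t))"
definition "uV t = lim (\<lambda>n. un n t)"

lemma un_continuous: "continuous_on {0..T} (un n)" and fn_L2: "L2 T (fn n)" and un_L2: "L2 T (un n)"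
  and un_0: "un n 0 = xn n"
  using sol[of n] by (auto simp: strong_solution_def intro: L2_continuous)

lemma data_bound: "(norm (\<iota> (xn n)))\<^sup>2 + (1 / \<alpha>) * sqint T (fn n) \<le> E2 + k1 * (1/16) ^ n"
proof -
  have "(norm (\<iota> (xn n)))\<^sup>2 \<le> 2 * (norm x)\<^sup>2 + 2 * (1/16) ^ n"
    using norm_add_sq_le[of "\<iota> (xn n) - x" x] xn[of n] by simp
  moreover have "sqint T (fn n) \<le> 2 * sqint T f + 2 * (1/16) ^ n"
    using sqint_add_le[OF L2_diff[OF fn_L2[of n] f] f] fn[of n] by simp
  then have "(1 / \<alpha>) * sqint T (fn n) \<le> (1 / \<alpha>) * (2 * sqint T f + 2 * (1/16) ^ n)"
    using pos by (intro mult_left_mono) auto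
  ultimately show ?thesis by (simp add: E2_def k1_def algebra_simps add_divide_distrib)
qed

lemma data_Cauchy:
  assumes "n \<le> m"
  shows "(norm (\<iota> (xn m - xn n)))\<^sup>2 + (1 / \<alpha>) * sqint T (\<lambda>t. fn m t - fn n t) \<le> k2 * (1/16) ^ n"
proof -
  have p: "(1/16::real) ^ m \<le> (1/16) ^ n" using assms by (intro power_decreasing) auto
  have "(norm (\<iota> (xn m - xn n)))\<^sup>2 \<le> 4 * (1/16) ^ n"
  proof -
    have "(norm (\<iota> (xn m) - \<iota> (xn n)))\<^sup>2 \<le> 2 * (norm (\<iota> (xn m) - x))\<^sup>2 + 2 * (norm (\<iota> (xn n) - x))\<^sup>2"
      using norm_add_sq_le[of "\<iota> (xn m) - x" "- (\<iota> (xn n) - x)"] by (simp add: norm_minus_commute)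
    then show ?thesis using xn[of n] xn[of m] p unfolding linear_diff[OF \<iota>_linear] by linarith
  qed
  moreover have "sqint T (\<lambda>t. fn m t - fn n t) \<le> 4 * (1/16) ^ n"
    using sqint_diff_triangle[OF fn_L2[of m] f fn_L2[of n]] fn[of n] fn[of m] p
    unfolding sqint_minus_commute[of T f] by linarith
  then have "(1 / \<alpha>) * sqint T (\<lambda>t. fn m t - fn n t) \<le> (1 / \<alpha>) * (4 * (1/16) ^ n)"
    using pos by (intro mult_left_mono) auto
  ultimately show ?thesis by (simp add: k2_def algebra_simps)
qed

lemma k2_pos: "k2 > 0" using pos by (simp add: k2_def add_pos_pos)

lemma H_Cauchy:
  assumes "n \<le> m" "t \<in> {0..T}"
  shows "norm (\<iota> (un m t) - \<iota> (un n t)) \<le> sqrt k2 * (1/4) ^ n"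
proof (rule power2_le_imp_le)
  have "(norm (\<iota> (un m t - un n t)))\<^sup>2 \<le> k2 * (1/16) ^ n"
    using strong_solution_energy(1)[OF strong_solution_diff[OF sol sol] T assms(2), of m n] data_Cauchy[OF assms(1)]
    by linarith
  also have "\<dots> = (sqrt k2 * (1/4) ^ n)\<^sup>2"
    using k2_pos by (simp add: power_mult_distrib quarter_power_sq)
  finally show "(norm (\<iota> (un m t) - \<iota> (un n t)))\<^sup>2 \<le> (sqrt k2 * (1/4) ^ n)\<^sup>2"
    by (simp add: linear_diff[OF \<iota>_linear])
qed (use k2_pos in simp)

lemma V_Cauchy:
  assumes "n \<le> m"
  shows "sqint T (\<lambda>t. un m t - un n t) \<le> k2 / \<alpha> * (1/16) ^ n"
proof -
  have "\<alpha> * sqint T (\<lambda>t. un m t - un n t) \<le> k2 * (1/16) ^ n"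
    using strong_solution_energy(2)[OF strong_solution_diff[OF sol sol] T, of m n] data_Cauchy[OF assms] by linarith
  then show ?thesis using pos by (simp add: field_simps)
qed

lemma uH_lim:
  assumes t: "t \<in> {0..T}"
  shows "(\<lambda>n. \<iota> (un n t)) \<longlonglongrightarrow> uH t"
proof -
  have "convergent (\<lambda>n. \<iota> (un n t))"
  proof (rule convergent_geometric)
    fix n
    have "norm (\<iota> (un (Suc n) t) - \<iota> (un n t)) \<le> sqrt k2 * (1/4) ^ n" by (rule H_Cauchy[OF _ t]) simp
    also have "\<dots> \<le> sqrt k2 * (1/2) ^ n" using k2_pos by (intro mult_left_mono power_mono) auto
    finally show "norm (\<iota> (un (Suc n) t) - \<iota> (un n t)) \<le> sqrt k2 * (1/2) ^ n" .
  qed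
  then show ?thesis by (simp add: uH_def convergent_LIMSEQ_iff)
qed

lemma uH_error:
  assumes t: "t \<in> {0..T}"
  shows "norm (\<iota> (un n t) - uH t) \<le> sqrt k2 * (1/4) ^ n"
proof (rule LIMSEQ_le_const2)
  show "(\<lambda>m. norm (\<iota> (un n t) - \<iota> (un m t))) \<longlonglongrightarrow> norm (\<iota> (un n t) - uH t)"
    by (intro tendsto_intros uH_lim t)
  show "\<exists>N. \<forall>m\<ge>N. norm (\<iota> (un n t) - \<iota> (un m t)) \<le> sqrt k2 * (1/4) ^ n"
    using H_Cauchy[OF _ t, of n] by (intro exI[of _ n]) (simp add: norm_minus_commute)
qed

lemma uH_continuous: "continuous_on {0..T} uH"
proof (rule uniform_limit_theorem)
  show "\<forall>\<^sub>F n in sequentially. continuous_on {0..T} (\<lambda>t. \<iota> (un n t))"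
    by (intro always_eventually allI bounded_linear.continuous_on[OF \<iota>_bl] un_continuous)
  show "uniform_limit {0..T} (\<lambda>n t. \<iota> (un n t)) uH sequentially"
  proof (rule uniform_limitI)
    fix e :: real assume e: "e > 0"
    have "(\<lambda>n. sqrt k2 * (1/4) ^ n) \<longlonglongrightarrow> sqrt k2 * 0" by (intro tendsto_intros LIMSEQ_realpow_zero) auto
    then have "\<forall>\<^sub>F n in sequentially. sqrt k2 * (1/4) ^ n < e" using e by (intro order_tendstoD(2)) auto
    then show "\<forall>\<^sub>F n in sequentially. \<forall>t\<in>{0..T}. dist (\<iota> (un n t)) (uH t) < e"
      by eventually_elim (auto simp: dist_norm intro: le_less_trans[OF uH_error])
  qed
qed simp

text \<open>The integrals of the squared increments decay like 16^-n, so their sum with weights 4^n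
  has a finite integral. Where this sum is finite, the increments decay like 2^-n; the rate of the
  data thus replaces the choice of a subsequence.\<close>

lemma uV_lim: "AE t in leb T. (\<lambda>n. un n t) \<longlonglongrightarrow> uV t"
proof -
  define d where "d n t = (norm (un (Suc n) t - un n t))\<^sup>2" for n t
  have di: "integrable (leb T) (d n)" for n
    unfolding d_def[abs_def] by (intro L2_integrable_sq L2_diff un_L2)
  then have dm: "d n \<in> borel_measurable (leb T)" for n by simp
  have db: "(\<integral>t. d n t \<partial>leb T) \<le> k2 / \<alpha> * (1/16) ^ n" for n
    using V_Cauchy[of n "Suc n"] by (simp add: sqint_def d_def)
  have "(\<integral>\<^sup>+t. (\<Sum>n. ennreal (4 ^ n * d n t)) \<partial>leb T) = (\<Sum>n. \<integral>\<^sup>+t. ennreal (4 ^ n * d n t) \<partial>leb T)"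
    using dm by (intro nn_integral_suminf) measurable
  also have "\<dots> \<le> (\<Sum>n. ennreal (k2 / \<alpha> * (1/4) ^ n))"
  proof (intro suminf_le)
    fix n
    have "(\<integral>\<^sup>+t. ennreal (4 ^ n * d n t) \<partial>leb T) = ennreal (\<integral>t. 4 ^ n * d n t \<partial>leb T)"
      by (intro nn_integral_eq_integral integrable_mult_right di AE_I2) (simp add: d_def)
    also have "(\<integral>t. 4 ^ n * d n t \<partial>leb T) = 4 ^ n * (\<integral>t. d n t \<partial>leb T)" by simp
    also have "ennreal \<dots> \<le> ennreal (4 ^ n * (k2 / \<alpha> * (1/16) ^ n))"
      by (intro ennreal_leI mult_left_mono db) simp
    also have "4 ^ n * (k2 / \<alpha> * (1/16) ^ n) = k2 / \<alpha> * (1/4::real) ^ n"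
    proof -
      have "(4::real) ^ n * (1/16) ^ n = (1/4) ^ n" by (simp flip: power_mult_distrib)
      then show ?thesis by (simp add: mult_ac)
    qed
    finally show "(\<integral>\<^sup>+t. ennreal (4 ^ n * d n t) \<partial>leb T) \<le> ennreal (k2 / \<alpha> * (1/4) ^ n)" .
  qed auto
  also have "\<dots> < \<infinity>"
  proof -
    have "summable (\<lambda>n. k2 / \<alpha> * (1/4::real) ^ n)" by (intro summable_mult summable_geometric) simp
    then show ?thesis using k2_pos pos by (subst suminf_ennreal2) auto
  qed
  finally have "(\<integral>\<^sup>+t. (\<Sum>n. ennreal (4 ^ n * d n t)) \<partial>leb T) \<noteq> \<infinity>" by simp
  then have "AE t in leb T. (\<Sum>n. ennreal (4 ^ n * d n t)) \<noteq> \<infinity>"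
    using dm by (intro nn_integral_PInf_AE) measurable
  then show ?thesis
  proof eventually_elim
    fix t assume fin: "(\<Sum>n. ennreal (4 ^ n * d n t)) \<noteq> \<infinity>"
    define s where "s = enn2real (\<Sum>n. ennreal (4 ^ n * d n t))"
    have s: "(\<Sum>n. ennreal (4 ^ n * d n t)) = ennreal s" using fin by (simp add: s_def less_top)
    have sn: "s \<ge> 0" by (simp add: s_def)
    have "convergent (\<lambda>n. un n t)"
    proof (rule convergent_geometric)
      fix n
      have "ennreal (4 ^ n * d n t) \<le> (\<Sum>n. ennreal (4 ^ n * d n t))"
        using sum_le_suminf[of "\<lambda>n. ennreal (4 ^ n * d n t)" "{n}"] by simp
      then have "4 ^ n * d n t \<le> s" using sn unfolding s by (simp add: ennreal_le_iff)
      then have "(2 ^ n * norm (un (Suc n) t - un n t))\<^sup>2 \<le> (sqrt s)\<^sup>2"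
        using sn by (simp add: d_def power_mult_distrib power_mult[symmetric] mult.commute[of n 2] power_mult)
      then have "2 ^ n * norm (un (Suc n) t - un n t) \<le> sqrt s" by (rule power2_le_imp_le) (use sn in simp)
      then show "norm (un (Suc n) t - un n t) \<le> sqrt s * (1/2) ^ n"
        by (simp add: power_one_over field_simps)
    qed
    then show "(\<lambda>n. un n t) \<longlonglongrightarrow> uV t" by (simp add: uV_def convergent_LIMSEQ_iff)
  qed
qed

lemma uH_uV: "AE t in leb T. uH t = \<iota> (uV t)"
  using uV_lim AE_space
proof eventually_elim
  fix t assume t: "(\<lambda>n. un n t) \<longlonglongrightarrow> uV t" "t \<in> space (leb T)"
  then have "(\<lambda>n. \<iota> (un n t)) \<longlonglongrightarrow> uH t" by (intro uH_lim) simp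
  then show "uH t = \<iota> (uV t)" by (rule LIMSEQ_unique[OF _ bounded_linear.tendsto[OF \<iota>_bl t(1)]])
qed

lemma uV_measurable: "strongly_measurable (leb T) uV"
  by (rule strongly_measurable_limit_continuous[OF un_continuous uV_lim])

text \<open>By Fatou's lemma.\<close>

lemma uV_diff: "L2 T (\<lambda>t. uV t - un n t)" "sqint T (\<lambda>t. uV t - un n t) \<le> k2 / \<alpha> * (1/16) ^ n"
proof -
  define e where "e = k2 / \<alpha> * (1/16) ^ n"
  have e: "e \<ge> 0" using k2_pos pos by (simp add: e_def)
  have sm: "strongly_measurable (leb T) (\<lambda>t. uV t - un n t)"
    by (intro strongly_measurable_diff uV_measurable strongly_measurable_continuous un_continuous)
  then have m: "(\<lambda>t. (norm (uV t - un n t))\<^sup>2) \<in> borel_measurable (leb T)"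
    using strongly_measurable_imp_measurable[OF sm] by measurable
  have i: "integrable (leb T) (\<lambda>t. (norm (un m t - un n t))\<^sup>2)" for m
    by (intro L2_integrable_sq L2_diff un_L2)
  have "(\<integral>\<^sup>+t. ennreal ((norm (uV t - un n t))\<^sup>2) \<partial>leb T) =
      (\<integral>\<^sup>+t. liminf (\<lambda>m. ennreal ((norm (un m t - un n t))\<^sup>2)) \<partial>leb T)"
  proof (rule nn_integral_cong_AE)
    show "AE t in leb T. ennreal ((norm (uV t - un n t))\<^sup>2) = liminf (\<lambda>m. ennreal ((norm (un m t - un n t))\<^sup>2))"
      using uV_lim
    proof eventually_elim
      fix t assume "(\<lambda>n. un n t) \<longlonglongrightarrow> uV t"
      then have "(\<lambda>m. ennreal ((norm (un m t - un n t))\<^sup>2)) \<longlonglongrightarrow> ennreal ((norm (uV t - un n t))\<^sup>2)"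
        by (intro tendsto_ennrealI tendsto_intros)
      then show "ennreal ((norm (uV t - un n t))\<^sup>2) = liminf (\<lambda>m. ennreal ((norm (un m t - un n t))\<^sup>2))"
        by (intro lim_imp_Liminf[symmetric]) simp_all
    qed
  qed
  also have "\<dots> \<le> liminf (\<lambda>m. \<integral>\<^sup>+t. ennreal ((norm (un m t - un n t))\<^sup>2) \<partial>leb T)"
    using i by (intro nn_integral_liminf) (auto intro: borel_measurable_integrable)
  also have "\<dots> \<le> liminf (\<lambda>m::nat. ennreal e)"
  proof (rule Liminf_mono)
    show "\<forall>\<^sub>F m in sequentially. (\<integral>\<^sup>+t. ennreal ((norm (un m t - un n t))\<^sup>2) \<partial>leb T) \<le> ennreal e"
      using eventually_ge_at_top[of n]
    proof eventually_elim
      fix m assume "n \<le> m"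
      have "(\<integral>\<^sup>+t. ennreal ((norm (un m t - un n t))\<^sup>2) \<partial>leb T) = ennreal (sqint T (\<lambda>t. un m t - un n t))"
        unfolding sqint_def by (rule nn_integral_eq_integral[OF i]) simp
      then show "(\<integral>\<^sup>+t. ennreal ((norm (un m t - un n t))\<^sup>2) \<partial>leb T) \<le> ennreal e"
        using V_Cauchy[OF \<open>n \<le> m\<close>] by (simp add: e_def ennreal_leI)
    qed
  qed
  also have "\<dots> = ennreal e" by (simp add: Liminf_const)
  finally have le: "(\<integral>\<^sup>+t. ennreal ((norm (uV t - un n t))\<^sup>2) \<partial>leb T) \<le> ennreal e" .
  have int: "integrable (leb T) (\<lambda>t. (norm (uV t - un n t))\<^sup>2)"
    by (rule integrableI_bounded[OF m]) (use le in \<open>auto simp: le_less_trans\<close>)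
  then show "L2 T (\<lambda>t. uV t - un n t)" using sm by (simp add: L2_def)
  have "ennreal (sqint T (\<lambda>t. uV t - un n t)) \<le> ennreal e"
    using le unfolding sqint_def by (subst (asm) nn_integral_eq_integral[OF int]) simp_all
  then show "sqint T (\<lambda>t. uV t - un n t) \<le> k2 / \<alpha> * (1/16) ^ n"
    using e by (simp add: e_def ennreal_le_iff)
qed

lemma uV_L2: "L2 T uV"
  using L2_add[OF uV_diff(1)[of 0] un_L2[of 0]] by simp

lemma uH_bound:
  assumes t: "t \<in> {0..T}"
  shows "(norm (uH t))\<^sup>2 \<le> E2"
proof (rule LIMSEQ_le[OF _ geometric_tendsto])
  show "(\<lambda>n. (norm (\<iota> (un n t)))\<^sup>2) \<longlonglongrightarrow> (norm (uH t))\<^sup>2" by (intro tendsto_intros uH_lim t)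
  show "\<exists>N. \<forall>n\<ge>N. (norm (\<iota> (un n t)))\<^sup>2 \<le> E2 + k1 * (1/16) ^ n"
    using order_trans[OF strong_solution_energy(1)[OF sol T t] data_bound] by blast
qed

text \<open>The factor 2 beside \<open>E2\<close> comes from splitting \<open>uV\<close> into
  \<open>un n\<close> and the error before n grows.\<close>

lemma uV_bound: "\<alpha> * sqint T uV \<le> 2 * E2"
proof (rule LIMSEQ_le_const[OF geometric_tendsto])
  have "\<alpha> * sqint T uV \<le> 2 * E2 + (2 * k2 + 2 * k1) * (1/16) ^ n" for n
  proof -
    have "\<alpha> * sqint T uV \<le> \<alpha> * (2 * sqint T (\<lambda>t. uV t - un n t) + 2 * sqint T (un n))"
      using sqint_add_le[OF uV_diff(1)[of n] un_L2[of n]] pos by (intro mult_left_mono) auto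
    also have "\<dots> = 2 * (\<alpha> * sqint T (\<lambda>t. uV t - un n t)) + 2 * (\<alpha> * sqint T (un n))" by (simp add: algebra_simps)
    also have "\<dots> \<le> 2 * (\<alpha> * (k2 / \<alpha> * (1/16) ^ n)) + 2 * (E2 + k1 * (1/16) ^ n)"
      using pos order_trans[OF strong_solution_energy(2)[OF sol T] data_bound]
      by (intro add_mono mult_left_mono uV_diff) auto
    also have "\<dots> = 2 * E2 + (2 * k2 + 2 * k1) * (1/16) ^ n" using pos by (simp add: algebra_simps)
    finally show ?thesis .
  qed
  then show "\<exists>N. \<forall>n\<ge>N. \<alpha> * sqint T uV \<le> 2 * E2 + (2 * k2 + 2 * k1) * (1/16) ^ n" by blast
qed

lemma xn_lim: "(\<lambda>n. \<iota> (xn n)) \<longlonglongrightarrow> x"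
proof (rule LIM_zero_cancel, rule Lim_null_comparison)
  have "norm (\<iota> (xn n) - x) \<le> (1/4) ^ n" for n
  proof (rule power2_le_imp_le)
    show "(norm (\<iota> (xn n) - x))\<^sup>2 \<le> ((1/4) ^ n)\<^sup>2" using xn[of n] by (simp only: quarter_power_sq)
  qed simp
  then show "\<forall>\<^sub>F n in sequentially. norm (\<iota> (xn n) - x) \<le> (1/4) ^ n" by simp
qed (intro LIMSEQ_realpow_zero; simp)

lemma uH_0: "uH 0 = x"
  using uH_lim[of 0] xn_lim T by (simp add: un_0 LIMSEQ_unique)

text \<open>The formula holds for every \<open>un n\<close>. The integral converges through the L2
  error of \<open>fn n\<close>, the other terms by continuity.\<close>

lemma uH_formula:
  assumes t: "t \<in> {0..T}"
  shows "antidual_apply (j (uH t)) v = antidual_apply (S t (j x)) v + (\<integral>s. antidual_apply (S (t - s) (f s)) v \<partial>leb t)"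
proof (rule LIMSEQ_unique)
  note bl = bounded_linear.tendsto[OF bounded_linear_antidual_apply]
  have t0: "t \<ge> 0" "t \<le> T" using t by auto
  show "(\<lambda>n. antidual_apply (j (\<iota> (un n t))) v) \<longlonglongrightarrow> antidual_apply (j (uH t)) v"
    by (intro bl bounded_linear.tendsto[OF j_bl] uH_lim t)
  have "(\<lambda>n. \<integral>s. antidual_apply (S (t - s) (fn n s)) v \<partial>leb t) \<longlonglongrightarrow> (\<integral>s. antidual_apply (S (t - s) (f s)) v \<partial>leb t)"
  proof (rule L2_apply_tendsto[OF L2_convolution L2_convolution t0(1)])
    show l: "L2 t (fn n)" "L2 t f" for n using L2_subinterval[OF fn_L2 t0(2)] L2_subinterval[OF f t0(2)] by auto
    fix n
    have "sqint t (\<lambda>s. S (t - s) (fn n s) - S (t - s) (f s)) \<le> Ms\<^sup>2 * sqint t (\<lambda>s. fn n s - f s)"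
    proof (rule sqint_le[OF L2_diff[OF L2_convolution L2_convolution] L2_diff])
      fix s assume "s \<in> {0..t}"
      then show "norm (S (t - s) (fn n s) - S (t - s) (f s)) \<le> Ms * norm (fn n s - f s)"
        using star.S_bound[of "t - s" "fn n s - f s"] linear_diff[OF star.S_linear[of "t - s"]] by simp
    qed (use l in auto)
    also have "\<dots> \<le> Ms\<^sup>2 * (1/16) ^ n"
    proof (rule mult_left_mono)
      have "sqint t (\<lambda>s. fn n s - f s) \<le> sqint T (\<lambda>s. fn n s - f s)"
        unfolding sqint_def by (rule integral_leb_mono_interval[OF L2_integrable_sq[OF L2_diff[OF fn_L2 f]] t0(2)]) simp
      then show "sqint t (\<lambda>s. fn n s - f s) \<le> (1/16) ^ n" using fn[of n] by linarith
    qed simp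
    finally show "sqint t (\<lambda>s. S (t - s) (fn n s) - S (t - s) (f s)) \<le> Ms\<^sup>2 * (1/16) ^ n" .
  qed
  then have "(\<lambda>n. antidual_apply (S t (j (\<iota> (xn n)))) v + (\<integral>s. antidual_apply (S (t - s) (fn n s)) v \<partial>leb t)) \<longlonglongrightarrow>
      antidual_apply (S t (j x)) v + (\<integral>s. antidual_apply (S (t - s) (f s)) v \<partial>leb t)"
    using t0 by (intro tendsto_add bl bounded_linear.tendsto[OF star.S_bl] bounded_linear.tendsto[OF j_bl] xn_lim)
  then show "(\<lambda>n. antidual_apply (j (\<iota> (un n t))) v) \<longlonglongrightarrow>
      antidual_apply (S t (j x)) v + (\<integral>s. antidual_apply (S (t - s) (f s)) v \<partial>leb t)"
    by (simp add: strong_solution_formula[OF sol t])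
qed

lemma uH_weak:
  assumes \<phi>: "test_function T \<phi>"
  shows "(\<integral>t. - vector_derivative \<phi> (at t) * antidual_apply (j (uH t)) v \<partial>leb T) +
      (\<integral>t. \<phi> t * antidual_apply (L (uV t)) v \<partial>leb T) = (\<integral>t. \<phi> t * antidual_apply (f t) v \<partial>leb T)"
proof (rule LIMSEQ_unique)
  note p = test_function_props[OF \<phi>]
  have T0: "T \<ge> 0" using T by simp
  have c: "continuous_on {0..T} (\<lambda>t. - vector_derivative \<phi> (at t))" by (intro continuous_on_minus p)
  have jc: "continuous_on {0..T} (\<lambda>t. j (\<iota> (un n t)))" "continuous_on {0..T} (\<lambda>t. j (uH t))" for n
    by (intro bounded_linear.continuous_on[OF j_bl] bounded_linear.continuous_on[OF \<iota>_bl] un_continuous uH_continuous)+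
  have 1: "(\<lambda>n. \<integral>t. - vector_derivative \<phi> (at t) * antidual_apply (j (\<iota> (un n t))) v \<partial>leb T) \<longlonglongrightarrow>
      (\<integral>t. - vector_derivative \<phi> (at t) * antidual_apply (j (uH t)) v \<partial>leb T)"
  proof (rule L2_apply_tendsto_mult[OF L2_continuous[OF jc(1)] L2_continuous[OF jc(2)] T0 _ c])
    fix n
    have "sqint T (\<lambda>t. j (\<iota> (un n t)) - j (uH t)) \<le> (\<kappa> * (sqrt k2 * (1/4) ^ n))\<^sup>2 * sqint T (\<lambda>t. 1 :: real)"
    proof (rule sqint_le)
      show "L2 T (\<lambda>t. j (\<iota> (un n t)) - j (uH t))" by (intro L2_diff L2_continuous jc)
      show "L2 T (\<lambda>t. 1 :: real)" by (intro L2_continuous continuous_on_const)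
      fix t assume t: "t \<in> {0..T}"
      have "norm (j (\<iota> (un n t) - uH t)) \<le> \<kappa> * (sqrt k2 * (1/4) ^ n)"
        using pos by (intro order_trans[OF j_norm] mult_left_mono uH_error t) auto
      then show "norm (j (\<iota> (un n t)) - j (uH t)) \<le> \<kappa> * (sqrt k2 * (1/4) ^ n) * norm (1::real)"
        by (simp add: linear_diff[OF j_linear])
    qed
    also have "\<dots> = (\<kappa>\<^sup>2 * k2 * sqint T (\<lambda>t. 1 :: real)) * (1/16) ^ n"
      using k2_pos by (simp add: power_mult_distrib quarter_power_sq)
    finally show "sqint T (\<lambda>t. j (\<iota> (un n t)) - j (uH t)) \<le> (\<kappa>\<^sup>2 * k2 * sqint T (\<lambda>t. 1 :: real)) * (1/16) ^ n" .
  qed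
  have Ll: "L2 T (\<lambda>t. L (un n t))" "L2 T (\<lambda>t. L (uV t))" for n
    by (intro L2_bounded_linear[OF _ L_bl] un_L2 uV_L2)+
  have 2: "(\<lambda>n. \<integral>t. \<phi> t * antidual_apply (L (un n t)) v \<partial>leb T) \<longlonglongrightarrow> (\<integral>t. \<phi> t * antidual_apply (L (uV t)) v \<partial>leb T)"
  proof (rule L2_apply_tendsto_mult[OF Ll T0 _ p(2)])
    fix n
    have "sqint T (\<lambda>t. L (un n t) - L (uV t)) \<le> C\<^sup>2 * sqint T (\<lambda>t. uV t - un n t)"
    proof (rule sqint_le[OF L2_diff[OF Ll] uV_diff(1)])
      show "norm (L (un n t) - L (uV t)) \<le> C * norm (uV t - un n t)" for t
        using L_norm[of "un n t - uV t"] by (simp add: linear_diff[OF L_linear] norm_minus_commute)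
    qed
    also have "\<dots> \<le> C\<^sup>2 * (k2 / \<alpha> * (1/16) ^ n)" by (intro mult_left_mono uV_diff) simp
    finally show "sqint T (\<lambda>t. L (un n t) - L (uV t)) \<le> (C\<^sup>2 * (k2 / \<alpha>)) * (1/16) ^ n" by (simp add: mult_ac)
  qed
  show "(\<lambda>n. (\<integral>t. - vector_derivative \<phi> (at t) * antidual_apply (j (\<iota> (un n t))) v \<partial>leb T) +
      (\<integral>t. \<phi> t * antidual_apply (L (un n t)) v \<partial>leb T)) \<longlonglongrightarrow>
      (\<integral>t. - vector_derivative \<phi> (at t) * antidual_apply (j (uH t)) v \<partial>leb T) + (\<integral>t. \<phi> t * antidual_apply (L (uV t)) v \<partial>leb T)"
    by (rule tendsto_add[OF 1 2])
  have "(\<lambda>n. \<integral>t. \<phi> t * antidual_apply (fn n t) v \<partial>leb T) \<longlonglongrightarrow> (\<integral>t. \<phi> t * antidual_apply (f t) v \<partial>leb T)"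
    by (rule L2_apply_tendsto_mult[OF fn_L2 f T0 _ p(2), where K = 1]) (use fn in simp)
  then show "(\<lambda>n. (\<integral>t. - vector_derivative \<phi> (at t) * antidual_apply (j (\<iota> (un n t))) v \<partial>leb T) +
      (\<integral>t. \<phi> t * antidual_apply (L (un n t)) v \<partial>leb T)) \<longlonglongrightarrow> (\<integral>t. \<phi> t * antidual_apply (f t) v \<partial>leb T)"
    by (simp only: strong_solution_weak[OF sol T \<phi>])
qed

end

lemma initial_value_problem_solvable:
  assumes T: "T > 0" and f: "L2 T f"
  obtains u w where "continuous_on {0..T} u" "u 0 = x" "L2 T w" "AE t in leb T. u t = \<iota> (w t)"
    "\<And>t v. t \<in> {0..T} \<Longrightarrow> antidual_apply (j (u t)) v =
      antidual_apply (S t (j x)) v + (\<integral>s. antidual_apply (S (t - s) (f s)) v \<partial>leb t)"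
    "\<And>\<phi> v. test_function T \<phi> \<Longrightarrow> (\<integral>t. - vector_derivative \<phi> (at t) * antidual_apply (j (u t)) v \<partial>leb T) +
      (\<integral>t. \<phi> t * antidual_apply (L (w t)) v \<partial>leb T) = (\<integral>t. \<phi> t * antidual_apply (f t) v \<partial>leb T)"
    "\<And>t. t \<in> {0..T} \<Longrightarrow> (norm (u t))\<^sup>2 \<le> 2 * (norm x)\<^sup>2 + (2 / \<alpha>) * sqint T f"
    "\<alpha> * sqint T w \<le> 2 * (2 * (norm x)\<^sup>2 + (2 / \<alpha>) * sqint T f)"
proof -
  have "\<exists>g y u. strong_solution T g y u \<and> sqint T (\<lambda>t. g t - f t) \<le> (1/16) ^ n \<and> (norm (\<iota> y - x))\<^sup>2 \<le> (1/16) ^ n" for n :: nat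
  proof -
    have "(1/16::real) ^ n > 0" by simp
    then show ?thesis by (rule strong_solution_approx[OF f]) blast
  qed
  then have "\<forall>n::nat. \<exists>g y u. strong_solution T g y u \<and> sqint T (\<lambda>t. g t - f t) \<le> (1/16) ^ n \<and> (norm (\<iota> y - x))\<^sup>2 \<le> (1/16) ^ n"
    by blast
  from choice[OF this] obtain fn :: "nat \<Rightarrow> real \<Rightarrow> 'v antidual" where
    "\<forall>n. \<exists>y u. strong_solution T (fn n) y u \<and> sqint T (\<lambda>t. fn n t - f t) \<le> (1/16) ^ n \<and> (norm (\<iota> y - x))\<^sup>2 \<le> (1/16) ^ n"
    by blast
  from choice[OF this] obtain xn :: "nat \<Rightarrow> 'v" where
    "\<forall>n. \<exists>u. strong_solution T (fn n) (xn n) u \<and> sqint T (\<lambda>t. fn n t - f t) \<le> (1/16) ^ n \<and> (norm (\<iota> (xn n) - x))\<^sup>2 \<le> (1/16) ^ n"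
    by blast
  from choice[OF this] obtain un where *: "\<And>n::nat. strong_solution T (fn n) (xn n) (un n)"
    "\<And>n. sqint T (\<lambda>t. fn n t - f t) \<le> (1/16) ^ n" "\<And>n. (norm (\<iota> (xn n) - x))\<^sup>2 \<le> (1/16) ^ n"
    by blast
  note c = T f *
  show thesis
    by (rule that[OF uH_continuous[OF c] uH_0[OF c] uV_L2[OF c] uH_uV[OF c] uH_formula[OF c] uH_weak[OF c]
          uH_bound[OF c, unfolded E2_def[OF c]] uV_bound[OF c, unfolded E2_def[OF c]]])
qed

end

section \<open>Weak solutions\<close>

lemma integral_indicator_Ioc:
  fixes g :: "real \<Rightarrow> complex"
  assumes g: "integrable (leb T) g" and ab: "0 \<le> a" "a \<le> b" "b \<le> T"
  shows "integral {a..b} g = integral {0..b} g - integral {0..a} g"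
    and "(\<integral>t. indicator {a<..b} t * g t \<partial>leb T) = integral {a..b} g"
proof -
  have gi: "g integrable_on {0..T}" using has_integral_leb[OF g] by (rule has_integral_integrable)
  have "integral {0..a} g + integral {a..b} g = integral {0..b} g"
    by (rule Henstock_Kurzweil_Integration.integral_combine) (use ab gi in \<open>auto intro: integrable_on_subinterval\<close>)
  then show "integral {a..b} g = integral {0..b} g - integral {0..a} g" by (simp add: algebra_simps)
  have "(g has_integral integral {a..b} g) {a..b}"
    using gi ab by (intro integrable_integral) (auto intro: integrable_on_subinterval)
  then have "((\<lambda>t. if t \<in> {a..b} then g t else 0) has_integral integral {a..b} g) {0..T}"
    by (subst has_integral_restrict) (use ab in auto)
  then have h: "((\<lambda>t. indicator {a<..b} t * g t) has_integral integral {a..b} g) {0..T}"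
    by (rule has_integral_spike_finite[of "{a}", rotated 2]) (auto simp: indicator_def)
  have "{a<..b} \<in> sets (leb T)" using ab by (auto simp: sets_restrict_space_iff)
  then have "integrable (leb T) (\<lambda>t. indicator {a<..b} t *\<^sub>R g t)" using g by (rule integrable_mult_indicator)
  moreover have "(\<lambda>t. indicator {a<..b} t *\<^sub>R g t) = (\<lambda>t. indicator {a<..b} t * g t)"
    by (intro ext) (simp split: split_indicator)
  ultimately have "integrable (leb T) (\<lambda>t. indicator {a<..b} t * g t)" by simp
  then show "(\<integral>t. indicator {a<..b} t * g t \<partial>leb T) = integral {a..b} g"
    by (rule integral_leb_eqI[OF _ h])
qed

text \<open>On the open interval w minus the primitive of g is constant; it is continuous on the
  closed interval, so the constancy extends to the end points.\<close>

lemma du_Bois_Reymond_closed: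
  fixes w g :: "real \<Rightarrow> complex"
  assumes T: "0 < T" and w: "continuous_on {0..T} w" and g: "integrable (leb T) g"
    and eq: "\<And>\<phi>. test_function T \<phi> \<Longrightarrow>
      (\<integral>t. \<phi> t * g t \<partial>leb T) = (\<integral>t. - vector_derivative \<phi> (at t) * w t \<partial>leb T)"
    and t: "t \<in> {0..T}"
  shows "integral {0..t} g = w t - w 0"
proof -
  have gi: "g integrable_on {0..T}" using has_integral_leb[OF g] by (rule has_integral_integrable)
  define K where "K t = w t - integral {0..t} g" for t
  have Kc: "continuous_on (closure {0<..<T}) K"
    using T w indefinite_integral_continuous_1[OF gi] unfolding K_def by (auto intro!: continuous_on_diff)
  have K1: "K b = K a" if "0 < a" "a \<le> b" "b < T" for a b
  proof -
    have "integral {0..b} g - integral {0..a} g = w b - w a"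
      using du_Bois_Reymond[OF w g eq that] integral_indicator_Ioc[OF g, of a b] that by simp
    then show ?thesis unfolding K_def by algebra
  qed
  have K2: "K s = K (T / 2)" if "s \<in> {0<..<T}" for s
    using K1[of s "T / 2"] K1[of "T / 2" s] that T by (cases "s \<le> T / 2") auto
  have "K s = K (T / 2)" if "s \<in> {0..T}" for s
    by (rule continuous_constant_on_closure[OF Kc K2]) (use that T in auto)
  from this[OF t] this[of 0] T have "K t = K 0" by simp
  then have *: "w t - integral {0..t} g = w 0" by (simp add: K_def)
  have "integral {0..t} g = w t - (w t - integral {0..t} g)" by simp
  then show ?thesis unfolding * .
qed

text \<open>The integral vanishes over rays, hence over Borel sets, hence over Lebesgue sets; the
  sets where the real or the imaginary part has a fixed sign leave only the value 0.\<close>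

lemma AE_zero_if_integrals_zero:
  fixes g :: "real \<Rightarrow> complex"
  assumes T: "0 < T" and g: "integrable (leb T) g" and 0: "\<And>t. t \<in> {0..T} \<Longrightarrow> integral {0..t} g = 0"
  shows "AE t in leb T. g t = 0"
proof -
  have ii: "integrable (leb T) (\<lambda>t. indicator E t *\<^sub>R g t)" if "E \<in> sets borel" for E
  proof -
    have "integrable (leb T) (\<lambda>t. indicator (E \<inter> {0..T}) t *\<^sub>R g t)"
      by (rule integrable_mult_indicator[OF borel_in_leb[OF that] g])
    then show ?thesis by (rule Bochner_Integration.integrable_cong[THEN iffD1, rotated 2]) (auto simp: indicator_def)
  qed
  have "sets borel = sigma_sets UNIV (range (\<lambda>c::real. {c<..}))"
    unfolding borel_Ioi by (subst sets_measure_of) auto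
  note sb = this
  have stab: "Int_stable (range (\<lambda>c::real. {c<..}))"
  proof (rule Int_stableI)
    fix A B assume "A \<in> range (\<lambda>c::real. {c<..})" "B \<in> range (\<lambda>c::real. {c<..})"
    then obtain c d where "A = {c<..}" "B = {d<..}" by blast
    then have "A \<inter> B = {max c d<..}" by auto
    then show "A \<inter> B \<in> range (\<lambda>c::real. {c<..})" by blast
  qed
  have gT: "(\<integral>t. g t \<partial>leb T) = 0" using lebesgue_integral_eq_integral[OF g] 0[of T] T by simp
  have borel: "(\<integral>t. indicator E t *\<^sub>R g t \<partial>leb T) = 0" if "E \<in> sets borel" for E
  proof (rule sigma_sets_induct_disjoint[OF stab, of UNIV E, where P = "\<lambda>E. (\<integral>t. indicator E t *\<^sub>R g t \<partial>leb T) = 0"])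
    show "E \<in> sigma_sets UNIV (range (\<lambda>c::real. {c<..}))" using that sb by simp
    fix A :: "real set" assume "A \<in> range (\<lambda>c. {c<..})"
    then obtain c where A: "A = {c<..}" by blast
    consider "c < 0" | "0 \<le> c" "c \<le> T" | "T < c" by linarith
    then show "(\<integral>t. indicator A t *\<^sub>R g t \<partial>leb T) = 0"
    proof cases
      case 1
      have "(\<integral>t. indicator A t *\<^sub>R g t \<partial>leb T) = (\<integral>t. g t \<partial>leb T)"
        by (rule Bochner_Integration.integral_cong) (use 1 in \<open>auto simp: A\<close>)
      then show ?thesis using gT by simp
    next
      case 2
      have "(\<integral>t. indicator A t *\<^sub>R g t \<partial>leb T) = (\<integral>t. indicator {c<..T} t * g t \<partial>leb T)"
        by (rule Bochner_Integration.integral_cong) (auto simp: A indicator_def)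
      also have "\<dots> = 0" using integral_indicator_Ioc[OF g 2(1,2) order_refl] 0[of T] 0[of c] 2 T by simp
      finally show ?thesis .
    next
      case 3
      have "(\<integral>t. indicator A t *\<^sub>R g t \<partial>leb T) = (\<integral>t. 0 \<partial>leb T)"
        by (rule Bochner_Integration.integral_cong) (use 3 in \<open>auto simp: A\<close>)
      then show ?thesis by simp
    qed
  next
    fix A :: "real set" assume A: "A \<in> sigma_sets UNIV (range (\<lambda>c::real. {c<..}))" "(\<integral>t. indicator A t *\<^sub>R g t \<partial>leb T) = 0"
    have "A \<in> sets borel" using A sb by simp
    have "(\<integral>t. indicator (UNIV - A) t *\<^sub>R g t \<partial>leb T) = (\<integral>t. g t - indicator A t *\<^sub>R g t \<partial>leb T)"
      by (rule Bochner_Integration.integral_cong) (auto simp: indicator_def)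
    also have "\<dots> = 0" using A gT ii[OF \<open>A \<in> sets borel\<close>] g by (subst Bochner_Integration.integral_diff) auto
    finally show "(\<integral>t. indicator (UNIV - A) t *\<^sub>R g t \<partial>leb T) = 0" .
  next
    fix A :: "nat \<Rightarrow> real set"
    assume dis: "disjoint_family A" and A: "range A \<subseteq> sigma_sets UNIV (range (\<lambda>c. {c<..}))"
      and z: "\<And>i. (\<integral>t. indicator (A i) t *\<^sub>R g t \<partial>leb T) = 0"
    have Ab: "A i \<in> sets borel" for i using A sb by blast
    have fin: "(\<integral>t. indicator (\<Union>i<n. A i) t *\<^sub>R g t \<partial>leb T) = 0" for n
    proof (induction n)
      case (Suc n)
      have "(\<integral>t. indicator (\<Union>i<Suc n. A i) t *\<^sub>R g t \<partial>leb T) =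
          (\<integral>t. indicator (\<Union>i<n. A i) t *\<^sub>R g t + indicator (A n) t *\<^sub>R g t \<partial>leb T)"
      proof (rule Bochner_Integration.integral_cong[OF refl])
        fix t
        show "indicator (\<Union>i<Suc n. A i) t *\<^sub>R g t = indicator (\<Union>i<n. A i) t *\<^sub>R g t + indicator (A n) t *\<^sub>R g t"
        proof (cases "t \<in> A n")
          case True
          then have "t \<notin> (\<Union>i<n. A i)" using dis unfolding disjoint_family_on_def by (metis IntI UN_iff UNIV_I empty_iff lessThan_iff less_irrefl)
          then show ?thesis using True by (simp add: lessThan_Suc)
        qed (simp add: lessThan_Suc indicator_def)
      qed
      also have "\<dots> = 0" using Suc z[of n] ii[OF Ab[of n]] ii[of "\<Union>i<n. A i"] Ab
        by (subst Bochner_Integration.integral_add) auto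
      finally show ?case .
    qed simp
    have "(\<lambda>n. \<integral>t. indicator (\<Union>i<n. A i) t *\<^sub>R g t \<partial>leb T) \<longlonglongrightarrow> (\<integral>t. indicator (\<Union>i. A i) t *\<^sub>R g t \<partial>leb T)"
    proof (rule integral_dominated_convergence)
      show "integrable (leb T) (\<lambda>t. norm (g t))" using g by simp
      show "(\<lambda>t. indicator (\<Union>i. A i) t *\<^sub>R g t) \<in> borel_measurable (leb T)"
        using ii[of "\<Union>i. A i"] Ab by (auto intro: borel_measurable_integrable)
      show "(\<lambda>t. indicator (\<Union>i<n. A i) t *\<^sub>R g t) \<in> borel_measurable (leb T)" for n
        using ii[of "\<Union>i<n. A i"] Ab by (auto intro: borel_measurable_integrable)
      show "AE t in leb T. (\<lambda>n. indicator (\<Union>i<n. A i) t *\<^sub>R g t) \<longlonglongrightarrow> indicator (\<Union>i. A i) t *\<^sub>R g t"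
        by (intro AE_I2 tendsto_scaleR tendsto_const LIMSEQ_indicator_UN)
      show "AE t in leb T. norm (indicator (\<Union>i<n. A i) t *\<^sub>R g t) \<le> norm (g t)" for n
        by (intro AE_I2) (auto simp: indicator_def)
    qed
    with fin show "(\<integral>t. indicator (\<Union>i. A i) t *\<^sub>R g t \<partial>leb T) = 0" by (simp add: LIMSEQ_const_iff)
  qed simp_all
  have all: "(\<integral>t. indicator E t *\<^sub>R g t \<partial>leb T) = 0" if E: "E \<in> sets (leb T)" for E
  proof -
    have E': "E \<in> sets lebesgue" using E by (simp add: sets_restrict_space_iff)
    have Mb: "main_part lborel E \<in> sets borel" using main_part_sets[OF E'] by simp
    have "(\<integral>t. indicator E t *\<^sub>R g t \<partial>leb T) = (\<integral>t. indicator (main_part lborel E) t *\<^sub>R g t \<partial>leb T)"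
    proof (rule integral_cong_AE)
      show "(\<lambda>t. indicator E t *\<^sub>R g t) \<in> borel_measurable (leb T)"
        by (rule borel_measurable_integrable[OF integrable_mult_indicator[OF E g]])
      show "(\<lambda>t. indicator (main_part lborel E) t *\<^sub>R g t) \<in> borel_measurable (leb T)"
        by (rule borel_measurable_integrable[OF ii[OF Mb]])
      have "AE t in leb T. t \<in> main_part lborel E \<longleftrightarrow> t \<in> E"
        by (rule AE_leb_I) (rule AE_in_main_part[OF E'])
      then show "AE t in leb T. indicator E t *\<^sub>R g t = indicator (main_part lborel E) t *\<^sub>R g t"
        by eventually_elim (simp add: indicator_def)
    qed
    then show ?thesis using borel[OF Mb] by simp
  qed
  have real: "AE t in leb T. h t \<le> 0"
    if h: "integrable (leb T) h" and z: "\<And>E. E \<in> sets (leb T) \<Longrightarrow> (\<integral>t. indicator E t *\<^sub>R h t \<partial>leb T) = 0"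
    for h :: "real \<Rightarrow> real"
  proof -
    have [measurable]: "h \<in> borel_measurable (leb T)" using h by simp
    \<comment> \<open>On the set of positive values the integrand is nonnegative with integral 0,
      hence 0 almost everywhere.\<close>
    define E where "E = {t \<in> space (leb T). h t > 0}"
    have E: "E \<in> sets (leb T)" unfolding E_def by measurable
    have "AE t in leb T. indicator E t *\<^sub>R h t = 0"
      using z[OF E] integrable_mult_indicator[OF E h]
      by (subst (asm) integral_nonneg_eq_0_iff_AE) (auto simp: E_def indicator_def)
    then show ?thesis using AE_space by eventually_elim (auto simp: E_def indicator_def split: if_splits)
  qed
  have Re: "(\<integral>t. indicator E t *\<^sub>R Re (g t) \<partial>leb T) = 0" and Im: "(\<integral>t. indicator E t *\<^sub>R Im (g t) \<partial>leb T) = 0"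
    if "E \<in> sets (leb T)" for E
    using all[OF that] integral_Re[OF integrable_mult_indicator[OF that g]] integral_Im[OF integrable_mult_indicator[OF that g]] by simp_all
  have "AE t in leb T. Re (g t) \<le> 0" by (rule real) (use g Re in auto)
  moreover have "AE t in leb T. - Re (g t) \<le> 0" by (rule real) (use g Re in auto)
  moreover have "AE t in leb T. Im (g t) \<le> 0" by (rule real) (use g Im in auto)
  moreover have "AE t in leb T. - Im (g t) \<le> 0" by (rule real) (use g Im in auto)
  ultimately show ?thesis by eventually_elim (simp add: complex_eq_iff)
qed

text \<open>Half the norm is too small a bound for a nonzero functional; a vector that violates it
  is normalized.\<close>

lemma antidual_norming_vector:
  fixes q :: "'v::complex_inner antidual"
  obtains v where "norm v \<le> 1" "norm q \<le> 2 * cmod (antidual_apply q v)"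
proof (cases "q = 0")
  case True
  then show thesis by (intro that[of 0]) auto
next
  case False
  have "\<not> (\<forall>v. cmod (antidual_apply q v) \<le> norm q / 2 * norm v)"
    using norm_antidual_le[of "norm q / 2" q] False by auto
  then obtain v where v: "cmod (antidual_apply q v) > norm q / 2 * norm v" by (auto simp: not_le)
  then have v0: "norm v > 0" by (cases "v = 0") auto
  show thesis
  proof (rule that[of "v /\<^sub>R norm v"])
    show "norm (v /\<^sub>R norm v) \<le> 1" using v0 by simp
    show "norm q \<le> 2 * cmod (antidual_apply q (v /\<^sub>R norm v))"
      using v v0 by (simp add: antidual_apply_scaleR_right field_simps)
  qed
qed

text \<open>Strong measurability replaces separability: countably many test vectors suffice.\<close>

lemma strongly_measurable_AE_zero:
  fixes d :: "real \<Rightarrow> 'v::complex_inner antidual"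
  assumes d: "strongly_measurable (leb T) d" and z: "\<And>v. AE t in leb T. antidual_apply (d t) v = 0"
  shows "AE t in leb T. d t = 0"
proof -
  obtain s where s: "\<And>i::nat. simple_function (leb T) (s i)" "AE t in leb T. (\<lambda>i. s i t) \<longlonglongrightarrow> d t"
    using d unfolding strongly_measurable_def by blast
  define Q where "Q = (\<Union>i. s i ` space (leb T))"
  have Q: "countable Q"
  proof -
    have "finite (s i ` space (leb T))" for i using s(1)[of i] by (simp add: simple_function_def)
    then show ?thesis unfolding Q_def by (intro countable_UN[OF countableI_type] countable_finite)
  qed
  have "\<forall>q::'v antidual. \<exists>v. norm v \<le> 1 \<and> norm q \<le> 2 * cmod (antidual_apply q v)"
    using antidual_norming_vector by metis
  \<comment> \<open>Each value q of the approximants receives a vector that norms it up to the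
    factor 2; outside one null set, \<open>d t\<close> annihilates all these vectors.\<close>
  then obtain V where V: "\<And>q::'v antidual. norm (V q) \<le> 1" "\<And>q. norm q \<le> 2 * cmod (antidual_apply q (V q))"
    by metis
  have "AE t in leb T. \<forall>q\<in>Q. antidual_apply (d t) (V q) = 0"
    using z by (subst AE_ball_countable[OF Q]) auto
  with s(2) AE_space show ?thesis
  proof eventually_elim
    fix t assume t: "(\<lambda>i. s i t) \<longlonglongrightarrow> d t" "t \<in> space (leb T)" "\<forall>q\<in>Q. antidual_apply (d t) (V q) = 0"
    have "norm (s i t) \<le> 2 * norm (s i t - d t)" for i
    proof -
      have "s i t \<in> Q" unfolding Q_def using t(2) by blast
      then have "antidual_apply (s i t) (V (s i t)) = antidual_apply (s i t - d t) (V (s i t))"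
        using t(3) by (simp add: antidual_apply_diff_left)
      moreover have "cmod (antidual_apply (s i t - d t) (V (s i t))) \<le> norm (s i t - d t) * 1"
        by (rule order_trans[OF norm_antidual_apply mult_left_mono[OF V(1) norm_ge_zero]])
      ultimately show ?thesis using V(2)[of "s i t"] by simp
    qed
    then have "\<exists>N. \<forall>i\<ge>N. norm (s i t) \<le> 2 * norm (s i t - d t)" by blast
    moreover have "(\<lambda>i. 2 * norm (s i t - d t)) \<longlonglongrightarrow> 2 * norm (d t - d t)" by (intro tendsto_intros t)
    ultimately have "norm (d t) \<le> 2 * norm (d t - d t)"
      using LIMSEQ_le[OF tendsto_norm[OF t(1)]] by blast
    then show "d t = 0" by simp
  qed
qed

text \<open>\<open>weak_derivative\<close> is a choice that enters the norm of X, so it has to be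
  determined almost everywhere. Paired with any v, the difference of two candidates has vanishing
  integrals.\<close>

lemma weak_derivative_unique:
  fixes g :: "real \<Rightarrow> 'v::complex_inner antidual"
  assumes T: "T > 0" and p: "L2 T p" "has_weak_derivative T g p" and q: "L2 T q" "has_weak_derivative T g q"
  shows "AE t in leb T. p t = q t"
proof -
  have "AE t in leb T. p t - q t = 0"
  proof (rule strongly_measurable_AE_zero[OF L2_strongly_measurable[OF L2_diff[OF p(1) q(1)]]])
    fix v
    show "AE t in leb T. antidual_apply (p t - q t) v = 0"
    proof (rule AE_zero_if_integrals_zero[OF T L2_integrable_apply[OF L2_diff[OF p(1) q(1)]]])
      fix t assume t: "t \<in> {0..T}"
      have "integral {0..t} (\<lambda>t. antidual_apply (p t - q t) v) = (\<lambda>_. 0) t - (\<lambda>_. 0) 0"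
      proof (rule du_Bois_Reymond_closed[OF T continuous_on_const L2_integrable_apply[OF L2_diff[OF p(1) q(1)]] _ t])
        fix \<phi> assume \<phi>: "test_function T \<phi>"
        note c = test_function_props(2)[OF \<phi>, of "{0..T}"]
        have "pairing T p \<phi> = pairing T q \<phi>" using p(2) q(2) \<phi> by (simp add: has_weak_derivative_def)
        from arg_cong[OF this, of "\<lambda>x. antidual_apply x v"]
        have "(\<integral>t. \<phi> t * antidual_apply (p t) v \<partial>leb T) - (\<integral>t. \<phi> t * antidual_apply (q t) v \<partial>leb T) = 0"
          by (simp add: pairing_apply p q c)
        then have "(\<integral>t. \<phi> t * antidual_apply (p t) v - \<phi> t * antidual_apply (q t) v \<partial>leb T) = 0"
          by (subst Bochner_Integration.integral_diff) (auto intro!: L2_integrable_mult_apply p q c)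
        then show "(\<integral>t. \<phi> t * antidual_apply (p t - q t) v \<partial>leb T) = (\<integral>t. - vector_derivative \<phi> (at t) * 0 \<partial>leb T)"
          by (simp add: antidual_apply_diff_left right_diff_distrib)
      qed
      then show "integral {0..t} (\<lambda>t. antidual_apply (p t - q t) v) = 0" by simp
    qed
  qed
  then show ?thesis by (auto elim: eventually_mono)
qed

section \<open>Weak solutions and their uniqueness\<close>

context elliptic_form
begin

text \<open>u is the version continuous into H and w the version with values in V; testing with
  fixed v leaves only scalar integrals.\<close>

definition "weak_solution T f u w \<longleftrightarrow> continuous_on {0..T} u \<and> L2 T w \<and> (AE t in leb T. u t = \<iota> (w t)) \<and>
  (\<forall>\<phi> v. test_function T \<phi> \<longrightarrow> (\<integral>t. - vector_derivative \<phi> (at t) * antidual_apply (j (u t)) v \<partial>leb T) +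
      (\<integral>t. \<phi> t * antidual_apply (L (w t)) v \<partial>leb T) = (\<integral>t. \<phi> t * antidual_apply (f t) v \<partial>leb T))"

lemma weak_solutionD:
  assumes "weak_solution T f u w"
  shows "continuous_on {0..T} u" "L2 T w" "AE t in leb T. u t = \<iota> (w t)"
    "test_function T \<phi> \<Longrightarrow> (\<integral>t. - vector_derivative \<phi> (at t) * antidual_apply (j (u t)) v \<partial>leb T) +
      (\<integral>t. \<phi> t * antidual_apply (L (w t)) v \<partial>leb T) = (\<integral>t. \<phi> t * antidual_apply (f t) v \<partial>leb T)"
  using assms by (auto simp: weak_solution_def)

lemma weak_solution_integrable:
  assumes "weak_solution T f u w" "test_function T \<phi>"
  shows "integrable (leb T) (\<lambda>t. - vector_derivative \<phi> (at t) * antidual_apply (j (u t)) v)"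
    and "integrable (leb T) (\<lambda>t. \<phi> t * antidual_apply (L (w t)) v)"
    and "L2 T (\<lambda>t. j (u t))" "L2 T (\<lambda>t. L (w t))"
proof -
  note s = weak_solutionD[OF assms(1)]
  note p = test_function_props[OF assms(2)]
  show a: "L2 T (\<lambda>t. j (u t))" by (intro L2_continuous bounded_linear.continuous_on[OF j_bl] s)
  show b: "L2 T (\<lambda>t. L (w t))" by (intro L2_bounded_linear[OF _ L_bl] s)
  show "integrable (leb T) (\<lambda>t. - vector_derivative \<phi> (at t) * antidual_apply (j (u t)) v)"
    by (rule L2_integrable_mult_apply[OF a continuous_on_minus[OF p(3)]])
  show "integrable (leb T) (\<lambda>t. \<phi> t * antidual_apply (L (w t)) v)"
    by (rule L2_integrable_mult_apply[OF b p(2)])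
qed

lemma weak_solution_diff:
  assumes u: "weak_solution T f u w" and u': "weak_solution T f' u' w'" and f: "L2 T f" "L2 T f'"
  shows "weak_solution T (\<lambda>t. f t - f' t) (\<lambda>t. u t - u' t) (\<lambda>t. w t - w' t)"
  unfolding weak_solution_def
proof (intro conjI allI impI)
  note s = weak_solutionD[OF u] and s' = weak_solutionD[OF u']
  show "continuous_on {0..T} (\<lambda>t. u t - u' t)" by (intro continuous_on_diff s s')
  show "L2 T (\<lambda>t. w t - w' t)" by (intro L2_diff s s')
  show "AE t in leb T. u t - u' t = \<iota> (w t - w' t)"
    using s(3) s'(3) by eventually_elim (simp add: linear_diff[OF \<iota>_linear])
  fix \<phi> v assume \<phi>: "test_function T \<phi>"
  note c = test_function_props(2)[OF \<phi>, of "{0..T}"]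
  note i = weak_solution_integrable(1,2)[OF u \<phi>, of v] weak_solution_integrable(1,2)[OF u' \<phi>, of v]
    L2_integrable_mult_apply[OF f(1) c, of v] L2_integrable_mult_apply[OF f(2) c, of v]
  show "(\<integral>t. - vector_derivative \<phi> (at t) * antidual_apply (j (u t - u' t)) v \<partial>leb T) +
      (\<integral>t. \<phi> t * antidual_apply (L (w t - w' t)) v \<partial>leb T) = (\<integral>t. \<phi> t * antidual_apply (f t - f' t) v \<partial>leb T)"
    unfolding linear_diff[OF j_linear] linear_diff[OF L_linear] antidual_apply_diff_left right_diff_distrib
      Bochner_Integration.integral_diff[OF i(1) i(3)] Bochner_Integration.integral_diff[OF i(2) i(4)]
      Bochner_Integration.integral_diff[OF i(5) i(6)]
    using s(4)[OF \<phi>, of v] s'(4)[OF \<phi>, of v] by (simp add: algebra_simps)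
qed

lemma weak_solution_cong:
  assumes u: "weak_solution T f u w" and eq: "\<And>t. t \<in> {0..T} \<Longrightarrow> u t = u' t"
  shows "weak_solution T f u' w"
  unfolding weak_solution_def
proof (intro conjI allI impI)
  note s = weak_solutionD[OF u]
  show "continuous_on {0..T} u'" by (rule continuous_on_cong[THEN iffD1, OF refl eq s(1)])
  show "L2 T w" by (rule s)
  show "AE t in leb T. u' t = \<iota> (w t)" using s(3) AE_space by eventually_elim (use eq in auto)
  fix \<phi> v assume \<phi>: "test_function T \<phi>"
  have "(\<integral>t. - vector_derivative \<phi> (at t) * antidual_apply (j (u' t)) v \<partial>leb T) =
      (\<integral>t. - vector_derivative \<phi> (at t) * antidual_apply (j (u t)) v \<partial>leb T)"
    by (rule Bochner_Integration.integral_cong) (use eq in auto)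
  then show "(\<integral>t. - vector_derivative \<phi> (at t) * antidual_apply (j (u' t)) v \<partial>leb T) +
      (\<integral>t. \<phi> t * antidual_apply (L (w t)) v \<partial>leb T) = (\<integral>t. \<phi> t * antidual_apply (f t) v \<partial>leb T)"
    using s(4)[OF \<phi>, of v] by simp
qed

text \<open>Lax--Milgram for the adjoint form. It moves \<open>Bs\<close> onto the test vector, so
  that the weak equation tested with v' becomes an equation for the smoothed solution.\<close>

lemma Bs_adjoint: "\<exists>v'. \<forall>g. antidual_apply (Bs g) v = antidual_apply g v'"
proof -
  define b where "b u v = cnj (a v u)" for u v
  have "bounded_sesquilinear b"
    unfolding bounded_sesquilinear_def
  proof (intro conjI)
    have "cmod (b u v) \<le> C * norm u * norm v" for u v using a_bound[of v u] by (simp add: b_def mult_ac)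
    then show "\<exists>C. \<forall>u v. cmod (b u v) \<le> C * norm u * norm v" by blast
  qed (simp_all add: b_def a_add_left a_add_right a_scaleC_left a_scaleC_right)
  moreover have "elliptic b" using a_form_elliptic by (simp add: elliptic_def b_def)
  ultimately obtain v' where v': "\<And>u. b v' u = antidual_apply (j (\<iota> v)) u"
    using lax_milgram_solvable by blast
  have "antidual_apply (Bs g) v = antidual_apply g v'" for g
  proof -
    have "cnj (a (Linv g) v') = cinner (\<iota> v) (\<iota> (Linv g))" using v'[of "Linv g"] by (simp add: b_def j_apply)
    then have "a (Linv g) v' = cinner (\<iota> (Linv g)) (\<iota> v)" by (metis cinner_commute complex_cnj_cnj)
    then show ?thesis using L_apply[of "Linv g" v'] by (simp add: Bs_def j_apply)
  qed
  then show ?thesis by blast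
qed

text \<open>Smoothing by \<open>Bs = A\<^sup>-\<^sup>1\<close> turns a weak solution of the homogeneous equation into a classical one.\<close>

lemma weak_solution_homogeneous:
  assumes T: "T > 0" and u: "weak_solution T (\<lambda>_. 0) u w" and t: "t \<in> {0..T}"
  shows "j (u t) = S t (j (u 0))"
proof -
  note s = weak_solutionD[OF u]
  define y where "y t = j (u t)" for t
  have yc: "continuous_on {0..T} y" unfolding y_def by (intro bounded_linear.continuous_on[OF j_bl] s)
  have yvc: "continuous_on {0..T} (\<lambda>t. antidual_apply (y t) v)" for v
    by (rule bounded_linear.continuous_on[OF bounded_linear_antidual_apply yc])
  have scalar: "antidual_apply (Bs (y t) - Bs (y 0)) v = integral {0..t} (\<lambda>t. - antidual_apply (y t) v)" if "t \<in> {0..T}" for t v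
  proof -
    obtain v' where v': "\<And>g. antidual_apply (Bs g) v = antidual_apply g v'" using Bs_adjoint by blast
    have "integral {0..t} (\<lambda>t. - antidual_apply (y t) v) = antidual_apply (Bs (y t)) v - antidual_apply (Bs (y 0)) v"
    proof (rule du_Bois_Reymond_closed[OF T _ _ _ that])
      show "continuous_on {0..T} (\<lambda>t. antidual_apply (Bs (y t)) v)" by (simp add: v' yvc)
      show "integrable (leb T) (\<lambda>t. - antidual_apply (y t) v)"
        by (intro integrable_leb_continuous continuous_on_minus yvc)
      fix \<phi> assume \<phi>: "test_function T \<phi>"
      \<comment> \<open>Almost everywhere \<open>y t\<close> is \<open>Bs (L (w t))\<close>, and the
        adjoint identity transfers \<open>Bs\<close> to v'.\<close>
      have "(\<integral>t. \<phi> t * antidual_apply (y t) v \<partial>leb T) = (\<integral>t. \<phi> t * antidual_apply (L (w t)) v' \<partial>leb T)"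
      proof (rule integral_cong_AE)
        show "(\<lambda>t. \<phi> t * antidual_apply (y t) v) \<in> borel_measurable (leb T)"
          by (intro borel_measurable_integrable integrable_leb_continuous continuous_on_mult yvc test_function_props(2)[OF \<phi>])
        show "(\<lambda>t. \<phi> t * antidual_apply (L (w t)) v') \<in> borel_measurable (leb T)"
          by (rule borel_measurable_integrable[OF weak_solution_integrable(2)[OF u \<phi>]])
        show "AE t in leb T. \<phi> t * antidual_apply (y t) v = \<phi> t * antidual_apply (L (w t)) v'"
          using s(3) by eventually_elim (simp add: y_def Bs_def flip: v')
      qed
      then show "(\<integral>t. \<phi> t * - antidual_apply (y t) v \<partial>leb T) = (\<integral>t. - vector_derivative \<phi> (at t) * antidual_apply (Bs (y t)) v \<partial>leb T)"
        using s(4)[OF \<phi>, of v'] by (simp add: v' y_def add_eq_0_iff)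
    qed
    then show ?thesis by (simp add: antidual_apply_diff_left)
  qed
  have der: "((\<lambda>t. Bs (y t)) has_vector_derivative - y r) (at r within {0..t})" if r: "r \<in> {0..t}" for r
    unfolding has_vector_derivative_iff_quotient
  proof (rule tendstoI)
    fix e :: real assume e: "e > 0"
    have rT: "r \<in> {0..T}" using r t by auto
    obtain d where d: "d > 0" "\<And>s. s \<in> {0..T} \<Longrightarrow> dist s r < d \<Longrightarrow> dist (y s) (y r) < e / 2"
      using yc rT e unfolding continuous_on_iff by (meson half_gt_zero)
    \<comment> \<open>The estimate is uniform in v, so that the paired identities give
      differentiability in the norm of the antidual and not only weakly.\<close>
    have bound: "norm (Bs (y q) - Bs (y p) + (q - p) *\<^sub>R y r) \<le> (q - p) * (e / 2)"
      if pq: "p \<le> q" "p \<in> {0..T}" "q \<in> {0..T}" "\<And>s. s \<in> {p..q} \<Longrightarrow> dist s r < d" for p q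
    proof (rule norm_antidual_le)
      show "0 \<le> (q - p) * (e / 2)" using pq e by simp
      fix v
      have c: "continuous_on {p..q} (\<lambda>t. - antidual_apply (y t) v)"
        by (rule continuous_on_subset[OF continuous_on_minus[OF yvc]]) (use pq in auto)
      have iv: "(\<lambda>t. - antidual_apply (y t) v) integrable_on {0..q}"
        by (rule integrable_continuous_real, rule continuous_on_subset[OF continuous_on_minus[OF yvc]]) (use pq in auto)
      have "antidual_apply (Bs (y q) - Bs (y p)) v = integral {p..q} (\<lambda>t. - antidual_apply (y t) v)"
      proof -
        have "integral {0..p} (\<lambda>t. - antidual_apply (y t) v) + integral {p..q} (\<lambda>t. - antidual_apply (y t) v) = integral {0..q} (\<lambda>t. - antidual_apply (y t) v)"
          by (rule Henstock_Kurzweil_Integration.integral_combine) (use pq iv in auto)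
        then have "integral {p..q} (\<lambda>t. - antidual_apply (y t) v) =
            antidual_apply (Bs (y q) - Bs (y 0)) v - antidual_apply (Bs (y p) - Bs (y 0)) v"
          unfolding scalar[OF pq(2)] scalar[OF pq(3)] by (metis add_diff_cancel_left')
        then show ?thesis by (simp add: antidual_apply_diff_left)
      qed
      then have "antidual_apply (Bs (y q) - Bs (y p) + (q - p) *\<^sub>R y r) v =
          integral {p..q} (\<lambda>t. - antidual_apply (y t) v) + integral {p..q} (\<lambda>t. antidual_apply (y r) v)"
        using pq by (simp add: antidual_apply_add_left antidual_apply_scaleR_left)
      also have "\<dots> = integral {p..q} (\<lambda>t. - antidual_apply (y t) v + antidual_apply (y r) v)"
        by (rule Henstock_Kurzweil_Integration.integral_add[symmetric]) (use c in \<open>auto intro: integrable_continuous_real\<close>)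
      also have "norm \<dots> \<le> (e / 2 * norm v) * (q - p)"
      proof (rule integral_bound[OF pq(1)])
        show "continuous_on {p..q} (\<lambda>t. - antidual_apply (y t) v + antidual_apply (y r) v)"
          by (intro continuous_on_add c continuous_on_const)
        fix s assume s: "s \<in> {p..q}"
        have "- antidual_apply (y s) v + antidual_apply (y r) v = antidual_apply (y r - y s) v"
          by (simp add: antidual_apply_diff_left)
        also have "cmod \<dots> \<le> norm (y r - y s) * norm v" by (rule norm_antidual_apply)
        also have "\<dots> \<le> e / 2 * norm v"
          using d(2)[of s] pq s by (intro mult_right_mono) (auto simp: dist_norm norm_minus_commute less_imp_le)
        finally show "norm (- antidual_apply (y s) v + antidual_apply (y r) v) \<le> e / 2 * norm v" .
      qed
      finally show "cmod (antidual_apply (Bs (y q) - Bs (y p) + (q - p) *\<^sub>R y r) v) \<le> (q - p) * (e / 2) * norm v"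
        by (simp add: mult_ac)
    qed
    show "\<forall>\<^sub>F s in at r within {0..t}. dist ((Bs (y s) - Bs (y r)) /\<^sub>R (s - r)) (- y r) < e"
      unfolding eventually_at
    proof (intro exI[of _ d] conjI ballI impI d)
      fix s assume s: "s \<in> {0..t}" "s \<noteq> r \<and> dist s r < d"
      have sT: "s \<in> {0..T}" using s t by auto
      have "norm (Bs (y s) - Bs (y r) + (s - r) *\<^sub>R y r) \<le> \<bar>s - r\<bar> * (e / 2)"
      proof (cases "r \<le> s")
        case True
        then show ?thesis using bound[of r s] rT sT s by (auto simp: dist_real_def)
      next
        case False
        have eq: "Bs (y s) - Bs (y r) + (s - r) *\<^sub>R y r = - (Bs (y r) - Bs (y s) + (r - s) *\<^sub>R y r)"
          by (simp add: algebra_simps)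
        show ?thesis unfolding eq norm_minus_cancel
          using bound[of s r] False rT sT s by (auto simp: dist_real_def)
      qed
      then have "norm (Bs (y s) - Bs (y r) + (s - r) *\<^sub>R y r) / \<bar>s - r\<bar> \<le> e / 2"
        using s by (simp add: pos_divide_le_eq mult.commute)
      moreover have q: "(Bs (y s) - Bs (y r)) /\<^sub>R (s - r) - - y r = (Bs (y s) - Bs (y r) + (s - r) *\<^sub>R y r) /\<^sub>R (s - r)"
        using s by (simp add: scaleR_add_right)
      have "dist ((Bs (y s) - Bs (y r)) /\<^sub>R (s - r)) (- y r) = norm (Bs (y s) - Bs (y r) + (s - r) *\<^sub>R y r) / \<bar>s - r\<bar>"
        unfolding dist_norm q norm_scaleR by (metis abs_inverse divide_inverse_commute)
      ultimately have "dist ((Bs (y s) - Bs (y r)) /\<^sub>R (s - r)) (- y r) \<le> e / 2" by (simp only:)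
      then show "dist ((Bs (y s) - Bs (y r)) /\<^sub>R (s - r)) (- y r) < e" using e by simp
    qed
  qed
  have "Bs (y t) = S t (Bs (y 0))"
    by (rule star.classical_solution_eq[OF _ der]) (use t in auto)
  also have "\<dots> = Bs (S t (y 0))" using t by (simp add: star.B_S)
  finally show ?thesis using star.B_inj by (simp add: inj_eq y_def)
qed

lemma weak_solution_unique:
  assumes T: "T > 0" and f: "L2 T f" and u: "weak_solution T f u w" and u': "weak_solution T f u' w'"
    and 0: "u 0 = u' 0" and t: "t \<in> {0..T}"
  shows "u t = u' t"
proof -
  have "weak_solution T (\<lambda>_. 0) (\<lambda>t. u t - u' t) (\<lambda>t. w t - w' t)"
    using weak_solution_diff[OF u u' f f] by simp
  from weak_solution_homogeneous[OF T this t] have "j (u t - u' t) = j 0"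
    using 0 t by (simp add: linear_0[OF j_linear] linear_0[OF star.S_linear])
  then show ?thesis using j_inj by (simp add: inj_eq)
qed

lemma weak_solution_exists:
  assumes T: "T > 0" and f: "L2 T f"
  obtains u w where "weak_solution T f u w" "u 0 = x"
    "\<And>t. t \<in> {0..T} \<Longrightarrow> j (u t) = S t (j x) + duhamel \<iota> a f t"
    "\<And>t. t \<in> {0..T} \<Longrightarrow> (norm (u t))\<^sup>2 \<le> 2 * (norm x)\<^sup>2 + (2 / \<alpha>) * sqint T f"
    "\<alpha> * sqint T w \<le> 2 * (2 * (norm x)\<^sup>2 + (2 / \<alpha>) * sqint T f)"
proof (rule initial_value_problem_solvable[OF T f])
  fix u w
  assume *: "continuous_on {0..T} u" "u 0 = x" "L2 T w" "AE t in leb T. u t = \<iota> (w t)"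
    "\<And>t v. t \<in> {0..T} \<Longrightarrow> antidual_apply (j (u t)) v =
      antidual_apply (S t (j x)) v + (\<integral>s. antidual_apply (S (t - s) (f s)) v \<partial>leb t)"
    "\<And>\<phi> v. test_function T \<phi> \<Longrightarrow> (\<integral>t. - vector_derivative \<phi> (at t) * antidual_apply (j (u t)) v \<partial>leb T) +
      (\<integral>t. \<phi> t * antidual_apply (L (w t)) v \<partial>leb T) = (\<integral>t. \<phi> t * antidual_apply (f t) v \<partial>leb T)"
    "\<And>t. t \<in> {0..T} \<Longrightarrow> (norm (u t))\<^sup>2 \<le> 2 * (norm x)\<^sup>2 + (2 / \<alpha>) * sqint T f"
    "\<alpha> * sqint T w \<le> 2 * (2 * (norm x)\<^sup>2 + (2 / \<alpha>) * sqint T f)"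
  show thesis
  proof (rule that[of u w])
    show "weak_solution T f u w" using * unfolding weak_solution_def by blast
    show "j (u t) = S t (j x) + duhamel \<iota> a f t" if "t \<in> {0..T}" for t
      by (rule antidual_eqI) (simp add: *(5)[OF that] antidual_apply_add_left duhamel_apply[OF f that])
  qed (use * in auto)
qed

text \<open>The integral is the value at t of the solution with initial value 0, and this solution
  takes its values in H.\<close>

lemma duhamel_in_range:
  assumes T: "T > 0" and f: "L2 T f" and t: "t \<in> {0..T}"
  shows "duhamel \<iota> a f t \<in> range j"
proof -
  obtain u w where "j (u t) = S t (j 0) + duhamel \<iota> a f t"
    using weak_solution_exists[OF T f, of 0] t by metis
  then show ?thesis using t by (metis add_0 linear_0[OF j_linear] linear_0[OF star.S_linear] atLeastAtMost_iff rangeI)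
qed

lemma j_duhamel_H: "T > 0 \<Longrightarrow> L2 T f \<Longrightarrow> t \<in> {0..T} \<Longrightarrow> j (duhamel_H \<iota> a f t) = duhamel \<iota> a f t"
  unfolding duhamel_H_def by (rule f_inv_into_f) (rule duhamel_in_range)

text \<open>Every weak solution inherits formula and bounds from the constructed one with the same initial value.\<close>

lemma weak_solution_properties:
  assumes T: "T > 0" and f: "L2 T f" and u: "weak_solution T f u w"
  shows "t \<in> {0..T} \<Longrightarrow> u t = H.S t (u 0) + duhamel_H \<iota> a f t"
    and "t \<in> {0..T} \<Longrightarrow> (norm (u t))\<^sup>2 \<le> 2 * (norm (u 0))\<^sup>2 + (2 / \<alpha>) * sqint T f"
    and "\<alpha> * sqint T w \<le> 2 * (2 * (norm (u 0))\<^sup>2 + (2 / \<alpha>) * sqint T f)"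
proof -
  obtain u' w' where u': "weak_solution T f u' w'" "u' 0 = u 0"
    "\<And>t. t \<in> {0..T} \<Longrightarrow> j (u' t) = S t (j (u 0)) + duhamel \<iota> a f t"
    "\<And>t. t \<in> {0..T} \<Longrightarrow> (norm (u' t))\<^sup>2 \<le> 2 * (norm (u 0))\<^sup>2 + (2 / \<alpha>) * sqint T f"
    "\<alpha> * sqint T w' \<le> 2 * (2 * (norm (u 0))\<^sup>2 + (2 / \<alpha>) * sqint T f)"
    by (rule weak_solution_exists[OF T f, of "u 0"]) blast
  have eq: "u' t = u t" if "t \<in> {0..T}" for t
    by (rule weak_solution_unique[OF T f u'(1) u u'(2) that])
  show "u t = H.S t (u 0) + duhamel_H \<iota> a f t" if t: "t \<in> {0..T}"
  proof -
    have "j (u t) = j (H.S t (u 0) + duhamel_H \<iota> a f t)"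
      using u'(3)[OF t] t by (simp add: eq linear_add[OF j_linear] j_HS j_duhamel_H[OF T f])
    then show ?thesis using j_inj by (simp add: inj_eq)
  qed
  show "(norm (u t))\<^sup>2 \<le> 2 * (norm (u 0))\<^sup>2 + (2 / \<alpha>) * sqint T f" if t: "t \<in> {0..T}"
    using u'(4)[OF t] by (simp add: eq[OF t])
  have "AE t in leb T. w t = w' t"
    using weak_solutionD(3)[OF u] weak_solutionD(3)[OF u'(1)] AE_space
  proof eventually_elim
    fix t assume "u t = \<iota> (w t)" "u' t = \<iota> (w' t)" "t \<in> space (leb T)"
    then have "\<iota> (w t) = \<iota> (w' t)" using eq[of t] by simp
    then show "w t = w' t" using \<iota>_inj by (simp add: inj_eq)
  qed
  then have "sqint T w = sqint T w'"
    unfolding sqint_def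
    by (intro integral_cong_AE borel_measurable_integrable L2_integrable_sq weak_solutionD(2)[OF u] weak_solutionD(2)[OF u'(1)])
      (auto elim: eventually_mono)
  then show "\<alpha> * sqint T w \<le> 2 * (2 * (norm (u 0))\<^sup>2 + (2 / \<alpha>) * sqint T f)" using u'(5) by simp
qed

section \<open>Weak solutions as solutions in X\<close>

lemma weak_solution_weak_derivative:
  assumes f: "L2 T f" and u: "weak_solution T f u w"
  shows "L2 T (\<lambda>t. f t - L (w t))" "has_weak_derivative T (\<lambda>t. j (u t)) (\<lambda>t. f t - L (w t))"
proof -
  note s = weak_solutionD[OF u]
  have Lw: "L2 T (\<lambda>t. L (w t))" by (intro L2_bounded_linear[OF _ L_bl] s)
  have ju: "L2 T (\<lambda>t. j (u t))" by (intro L2_continuous bounded_linear.continuous_on[OF j_bl] s)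
  show d: "L2 T (\<lambda>t. f t - L (w t))" by (rule L2_diff[OF f Lw])
  show "has_weak_derivative T (\<lambda>t. j (u t)) (\<lambda>t. f t - L (w t))"
    unfolding has_weak_derivative_def
  proof (intro allI impI antidual_eqI)
    fix \<phi> v assume \<phi>: "test_function T \<phi>"
    note p = test_function_props[OF \<phi>]
    have "antidual_apply (pairing T (\<lambda>t. f t - L (w t)) \<phi>) v =
        (\<integral>t. \<phi> t * antidual_apply (f t) v - \<phi> t * antidual_apply (L (w t)) v \<partial>leb T)"
      by (simp add: pairing_apply[OF d p(2)] antidual_apply_diff_left right_diff_distrib)
    also have "\<dots> = (\<integral>t. \<phi> t * antidual_apply (f t) v \<partial>leb T) - (\<integral>t. \<phi> t * antidual_apply (L (w t)) v \<partial>leb T)"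
      by (rule Bochner_Integration.integral_diff[OF L2_integrable_mult_apply[OF f p(2)] L2_integrable_mult_apply[OF Lw p(2)]])
    also have "\<dots> = (\<integral>t. - vector_derivative \<phi> (at t) * antidual_apply (j (u t)) v \<partial>leb T)"
      using s(4)[OF \<phi>, of v] by (simp add: algebra_simps)
    also have "\<dots> = antidual_apply (pairing T (\<lambda>t. j (u t)) (\<lambda>t. - vector_derivative \<phi> (at t))) v"
      by (rule pairing_apply[OF ju continuous_on_minus[OF p(3)], symmetric])
    finally show "antidual_apply (pairing T (\<lambda>t. f t - L (w t)) \<phi>) v =
        antidual_apply (pairing T (\<lambda>t. j (u t)) (\<lambda>t. - vector_derivative \<phi> (at t))) v" .
  qed
qed

lemma inv_\<iota> [simp]: "inv \<iota> (\<iota> v) = v"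
  by (rule inv_f_f[OF \<iota>_inj])

lemma weak_solution_in_X:
  assumes f: "L2 T f" and u: "weak_solution T f u w"
  shows "in_X \<iota> T u" and "solves_fvp \<iota> a T f (u T) u"
proof -
  note s = weak_solutionD[OF u]
  have ae: "AE t in leb T. w t = inv \<iota> (u t)" using s(3) by eventually_elim simp
  have ju: "L2 T (\<lambda>t. j (u t))" by (intro L2_continuous bounded_linear.continuous_on[OF j_bl] s)
  have w': "L2 T (\<lambda>t. inv \<iota> (u t))" by (rule L2_cong_AE[OF s(2) ae])
  have "AE t in leb T. u t \<in> range \<iota>" using s(3) by eventually_elim simp
  then show "in_X \<iota> T u"
    unfolding in_X_def H1_def using weak_solution_weak_derivative[OF f u] s(1) ju w' by blast
  have Lw: "L2 T (\<lambda>t. L (inv \<iota> (u t)))" by (rule L2_bounded_linear[OF w' L_bl])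
  show "solves_fvp \<iota> a T f (u T) u"
    unfolding solves_fvp_def
  proof (intro conjI allI impI antidual_eqI refl)
    fix \<phi> v assume \<phi>: "test_function T \<phi>"
    note p = test_function_props[OF \<phi>]
    have "(\<integral>t. \<phi> t * antidual_apply (L (inv \<iota> (u t))) v \<partial>leb T) = (\<integral>t. \<phi> t * antidual_apply (L (w t)) v \<partial>leb T)"
      using ae by (intro integral_cong_AE borel_measurable_integrable L2_integrable_mult_apply[OF Lw p(2)] weak_solution_integrable(2)[OF u \<phi>])
        (auto elim: eventually_mono)
    then show "antidual_apply (pairing T (\<lambda>t. j (u t)) (\<lambda>t. - vector_derivative \<phi> (at t)) + pairing T (\<lambda>t. L (inv \<iota> (u t))) \<phi>) v =
        antidual_apply (pairing T f \<phi>) v"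
      using s(4)[OF \<phi>, of v]
      by (simp add: antidual_apply_add_left pairing_apply[OF ju continuous_on_minus[OF p(3)]] pairing_apply[OF Lw p(2)] pairing_apply[OF f p(2)])
  qed
qed

lemma in_X_weak_solution:
  assumes f: "L2 T f" and X: "in_X \<iota> T u" and s: "solves_fvp \<iota> a T f u\<^sub>T u"
  shows "weak_solution T f u (\<lambda>t. inv \<iota> (u t))"
  unfolding weak_solution_def
proof (intro conjI allI impI)
  show uc: "continuous_on {0..T} u" and w: "L2 T (\<lambda>t. inv \<iota> (u t))" using X by (simp_all add: in_X_def)
  have "AE t in leb T. u t \<in> range \<iota>" using X by (simp add: in_X_def)
  then show "AE t in leb T. u t = \<iota> (inv \<iota> (u t))" by eventually_elim (simp add: f_inv_into_f)
  fix \<phi> v assume \<phi>: "test_function T \<phi>"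
  note p = test_function_props[OF \<phi>]
  have ju: "L2 T (\<lambda>t. j (u t))" by (intro L2_continuous bounded_linear.continuous_on[OF j_bl] uc)
  have Lw: "L2 T (\<lambda>t. L (inv \<iota> (u t)))" by (rule L2_bounded_linear[OF w L_bl])
  have "pairing T (\<lambda>t. j (u t)) (\<lambda>t. - vector_derivative \<phi> (at t)) + pairing T (\<lambda>t. L (inv \<iota> (u t))) \<phi> = pairing T f \<phi>"
    using s \<phi> by (simp add: solves_fvp_def)
  from arg_cong[OF this, of "\<lambda>g. antidual_apply g v"]
  show "(\<integral>t. - vector_derivative \<phi> (at t) * antidual_apply (j (u t)) v \<partial>leb T) +
      (\<integral>t. \<phi> t * antidual_apply (L (inv \<iota> (u t))) v \<partial>leb T) = (\<integral>t. \<phi> t * antidual_apply (f t) v \<partial>leb T)"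
    by (simp add: antidual_apply_add_left pairing_apply[OF ju continuous_on_minus[OF p(3)]] pairing_apply[OF Lw p(2)] pairing_apply[OF f p(2)])
qed

end

section \<open>The final value problem\<close>

context elliptic_form
begin

section \<open>Linearity of the data space\<close>

lemma semigroup_S_scaleC: "t \<ge> 0 \<Longrightarrow> S t (x + c *\<^sub>C y) = S t x + c *\<^sub>C S t y"
  by (simp add: linear_add[OF star.S_linear] clinear_scaleC[OF star.S_clinear])

lemma L2_add_scaleC:
  fixes f g :: "real \<Rightarrow> 'v antidual"
  shows "L2 T f \<Longrightarrow> L2 T g \<Longrightarrow> L2 T (\<lambda>t. f t + c *\<^sub>C g t)"
  by (intro L2_add L2_bounded_linear[OF _ bounded_linear_scaleC_antidual])

lemma duhamel_H_linear:
  assumes T: "T > 0" and f: "L2 T f" and g: "L2 T g" and t: "t \<in> {0..T}"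
  shows "duhamel_H \<iota> a (\<lambda>t. f t + c *\<^sub>C g t) t = duhamel_H \<iota> a f t + c *\<^sub>C duhamel_H \<iota> a g t"
proof -
  have ft: "L2 t f" and gt: "L2 t g" using L2_subinterval[OF f] L2_subinterval[OF g] t by auto
  have "duhamel \<iota> a (\<lambda>t. f t + c *\<^sub>C g t) t = duhamel \<iota> a f t + c *\<^sub>C duhamel \<iota> a g t"
  proof (rule antidual_eqI)
    fix v
    have "(\<integral>s. antidual_apply (S (t - s) (f s + c *\<^sub>C g s)) v \<partial>leb t) =
        (\<integral>s. antidual_apply (S (t - s) (f s)) v + c * antidual_apply (S (t - s) (g s)) v \<partial>leb t)"
      by (rule Bochner_Integration.integral_cong)
        (simp_all add: semigroup_S_scaleC antidual_apply_add_left antidual_apply_scaleC_left)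
    also have "\<dots> = (\<integral>s. antidual_apply (S (t - s) (f s)) v \<partial>leb t) + c * (\<integral>s. antidual_apply (S (t - s) (g s)) v \<partial>leb t)"
      using L2_integrable_apply[OF L2_convolution[OF ft], of v] L2_integrable_apply[OF L2_convolution[OF gt], of v]
      by simp
    finally show "antidual_apply (duhamel \<iota> a (\<lambda>t. f t + c *\<^sub>C g t) t) v = antidual_apply (duhamel \<iota> a f t + c *\<^sub>C duhamel \<iota> a g t) v"
      by (simp add: duhamel_apply[OF L2_add_scaleC[OF f g] t] duhamel_apply[OF f t] duhamel_apply[OF g t]
          antidual_apply_add_left antidual_apply_scaleC_left)
  qed
  then have "j (duhamel_H \<iota> a (\<lambda>t. f t + c *\<^sub>C g t) t) = j (duhamel_H \<iota> a f t + c *\<^sub>C duhamel_H \<iota> a g t)"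
    using j_duhamel_H[OF T L2_add_scaleC[OF f g] t] j_duhamel_H[OF T f t] j_duhamel_H[OF T g t]
    by (simp add: linear_add[OF j_linear] clinear_scaleC[OF j_clinear])
  then show ?thesis using j_inj by (simp add: inj_eq)
qed

lemma L2_zero: "L2 T (\<lambda>_. 0 :: 'v antidual)"
  by (rule L2_continuous) simp

lemma duhamel_H_zero: "T > 0 \<Longrightarrow> t \<in> {0..T} \<Longrightarrow> duhamel_H \<iota> a (\<lambda>_. 0) t = 0"
  \<comment> \<open>Linearity with coefficient -1 and both functions 0 writes the value as its
    difference with itself.\<close>
  using duhamel_H_linear[OF _ L2_zero L2_zero, of T t "-1"] by (simp add: scaleC_minus_one)

text \<open>In this form the vector x is the initial value of the solution.\<close>

lemma Y_space_iff:
  assumes T: "T > 0"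
  shows "(f, u\<^sub>T) \<in> Y_space \<iota> a T \<longleftrightarrow> L2 T f \<and> (\<exists>x. u\<^sub>T = H.S T x + duhamel_H \<iota> a f T)"
proof -
  have "u\<^sub>T - duhamel_H \<iota> a f T \<in> range (H.S T) \<longleftrightarrow> (\<exists>x. u\<^sub>T = H.S T x + duhamel_H \<iota> a f T)"
    by (auto simp: diff_eq_eq image_iff)
  then show ?thesis
    using T by (simp add: Y_space_def exp_pos_domain_def semigroup_H_eq)
qed

text \<open>Injectivity of the semigroup on H makes the inverse defined by choice a true left
  inverse.\<close>

lemma exp_pos_eq: "T > 0 \<Longrightarrow> exp_pos \<iota> a T (H.S T x) = x"
  by (simp add: exp_pos_def semigroup_H_eq HS_inj)

lemma Y_space_zero: "T > 0 \<Longrightarrow> (\<lambda>_. 0, 0) \<in> Y_space \<iota> a T"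
  unfolding Y_space_iff
  by (intro conjI L2_zero exI[of _ 0]) (simp add: duhamel_H_zero linear_0[OF H.S_linear])

lemma Y_space_add_scaleC:
  assumes T: "T > 0" and f: "(f, u\<^sub>T) \<in> Y_space \<iota> a T" and g: "(g, v\<^sub>T) \<in> Y_space \<iota> a T"
  shows "(\<lambda>t. f t + c *\<^sub>C g t, u\<^sub>T + c *\<^sub>C v\<^sub>T) \<in> Y_space \<iota> a T"
proof -
  from f g obtain x y where *: "L2 T f" "u\<^sub>T = H.S T x + duhamel_H \<iota> a f T" "L2 T g" "v\<^sub>T = H.S T y + duhamel_H \<iota> a g T"
    unfolding Y_space_iff[OF T] by blast
  have "u\<^sub>T + c *\<^sub>C v\<^sub>T = H.S T (x + c *\<^sub>C y) + duhamel_H \<iota> a (\<lambda>t. f t + c *\<^sub>C g t) T"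
    using T by (simp add: * duhamel_H_linear[OF T *(1,3)] linear_add[OF H.S_linear] clinear_scaleC[OF H.S_clinear] scaleC_add_right)
  then show ?thesis unfolding Y_space_iff[OF T] using L2_add_scaleC[OF *(1,3)] by blast
qed

text \<open>Evaluation at T and inversion of the semigroup give back u 0; the data thereby determine
  the whole solution.\<close>

lemma solution_formula:
  assumes T: "T > 0" and f: "L2 T f" and X: "in_X \<iota> T u" and s: "solves_fvp \<iota> a T f u\<^sub>T u"
  shows "t \<in> {0..T} \<Longrightarrow> u t = H.S t (u 0) + duhamel_H \<iota> a f t"
    and "u T = u\<^sub>T" and "exp_pos \<iota> a T (u\<^sub>T - duhamel_H \<iota> a f T) = u 0"
proof -
  show 1: "u t = H.S t (u 0) + duhamel_H \<iota> a f t" if "t \<in> {0..T}" for t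
    by (rule weak_solution_properties(1)[OF T f in_X_weak_solution[OF f X s] that])
  show 2: "u T = u\<^sub>T" using s by (simp add: solves_fvp_def)
  have "u\<^sub>T - duhamel_H \<iota> a f T = H.S T (u 0)" using 1[of T] 2 T by (simp add: diff_eq_eq)
  then show "exp_pos \<iota> a T (u\<^sub>T - duhamel_H \<iota> a f T) = u 0" by (simp add: exp_pos_eq[OF T])
qed

lemma solvable_iff:
  assumes T: "T > 0" and f: "L2 T f"
  shows "(\<exists>u. in_X \<iota> T u \<and> solves_fvp \<iota> a T f u\<^sub>T u) \<longleftrightarrow> (f, u\<^sub>T) \<in> Y_space \<iota> a T"
proof
  assume "\<exists>u. in_X \<iota> T u \<and> solves_fvp \<iota> a T f u\<^sub>T u"
  then obtain u where u: "in_X \<iota> T u" "solves_fvp \<iota> a T f u\<^sub>T u" by blast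
  have "u\<^sub>T = H.S T (u 0) + duhamel_H \<iota> a f T"
    using solution_formula(1)[OF T f u, of T] solution_formula(2)[OF T f u] T by simp
  then show "(f, u\<^sub>T) \<in> Y_space \<iota> a T" using f unfolding Y_space_iff[OF T] by blast
next
  assume "(f, u\<^sub>T) \<in> Y_space \<iota> a T"
  then obtain x where x: "u\<^sub>T = H.S T x + duhamel_H \<iota> a f T" unfolding Y_space_iff[OF T] by blast
  obtain u w where u: "weak_solution T f u w" "u 0 = x" by (rule weak_solution_exists[OF T f, of x]) blast
  have "u T = u\<^sub>T" using weak_solution_properties(1)[OF T f u(1), of T] u(2) x T by simp
  with weak_solution_in_X[OF f u(1)] show "\<exists>u. in_X \<iota> T u \<and> solves_fvp \<iota> a T f u\<^sub>T u" by blast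
qed

text \<open>In the constant, 4/\<alpha> comes from the L2 norm in V, 2 from the supremum, 2 T
  \<kappa>^2 from the embedding of H into the antidual, and 8 C^2/\<alpha> together with the last
  summand from the derivative f - A u.\<close>

lemma norm_X_le:
  assumes T: "T > 0" and f: "L2 T f" and X: "in_X \<iota> T u" and s: "solves_fvp \<iota> a T f u\<^sub>T u"
  shows "(norm_X \<iota> T u)\<^sup>2 \<le> (4 / \<alpha> + 2 + 2 * T * \<kappa>\<^sup>2 + 8 * C\<^sup>2 / \<alpha>) * ((norm (u 0))\<^sup>2 + (1 / \<alpha>) * sqint T f) + 2 * sqint T f"
proof -
  define w where "w t = inv \<iota> (u t)" for t
  define D where "D = weak_derivative T (\<lambda>t. j (u t))"
  define E where "E = 2 * (norm (u 0))\<^sup>2 + (2 / \<alpha>) * sqint T f"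
  have u: "weak_solution T f u w" using in_X_weak_solution[OF f X s] by (simp add: w_def[abs_def])
  note uc = weak_solutionD(1)[OF u] and wL = weak_solutionD(2)[OF u]
  note d = weak_solution_weak_derivative[OF f u]
  \<comment> \<open>Existence gives the chosen \<open>weak_derivative\<close> its properties;
    uniqueness then replaces it by f - L w.\<close>
  have "\<exists>g'. L2 T g' \<and> has_weak_derivative T (\<lambda>t. j (u t)) g'" using d by blast
  from someI_ex[OF this] have D: "L2 T D" "has_weak_derivative T (\<lambda>t. j (u t)) D"
    unfolding D_def weak_derivative_def by auto
  have Deq: "sqint T D = sqint T (\<lambda>t. f t - L (w t))"
    unfolding sqint_def using weak_derivative_unique[OF T D d]
    by (intro integral_cong_AE borel_measurable_integrable L2_integrable_sq D d) (auto elim: eventually_mono)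
  have ju: "L2 T (\<lambda>t. j (u t))" by (intro L2_continuous bounded_linear.continuous_on[OF j_bl] uc)
  have Lw: "L2 T (\<lambda>t. L (w t))" by (rule L2_bounded_linear[OF wL L_bl])
  have b1: "(norm (u t))\<^sup>2 \<le> E" if "t \<in> {0..T}" for t
    unfolding E_def by (rule weak_solution_properties(2)[OF T f u that])
  have b2: "sqint T w \<le> 2 * E / \<alpha>"
    using weak_solution_properties(3)[OF T f u] pos by (simp add: E_def pos_le_divide_eq mult.commute)
  have b3: "sqint T (\<lambda>t. j (u t)) \<le> T * (\<kappa>\<^sup>2 * E)"
  proof -
    have "sqint T (\<lambda>t. j (u t)) \<le> (\<integral>t. \<kappa>\<^sup>2 * E \<partial>leb T)"
      unfolding sqint_def
    proof (rule integral_mono[OF L2_integrable_sq[OF ju]])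
      show "integrable (leb T) (\<lambda>t. \<kappa>\<^sup>2 * E)" by (intro integrable_leb_continuous continuous_on_const)
      fix t assume t: "t \<in> space (leb T)"
      have "(norm (j (u t)))\<^sup>2 \<le> (\<kappa> * norm (u t))\<^sup>2" by (intro power_mono j_norm) simp
      also have "\<dots> \<le> \<kappa>\<^sup>2 * E" unfolding power_mult_distrib using b1[of t] t by (intro mult_left_mono) auto
      finally show "(norm (j (u t)))\<^sup>2 \<le> \<kappa>\<^sup>2 * E" .
    qed
    also have "\<dots> = T * (\<kappa>\<^sup>2 * E)" using T by (simp add: measure_restrict_space)
    finally show ?thesis .
  qed
  have b4: "sqint T (\<lambda>t. f t - L (w t)) \<le> 2 * sqint T f + 2 * (C\<^sup>2 * (2 * E / \<alpha>))"
  proof -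
    have "sqint T (\<lambda>t. f t + - L (w t)) \<le> 2 * sqint T f + 2 * sqint T (\<lambda>t. - L (w t))"
      by (rule sqint_add_le[OF f L2_uminus[OF Lw]])
    moreover have "sqint T (\<lambda>t. - L (w t)) \<le> C\<^sup>2 * sqint T w"
      by (rule sqint_le[OF L2_uminus[OF Lw] wL]) (simp add: L_norm)
    moreover have "C\<^sup>2 * sqint T w \<le> C\<^sup>2 * (2 * E / \<alpha>)" by (intro mult_left_mono b2) simp
    ultimately show ?thesis by simp
  qed
  have sup: "(SUP t\<in>{0..T}. (norm (u t))\<^sup>2) \<le> E" by (rule cSUP_least) (use T b1 in auto)
  have sup0: "0 \<le> (SUP t\<in>{0..T}. (norm (u t))\<^sup>2)"
  proof -
    have "bdd_above ((\<lambda>t. (norm (u t))\<^sup>2) ` {0..T})" using b1 by (intro bdd_aboveI[of _ E]) auto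
    then have "(norm (u 0))\<^sup>2 \<le> (SUP t\<in>{0..T}. (norm (u t))\<^sup>2)" by (rule cSUP_upper[rotated]) (use T in auto)
    then show ?thesis using zero_le_power2[of "norm (u 0)"] by linarith
  qed
  have "(\<integral>t. (norm (j (u t)))\<^sup>2 + (norm (D t))\<^sup>2 \<partial>leb T) = sqint T (\<lambda>t. j (u t)) + sqint T D"
    unfolding sqint_def by (intro Bochner_Integration.integral_add L2_integrable_sq ju D)
  then have "norm_X \<iota> T u = sqrt (sqint T w + (SUP t\<in>{0..T}. (norm (u t))\<^sup>2) + (sqint T (\<lambda>t. j (u t)) + sqint T D))"
    by (simp add: norm_X_def w_def sqint_def D_def)
  then have "(norm_X \<iota> T u)\<^sup>2 = sqint T w + (SUP t\<in>{0..T}. (norm (u t))\<^sup>2) + (sqint T (\<lambda>t. j (u t)) + sqint T D)"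
    using sup0 by (simp add: sqint_nonneg)
  also have "\<dots> \<le> 2 * E / \<alpha> + E + (T * (\<kappa>\<^sup>2 * E) + (2 * sqint T f + 2 * (C\<^sup>2 * (2 * E / \<alpha>))))"
    unfolding Deq by (intro add_mono b2 b3 b4 sup)
  also have "\<dots> = (4 / \<alpha> + 2 + 2 * T * \<kappa>\<^sup>2 + 8 * C\<^sup>2 / \<alpha>) * ((norm (u 0))\<^sup>2 + (1 / \<alpha>) * sqint T f) + 2 * sqint T f"
    using pos by (simp add: E_def field_simps)
  finally show ?thesis .
qed

text \<open>The third term in the norm of Y is the squared norm of u 0, so the energy bound in terms
  of u 0 and f is already the estimate.\<close>

lemma norm_X_estimate:
  assumes T: "T > 0"
  obtains c where "c > 0" "\<And>f u\<^sub>T u. (f, u\<^sub>T) \<in> Y_space \<iota> a T \<Longrightarrow> in_X \<iota> T u \<Longrightarrow> solves_fvp \<iota> a T f u\<^sub>T u \<Longrightarrow>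
    norm_X \<iota> T u \<le> c * norm_Y \<iota> a T f u\<^sub>T"
proof -
  define k where "k = 4 / \<alpha> + 2 + 2 * T * \<kappa>\<^sup>2 + 8 * C\<^sup>2 / \<alpha>"
  define c where "c = k * (1 + 1 / \<alpha>) + 2"
  have k: "k \<ge> 0" using pos T by (simp add: k_def)
  have c: "c > 0" using k pos by (simp add: c_def add_nonneg_pos)
  show thesis
  proof (rule that[of "sqrt c"])
    show "sqrt c > 0" using c by simp
    fix f u\<^sub>T u assume Y: "(f, u\<^sub>T) \<in> Y_space \<iota> a T" and X: "in_X \<iota> T u" and s: "solves_fvp \<iota> a T f u\<^sub>T u"
    have f: "L2 T f" using Y by (simp add: Y_space_iff[OF T])
    have u0: "(norm_Y \<iota> a T f u\<^sub>T)\<^sup>2 = (norm u\<^sub>T)\<^sup>2 + sqint T f + (norm (u 0))\<^sup>2"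
      using sqint_nonneg[of T f] by (simp add: norm_Y_def solution_formula(3)[OF T f X s] flip: sqint_def)
    define A where "A = (norm (u 0))\<^sup>2"
    define B where "B = sqint T f"
    have AB: "A \<ge> 0" "B \<ge> 0" by (simp_all add: A_def B_def sqint_nonneg)
    have "(norm_X \<iota> T u)\<^sup>2 \<le> k * (A + (1 / \<alpha>) * B) + 2 * B"
      using norm_X_le[OF T f X s] by (simp add: k_def A_def B_def)
    also have "\<dots> \<le> c * (A + B)"
    proof -
      have "k * (A + (1 / \<alpha>) * B) \<le> k * ((1 + 1 / \<alpha>) * (A + B))"
        using k AB pos by (intro mult_left_mono) (simp_all add: algebra_simps add_divide_distrib)
      then show ?thesis using AB by (simp add: c_def algebra_simps)
    qed
    also have "\<dots> \<le> c * (norm_Y \<iota> a T f u\<^sub>T)\<^sup>2"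
      unfolding u0 using c by (intro mult_left_mono) (simp_all add: A_def B_def)
    also have "\<dots> = (sqrt c * norm_Y \<iota> a T f u\<^sub>T)\<^sup>2" using c by (simp add: power_mult_distrib)
    finally show "norm_X \<iota> T u \<le> sqrt c * norm_Y \<iota> a T f u\<^sub>T"
      by (rule power2_le_imp_le) (use c in \<open>simp add: norm_Y_def sqint_nonneg flip: sqint_def\<close>)
  qed
qed

text \<open>Linearity reduces continuity of the solution operator to the estimate for a difference
  of two solutions.\<close>

lemma solution_difference:
  assumes T: "T > 0" and f: "L2 T f" and g: "L2 T g"
    and u: "in_X \<iota> T u" "solves_fvp \<iota> a T f u\<^sub>T u" and v: "in_X \<iota> T v" "solves_fvp \<iota> a T g v\<^sub>T v"
  shows "in_X \<iota> T (\<lambda>t. v t - u t)" "solves_fvp \<iota> a T (\<lambda>t. g t - f t) (v\<^sub>T - u\<^sub>T) (\<lambda>t. v t - u t)"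
  using weak_solution_in_X[OF L2_diff[OF g f] weak_solution_diff[OF in_X_weak_solution[OF g v] in_X_weak_solution[OF f u] g f]]
    solution_formula(2)[OF T f u] solution_formula(2)[OF T g v] by simp_all

text \<open>Each part is itself a solution: the first with right-hand side 0 and initial value x,
  the second with right-hand side f and initial value 0.\<close>

lemma solution_parts_in_X:
  assumes T: "T > 0" and f: "L2 T f"
  shows "in_X \<iota> T (\<lambda>t. semigroup_H \<iota> a t x)" "in_X \<iota> T (duhamel_H \<iota> a f)"
proof -
  obtain u w where u: "weak_solution T (\<lambda>_. 0) u w" "u 0 = x"
    by (rule weak_solution_exists[OF T L2_zero, of x]) blast
  have "weak_solution T (\<lambda>_. 0) (\<lambda>t. semigroup_H \<iota> a t x) w"
    by (rule weak_solution_cong[OF u(1)])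
      (simp add: weak_solution_properties(1)[OF T L2_zero u(1)] u(2) duhamel_H_zero[OF T] semigroup_H_eq)
  then show "in_X \<iota> T (\<lambda>t. semigroup_H \<iota> a t x)" by (rule weak_solution_in_X(1)[OF L2_zero])
  obtain u w where u: "weak_solution T f u w" "u 0 = 0"
    by (rule weak_solution_exists[OF T f, of 0]) blast
  have "weak_solution T f (duhamel_H \<iota> a f) w"
    by (rule weak_solution_cong[OF u(1)])
      (simp add: weak_solution_properties(1)[OF T f u(1)] u(2) linear_0[OF H.S_linear])
  then show "in_X \<iota> T (duhamel_H \<iota> a f)" by (rule weak_solution_in_X(1)[OF f])
qed

end

text \<open>The bounds of the form and of the embedding are enlarged to at least 1, as the locale
  asks for positive constants.\<close>

lemma elliptic_form_exists:
  assumes "gelfand_triple \<iota>" and a: "bounded_sesquilinear a" and e: "elliptic a"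
  obtains C \<alpha> \<kappa> where "elliptic_form \<iota> a C \<alpha> \<kappa>"
proof -
  obtain C0 where C0: "\<And>u v. cmod (a u v) \<le> C0 * norm u * norm v"
    using a by (auto simp: bounded_sesquilinear_def)
  obtain \<alpha> where \<alpha>: "\<alpha> > 0" "\<And>v. \<alpha> * (norm v)\<^sup>2 \<le> Re (a v v)" using e by (auto simp: elliptic_def)
  have "bounded_linear \<iota>" using assms(1) by (simp add: gelfand_triple_def)
  then obtain K where K: "\<And>v. norm (\<iota> v) \<le> norm v * K"
    using bounded_linear.bounded by blast
  have "elliptic_form \<iota> a (max C0 1) \<alpha> (max K 1)"
  proof
    show "cmod (a u v) \<le> max C0 1 * norm u * norm v" for u v
      by (rule order_trans[OF C0]) (auto intro!: mult_right_mono)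
    show "norm (\<iota> v) \<le> max K 1 * norm v" for v
      using order_trans[OF K[of v] mult_left_mono[of K "max K 1" "norm v"]] by (simp add: mult.commute)
  qed (use assms \<alpha> in auto)
  then show thesis by (rule that)
qed

theorem theorem1:
  fixes \<iota> :: "'v::chilbert_space \<Rightarrow> 'h::chilbert_space"
    and a :: "'v \<Rightarrow> 'v \<Rightarrow> complex"
    and T :: real
  assumes "gelfand_triple \<iota>" and "bounded_sesquilinear a" and "elliptic a" and "0 < T"
  shows
    \<comment> \<open>the values of the integrals, in particular \<open>y\<^sub>f\<close>, lie in \<open>H\<close>\<close>
    "(\<forall>f. L2 T f \<longrightarrow> (\<forall>t\<in>{0..T}. duhamel \<iota> a f t \<in> range (H_to_antidual \<iota>))) \<and>
    \<comment> \<open>\<open>Y\<close> is a subspace\<close>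
     ((\<lambda>_. 0, 0) \<in> Y_space \<iota> a T \<and>
      (\<forall>f u\<^sub>T g v\<^sub>T c. (f, u\<^sub>T) \<in> Y_space \<iota> a T \<and> (g, v\<^sub>T) \<in> Y_space \<iota> a T \<longrightarrow>
        (\<lambda>t. f t + c *\<^sub>C g t, u\<^sub>T + c *\<^sub>C v\<^sub>T) \<in> Y_space \<iota> a T)) \<and>
    \<comment> \<open>solvability\<close>
     (\<forall>f u\<^sub>T. L2 T f \<longrightarrow>
       ((\<exists>u. in_X \<iota> T u \<and> solves_fvp \<iota> a T f u\<^sub>T u) \<longleftrightarrow> (f, u\<^sub>T) \<in> Y_space \<iota> a T)) \<and>
    \<comment> \<open>uniqueness\<close>
     (\<forall>f u\<^sub>T u v. (f, u\<^sub>T) \<in> Y_space \<iota> a T \<and>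
       in_X \<iota> T u \<and> solves_fvp \<iota> a T f u\<^sub>T u \<and>
       in_X \<iota> T v \<and> solves_fvp \<iota> a T f u\<^sub>T v \<longrightarrow> (\<forall>t\<in>{0..T}. u t = v t)) \<and>
    \<comment> \<open>the estimate\<close>
     (\<exists>c. \<forall>f u\<^sub>T u. (f, u\<^sub>T) \<in> Y_space \<iota> a T \<and> in_X \<iota> T u \<and> solves_fvp \<iota> a T f u\<^sub>T u \<longrightarrow>
       norm_X \<iota> T u \<le> c * norm_Y \<iota> a T f u\<^sub>T) \<and>
    \<comment> \<open>continuity of the solution operator\<close>
     (\<forall>f u\<^sub>T u. (f, u\<^sub>T) \<in> Y_space \<iota> a T \<and> in_X \<iota> T u \<and> solves_fvp \<iota> a T f u\<^sub>T u \<longrightarrow>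
       (\<forall>\<epsilon>>0. \<exists>\<delta>>0. \<forall>g v\<^sub>T v.
         (g, v\<^sub>T) \<in> Y_space \<iota> a T \<and> in_X \<iota> T v \<and> solves_fvp \<iota> a T g v\<^sub>T v \<and>
         norm_Y \<iota> a T (\<lambda>t. g t - f t) (v\<^sub>T - u\<^sub>T) < \<delta> \<longrightarrow>
         norm_X \<iota> T (\<lambda>t. v t - u t) < \<epsilon>)) \<and>
    \<comment> \<open>the solution formula\<close>
     (\<forall>f u\<^sub>T u. (f, u\<^sub>T) \<in> Y_space \<iota> a T \<and> in_X \<iota> T u \<and> solves_fvp \<iota> a T f u\<^sub>T u \<longrightarrow>
       (\<forall>t\<in>{0..T}. u t =
         semigroup_H \<iota> a t (exp_pos \<iota> a T (u T - duhamel_H \<iota> a f T)) + duhamel_H \<iota> a f t) \<and>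
       in_X \<iota> T (\<lambda>t. semigroup_H \<iota> a t (exp_pos \<iota> a T (u T - duhamel_H \<iota> a f T))) \<and>
       in_X \<iota> T (\<lambda>t. duhamel_H \<iota> a f t))"
proof -
  obtain C \<alpha> \<kappa> where "elliptic_form \<iota> a C \<alpha> \<kappa>"
    using elliptic_form_exists[OF assms(1-3)] by blast
  then interpret elliptic_form \<iota> a C \<alpha> \<kappa> .
  note T = assms(4)
  have YL2: "L2 T f" if "(f, u\<^sub>T) \<in> Y_space \<iota> a T" for f u\<^sub>T
    using that by (simp add: Y_space_iff[OF T])
  obtain c where c: "c > 0" and est: "\<And>f u\<^sub>T u. (f, u\<^sub>T) \<in> Y_space \<iota> a T \<Longrightarrow> in_X \<iota> T u \<Longrightarrow>
      solves_fvp \<iota> a T f u\<^sub>T u \<Longrightarrow> norm_X \<iota> T u \<le> c * norm_Y \<iota> a T f u\<^sub>T"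
    using norm_X_estimate[OF T] by blast
  show ?thesis
  proof (intro conjI allI impI)
    show "\<forall>t\<in>{0..T}. duhamel \<iota> a f t \<in> range (H_to_antidual \<iota>)" if "L2 T f" for f
      using duhamel_in_range[OF T that] by blast
    show "(\<lambda>_. 0, 0) \<in> Y_space \<iota> a T" by (rule Y_space_zero[OF T])
    show "(\<lambda>t. f t + k *\<^sub>C g t, u\<^sub>T + k *\<^sub>C v\<^sub>T) \<in> Y_space \<iota> a T"
      if "(f, u\<^sub>T) \<in> Y_space \<iota> a T \<and> (g, v\<^sub>T) \<in> Y_space \<iota> a T" for f u\<^sub>T g v\<^sub>T k
      using Y_space_add_scaleC[OF T] that by blast
    show "(\<exists>u. in_X \<iota> T u \<and> solves_fvp \<iota> a T f u\<^sub>T u) \<longleftrightarrow> (f, u\<^sub>T) \<in> Y_space \<iota> a T" if "L2 T f" for f u\<^sub>T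
      by (rule solvable_iff[OF T that])
    show "\<forall>t\<in>{0..T}. u t = v t"
      if "(f, u\<^sub>T) \<in> Y_space \<iota> a T \<and> in_X \<iota> T u \<and> solves_fvp \<iota> a T f u\<^sub>T u \<and> in_X \<iota> T v \<and> solves_fvp \<iota> a T f u\<^sub>T v"
      for f u\<^sub>T u v
    proof
      fix t assume t: "t \<in> {0..T}"
      from that have f: "L2 T f" and u: "in_X \<iota> T u" "solves_fvp \<iota> a T f u\<^sub>T u" and v: "in_X \<iota> T v" "solves_fvp \<iota> a T f u\<^sub>T v"
        using YL2 by auto
      \<comment> \<open>Both initial values are e^(TA) applied to the same vector.\<close>
      have "u 0 = v 0" using solution_formula(3)[OF T f u] solution_formula(3)[OF T f v] by simp
      then show "u t = v t"
        by (simp add: solution_formula(1)[OF T f u t] solution_formula(1)[OF T f v t])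
    qed
    show "\<exists>c. \<forall>f u\<^sub>T u. (f, u\<^sub>T) \<in> Y_space \<iota> a T \<and> in_X \<iota> T u \<and> solves_fvp \<iota> a T f u\<^sub>T u \<longrightarrow>
       norm_X \<iota> T u \<le> c * norm_Y \<iota> a T f u\<^sub>T"
      using est by blast
    show "\<exists>\<delta>>0. \<forall>g v\<^sub>T v.
         (g, v\<^sub>T) \<in> Y_space \<iota> a T \<and> in_X \<iota> T v \<and> solves_fvp \<iota> a T g v\<^sub>T v \<and>
         norm_Y \<iota> a T (\<lambda>t. g t - f t) (v\<^sub>T - u\<^sub>T) < \<delta> \<longrightarrow> norm_X \<iota> T (\<lambda>t. v t - u t) < \<epsilon>"
      if fu: "(f, u\<^sub>T) \<in> Y_space \<iota> a T \<and> in_X \<iota> T u \<and> solves_fvp \<iota> a T f u\<^sub>T u" and \<epsilon>: "\<epsilon> > 0" for f u\<^sub>T u \<epsilon>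
    proof (intro exI[of _ "\<epsilon> / c"] conjI allI impI)
      show "\<epsilon> / c > 0" using c \<epsilon> by simp
      fix g v\<^sub>T v
      assume gv: "(g, v\<^sub>T) \<in> Y_space \<iota> a T \<and> in_X \<iota> T v \<and> solves_fvp \<iota> a T g v\<^sub>T v \<and>
         norm_Y \<iota> a T (\<lambda>t. g t - f t) (v\<^sub>T - u\<^sub>T) < \<epsilon> / c"
      \<comment> \<open>A difference is a combination with coefficient -1, so the subspace property
        makes the estimate applicable to it.\<close>
      have "(\<lambda>t. g t + (- 1) *\<^sub>C f t, v\<^sub>T + (- 1) *\<^sub>C u\<^sub>T) \<in> Y_space \<iota> a T"
        using Y_space_add_scaleC[OF T] fu gv by blast
      then have "(\<lambda>t. g t - f t, v\<^sub>T - u\<^sub>T) \<in> Y_space \<iota> a T" by (simp add: scaleC_minus_one)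
      moreover have "in_X \<iota> T (\<lambda>t. v t - u t)" "solves_fvp \<iota> a T (\<lambda>t. g t - f t) (v\<^sub>T - u\<^sub>T) (\<lambda>t. v t - u t)"
        using solution_difference[OF T, of f g u u\<^sub>T v v\<^sub>T] fu gv YL2 by blast+
      ultimately have "norm_X \<iota> T (\<lambda>t. v t - u t) \<le> c * norm_Y \<iota> a T (\<lambda>t. g t - f t) (v\<^sub>T - u\<^sub>T)" by (rule est)
      also have "\<dots> < c * (\<epsilon> / c)" using gv c by (intro mult_strict_left_mono) auto
      finally show "norm_X \<iota> T (\<lambda>t. v t - u t) < \<epsilon>" using c by simp
    qed
    fix f u\<^sub>T u assume "(f, u\<^sub>T) \<in> Y_space \<iota> a T \<and> in_X \<iota> T u \<and> solves_fvp \<iota> a T f u\<^sub>T u"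
    then have f: "L2 T f" and u: "in_X \<iota> T u" "solves_fvp \<iota> a T f u\<^sub>T u" using YL2 by auto
    note form = solution_formula[OF T f u]
    show "\<forall>t\<in>{0..T}. u t = semigroup_H \<iota> a t (exp_pos \<iota> a T (u T - duhamel_H \<iota> a f T)) + duhamel_H \<iota> a f t"
      unfolding form(2,3)
    proof
      fix t assume t: "t \<in> {0..T}"
      show "u t = semigroup_H \<iota> a t (u 0) + duhamel_H \<iota> a f t"
        using form(1)[OF t] t by (simp only: semigroup_H_eq atLeastAtMost_iff)
    qed
    show "in_X \<iota> T (\<lambda>t. semigroup_H \<iota> a t (exp_pos \<iota> a T (u T - duhamel_H \<iota> a f T)))"
      by (rule solution_parts_in_X(1)[OF T f])
    show "in_X \<iota> T (\<lambda>t. duhamel_H \<iota> a f t)"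
      using solution_parts_in_X(2)[OF T f] by simp
  qed
qed

end
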